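(* Let $\lambda>0$ and $s\in[0,1]$. The following propositions are equivalent: (i) There exists a one-sided test for deciding $\mathbb{P}_{0,d}$ versus $\mathbb{P}_{1,d}$. (ii) $\lim_{d\to\infty}\mathrm{KL}_d=+\infty$ and $\lambda s>1$. (iii) There exists a sequence $(a_d)_{d\ge 0}$ with $a_d\to\infty$ such that $\mathbb{P}_{0,d}(\mathbf{L}_d>a_d)\to 0$ and $\liminf_{d\to\infty}\mathbb{P}_{1,d}(\mathbf{L}_d>a_d)>0$. (iv) The martingale $(\mathbf{L}_d)_{d\ge0}$ under $\mathbb{P}_0$ (with respect to the filtration $\mathcal{F}_d=\sigma(p_d(\mathbf{t}),p_d(\mathbf{t}'))$) is not uniformly integrable. (v) $\lambda s>1$ and $\mathbb{P}_1\left(\liminf_{d\to\infty}(\lambda s)^{-d}\log \mathbf{L}_d>0\right)\ge 1-p_{\mathrm{ext}}(\lambda s)$.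
   Context: Rooted trees are canonically labeled: the root has label $\varnothing$, and if a node has label $m$ and $c$ children, its children have labels $\{m,1\},\dots,\{m,c\}$. $\mathcal{X}_n$ is the set of canonically labeled rooted trees of depth at most $n$; $p_n(t)$ is the pruning of $t$ at depth $n$ (nodes at distance $>n$ from the root are removed). For $\mu>0$, $\pi_\mu(k)=e^{-\mu}\mu^k/k!$, $\mathrm{GW}_\mu$ is the law of a labeled Galton–Watson tree with $\mathrm{Poisson}(\mu)$ offspring, and $\mathrm{GW}_{\mu,n}$ the law of its pruning at depth $n$. A uniform random relabeling of a labeled tree is obtained by independently, at every node, permuting its children by a uniformly random permutation, then relabeling canonically. Write $\bar s=1-s$. A $(\lambda,s)$-augmentation of a tree $\tau$ is obtained by attaching to each node of $\tau$ an independent $\mathrm{Poisson}(\lambda\bar s)$ number of new children, and attaching to each new child an independent $\mathrm{GW}_\lambda$ tree. Under $\mathbb{P}_0$, $(\mathbf{t},\mathbf{t}')$ are two independent $\mathrm{GW}_\lambda$ trees. Under $\mathbb{P}_1$: $\boldsymbol{\tau}^*\sim\mathrm{GW}_{\lambda s}$, $\boldsymbol\tau,\boldsymbol\tau'$ are two independent $(\lambda,s)$-augmentations of $\boldsymbol\tau^*$, and $\mathbf{t},\mathbf{t}'$ are independent uniform random relabelings of $\boldsymbol\tau,\boldsymbol\tau'$. $\mathbb{P}_{i,n}$ is the law of $(p_n(\mathbf t),p_n(\mathbf t'))$ under $\mathbb{P}_i$, $i\in\{0,1\}$. For $t,t'\in\mathcal X_n$, $L_n(t,t')=\mathbb{P}_{1,n}(t,t')/\mathbb{P}_{0,n}(t,t')$,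 and $\mathbf{L}_n:=L_n(p_n(\mathbf t),p_n(\mathbf t'))$. A one-sided test is a sequence of maps $\mathcal{T}_n:\mathcal X_n\times\mathcal X_n\to\{0,1\}$ with $\mathbb{P}_{0,n}(\mathcal T_n=1)\to0$ and $\liminf_n\mathbb{P}_{1,n}(\mathcal T_n=1)>0$. $\mathrm{KL}_d:=\mathrm{KL}(\mathbb{P}_{1,d}\Vert\mathbb{P}_{0,d})=\mathbb{E}_1[\log\mathbf{L}_d]$. $p_{\mathrm{ext}}(\mu)$ is the extinction probability of a Galton–Watson tree with $\mathrm{Poisson}(\mu)$ offspring. *)

theory Defs
  imports "HOL-Probability.Probability"
begin

section \<open>Canonically labeled rooted trees\<close>

text \<open>
  A canonically labeled tree is identified with the set of the labels of its nodes: the label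
  \<open>{\<dots>{{\<emptyset>, i\<^sub>1}, i\<^sub>2}\<dots>, i\<^sub>k}\<close> is the list \<open>[i\<^sub>1, \<dots>, i\<^sub>k]\<close>. Trees may be infinite, but
  every node has finitely many children.
\<close>

type_synonym ltree = "nat list set"

definition ltrees :: "ltree set" where
  "ltrees = {t. [] \<in> t \<and> (\<forall>m i. m @ [i] \<in> t \<longrightarrow> m \<in> t) \<and>
                (\<forall>m\<in>t. \<exists>c. {i. m @ [i] \<in> t} = {1..c})}"

definition nchildren :: "ltree \<Rightarrow> nat list \<Rightarrow> nat" where
  "nchildren t m = card {i. m @ [i] \<in> t}"

definition ltrees_upto :: "nat \<Rightarrow> ltree set" where
  "ltrees_upto n = {t \<in> ltrees. \<forall>m\<in>t. length m \<le> n}"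

definition prune :: "nat \<Rightarrow> ltree \<Rightarrow> ltree" where
  "prune n t = {m \<in> t. length m \<le> n}"

definition prune2 :: "nat \<Rightarrow> ltree \<times> ltree \<Rightarrow> ltree \<times> ltree" where
  "prune2 n = (\<lambda>(t, t'). (prune n t, prune n t'))"

text \<open>The \<open>\<sigma>\<close>-algebra below is also the one generated by all prunings \<open>prune n\<close>.\<close>

definition tree_space :: "ltree measure" where
  "tree_space = sigma ltrees {{t \<in> ltrees. m \<in> t} | m. True}"

section \<open>Random trees\<close>

text \<open>The library's Poisson distribution is only specified for a positive rate; rate \<open>0\<close> (point
  mass at \<open>0\<close>) is needed when \<open>s = 0\<close> or \<open>s = 1\<close>.\<close>

definition Poisson :: "real \<Rightarrow> nat pmf" where
  "Poisson \<mu> = (if \<mu> > 0 then poisson_pmf \<mu> else return_pmf 0)"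

inductive_set tree_of_offspring :: "(nat list \<Rightarrow> nat) \<Rightarrow> ltree" for \<omega> where
  root: "[] \<in> tree_of_offspring \<omega>"
| child: "m \<in> tree_of_offspring \<omega> \<Longrightarrow> i \<in> {1..\<omega> m} \<Longrightarrow> m @ [i] \<in> tree_of_offspring \<omega>"

definition GW :: "real \<Rightarrow> ltree measure" where
  "GW \<mu> = distr (\<Pi>\<^sub>M m\<in>UNIV. measure_pmf (Poisson \<mu>)) tree_space tree_of_offspring"

definition p_ext :: "real \<Rightarrow> real" where
  "p_ext \<mu> = measure (GW \<mu>) {t \<in> ltrees. \<exists>n. \<forall>m\<in>t. length m \<noteq> n}"

text \<open>If the children of every node \<open>m\<close> are permuted by \<open>\<sigma> m\<close>, the \<open>i\<close>-th child of \<open>m\<close> becomes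
  the \<open>\<sigma> m i\<close>-th child of the relabeled \<open>m\<close>.\<close>

definition new_label :: "(nat list \<Rightarrow> nat \<Rightarrow> nat) \<Rightarrow> nat list \<Rightarrow> nat list" where
  "new_label \<sigma> m = map (\<lambda>k. \<sigma> (take k m) (m ! k)) [0..<length m]"

definition uniform_relabeling :: "ltree \<Rightarrow> ltree measure" where
  "uniform_relabeling t =
     distr (\<Pi>\<^sub>M m\<in>UNIV. uniform_count_measure {\<pi>. \<pi> permutes {1..nchildren t m}})
       tree_space (\<lambda>\<sigma>. new_label \<sigma> ` t)"

text \<open>Node \<open>m\<close> receives \<open>K m\<close> new children, labeled after its existing ones, and the tree
  \<open>G (m, j)\<close> is grafted at the \<open>j\<close>-th of them.\<close>

definition attach :: "ltree \<Rightarrow> (nat list \<Rightarrow> nat) \<Rightarrow> (nat list \<times> nat \<Rightarrow> ltree) \<Rightarrow> ltree" where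
  "attach t K G =
     t \<union> {m @ [nchildren t m + j] @ u | m j u. m \<in> t \<and> j \<in> {1..K m} \<and> u \<in> G (m, j)}"

definition augmentation :: "real \<Rightarrow> real \<Rightarrow> ltree \<Rightarrow> ltree measure" where
  "augmentation lam s t =
     distr ((\<Pi>\<^sub>M m\<in>UNIV. measure_pmf (Poisson (lam * (1 - s)))) \<Otimes>\<^sub>M (\<Pi>\<^sub>M mj\<in>UNIV. GW lam))
       tree_space (\<lambda>(K, G). attach t K G)"

section \<open>The two hypotheses and the likelihood ratio\<close>

definition P0 :: "real \<Rightarrow> (ltree \<times> ltree) measure" where
  "P0 lam = GW lam \<Otimes>\<^sub>M GW lam"

text \<open>Conditionally on \<open>\<tau>\<close>, the two relabeled augmentations are independent.\<close>

definition P1 :: "real \<Rightarrow> real \<Rightarrow> (ltree \<times> ltree) measure" where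
  "P1 lam s = GW (lam * s) \<bind> (\<lambda>\<tau>.
     (augmentation lam s \<tau> \<bind> uniform_relabeling) \<Otimes>\<^sub>M
     (augmentation lam s \<tau> \<bind> uniform_relabeling))"

definition pruned_law :: "(ltree \<times> ltree) measure \<Rightarrow> nat \<Rightarrow> (ltree \<times> ltree) measure" where
  "pruned_law P n = distr P (count_space (ltrees_upto n \<times> ltrees_upto n)) (prune2 n)"

text \<open>For \<open>s = 1\<close> the ratio vanishes on pairs of non-isomorphic trees, but always with
  \<open>P1\<close>-probability \<open>0\<close>, so the convention \<open>ln 0 = 0\<close> does not matter under \<open>P1\<close>.\<close>

definition L :: "real \<Rightarrow> real \<Rightarrow> nat \<Rightarrow> ltree \<times> ltree \<Rightarrow> real" where
  "L lam s n x = measure (pruned_law (P1 lam s) n) {x} / measure (pruned_law (P0 lam) n) {x}"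

text \<open>\<open>KL_divergence b M N\<close> is the divergence of \<open>N\<close> relative to \<open>M\<close>, so the reference measure
  comes first. The integral defining it is finite here: the divergence is the mutual information
  of two pruned trees of law \<open>GW lam\<close>, hence at most the (finite) entropy of one of them.\<close>

definition KL :: "real \<Rightarrow> real \<Rightarrow> nat \<Rightarrow> real" where
  "KL lam s d = KL_divergence (exp 1) (pruned_law (P0 lam) d) (pruned_law (P1 lam s) d)"

definition pruned_filtration :: "nat \<Rightarrow> (ltree \<times> ltree) measure" where
  "pruned_filtration d =
     vimage_algebra (ltrees \<times> ltrees) (prune2 d) (count_space (ltrees_upto d \<times> ltrees_upto d))"

section \<open>Tests, martingales, uniform integrability\<close>

definition one_sided_test ::
  "(nat \<Rightarrow> (ltree \<times> ltree) measure) \<Rightarrow> (nat \<Rightarrow> (ltree \<times> ltree) measure) \<Rightarrow>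
   (nat \<Rightarrow> ltree \<times> ltree \<Rightarrow> nat) \<Rightarrow> bool" where
  "one_sided_test Q0 Q1 T \<longleftrightarrow>
     (\<forall>n. T n \<in> ltrees_upto n \<times> ltrees_upto n \<rightarrow> {0, 1}) \<and>
     (\<lambda>n. measure (Q0 n) {x \<in> ltrees_upto n \<times> ltrees_upto n. T n x = 1}) \<longlonglongrightarrow> 0 \<and>
     liminf (\<lambda>n. ereal (measure (Q1 n) {x \<in> ltrees_upto n \<times> ltrees_upto n. T n x = 1})) > 0"

definition martingale :: "'a measure \<Rightarrow> (nat \<Rightarrow> 'a measure) \<Rightarrow> (nat \<Rightarrow> 'a \<Rightarrow> real) \<Rightarrow> bool" where
  "martingale M F X \<longleftrightarrow>
     filtration (space M) F \<and> (\<forall>n. subalgebra M (F n)) \<and>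
     (\<forall>n. X n \<in> borel_measurable (F n)) \<and> (\<forall>n. integrable M (X n)) \<and>
     (\<forall>m n. m \<le> n \<longrightarrow> (AE x in M. real_cond_exp M (F m) (X n) x = X m x))"

definition uniformly_integrable :: "'a measure \<Rightarrow> (nat \<Rightarrow> 'a \<Rightarrow> real) \<Rightarrow> bool" where
  "uniformly_integrable M X \<longleftrightarrow>
     (\<forall>n. X n \<in> borel_measurable M) \<and>
     ((\<lambda>K::real. SUP n. \<integral>\<^sup>+x. ennreal \<bar>X n x\<bar> * indicator {x. \<bar>X n x\<bar> > K} x \<partial>M)
        \<longlongrightarrow> 0) at_top"

end

theory Submission
  imports Defs
begin

text \<open>
  Cut at a finite depth, all laws are discrete, and the correlated law has a branching recursion: the
  root has \<open>Poisson (lam * s)\<close> common children carrying independent correlated pairs, \<open>Poisson (lam * (1 - s))\<close>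
  further children on either side carrying independent Galton--Watson trees, and both sides are
  shuffled. Keeping one outcome of this experiment bounds the likelihood ratio at a node below by
  \<open>exp B\<close>, with \<open>B\<close> a function of the root degrees, times the product of the ratios at the common children.

  If the relative entropy diverges and \<open>\<mu> = lam * s > 1\<close>, then at some depth the (truncated) log-ratio
  has a mean that outweighs the accumulated contribution of \<open>B\<close>; a second-moment argument for the
  resulting branching sums gives growth of order \<open>\<mu> ^ d\<close> with positive probability. A single growing
  common child makes the root grow, since log-ratios are rarely very negative under the correlated law,
  so the probability \<open>\<eta>\<close> of no growth satisfies \<open>\<eta> \<le> exp (\<mu> * (\<eta> - 1))\<close>, which together with \<open>\<eta> < 1\<close>
  forces \<open>\<eta> \<le> p_ext \<mu>\<close>.

  If \<open>\<mu> \<le> 1\<close>, the common tree is almost surely finite, and given a fixed finite common tree the law of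
  either side has a bounded density with respect to the Galton--Watson law, uniformly in the depth.
  Hence the correlated law is uniformly absolutely continuous and no test exists. The other
  implications are changes of measure.
\<close>

text \<open>At finite depth there are only countably many trees, so all laws become pmfs; infinite
  trees enter only through cylinders, and statements about them are monotone limits of finite-depth
  ones. The exact recursion for the ratio sums over all matchings of the children of the two roots,
  and its logarithm is not additive. Keeping only the realised matching makes it additive: S(root) =
  B + sum of S over common children, with a cost B whose law does not depend on depth. Its mean
  accumulates to at most |E B| / (\<mu> - 1) in units of \<mu>^n; this is the constant that the
  relative entropy at the starting depth has to exceed. A second moment bound gives growth at one
  depth with a probability that does not shrink. Growth at all later depths at once needs the
  innovations S(n+1) - \<mu> S(n) - E B: their variance is of order \<mu>^n instead of \<mu>^(2n),
  so Chebyshev at level \<mu>^(3n/4) leaves summable errors. The log-ratio is truncated from above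
  because its second moment under the correlated law is controlled directly only where the ratio is
  below 1, by boundedness of x (ln x)^2 on (0,1).\<close>

definition node :: "nat \<Rightarrow> (nat \<Rightarrow> ltree) \<Rightarrow> ltree" where
  "node c f = insert [] {i # u | i u. i \<in> {1..c} \<and> u \<in> f i}"

definition sub :: "ltree \<Rightarrow> nat \<Rightarrow> ltree" where
  "sub t i = {m. i # m \<in> t}"

lemma Nil_in_node [simp]: "[] \<in> node c f"
  and Cons_in_node [simp]: "i # u \<in> node c f \<longleftrightarrow> i \<in> {1..c} \<and> u \<in> f i"
  by (auto simp: node_def)

lemma ltree_eqI:
  assumes "[] \<in> t \<longleftrightarrow> [] \<in> t'" "\<And>i m. i # m \<in> t \<longleftrightarrow> i # m \<in> t'"
  shows "t = (t' :: ltree)"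
proof (rule set_eqI)
  fix m show "m \<in> t \<longleftrightarrow> m \<in> t'" using assms by (cases m) auto
qed

lemma Nil_in_ltrees: "t \<in> ltrees \<Longrightarrow> [] \<in> t"
  by (simp add: ltrees_def)

lemma ltrees_snocD: "t \<in> ltrees \<Longrightarrow> m @ [i] \<in> t \<Longrightarrow> m \<in> t"
  unfolding ltrees_def by blast

lemma ltrees_children: "t \<in> ltrees \<Longrightarrow> m \<in> t \<Longrightarrow> {i. m @ [i] \<in> t} = {1..nchildren t m}"
  unfolding ltrees_def nchildren_def by force

lemma ltrees_prefix: "t \<in> ltrees \<Longrightarrow> m @ m' \<in> t \<Longrightarrow> m \<in> t"
proof (induction m' rule: rev_induct)
  case (snoc i m')
  then have "(m @ m') @ [i] \<in> t" by simp
  with snoc show ?case using ltrees_snocD by blast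
qed simp

lemma ltrees_root_child: "t \<in> ltrees \<Longrightarrow> [i] \<in> t \<longleftrightarrow> i \<in> {1..nchildren t []}"
  using ltrees_children[of t "[]"] Nil_in_ltrees[of t] by auto

lemma ltrees_ConsD: "t \<in> ltrees \<Longrightarrow> i # m \<in> t \<Longrightarrow> i \<in> {1..nchildren t []}"
  using ltrees_prefix[of t "[i]" m] ltrees_root_child by simp

lemma nchildren_sub: "nchildren (sub t i) m = nchildren t (i # m)"
  by (simp add: nchildren_def sub_def)

lemma sub_in_ltrees:
  assumes "t \<in> ltrees" "i \<in> {1..nchildren t []}" shows "sub t i \<in> ltrees"
proof -
  have "[i] \<in> t" using assms ltrees_root_child by blast
  moreover have "i # m \<in> t" if "i # (m @ [j]) \<in> t" for m j
    using ltrees_snocD[OF assms(1), of "i # m" j] that by simp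
  moreover have "\<exists>c. {j. i # (m @ [j]) \<in> t} = {1..c}" if "i # m \<in> t" for m
    using ltrees_children[OF assms(1) that] by auto
  ultimately show ?thesis by (auto simp: ltrees_def sub_def)
qed

lemma node_sub: "t \<in> ltrees \<Longrightarrow> node (nchildren t []) (sub t) = t"
  by (rule ltree_eqI) (auto simp: Nil_in_ltrees sub_def dest: ltrees_ConsD)

lemma nchildren_node:
  assumes "\<And>i. i \<in> {1..c} \<Longrightarrow> [] \<in> f i" shows "nchildren (node c f) [] = c"
proof -
  have "{i. [] @ [i] \<in> node c f} = {1..c}" using assms by auto
  then show ?thesis by (simp add: nchildren_def)
qed

lemma sub_node: "i \<in> {1..c} \<Longrightarrow> sub (node c f) i = f i"
  by (auto simp: sub_def)

lemma node_cong: "c = c' \<Longrightarrow> (\<And>i. i \<in> {1..c'} \<Longrightarrow> f i = f' i) \<Longrightarrow> node c f = node c' f'"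
  by (rule ltree_eqI) auto

text \<open>The root label in every \<open>f i\<close> makes the degree readable from the node set:
  an empty \<open>f i\<close> would simply remove child \<open>i\<close>.\<close>

lemma node_eq_iff:
  assumes "\<And>i. i \<in> {1..c} \<Longrightarrow> [] \<in> f i" "\<And>i. i \<in> {1..c'} \<Longrightarrow> [] \<in> f' i"
  shows "node c f = node c' f' \<longleftrightarrow> c = c' \<and> (\<forall>i\<in>{1..c}. f i = f' i)"
proof
  assume eq: "node c f = node c' f'"
  then have "nchildren (node c f) [] = nchildren (node c' f') []" by simp
  then have c: "c = c'" using nchildren_node[OF assms(1)] nchildren_node[OF assms(2)] by simp
  moreover have "f i = f' i" if "i \<in> {1..c}" for i
    using that eq c sub_node[of i c f] sub_node[of i c' f'] by simp
  ultimately show "c = c' \<and> (\<forall>i\<in>{1..c}. f i = f' i)" by blast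
qed (auto intro!: node_cong)

lemma node_in_ltrees:
  assumes "\<And>i. i \<in> {1..c} \<Longrightarrow> f i \<in> ltrees" shows "node c f \<in> ltrees"
  unfolding ltrees_def mem_Collect_eq
proof (intro conjI allI ballI impI)
  fix m i assume "m @ [i] \<in> node c f"
  then show "m \<in> node c f" using assms by (cases m) (auto dest: ltrees_snocD)
next
  fix m assume m: "m \<in> node c f"
  show "\<exists>k. {i. m @ [i] \<in> node c f} = {1..k}"
  proof (cases m)
    case Nil
    then have "{i. m @ [i] \<in> node c f} = {1..c}" using assms by (auto simp: Nil_in_ltrees)
    then show ?thesis by blast
  next
    case (Cons j u)
    then have "{i. m @ [i] \<in> node c f} = {1..nchildren (f j) u}"
      using m ltrees_children[OF assms, of j u] by auto
    then show ?thesis by blast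
  qed
qed simp

lemma prune_node: "prune (Suc n) (node c f) = node c (\<lambda>i. prune n (f i))"
  by (rule ltree_eqI) (auto simp: prune_def)

lemma prune_0: "t \<in> ltrees \<Longrightarrow> prune 0 t = {[]}"
  by (auto simp: prune_def Nil_in_ltrees)

lemma prune_prune: "m \<le> n \<Longrightarrow> prune m (prune n t) = prune m t"
  by (auto simp: prune_def)

lemma Nil_in_prune [simp]: "[] \<in> prune n t \<longleftrightarrow> [] \<in> t"
  by (simp add: prune_def)

lemma ltrees_upto_0: "ltrees_upto 0 = {{[]}}"
proof -
  have "{[]} = node 0 (\<lambda>_. {})" by (auto simp: node_def)
  then have "{[]} \<in> ltrees" using node_in_ltrees[of 0] by simp
  then show ?thesis by (force simp: ltrees_upto_def ltrees_def)
qed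

lemma leaf_in_ltrees_upto: "{[]} \<in> ltrees_upto n"
  using ltrees_upto_0 by (auto simp: ltrees_upto_def)

lemma node_in_ltrees_upto:
  assumes "\<And>i. i \<in> {1..c} \<Longrightarrow> f i \<in> ltrees_upto n" shows "node c f \<in> ltrees_upto (Suc n)"
  using assms node_in_ltrees[of c f] by (auto simp: ltrees_upto_def node_def)

lemma sub_in_ltrees_upto:
  "t \<in> ltrees_upto (Suc n) \<Longrightarrow> i \<in> {1..nchildren t []} \<Longrightarrow> sub t i \<in> ltrees_upto n"
  using sub_in_ltrees[of t i] by (auto simp: ltrees_upto_def sub_def)

lemma ltrees_upto_SucE:
  assumes "t \<in> ltrees_upto (Suc n)"
  obtains c f where "t = node c f" "\<And>i. f i \<in> ltrees_upto n"
proof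
  \<comment> \<open>The one-node tree as default makes \<open>f i \<in> ltrees_upto n\<close> hold
    for every \<open>i\<close>, also outside the range of children.\<close>
  let ?f = "\<lambda>i. if i \<in> {1..nchildren t []} then sub t i else {[]}"
  have "t \<in> ltrees" using assms by (simp add: ltrees_upto_def)
  then show "t = node (nchildren t []) ?f"
    by (subst (1) node_sub[symmetric]) (auto intro!: node_cong)
  show "?f i \<in> ltrees_upto n" for i
    using assms by (auto simp: leaf_in_ltrees_upto intro!: sub_in_ltrees_upto)
qed

lemma prune_in_ltrees_upto: "t \<in> ltrees \<Longrightarrow> prune n t \<in> ltrees_upto n"
proof (induction n arbitrary: t)
  case 0 then show ?case by (simp add: prune_0 ltrees_upto_0)
next
  case (Suc n)
  have "prune (Suc n) t = node (nchildren t []) (\<lambda>i. prune n (sub t i))"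
    using prune_node node_sub[OF Suc.prems] by metis
  then show ?case using Suc by (auto intro!: node_in_ltrees_upto sub_in_ltrees)
qed

lemma prune_in_ltrees: "t \<in> ltrees \<Longrightarrow> prune n t \<in> ltrees"
  using prune_in_ltrees_upto by (auto simp: ltrees_upto_def)

lemma prune_ident: "t \<in> ltrees_upto n \<Longrightarrow> prune n t = t"
  by (auto simp: prune_def ltrees_upto_def)

lemma ltrees_upto_imp: "t \<in> ltrees_upto n \<Longrightarrow> t \<in> ltrees"
  by (simp add: ltrees_upto_def)

lemma Nil_in_ltrees_upto: "t \<in> ltrees_upto n \<Longrightarrow> [] \<in> t"
  by (simp add: ltrees_upto_imp Nil_in_ltrees)

text \<open>Each defining condition of \<open>ltrees\<close> looks at nodes of bounded depth, so it
  can be checked in a pruning. This opens infinite trees to induction on the depth.\<close>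

lemma ltreesI_prune:
  assumes "\<And>n. prune n t \<in> ltrees" shows "t \<in> ltrees"
  unfolding ltrees_def mem_Collect_eq
proof (intro conjI allI ballI impI)
  show "[] \<in> t" using Nil_in_ltrees[OF assms[of 0]] by simp
next
  fix m i assume "m @ [i] \<in> t"
  then have "m @ [i] \<in> prune (Suc (length m)) t" by (simp add: prune_def)
  then show "m \<in> t" using ltrees_snocD[OF assms] by (auto simp: prune_def)
next
  fix m assume "m \<in> t"
  then have "m \<in> prune (Suc (length m)) t" by (simp add: prune_def)
  from ltrees_children[OF assms this] show "\<exists>c. {i. m @ [i] \<in> t} = {1..c}"
    by (auto simp: prune_def)
qed

lemma finite_ltrees_upto_member: "t \<in> ltrees_upto n \<Longrightarrow> finite t"
proof (induction n arbitrary: t)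
  case 0 then show ?case by (simp add: ltrees_upto_0)
next
  case (Suc n)
  then obtain c f where t: "t = node c f" "\<And>i. f i \<in> ltrees_upto n" by (blast elim: ltrees_upto_SucE)
  have "node c f = insert [] (\<Union>i\<in>{1..c}. (#) i ` f i)" by (auto simp: node_def)
  then show ?case using t Suc.IH by simp
qed

lemma countable_ltrees_upto [simp]: "countable (ltrees_upto n)"
proof (rule countable_subset)
  show "ltrees_upto n \<subseteq> {A. finite A}" using finite_ltrees_upto_member by blast
  show "countable {A :: ltree. finite A}" by (rule countable_Collect_finite)
qed

section \<open>Root decompositions of the three tree constructions\<close>

lemma tree_of_offspring_snoc:
  "m @ [i] \<in> tree_of_offspring \<omega> \<longleftrightarrow> m \<in> tree_of_offspring \<omega> \<and> i \<in> {1..\<omega> m}"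
  by (subst tree_of_offspring.simps) auto

lemma tree_of_offspring_Cons:
  "i # m \<in> tree_of_offspring \<omega> \<longleftrightarrow> i \<in> {1..\<omega> []} \<and> m \<in> tree_of_offspring (\<lambda>u. \<omega> (i # u))"
proof (induction m rule: rev_induct)
  case Nil
  show ?case using tree_of_offspring_snoc[of "[]" i \<omega>] by (auto intro: tree_of_offspring.root)
next
  case (snoc j m)
  have "i # m @ [j] \<in> tree_of_offspring \<omega> \<longleftrightarrow> i # m \<in> tree_of_offspring \<omega> \<and> j \<in> {1..\<omega> (i # m)}"
    using tree_of_offspring_snoc[of "i # m" j \<omega>] by simp
  then show ?case using snoc by (simp add: tree_of_offspring_snoc)
qed

lemma tree_of_offspring_node:
  "tree_of_offspring \<omega> = node (\<omega> []) (\<lambda>i. tree_of_offspring (\<lambda>m. \<omega> (i # m)))"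
  by (rule ltree_eqI) (auto simp: tree_of_offspring_Cons intro: tree_of_offspring.root)

lemma tree_of_offspring_in_ltrees: "tree_of_offspring \<omega> \<in> ltrees"
proof (rule ltreesI_prune)
  show "prune n (tree_of_offspring \<omega>) \<in> ltrees" for n
  proof (induction n arbitrary: \<omega>)
    case 0
    have "prune 0 (tree_of_offspring \<omega>) = {[]}"
      by (auto simp: prune_def intro: tree_of_offspring.root)
    then show ?case using leaf_in_ltrees_upto ltrees_upto_imp by metis
  next
    case (Suc n)
    show ?case
      by (subst tree_of_offspring_node) (auto simp: prune_node intro!: node_in_ltrees Suc)
  qed
qed

lemma new_label_Nil [simp]: "new_label \<sigma> [] = []"
  by (simp add: new_label_def)

lemma new_label_Cons [simp]:
  "new_label \<sigma> (i # m) = \<sigma> [] i # new_label (\<lambda>u. \<sigma> (i # u)) m"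
  by (simp add: new_label_def upt_conv_Cons map_Suc_upt[symmetric] del: upt_Suc)

text \<open>Child \<open>i\<close> moves to position \<open>\<sigma> [] i\<close>, so position
  \<open>j\<close> holds the relabeled subtree of the old child \<open>inv (\<sigma> []) j\<close>,
  whose own permutations are the coordinates of \<open>\<sigma>\<close> below that child.\<close>

lemma new_label_node:
  assumes t: "t \<in> ltrees" and \<sigma>: "\<sigma> [] permutes {1..nchildren t []}"
  shows "new_label \<sigma> ` t = node (nchildren t [])
     (\<lambda>j. let i = inv (\<sigma> []) j in new_label (\<lambda>m. \<sigma> (i # m)) ` sub t i)" (is "_ = node ?c ?f")
proof (rule ltree_eqI)
  show "[] \<in> new_label \<sigma> ` t \<longleftrightarrow> [] \<in> node ?c ?f"
    using Nil_in_ltrees[OF t] new_label_Nil by (metis Nil_in_node image_eqI)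
next
  fix j m
  show "j # m \<in> new_label \<sigma> ` t \<longleftrightarrow> j # m \<in> node ?c ?f"
  proof
    assume "j # m \<in> new_label \<sigma> ` t"
    then obtain u where u: "u \<in> t" "new_label \<sigma> u = j # m" by auto
    then obtain i v where v: "u = i # v" by (cases u) auto
    with u have j: "j = \<sigma> [] i" "m = new_label (\<lambda>u. \<sigma> (i # u)) v" by auto
    have "i \<in> {1..?c}" using u v t ltrees_ConsD by blast
    then have "j \<in> {1..?c}" using j permutes_in_image[OF \<sigma>] by blast
    moreover have "inv (\<sigma> []) j = i" using j \<sigma> by (simp add: permutes_inverses)
    ultimately show "j # m \<in> node ?c ?f" using u v j by (auto simp: Let_def sub_def)
  next
    assume "j # m \<in> node ?c ?f"
    then obtain v where v: "v \<in> sub t (inv (\<sigma> []) j)"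
      "m = new_label (\<lambda>u. \<sigma> (inv (\<sigma> []) j # u)) v" by (auto simp: Let_def)
    then have "j # m = new_label \<sigma> (inv (\<sigma> []) j # v)" using \<sigma> by (simp add: permutes_inverses)
    moreover have "inv (\<sigma> []) j # v \<in> t" using v by (simp add: sub_def)
    ultimately show "j # m \<in> new_label \<sigma> ` t" by blast
  qed
qed

lemma new_label_in_ltrees:
  assumes "t \<in> ltrees" "\<And>m. \<sigma> m permutes {1..nchildren t m}"
  shows "new_label \<sigma> ` t \<in> ltrees"
proof (rule ltreesI_prune)
  show "prune n (new_label \<sigma> ` t) \<in> ltrees" for n
    using assms
  proof (induction n arbitrary: \<sigma> t)
    case 0
    have "prune 0 (new_label \<sigma> ` t) = {[]}"
      using Nil_in_ltrees[OF 0(1)] new_label_Nil[of \<sigma>] by (force simp: prune_def image_iff)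
    then show ?case using leaf_in_ltrees_upto ltrees_upto_imp by metis
  next
    case (Suc n)
    have "prune n (let i = inv (\<sigma> []) j in new_label (\<lambda>m. \<sigma> (i # m)) ` sub t i) \<in> ltrees"
      if "j \<in> {1..nchildren t []}" for j
    proof -
      have "inv (\<sigma> []) j \<in> {1..nchildren t []}"
        using that permutes_in_image[OF permutes_inv[OF Suc.prems(2)]] by blast
      then show ?thesis unfolding Let_def
        using Suc.prems by (intro Suc.IH) (auto simp: nchildren_sub intro: sub_in_ltrees)
    qed
    then show ?case
      using Suc.prems by (subst new_label_node) (auto simp: prune_node intro!: node_in_ltrees)
  qed
qed

text \<open>Inside an old child \<open>i\<close> only the coordinates of \<open>K\<close> and
  \<open>G\<close> whose label starts with \<open>i\<close> matter; new children of the root are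
  numbered after the old ones, whence the shift by \<open>nchildren t []\<close>. The three cases of
  the proof are: old node, graft at the root, graft below an old child.\<close>

lemma attach_node:
  assumes t: "t \<in> ltrees"
  shows "attach t K G = node (nchildren t [] + K [])
    (\<lambda>i. if i \<le> nchildren t [] then attach (sub t i) (\<lambda>m. K (i # m)) (\<lambda>(m, j). G (i # m, j))
         else G ([], i - nchildren t []))" (is "_ = node ?c ?f")
proof (rule ltree_eqI)
  show "[] \<in> attach t K G \<longleftrightarrow> [] \<in> node ?c ?f"
    using Nil_in_ltrees[OF t] by (simp add: attach_def)
next
  fix i u
  let ?k = "nchildren t []"
  have iff: "i # u \<in> attach t K G \<longleftrightarrow> i # u \<in> t \<or>
     (\<exists>j\<in>{1..K []}. i = ?k + j \<and> u \<in> G ([], j)) \<or>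
     (\<exists>m j v. i # m \<in> t \<and> j \<in> {1..K (i # m)} \<and> v \<in> G (i # m, j) \<and>
        u = m @ [nchildren t (i # m) + j] @ v)" (is "?L \<longleftrightarrow> ?R")
  proof
    assume ?L
    then consider "i # u \<in> t" | m j v where "i # u = m @ [nchildren t m + j] @ v"
      "m \<in> t" "j \<in> {1..K m}" "v \<in> G (m, j)" unfolding attach_def by auto
    then show ?R
    proof cases
      case 2 then show ?thesis by (cases m) auto
    qed simp
  next
    assume ?R
    then consider "i # u \<in> t" | j where "j\<in>{1..K []}" "i = ?k + j" "u \<in> G ([], j)"
      | m j v where "i # m \<in> t" "j \<in> {1..K (i # m)}" "v \<in> G (i # m, j)"
        "u = m @ [nchildren t (i # m) + j] @ v" by blast
    then show ?L
    proof cases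
      case 1 then show ?thesis by (simp add: attach_def)
    next
      case 2
      then have "i # u = [] @ [nchildren t [] + j] @ u" by simp
      then show ?thesis unfolding attach_def using 2 Nil_in_ltrees[OF t] by blast
    next
      case 3
      then have "i # u = (i # m) @ [nchildren t (i # m) + j] @ v" by simp
      then show ?thesis unfolding attach_def using 3 by blast
    qed
  qed
  show "i # u \<in> attach t K G \<longleftrightarrow> i # u \<in> node ?c ?f"
  proof (cases "i \<in> {1..?k}")
    case True
    then have "i # u \<in> node ?c ?f \<longleftrightarrow>
      u \<in> attach (sub t i) (\<lambda>m. K (i # m)) (\<lambda>(m, j). G (i # m, j))" by auto
    also have "\<dots> \<longleftrightarrow> i # u \<in> attach t K G"
      unfolding iff using True by (auto simp: attach_def sub_def nchildren_sub[unfolded sub_def])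
    finally show ?thesis by simp
  next
    case False
    then have "i # m \<notin> t" for m using ltrees_ConsD[OF t] by blast
    moreover have "(\<exists>j\<in>{1..K []}. i = ?k + j \<and> u \<in> G ([], j)) \<longleftrightarrow> i # u \<in> node ?c ?f"
      using False by (cases "i = 0") (auto intro!: bexI[of _ "i - ?k"])
    ultimately show ?thesis unfolding iff by blast
  qed
qed

lemma attach_in_ltrees:
  assumes "t \<in> ltrees" "\<And>x. G x \<in> ltrees"
  shows "attach t K G \<in> ltrees"
proof (rule ltreesI_prune)
  show "prune n (attach t K G) \<in> ltrees" for n
    using assms
  proof (induction n arbitrary: t K G)
    case 0
    have "prune 0 (attach t K G) = {[]}"
      using Nil_in_ltrees[OF 0(1)] by (auto simp: prune_def attach_def)
    then show ?case using leaf_in_ltrees_upto ltrees_upto_imp by metis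
  next
    case (Suc n)
    have "prune n (attach (sub t i) (\<lambda>m. K (i # m)) (\<lambda>(m, j). G (i # m, j))) \<in> ltrees"
      if "i \<in> {1..nchildren t []}" for i
      using Suc.prems that by (intro Suc.IH) (auto intro: sub_in_ltrees)
    moreover have "prune n (G x) \<in> ltrees" for x using Suc.prems(2) prune_in_ltrees by blast
    ultimately show ?case
      using Suc.prems(1) by (subst attach_node) (auto simp: prune_node intro!: node_in_ltrees)
  qed
qed

section \<open>Factorisation of integrals over product spaces along disjoint blocks of
  coordinates\<close>

lemma PiM_nn_integral_prod_blocks:
  fixes M :: "'i \<Rightarrow> 'a measure" and h :: "'j \<Rightarrow> ('i \<Rightarrow> 'a) \<Rightarrow> ennreal"
  assumes M: "\<And>i. prob_space (M i)" and J: "finite J" "disjoint_family_on K J"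
    and h: "\<And>j. j \<in> J \<Longrightarrow> h j \<in> borel_measurable (PiM UNIV M)"
    and dep: "\<And>j \<omega> \<omega>'. j \<in> J \<Longrightarrow> \<omega> \<in> space (PiM UNIV M) \<Longrightarrow> \<omega>' \<in> space (PiM UNIV M) \<Longrightarrow>
      (\<And>i. i \<in> K j \<Longrightarrow> \<omega> i = \<omega>' i) \<Longrightarrow> h j \<omega> = h j \<omega>'"
  shows "(\<integral>\<^sup>+\<omega>. (\<Prod>j\<in>J. h j \<omega>) \<partial>PiM UNIV M) = (\<Prod>j\<in>J. \<integral>\<^sup>+\<omega>. h j \<omega> \<partial>PiM UNIV M)"
proof -
  interpret P: prob_space "PiM UNIV M" by (rule prob_space_PiM) (rule M)
  obtain x0 where x0: "x0 \<in> space (PiM UNIV M)" using P.not_empty by blast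
  \<comment> \<open>A function that depends only on block \<open>K j\<close> factors through the
    restriction to that block: the missing coordinates are filled from a fixed point
    \<open>x0\<close>. Restrictions to disjoint blocks are independent.\<close>
  define e where "e j y = (\<lambda>i. if i \<in> K j then y i else x0 i)" for j and y :: "'i \<Rightarrow> 'a"
  have e [measurable]: "e j \<in> PiM (K j) M \<rightarrow>\<^sub>M PiM UNIV M" for j
  proof (rule measurable_PiM_single')
    fix i
    have "x0 i \<in> space (M i)" using x0 by (auto simp: space_PiM PiE_def Pi_def)
    then show "(\<lambda>y. e j y i) \<in> PiM (K j) M \<rightarrow>\<^sub>M M i"
      by (cases "i \<in> K j") (auto simp: e_def)
  qed (use x0 in \<open>auto simp: e_def space_PiM PiE_def Pi_def extensional_def\<close>)
  have "P.indep_vars M (\<lambda>i \<omega>. \<omega> i) UNIV"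
    by (subst P.indep_vars_iff_distr_eq_PiM)
       (auto simp: distr_PiM_component M restrict_UNIV intro!: distr_id2 PiM_cong)
  then have "P.indep_vars (\<lambda>j. PiM (K j) M) (\<lambda>j \<omega>. restrict (\<lambda>i. \<omega> i) (K j)) J"
    by (rule P.indep_vars_restrict) (use J in auto)
  then have "P.indep_vars (\<lambda>_. borel) (\<lambda>j \<omega>. h j (e j (restrict \<omega> (K j)))) J"
    by (rule P.indep_vars_compose2) (use h e in \<open>auto intro: measurable_compose\<close>)
  then have "(\<integral>\<^sup>+\<omega>. (\<Prod>j\<in>J. h j (e j (restrict \<omega> (K j)))) \<partial>PiM UNIV M) =
     (\<Prod>j\<in>J. \<integral>\<^sup>+\<omega>. h j (e j (restrict \<omega> (K j))) \<partial>PiM UNIV M)"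
    by (intro P.indep_vars_nn_integral) (use J in auto)
  moreover have "h j (e j (restrict \<omega> (K j))) = h j \<omega>"
    if "j \<in> J" "\<omega> \<in> space (PiM UNIV M)" for j \<omega>
    using that x0 by (intro dep) (auto simp: e_def space_PiM PiE_def Pi_def)
  ultimately show ?thesis by (simp cong: nn_integral_cong prod.cong)
qed

lemma measurable_reindex: "(\<lambda>\<omega> k. \<omega> (f k)) \<in> PiM UNIV M \<rightarrow>\<^sub>M PiM UNIV (\<lambda>k. M (f k))"
  by (rule measurable_PiM_single') (auto simp: space_PiM PiE_def Pi_def)

lemma PiM_nn_integral_reindex:
  fixes M :: "'i \<Rightarrow> 'a measure" and f :: "'k \<Rightarrow> 'i"
  assumes M: "\<And>i. prob_space (M i)" and f: "inj f"
    and h: "h \<in> borel_measurable (PiM UNIV (\<lambda>k. M (f k)))"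
  shows "(\<integral>\<^sup>+\<omega>. h (\<lambda>k. \<omega> (f k)) \<partial>PiM UNIV M) = (\<integral>\<^sup>+\<omega>. h \<omega> \<partial>PiM UNIV (\<lambda>k. M (f k)))"
proof -
  have "distr (PiM UNIV M) (PiM UNIV (\<lambda>k. M (f k))) (\<lambda>\<omega>. \<lambda>n\<in>UNIV. \<omega> (f n)) = PiM UNIV (\<lambda>k. M (f k))"
    by (rule distr_PiM_reindex) (use M f in auto)
  then have "(\<integral>\<^sup>+\<omega>. h \<omega> \<partial>PiM UNIV (\<lambda>k. M (f k))) =
    (\<integral>\<^sup>+\<omega>. h \<omega> \<partial>distr (PiM UNIV M) (PiM UNIV (\<lambda>k. M (f k))) (\<lambda>\<omega> n. \<omega> (f n)))"
    by (simp add: restrict_UNIV)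
  also have "\<dots> = (\<integral>\<^sup>+\<omega>. h (\<lambda>k. \<omega> (f k)) \<partial>PiM UNIV M)"
    using h by (intro nn_integral_distr measurable_reindex) simp
  finally show ?thesis by simp
qed

lemma PiM_nn_integral_component:
  assumes M: "\<And>i. prob_space (M i)" and h: "h \<in> borel_measurable (M i)"
  shows "(\<integral>\<^sup>+\<omega>. h (\<omega> i) \<partial>PiM UNIV M) = (\<integral>\<^sup>+x. h x \<partial>M i)"
  using nn_integral_distr[of "\<lambda>\<omega>. \<omega> i" "PiM UNIV M" "M i" h] distr_PiM_component[of UNIV M i] M h
  by simp

text \<open>Labels split into the root and, for each \<open>i\<close>, the labels starting with
  \<open>i\<close>. In the proof index \<open>0\<close> stands for the root block, which is free
  since children are numbered from \<open>1\<close>.\<close>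

lemma PiM_nn_integral_Cons:
  fixes M :: "nat list \<Rightarrow> 'a measure"
  assumes M: "\<And>m. prob_space (M m)" and h0: "h0 \<in> borel_measurable (M [])"
    and h: "\<And>i. i \<in> {1..c} \<Longrightarrow> h i \<in> borel_measurable (PiM UNIV (\<lambda>m. M (i # m)))"
  shows "(\<integral>\<^sup>+\<omega>. h0 (\<omega> []) * (\<Prod>i\<in>{1..c}. h i (\<lambda>m. \<omega> (i # m))) \<partial>PiM UNIV M) =
    (\<integral>\<^sup>+x. h0 x \<partial>M []) * (\<Prod>i\<in>{1..c}. \<integral>\<^sup>+\<omega>. h i \<omega> \<partial>PiM UNIV (\<lambda>m. M (i # m)))"
proof -
  define H where "H i \<omega> = (if i = 0 then h0 (\<omega> []) else h i (\<lambda>m. \<omega> (i # m)))" for i \<omega>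
  define K where "K i = (if i = 0 then {[]} else range ((#) i))" for i :: nat
  have ins: "{0..c} = insert 0 {1..c}" by auto
  have "(\<integral>\<^sup>+\<omega>. (\<Prod>i\<in>{0..c}. H i \<omega>) \<partial>PiM UNIV M) = (\<Prod>i\<in>{0..c}. \<integral>\<^sup>+\<omega>. H i \<omega> \<partial>PiM UNIV M)"
  proof (rule PiM_nn_integral_prod_blocks)
    show "disjoint_family_on K {0..c}" by (auto simp: disjoint_family_on_def K_def)
    show "H j \<omega> = H j \<omega>'" if "\<And>i. i \<in> K j \<Longrightarrow> \<omega> i = \<omega>' i" for j \<omega> \<omega>'
      using that by (cases "j = 0") (auto simp: H_def K_def)
    show "H j \<in> borel_measurable (PiM UNIV M)" if "j \<in> {0..c}" for j
    proof (cases "j = 0")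
      case True
      have "(\<lambda>\<omega>. h0 (\<omega> [])) \<in> borel_measurable (PiM UNIV M)" using h0 by measurable
      then show ?thesis using True by (simp add: H_def[abs_def])
    next
      case False
      then have [measurable]: "h j \<in> borel_measurable (PiM UNIV (\<lambda>m. M (j # m)))" using h that by auto
      have "(\<lambda>\<omega>. h j (\<lambda>m. \<omega> (j # m))) \<in> borel_measurable (PiM UNIV M)"
        by (rule measurable_compose[OF measurable_reindex]) measurable
      then show ?thesis using False by (simp add: H_def[abs_def])
    qed
  qed (use M in auto)
  moreover have "(\<integral>\<^sup>+\<omega>. H 0 \<omega> \<partial>PiM UNIV M) = (\<integral>\<^sup>+x. h0 x \<partial>M [])"
    using PiM_nn_integral_component[of M h0 "[]"] M h0 by (simp add: H_def)
  moreover have "(\<integral>\<^sup>+\<omega>. H i \<omega> \<partial>PiM UNIV M) = (\<integral>\<^sup>+\<omega>. h i \<omega> \<partial>PiM UNIV (\<lambda>m. M (i # m)))"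
    if "i \<in> {1..c}" for i
    using PiM_nn_integral_reindex[of M "(#) i" "h i"] M h[OF that] that by (simp add: H_def)
  moreover have "(\<Prod>i\<in>{0..c}. H i \<omega>) = h0 (\<omega> []) * (\<Prod>i\<in>{1..c}. h i (\<lambda>m. \<omega> (i # m)))" for \<omega>
    unfolding ins by (subst prod.insert) (auto simp: H_def intro!: arg_cong2[where f="(*)"] prod.cong)
  moreover have "(\<Prod>i\<in>{0..c}. \<integral>\<^sup>+\<omega>. H i \<omega> \<partial>PiM UNIV M) =
      (\<integral>\<^sup>+\<omega>. H 0 \<omega> \<partial>PiM UNIV M) * (\<Prod>i\<in>{1..c}. \<integral>\<^sup>+\<omega>. H i \<omega> \<partial>PiM UNIV M)"
    unfolding ins by (subst prod.insert) auto
  ultimately show ?thesis by simp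
qed

text \<open>The same splitting for graft coordinates: \<open>Inl j\<close> is the single graft at
  the \<open>j\<close>-th new child of the root, \<open>Inr i\<close> the block of all grafts inside
  the old child \<open>i\<close>.\<close>

lemma PiM_nn_integral_grafts:
  fixes N :: "'a measure"
  assumes N: "prob_space N" and g: "\<And>j. j \<in> {1..a} \<Longrightarrow> g j \<in> borel_measurable N"
    and h: "\<And>i. i \<in> {1..k} \<Longrightarrow> h i \<in> borel_measurable (PiM UNIV (\<lambda>_ :: nat list \<times> nat. N))"
  shows "(\<integral>\<^sup>+G. (\<Prod>j\<in>{1..a}. g j (G ([], j))) * (\<Prod>i\<in>{1..k}. h i (\<lambda>(m, j). G (i # m, j)))
      \<partial>PiM UNIV (\<lambda>_ :: nat list \<times> nat. N)) =
    (\<Prod>j\<in>{1..a}. \<integral>\<^sup>+x. g j x \<partial>N) * (\<Prod>i\<in>{1..k}. \<integral>\<^sup>+G. h i G \<partial>PiM UNIV (\<lambda>_. N))"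
proof -
  let ?P = "PiM UNIV (\<lambda>_ :: nat list \<times> nat. N)"
  define H where "H i G = (case i of Inl j \<Rightarrow> g j (G ([], j)) | Inr i \<Rightarrow> h i (\<lambda>(m, j). G (i # m, j)))"
    for i :: "nat + nat" and G
  define K where "K i = (case i of Inl j \<Rightarrow> {([] :: nat list, j)} | Inr i \<Rightarrow> range (\<lambda>(m, j). (i # m, j)))"
    for i :: "nat + nat"
  let ?J = "{1..a} <+> {1..k}"
  have [measurable]: "(\<lambda>G. (\<lambda>(m, j). G (i # m, j))) \<in> ?P \<rightarrow>\<^sub>M ?P" for i
    using measurable_reindex[of "\<lambda>(m, j). (i # m, j)" "\<lambda>_. N"] by (simp add: case_prod_unfold)
  have "(\<integral>\<^sup>+G. (\<Prod>i\<in>?J. H i G) \<partial>?P) = (\<Prod>i\<in>?J. \<integral>\<^sup>+G. H i G \<partial>?P)"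
  proof (rule PiM_nn_integral_prod_blocks)
    show "disjoint_family_on K ?J"
      by (auto simp: disjoint_family_on_def K_def split: sum.splits)
    show "H j \<omega> = H j \<omega>'" if "\<And>i. i \<in> K j \<Longrightarrow> \<omega> i = \<omega>' i" for j \<omega> \<omega>'
    proof (cases j)
      case (Inr i)
      then have "(i # m, l) \<in> K j" for m l by (auto simp: K_def)
      then have "(\<lambda>(m, j). \<omega> (i # m, j)) = (\<lambda>(m, j). \<omega>' (i # m, j))"
        using that by (auto simp: fun_eq_iff)
      then show ?thesis using Inr by (simp add: H_def)
    qed (use that in \<open>auto simp: H_def K_def\<close>)
    show "H j \<in> borel_measurable ?P" if j: "j \<in> ?J" for j
    proof (cases j)
      case (Inl l)
      then have [measurable]: "g l \<in> borel_measurable N" using g j by auto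
      have "(\<lambda>G. g l (G ([], l))) \<in> borel_measurable ?P" by measurable
      then show ?thesis using Inl by (simp add: H_def[abs_def])
    next
      case (Inr l)
      then have [measurable]: "h l \<in> borel_measurable ?P" using h j by auto
      have "(\<lambda>G. h l (\<lambda>(m, j). G (l # m, j))) \<in> borel_measurable ?P" by measurable
      then show ?thesis using Inr by (simp add: H_def[abs_def])
    qed
  qed (use N in auto)
  moreover have "(\<integral>\<^sup>+G. H (Inl j) G \<partial>?P) = (\<integral>\<^sup>+x. g j x \<partial>N)" if "j \<in> {1..a}" for j
    using PiM_nn_integral_component[of "\<lambda>_. N" "g j" "([], j)"] N g[OF that] by (simp add: H_def)
  moreover have "(\<integral>\<^sup>+G. H (Inr i) G \<partial>?P) = (\<integral>\<^sup>+G. h i G \<partial>?P)" if "i \<in> {1..k}" for i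
    using PiM_nn_integral_reindex[of "\<lambda>_. N" "\<lambda>(m, j). (i # m, j)" "h i"] N h[OF that]
    by (simp add: H_def case_prod_unfold inj_def)
  ultimately show ?thesis by (simp add: prod.Plus) (simp add: H_def)
qed

section \<open>Measurability\<close>

lemma space_tree_space [simp]: "space tree_space = ltrees"
  unfolding tree_space_def by (rule space_measure_of) auto

lemma pred_mem_tree_space [measurable]: "Measurable.pred tree_space (\<lambda>t. m \<in> t)"
proof -
  have "{t \<in> ltrees. m \<in> t} \<in> sets tree_space"
    unfolding tree_space_def by (rule in_measure_of) auto
  then show ?thesis by (simp add: pred_def)
qed

lemma measurable_tree_spaceI:
  assumes "\<And>x. x \<in> space M \<Longrightarrow> f x \<in> ltrees" "\<And>m. Measurable.pred M (\<lambda>x. m \<in> f x)"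
  shows "f \<in> M \<rightarrow>\<^sub>M tree_space"
  unfolding tree_space_def
proof (rule measurable_measure_of)
  fix A assume "A \<in> {{t \<in> ltrees. m \<in> t} | m. True}"
  then obtain m where "A = {t \<in> ltrees. m \<in> t}" by blast
  then have "f -` A \<inter> space M = {x \<in> space M. m \<in> f x}" using assms(1) by auto
  then show "f -` A \<inter> space M \<in> sets M" using assms(2)[of m] by (simp add: pred_def)
qed (use assms in auto)

lemma measurable_prune [measurable]: "prune n \<in> tree_space \<rightarrow>\<^sub>M count_space (ltrees_upto n)"
proof (subst measurable_count_space_eq_countable, simp, safe)
  fix x
  have "prune n -` {x} \<inter> space tree_space =
      {t \<in> space tree_space. \<forall>m. (m \<in> x) = (m \<in> t \<and> length m \<le> n)}"
    by (auto simp: prune_def)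
  also have "\<dots> \<in> sets tree_space" by measurable
  finally show "prune n -` {x} \<inter> space tree_space \<in> sets tree_space" .
qed (auto intro: prune_in_ltrees_upto)

lemma pred_prune_eq [measurable]: "Measurable.pred tree_space (\<lambda>t. prune n t = x)"
proof -
  have "prune n t = x \<longleftrightarrow> (\<forall>m. (m \<in> x) = (m \<in> t \<and> length m \<le> n))" for t
    by (auto simp: prune_def)
  then show ?thesis by (simp only:) measurable
qed

lemma measurable_tree_of_offspring [measurable]:
  "tree_of_offspring \<in> (\<Pi>\<^sub>M m\<in>UNIV. measure_pmf (p m)) \<rightarrow>\<^sub>M tree_space"
proof (rule measurable_tree_spaceI)
  show "Measurable.pred (\<Pi>\<^sub>M m\<in>UNIV. measure_pmf (p m)) (\<lambda>\<omega>. m \<in> tree_of_offspring \<omega>)" for m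
  proof (induction m rule: rev_induct)
    case Nil show ?case by (simp add: tree_of_offspring.root)
  next
    case (snoc i m)
    note [measurable] = snoc
    have [measurable]: "(\<lambda>\<omega>. \<omega> m) \<in> (\<Pi>\<^sub>M m\<in>UNIV. measure_pmf (p m)) \<rightarrow>\<^sub>M count_space UNIV"
      using measurable_component_singleton[of m UNIV "\<lambda>m. measure_pmf (p m)"] by simp
    show ?case unfolding tree_of_offspring_snoc by measurable
  qed
qed (rule tree_of_offspring_in_ltrees)

lemma prob_space_GW: "prob_space (GW \<mu>)"
  unfolding GW_def
  by (intro prob_space.prob_space_distr prob_space_PiM prob_space_measure_pmf measurable_tree_of_offspring)

lemma sets_GW [simp, measurable_cong]: "sets (GW \<mu>) = sets tree_space"
  and space_GW [simp]: "space (GW \<mu>) = ltrees"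
  by (simp_all add: GW_def)

lemma measurable_attach [measurable]:
  assumes "t \<in> ltrees"
  shows "(\<lambda>(K, G). attach t K G) \<in>
    (\<Pi>\<^sub>M m\<in>UNIV. measure_pmf p) \<Otimes>\<^sub>M (\<Pi>\<^sub>M mj\<in>UNIV. GW \<mu>) \<rightarrow>\<^sub>M tree_space" (is "_ \<in> ?A \<Otimes>\<^sub>M ?B \<rightarrow>\<^sub>M _")
proof (rule measurable_tree_spaceI)
  fix x assume "x \<in> space (?A \<Otimes>\<^sub>M ?B)"
  then show "(case x of (K, G) \<Rightarrow> attach t K G) \<in> ltrees"
    using assms by (auto simp: space_pair_measure space_PiM PiE_def Pi_def intro!: attach_in_ltrees)
next
  fix x
  have [measurable]: "(\<lambda>\<omega>. fst \<omega> m) \<in> ?A \<Otimes>\<^sub>M ?B \<rightarrow>\<^sub>M count_space UNIV" for m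
    using measurable_compose[OF measurable_fst measurable_component_singleton[of m UNIV "\<lambda>m. measure_pmf p"]] by simp
  have [measurable]: "Measurable.pred (?A \<Otimes>\<^sub>M ?B) (\<lambda>\<omega>. u \<in> snd \<omega> m)" for m u
    by (rule measurable_compose[OF _ pred_mem_tree_space]) measurable
  have "(case \<omega> of (K, G) \<Rightarrow> x \<in> attach t K G) \<longleftrightarrow> x \<in> t \<or> (\<exists>m j u. x = m @ [nchildren t m + j] @ u \<and>
      m \<in> t \<and> j \<in> {1..fst \<omega> m} \<and> u \<in> snd \<omega> (m, j))" for \<omega>
    by (cases \<omega>) (auto simp: attach_def)
  moreover have "Measurable.pred (?A \<Otimes>\<^sub>M ?B) (\<lambda>\<omega>. x \<in> t \<or> (\<exists>m j u. x = m @ [nchildren t m + j] @ u \<and>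
      m \<in> t \<and> j \<in> {1..fst \<omega> m} \<and> u \<in> snd \<omega> (m, j)))" by measurable
  ultimately show "Measurable.pred (?A \<Otimes>\<^sub>M ?B) (\<lambda>\<omega>. x \<in> (case \<omega> of (K, G) \<Rightarrow> attach t K G))"
    by (simp add: case_prod_unfold)
qed

abbreviation perms :: "nat \<Rightarrow> (nat \<Rightarrow> nat) set" where
  "perms c \<equiv> {\<pi>. \<pi> permutes {1..c}}"

lemma finite_perms: "finite (perms c)" and perms_nonempty: "perms c \<noteq> {}"
  and card_perms: "card (perms c) = fact c"
proof -
  have "id \<in> perms c" by (simp add: permutes_id)
  then show "perms c \<noteq> {}" by blast
qed (use card_permutations[of "{1..c}" c] in \<open>auto simp: finite_permutations\<close>)

lemma measurable_new_label [measurable]: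
  assumes t: "t \<in> ltrees"
  shows "(\<lambda>\<sigma>. new_label \<sigma> ` t) \<in> (\<Pi>\<^sub>M m\<in>UNIV. uniform_count_measure (perms (nchildren t m))) \<rightarrow>\<^sub>M tree_space"
    (is "_ \<in> ?A \<rightarrow>\<^sub>M _")
proof (rule measurable_tree_spaceI)
  fix \<sigma> assume "\<sigma> \<in> space ?A"
  then show "new_label \<sigma> ` t \<in> ltrees"
    using t by (auto simp: space_PiM PiE_def Pi_def space_uniform_count_measure intro!: new_label_in_ltrees)
next
  fix y
  have [measurable]: "(\<lambda>\<sigma>. \<sigma> m i) \<in> ?A \<rightarrow>\<^sub>M count_space UNIV" for m i
  proof (rule measurable_compose[OF measurable_component_singleton])
    show "(\<lambda>\<pi>. \<pi> i) \<in> uniform_count_measure (perms (nchildren t m)) \<rightarrow>\<^sub>M count_space UNIV"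
      by (auto simp: measurable_def sets_uniform_count_measure space_uniform_count_measure)
  qed simp
  have "new_label \<sigma> m = y \<longleftrightarrow> length y = length m \<and> (\<forall>k. k < length m \<longrightarrow> \<sigma> (take k m) (m ! k) = y ! k)"
    for \<sigma> m by (subst list_eq_iff_nth_eq) (auto simp: new_label_def)
  then have "y \<in> new_label \<sigma> ` t \<longleftrightarrow> (\<exists>m. m \<in> t \<and> length y = length m \<and>
      (\<forall>k. k < length m \<longrightarrow> \<sigma> (take k m) (m ! k) = y ! k))" for \<sigma>
    unfolding image_iff Bex_def by metis
  then show "Measurable.pred ?A (\<lambda>\<sigma>. y \<in> new_label \<sigma> ` t)" by (simp only:) measurable
qed

declare One_nat_def [simp del]

section \<open>The pruned laws as recursively defined discrete distributions\<close>

text \<open>\<open>gwp\<close>, \<open>augp\<close> and \<open>relp\<close> are the laws of the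
  depth-\<open>n\<close> prunings of \<open>GW\<close>, \<open>augmentation\<close> and
  \<open>uniform_relabeling\<close>, written as recursions over the root; the cylinder lemmas below
  identify them. The default \<open>{[]}\<close> of \<open>Pi_pmf\<close> is only a placeholder
  outside the children.\<close>

fun gwp :: "real \<Rightarrow> nat \<Rightarrow> ltree pmf" where
  "gwp \<mu> 0 = return_pmf {[]}"
| "gwp \<mu> (Suc n) = do {c \<leftarrow> Poisson \<mu>; F \<leftarrow> Pi_pmf {1..c} {[]} (\<lambda>_. gwp \<mu> n); return_pmf (node c F)}"

fun augp :: "real \<Rightarrow> real \<Rightarrow> nat \<Rightarrow> ltree \<Rightarrow> ltree pmf" where
  "augp lam s 0 t = return_pmf {[]}"
| "augp lam s (Suc n) t = do {
     a \<leftarrow> Poisson (lam * (1 - s));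
     F \<leftarrow> Pi_pmf {1..nchildren t [] + a} {[]}
            (\<lambda>i. if i \<le> nchildren t [] then augp lam s n (sub t i) else gwp lam n);
     return_pmf (node (nchildren t [] + a) F)}"

fun relp :: "nat \<Rightarrow> ltree \<Rightarrow> ltree pmf" where
  "relp 0 t = return_pmf {[]}"
| "relp (Suc n) t = do {
     \<pi> \<leftarrow> pmf_of_set (perms (nchildren t []));
     F \<leftarrow> Pi_pmf {1..nchildren t []} {[]} (\<lambda>i. relp n (sub t i));
     return_pmf (node (nchildren t []) (\<lambda>j. F (inv \<pi> j)))}"

lemma set_Pi_pmf_in:
  "F \<in> set_pmf (Pi_pmf {1..c} d P) \<Longrightarrow> i \<in> {1..c::nat} \<Longrightarrow> F i \<in> set_pmf (P i)"
  by (auto simp: set_Pi_pmf PiE_dflt_def)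

lemma set_gwp: "t \<in> set_pmf (gwp \<mu> n) \<Longrightarrow> t \<in> ltrees_upto n"
  by (induction n arbitrary: t)
     (auto simp: ltrees_upto_0 dest: set_Pi_pmf_in intro!: node_in_ltrees_upto)

lemma set_augp: "x \<in> set_pmf (augp lam s n t) \<Longrightarrow> x \<in> ltrees_upto n"
proof (induction n arbitrary: t x)
  case 0 then show ?case by (simp add: ltrees_upto_0)
next
  case (Suc n)
  then obtain a F where F: "F \<in> set_pmf (Pi_pmf {1..nchildren t [] + a} {[]}
      (\<lambda>i. if i \<le> nchildren t [] then augp lam s n (sub t i) else gwp lam n))"
    and x: "x = node (nchildren t [] + a) F" by auto
  have "F i \<in> ltrees_upto n" if "i \<in> {1..nchildren t [] + a}" for i
    using set_Pi_pmf_in[OF F that] Suc.IH by (auto split: if_splits dest: set_gwp)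
  then show ?case unfolding x by (rule node_in_ltrees_upto)
qed

lemma inv_perm_in: "\<pi> permutes {1..c} \<Longrightarrow> j \<in> {1..c::nat} \<Longrightarrow> inv \<pi> j \<in> {1..c}"
  using permutes_in_image[OF permutes_inv] by metis

lemma set_pmf_of_perms [simp]: "set_pmf (pmf_of_set (perms c)) = perms c"
  by (rule set_pmf_of_set) (rule perms_nonempty, rule finite_perms)

lemma set_relp: "x \<in> set_pmf (relp n t) \<Longrightarrow> x \<in> ltrees_upto n"
proof (induction n arbitrary: t x)
  case 0 then show ?case by (simp add: ltrees_upto_0)
next
  case (Suc n)
  then obtain \<pi> F where \<pi>: "\<pi> permutes {1..nchildren t []}"
    and F: "F \<in> set_pmf (Pi_pmf {1..nchildren t []} {[]} (\<lambda>i. relp n (sub t i)))"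
    and x: "x = node (nchildren t []) (\<lambda>j. F (inv \<pi> j))"
    by auto
  show ?case unfolding x
  proof (rule node_in_ltrees_upto)
    fix j assume "j \<in> {1..nchildren t []}"
    then show "F (inv \<pi> j) \<in> ltrees_upto n"
      using set_Pi_pmf_in[OF F inv_perm_in[OF \<pi>]] Suc.IH by blast
  qed
qed

lemma pmf_Pi_nn_integral_point:
  assumes "finite A"
  shows "(\<integral>\<^sup>+F. indicator {F. \<forall>i\<in>A. F i = f i} F \<partial>measure_pmf (Pi_pmf A d P)) =
    ennreal (\<Prod>i\<in>A. pmf (P i) (f i))"
proof -
  let ?f = "\<lambda>i. if i \<in> A then f i else d"
  have "AE F in measure_pmf (Pi_pmf A d P). (indicator {F. \<forall>i\<in>A. F i = f i} F :: ennreal) = indicator {?f} F"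
    using set_Pi_pmf_subset[OF assms, of d P]
    by (auto simp: AE_measure_pmf_iff indicator_def fun_eq_iff)
  then have "(\<integral>\<^sup>+F. indicator {F. \<forall>i\<in>A. F i = f i} F \<partial>measure_pmf (Pi_pmf A d P)) =
     (\<integral>\<^sup>+F. indicator {?f} F \<partial>measure_pmf (Pi_pmf A d P))"
    by (rule nn_integral_cong_AE)
  also have "\<dots> = ennreal (pmf (Pi_pmf A d P) ?f)" by (simp add: emeasure_pmf_single)
  also have "pmf (Pi_pmf A d P) ?f = (\<Prod>i\<in>A. pmf (P i) (f i))"
    using assms by (subst pmf_Pi') (auto intro!: prod.cong)
  finally show ?thesis .
qed

text \<open>The outcome determines the random choices: the degree gives \<open>a\<close> by
  injectivity of \<open>N\<close>, and the subtrees give \<open>F\<close>. So a single term of the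
  mixture survives.\<close>

lemma pmf_bind_node:
  assumes P: "\<And>a i t. i \<in> {1..N a} \<Longrightarrow> t \<in> set_pmf (P a i) \<Longrightarrow> [] \<in> t"
    and f: "\<And>i. i \<in> {1..N a} \<Longrightarrow> [] \<in> f i" and N: "inj N"
  shows "pmf (do {a \<leftarrow> p; F \<leftarrow> Pi_pmf {1..N a} {[]} (P a); return_pmf (node (N a) F)}) (node (N a) f) =
    pmf p a * (\<Prod>i\<in>{1..N a}. pmf (P a i) (f i))"
proof -
  let ?C = "\<Prod>i\<in>{1..N a}. pmf (P a i) (f i)"
  have inner: "(\<integral>\<^sup>+F. ennreal (pmf (return_pmf (node (N b) F)) (node (N a) f)) \<partial>Pi_pmf {1..N b} {[]} (P b)) =
      ennreal ?C * indicator {a} b" for b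
  proof -
    have eq: "node (N b) F = node (N a) f \<longleftrightarrow> b = a \<and> (\<forall>i\<in>{1..N a}. F i = f i)"
      if "F \<in> set_pmf (Pi_pmf {1..N b} {[]} (P b))" for F
      using P[OF _ set_Pi_pmf_in[OF that]] f N
      by (subst node_eq_iff) (auto simp: inj_eq)
    show ?thesis
    proof (cases "b = a")
      case True
      have "(\<integral>\<^sup>+F. ennreal (pmf (return_pmf (node (N b) F)) (node (N a) f)) \<partial>Pi_pmf {1..N b} {[]} (P b)) =
        (\<integral>\<^sup>+F. indicator {F. \<forall>i\<in>{1..N b}. F i = f i} F \<partial>Pi_pmf {1..N b} {[]} (P b))"
        using eq True by (intro nn_integral_cong_AE) (auto simp: AE_measure_pmf_iff indicator_def)
      also have "\<dots> = ennreal (\<Prod>i\<in>{1..N b}. pmf (P b i) (f i))"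
        by (rule pmf_Pi_nn_integral_point) simp
      finally show ?thesis using True by simp
    next
      case False
      then have "(\<integral>\<^sup>+F. ennreal (pmf (return_pmf (node (N b) F)) (node (N a) f)) \<partial>Pi_pmf {1..N b} {[]} (P b)) =
        (\<integral>\<^sup>+F. 0 \<partial>measure_pmf (Pi_pmf {1..N b} {[]} (P b)))"
        using eq by (intro nn_integral_cong_AE) (auto simp: AE_measure_pmf_iff indicator_def)
      then show ?thesis using False by simp
    qed
  qed
  have "ennreal (pmf (do {a \<leftarrow> p; F \<leftarrow> Pi_pmf {1..N a} {[]} (P a); return_pmf (node (N a) F)}) (node (N a) f))
     = (\<integral>\<^sup>+b. ennreal ?C * indicator {a} b \<partial>p)"
    by (simp only: ennreal_pmf_bind inner)
  also have "\<dots> = ennreal ?C * ennreal (pmf p a)"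
    by (simp add: nn_integral_cmult_indicator emeasure_pmf_single)
  also have "\<dots> = ennreal (pmf p a * ?C)"
    by (simp add: ennreal_mult'[symmetric] prod_nonneg mult.commute)
  finally show ?thesis by (simp add: prod_nonneg)
qed

lemma pmf_gwp_node:
  assumes "\<And>i. i \<in> {1..c} \<Longrightarrow> [] \<in> f i"
  shows "pmf (gwp \<mu> (Suc n)) (node c f) = pmf (Poisson \<mu>) c * (\<Prod>i\<in>{1..c}. pmf (gwp \<mu> n) (f i))"
  unfolding gwp.simps using assms
  by (intro pmf_bind_node[where N = "\<lambda>c. c" and P = "\<lambda>_ _. gwp \<mu> n"])
     (auto dest: set_gwp Nil_in_ltrees_upto)

lemma pmf_augp_node:
  assumes "\<And>i. i \<in> {1..nchildren t [] + a} \<Longrightarrow> [] \<in> f i"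
  shows "pmf (augp lam s (Suc n) t) (node (nchildren t [] + a) f) = pmf (Poisson (lam * (1 - s))) a *
    ((\<Prod>i\<in>{1..nchildren t []}. pmf (augp lam s n (sub t i)) (f i)) *
     (\<Prod>j\<in>{1..a}. pmf (gwp lam n) (f (nchildren t [] + j))))" (is "_ = _ * (?A * ?B)")
proof -
  let ?k = "nchildren t []"
  let ?P = "\<lambda>i. if i \<le> ?k then augp lam s n (sub t i) else gwp lam n"
  have "pmf (augp lam s (Suc n) t) (node (?k + a) f) =
     pmf (Poisson (lam * (1 - s))) a * (\<Prod>i\<in>{1..?k + a}. pmf (?P i) (f i))"
    unfolding augp.simps by (rule pmf_bind_node)
      (use assms in \<open>auto split: if_splits simp: inj_def intro: Nil_in_ltrees_upto dest: set_gwp set_augp\<close>)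
  also have "{1..?k + a} = {1..?k} \<union> {1 + ?k..a + ?k}" by auto
  also have "(\<Prod>i\<in>{1..?k} \<union> {1 + ?k..a + ?k}. pmf (?P i) (f i)) =
    (\<Prod>i\<in>{1..?k}. pmf (?P i) (f i)) * (\<Prod>i\<in>{1 + ?k..a + ?k}. pmf (?P i) (f i))"
    by (rule prod.union_disjoint) auto
  also have "(\<Prod>i\<in>{1 + ?k..a + ?k}. pmf (?P i) (f i)) = ?B"
    unfolding prod.shift_bounds_cl_nat_ivl by (auto intro!: prod.cong simp: add.commute)
  also have "(\<Prod>i\<in>{1..?k}. pmf (?P i) (f i)) = ?A" by (auto intro!: prod.cong)
  finally show ?thesis .
qed

text \<open>Given \<pi>, the outcome is hit exactly when child \<open>i\<close> is relabeled to
  \<open>f (\<pi> i)\<close>, the subtree at its new position; averaging over \<pi> gives the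
  formula.\<close>

lemma pmf_relp_node:
  assumes "\<And>i. i \<in> {1..nchildren t []} \<Longrightarrow> [] \<in> f i"
  shows "pmf (relp (Suc n) t) (node (nchildren t []) f) =
    (\<Sum>\<pi>\<in>perms (nchildren t []). \<Prod>i\<in>{1..nchildren t []}. pmf (relp n (sub t i)) (f (\<pi> i))) / fact (nchildren t [])"
proof -
  let ?c = "nchildren t []"
  let ?P = "Pi_pmf {1..?c} {[]} (\<lambda>i. relp n (sub t i))"
  have "pmf (?P \<bind> (\<lambda>F. return_pmf (node ?c (\<lambda>j. F (inv \<pi> j))))) (node ?c f) =
      (\<Prod>i\<in>{1..?c}. pmf (relp n (sub t i)) (f (\<pi> i)))" if \<pi>: "\<pi> permutes {1..?c}" for \<pi>
  proof -
    have eq: "node ?c (\<lambda>j. F (inv \<pi> j)) = node ?c f \<longleftrightarrow> (\<forall>i\<in>{1..?c}. F i = f (\<pi> i))"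
      if F: "F \<in> set_pmf ?P" for F
    proof -
      have "[] \<in> F (inv \<pi> j)" if "j \<in> {1..?c}" for j
        using set_Pi_pmf_in[OF F inv_perm_in[OF \<pi> that]] by (auto dest: set_relp Nil_in_ltrees_upto)
      then have "node ?c (\<lambda>j. F (inv \<pi> j)) = node ?c f \<longleftrightarrow> (\<forall>j\<in>{1..?c}. F (inv \<pi> j) = f j)"
        using assms by (subst node_eq_iff) auto
      also have "\<dots> \<longleftrightarrow> (\<forall>j\<in>\<pi> ` {1..?c}. F (inv \<pi> j) = f j)"
        using permutes_image[OF \<pi>] by simp
      also have "\<dots> \<longleftrightarrow> (\<forall>i\<in>{1..?c}. F i = f (\<pi> i))"
        using permutes_inverses[OF \<pi>] by simp
      finally show ?thesis .
    qed
    have "ennreal (pmf (?P \<bind> (\<lambda>F. return_pmf (node ?c (\<lambda>j. F (inv \<pi> j))))) (node ?c f)) =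
      (\<integral>\<^sup>+F. indicator {F. \<forall>i\<in>{1..?c}. F i = f (\<pi> i)} F \<partial>?P)"
      unfolding ennreal_pmf_bind using eq
      by (intro nn_integral_cong_AE) (auto simp: AE_measure_pmf_iff indicator_def)
    also have "\<dots> = ennreal (\<Prod>i\<in>{1..?c}. pmf (relp n (sub t i)) (f (\<pi> i)))"
      by (subst pmf_Pi_nn_integral_point) auto
    finally show ?thesis by (simp add: prod_nonneg)
  qed
  then show ?thesis
    unfolding relp.simps by (subst pmf_bind_pmf_of_set[OF perms_nonempty finite_perms]) (simp add: card_perms)
qed

lemma emeasure_prune_outside:
  assumes "x \<notin> ltrees_upto n" shows "{t \<in> ltrees. prune n t = x} = {}"
  using assms prune_in_ltrees_upto by blast

lemma pmf_eq_0_outside: "(\<And>t. t \<in> set_pmf p \<Longrightarrow> t \<in> A) \<Longrightarrow> x \<notin> A \<Longrightarrow> pmf p x = 0"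
  by (auto simp: set_pmf_eq)

abbreviation cyl :: "nat \<Rightarrow> ltree \<Rightarrow> ltree set" where
  "cyl n x \<equiv> {t \<in> ltrees. prune n t = x}"

lemma sets_cyl [measurable]: "cyl n x \<in> sets tree_space"
  using pred_prune_eq[of n x] by (simp add: pred_def)

lemma cyl_0: "cyl 0 x = (if x = {[]} then ltrees else {})"
  by (auto simp: prune_0)

lemma prod_indicator: "finite A \<Longrightarrow> (\<Prod>i\<in>A. indicator (B i) (g i) :: ennreal) = (if \<forall>i\<in>A. g i \<in> B i then 1 else 0)"
  by (induction A rule: finite_induct) (auto simp: indicator_def)

text \<open>The root degree and the subtrees of different children read disjoint coordinates, and
  the coordinates below a child again have the full product law, so cylinder probabilities obey the
  recursion of \<open>gwp\<close>.\<close>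

lemma emeasure_GW_cyl: "emeasure (GW \<mu>) (cyl n x) = ennreal (pmf (gwp \<mu> n) x)"
proof (induction n arbitrary: x)
  case 0
  show ?case using prob_space.emeasure_space_1[OF prob_space_GW, of \<mu>] by (simp add: cyl_0)
next
  case (Suc n)
  show ?case
  proof (cases "x \<in> ltrees_upto (Suc n)")
    case False
    have "pmf (gwp \<mu> (Suc n)) x = 0" by (rule pmf_eq_0_outside[OF _ False]) (rule set_gwp)
    then show ?thesis unfolding emeasure_prune_outside[OF False] by simp
  next
    case True
    then obtain c f where x: "x = node c f" and f: "\<And>i. f i \<in> ltrees_upto n"
      by (blast elim: ltrees_upto_SucE)
    let ?P = "\<Pi>\<^sub>M m\<in>(UNIV :: nat list set). measure_pmf (Poisson \<mu>)"
    have *: "prune (Suc n) (tree_of_offspring \<omega>) = x \<longleftrightarrow>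
      \<omega> [] = c \<and> (\<forall>i\<in>{1..c}. tree_of_offspring (\<lambda>m. \<omega> (i # m)) \<in> cyl n (f i))" for \<omega>
      unfolding x using Nil_in_ltrees_upto[OF f]
      by (subst tree_of_offspring_node, subst prune_node, subst node_eq_iff)
         (auto simp: Nil_in_ltrees tree_of_offspring_in_ltrees Nil_in_ltrees_upto)
    have "emeasure (GW \<mu>) (cyl (Suc n) x) =
        emeasure ?P (tree_of_offspring -` cyl (Suc n) x \<inter> space ?P)"
      unfolding GW_def by (rule emeasure_distr) measurable
    also have "\<dots> = (\<integral>\<^sup>+\<omega>. indicator (tree_of_offspring -` cyl (Suc n) x \<inter> space ?P) \<omega> \<partial>?P)"
      by (rule nn_integral_indicator[symmetric, OF measurable_sets[OF measurable_tree_of_offspring sets_cyl]])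
    also have "\<dots> = (\<integral>\<^sup>+\<omega>. indicator {c} (\<omega> []) *
        (\<Prod>i\<in>{1..c}. indicator (cyl n (f i)) (tree_of_offspring (\<lambda>m. \<omega> (i # m)))) \<partial>?P)"
      by (intro nn_integral_cong) (auto simp: prod_indicator indicator_def * tree_of_offspring_in_ltrees)
    also have "\<dots> = (\<integral>\<^sup>+k. indicator {c} k \<partial>Poisson \<mu>) *
        (\<Prod>i\<in>{1..c}. \<integral>\<^sup>+\<omega>. indicator (cyl n (f i)) (tree_of_offspring \<omega>) \<partial>?P)"
      by (subst PiM_nn_integral_Cons[where M = "\<lambda>_. measure_pmf (Poisson \<mu>)"])
         (auto simp: prob_space_measure_pmf)
    also have "(\<lambda>i. \<integral>\<^sup>+\<omega>. indicator (cyl n (f i)) (tree_of_offspring \<omega>) \<partial>?P) =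
        (\<lambda>i. emeasure (GW \<mu>) (cyl n (f i)))"
    proof
      fix i
      have "(\<integral>\<^sup>+t. indicator (cyl n (f i)) t \<partial>GW \<mu>) =
         (\<integral>\<^sup>+\<omega>. indicator (cyl n (f i)) (tree_of_offspring \<omega>) \<partial>?P)"
        unfolding GW_def by (rule nn_integral_distr) measurable
      then show "(\<integral>\<^sup>+\<omega>. indicator (cyl n (f i)) (tree_of_offspring \<omega>) \<partial>?P) = emeasure (GW \<mu>) (cyl n (f i))"
        by simp
    qed
    also have "(\<integral>\<^sup>+k. indicator {c} k \<partial>Poisson \<mu>) * (\<Prod>i\<in>{1..c}. emeasure (GW \<mu>) (cyl n (f i))) =
        ennreal (pmf (gwp \<mu> (Suc n)) x)"
      unfolding x using Nil_in_ltrees_upto[OF f]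
      by (subst pmf_gwp_node)
         (auto simp: Suc prod_ennreal emeasure_pmf_single ennreal_mult' prod_nonneg Nil_in_ltrees_upto)
    finally show ?thesis .
  qed
qed

lemma sets_augmentation [simp, measurable_cong]: "sets (augmentation lam s t) = sets tree_space"
  by (simp add: augmentation_def)

lemma sets_uniform_relabeling [simp, measurable_cong]: "sets (uniform_relabeling t) = sets tree_space"
  by (simp add: uniform_relabeling_def)

lemma prob_space_augmentation: "t \<in> ltrees \<Longrightarrow> prob_space (augmentation lam s t)"
  unfolding augmentation_def
  by (intro prob_space.prob_space_distr prob_space_pair prob_space_PiM prob_space_measure_pmf
      prob_space_GW measurable_attach)

lemma prob_space_uniform_relabeling: "t \<in> ltrees \<Longrightarrow> prob_space (uniform_relabeling t)"
  unfolding uniform_relabeling_def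
  by (intro prob_space.prob_space_distr prob_space_PiM prob_space_uniform_count_measure
      finite_perms perms_nonempty measurable_new_label)

text \<open>The grafts are integrated first with the counts \<open>K\<close> held fixed, then the
  counts; both integrals factor over the children of the root.\<close>

lemma emeasure_augmentation_cyl:
  "t \<in> ltrees \<Longrightarrow> emeasure (augmentation lam s t) (cyl n x) = ennreal (pmf (augp lam s n t) x)"
proof (induction n arbitrary: x t)
  case 0
  have "space (augmentation lam s t) = ltrees" by (simp add: augmentation_def)
  then show ?case
    using prob_space.emeasure_space_1[OF prob_space_augmentation[OF 0], of lam s] by (simp add: cyl_0)
next
  case (Suc n)
  let ?k = "nchildren t []"
  let ?A = "\<Pi>\<^sub>M m\<in>(UNIV :: nat list set). measure_pmf (Poisson (lam * (1 - s)))"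
  let ?B = "\<Pi>\<^sub>M mj\<in>(UNIV :: (nat list \<times> nat) set). GW lam"
  interpret A: prob_space ?A by (intro prob_space_PiM prob_space_measure_pmf)
  interpret B: prob_space ?B by (intro prob_space_PiM prob_space_GW)
  have spB: "G \<in> space ?B \<Longrightarrow> G y \<in> ltrees" for G y by (cases y) (auto simp: space_PiM PiE_def Pi_def)
  have meas: "emeasure (augmentation lam s t') C =
     (\<integral>\<^sup>+K. \<integral>\<^sup>+G. indicator C (attach t' K G) \<partial>?B \<partial>?A)"
    if "t' \<in> ltrees" "C \<in> sets tree_space" for t' C
  proof -
    note [measurable] = that(2) measurable_attach[OF that(1)]
    have "emeasure (augmentation lam s t') C = (\<integral>\<^sup>+y. indicator C y \<partial>augmentation lam s t')"
      by simp
    also have "\<dots> = (\<integral>\<^sup>+y. indicator C (case y of (K, G) \<Rightarrow> attach t' K G) \<partial>(?A \<Otimes>\<^sub>M ?B))"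
      unfolding augmentation_def by (rule nn_integral_distr) measurable
    also have "\<dots> = (\<integral>\<^sup>+K. \<integral>\<^sup>+G. indicator C (case (K, G) of (K, G) \<Rightarrow> attach t' K G) \<partial>?B \<partial>?A)"
      by (rule B.nn_integral_fst[symmetric]) measurable
    finally show ?thesis by simp
  qed
  show ?case
  proof (cases "x \<in> ltrees_upto (Suc n)")
    case False
    have "pmf (augp lam s (Suc n) t) x = 0" by (rule pmf_eq_0_outside[OF _ False]) (rule set_augp)
    then show ?thesis unfolding emeasure_prune_outside[OF False] by simp
  next
    case True
    then obtain c f where x: "x = node c f" and f: "\<And>i. f i \<in> ltrees_upto n"
      by (blast elim: ltrees_upto_SucE)
    define AT where "AT i K G = attach (sub t i) (\<lambda>m. K (i # m)) (\<lambda>(m, j). G (i # m, j))" for i K G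
    have AT: "AT i K G \<in> ltrees" if "i \<in> {1..?k}" "G \<in> space ?B" for i K G
      unfolding AT_def using that spB Suc.prems
      by (intro attach_in_ltrees sub_in_ltrees) (auto split: prod.split)
    have *: "attach t K G \<in> cyl (Suc n) x \<longleftrightarrow> ?k + K [] = c \<and>
      (\<forall>i\<in>{1..c}. (if i \<le> ?k then AT i K G else G ([], i - ?k)) \<in> cyl n (f i))"
      if G: "G \<in> space ?B" for K G
    proof -
      have "attach t K G \<in> ltrees" using spB[OF G] Suc.prems by (intro attach_in_ltrees) auto
      then have "attach t K G \<in> cyl (Suc n) x \<longleftrightarrow> prune (Suc n) (attach t K G) = x" by simp
      also have "\<dots> \<longleftrightarrow> ?k + K [] = c \<and>
        (\<forall>i\<in>{1..?k + K []}. prune n (if i \<le> ?k then AT i K G else G ([], i - ?k)) = f i)"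
        unfolding x AT_def using Nil_in_ltrees_upto[OF f] spB[OF G] Suc.prems AT[OF _ G, of _ K]
        by (subst attach_node, simp, subst prune_node, subst node_eq_iff)
           (auto simp: Nil_in_ltrees Nil_in_ltrees_upto AT_def)
      also have "\<dots> \<longleftrightarrow> ?k + K [] = c \<and>
        (\<forall>i\<in>{1..c}. (if i \<le> ?k then AT i K G else G ([], i - ?k)) \<in> cyl n (f i))"
        using AT[OF _ G, of _ K] spB[OF G] by auto
      finally show ?thesis .
    qed
    show ?thesis
    \<comment> \<open>An augmentation never removes children, so both sides vanish when the target
      degree is below the degree of \<open>t\<close>.\<close>
    proof (cases "c < ?k")
      case True
      have "(\<integral>\<^sup>+K. \<integral>\<^sup>+G. indicator (cyl (Suc n) x) (attach t K G) \<partial>?B \<partial>?A) = (\<integral>\<^sup>+K. \<integral>\<^sup>+G. 0 \<partial>?B \<partial>?A)"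
        using True by (intro nn_integral_cong) (auto simp: * simp del: mem_Collect_eq)
      moreover have "x \<notin> set_pmf (augp lam s (Suc n) t)"
      proof
        assume "x \<in> set_pmf (augp lam s (Suc n) t)"
        then obtain a F where F: "F \<in> set_pmf (Pi_pmf {1..?k + a} {[]}
            (\<lambda>i. if i \<le> ?k then augp lam s n (sub t i) else gwp lam n))" and xF: "x = node (?k + a) F"
          by auto
        have "[] \<in> F i" if "i \<in> {1..?k + a}" for i
          using set_Pi_pmf_in[OF F that] by (auto split: if_splits intro: Nil_in_ltrees_upto dest: set_gwp set_augp)
        then have "c = ?k + a" using xF Nil_in_ltrees_upto[OF f] unfolding x by (subst (asm) node_eq_iff) (auto simp: Nil_in_ltrees_upto)
        then show False using True by simp
      qed
      ultimately show ?thesis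
        by (subst meas) (auto simp: Suc.prems set_pmf_eq simp del: augp.simps)
    next
      case False
      define a where "a = c - ?k"
      have c: "c = ?k + a" using False by (simp add: a_def)
      note mAT = measurable_attach[OF sub_in_ltrees[OF Suc.prems]]
      let ?\<Phi> = "\<lambda>i K. \<integral>\<^sup>+G. indicator (cyl n (f i)) (attach (sub t i) K G) \<partial>?B"
      have m1: "(\<lambda>G. indicator (cyl n (f i)) (attach (sub t i) K G) :: ennreal) \<in> borel_measurable ?B"
        if "i \<in> {1..?k}" for i K
      proof -
        have "(\<lambda>G. attach (sub t i) K G) \<in> ?B \<rightarrow>\<^sub>M tree_space"
          using measurable_compose[OF measurable_Pair1' mAT[OF that], of K] by (simp add: space_PiM)
        then show ?thesis by measurable
      qed
      have m2: "?\<Phi> i \<in> borel_measurable ?A" if "i \<in> {1..?k}" for i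
      proof -
        note [measurable] = mAT[OF that]
        have "(\<lambda>K. \<integral>\<^sup>+G. indicator (cyl n (f i)) (case (K, G) of (K, G) \<Rightarrow> attach (sub t i) K G) \<partial>?B) \<in> borel_measurable ?A"
          by measurable
        then show ?thesis by simp
      qed
      have split: "{1..c} = {1..?k} \<union> (+) ?k ` {1..a}"
        unfolding c by (auto simp: image_iff)
      have ball: "(\<forall>i\<in>{1..c}. Q i) \<longleftrightarrow> (\<forall>j\<in>{1..a}. Q (?k + j)) \<and> (\<forall>i\<in>{1..?k}. Q i)" for Q
        unfolding split ball_Un by blast
      have "emeasure (augmentation lam s t) (cyl (Suc n) x) =
          (\<integral>\<^sup>+K. \<integral>\<^sup>+G. indicator (cyl (Suc n) x) (attach t K G) \<partial>?B \<partial>?A)"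
        using Suc.prems by (rule meas) measurable
      also have "\<dots> = (\<integral>\<^sup>+K. \<integral>\<^sup>+G. indicator {a} (K []) * ((\<Prod>j\<in>{1..a}. indicator (cyl n (f (?k + j))) (G ([], j))) *
         (\<Prod>i\<in>{1..?k}. indicator (cyl n (f i)) (attach (sub t i) (\<lambda>m. K (i # m)) (\<lambda>(m, j). G (i # m, j)))))
         \<partial>?B \<partial>?A)"
      proof (intro nn_integral_cong)
        fix K G assume G: "G \<in> space ?B"
        show "indicator (cyl (Suc n) x) (attach t K G) = (indicator {a} (K []) * ((\<Prod>j\<in>{1..a}. indicator (cyl n (f (?k + j))) (G ([], j))) *
         (\<Prod>i\<in>{1..?k}. indicator (cyl n (f i)) (attach (sub t i) (\<lambda>m. K (i # m)) (\<lambda>(m, j). G (i # m, j))))) :: ennreal)"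
          unfolding AT_def[symmetric] indicator_def[of "cyl (Suc n) x"] *[OF G] ball
          by (simp add: prod_indicator c indicator_def[of "{a}"] del: mem_Collect_eq)
      qed
      also have "\<dots> = (\<integral>\<^sup>+K. indicator {a} (K []) * (\<integral>\<^sup>+G. (\<Prod>j\<in>{1..a}. indicator (cyl n (f (?k + j))) (G ([], j))) *
         (\<Prod>i\<in>{1..?k}. indicator (cyl n (f i)) (attach (sub t i) (\<lambda>m. K (i # m)) (\<lambda>(m, j). G (i # m, j))))
         \<partial>?B) \<partial>?A)"
        by (intro nn_integral_cong) (auto simp: indicator_def)
      also have "\<dots> = (\<integral>\<^sup>+K. indicator {a} (K []) * ((\<Prod>j\<in>{1..a}. \<integral>\<^sup>+y. indicator (cyl n (f (?k + j))) y \<partial>GW lam) *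
         (\<Prod>i\<in>{1..?k}. ?\<Phi> i (\<lambda>m. K (i # m)))) \<partial>?A)"
        using m1 by (intro nn_integral_cong) (subst PiM_nn_integral_grafts, auto simp: prob_space_GW)
      also have "\<dots> = (\<integral>\<^sup>+K. (\<Prod>j\<in>{1..a}. ennreal (pmf (gwp lam n) (f (?k + j)))) *
          (indicator {a} (K []) * (\<Prod>i\<in>{1..?k}. ?\<Phi> i (\<lambda>m. K (i # m)))) \<partial>?A)"
        by (simp add: emeasure_GW_cyl ac_simps)
      also have "\<dots> = (\<Prod>j\<in>{1..a}. ennreal (pmf (gwp lam n) (f (?k + j)))) *
          (\<integral>\<^sup>+K. indicator {a} (K []) * (\<Prod>i\<in>{1..?k}. ?\<Phi> i (\<lambda>m. K (i # m))) \<partial>?A)"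
      proof (rule nn_integral_cmult)
        have m3: "(\<lambda>K. indicator {a} (K []) :: ennreal) \<in> borel_measurable ?A"
          using measurable_compose[OF measurable_component_singleton[of "[]" UNIV
            "\<lambda>m. measure_pmf (Poisson (lam * (1 - s)))"], of "indicator {a}" borel] by simp
        have m4: "(\<lambda>K. ?\<Phi> i (\<lambda>m. K (i # m))) \<in> borel_measurable ?A" if "i \<in> {1..?k}" for i
          by (rule measurable_compose[OF measurable_reindex[of "(#) i"
            "\<lambda>_. measure_pmf (Poisson (lam * (1 - s)))"] m2[OF that]])
        show "(\<lambda>K. indicator {a} (K []) * (\<Prod>i\<in>{1..?k}. ?\<Phi> i (\<lambda>m. K (i # m)))) \<in> borel_measurable ?A"
          by (intro borel_measurable_times_ennreal borel_measurable_prod_ennreal m3 m4)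
      qed
      also have "(\<integral>\<^sup>+K. indicator {a} (K []) * (\<Prod>i\<in>{1..?k}. ?\<Phi> i (\<lambda>m. K (i # m))) \<partial>?A) =
          (\<integral>\<^sup>+b. indicator {a} b \<partial>Poisson (lam * (1 - s))) * (\<Prod>i\<in>{1..?k}. \<integral>\<^sup>+K. ?\<Phi> i K \<partial>?A)"
        using m2 by (subst PiM_nn_integral_Cons[where M = "\<lambda>_. measure_pmf (Poisson (lam * (1 - s)))"])
         (auto simp: prob_space_measure_pmf)
      also have "(\<Prod>i\<in>{1..?k}. \<integral>\<^sup>+K. ?\<Phi> i K \<partial>?A) = (\<Prod>i\<in>{1..?k}. ennreal (pmf (augp lam s n (sub t i)) (f i)))"
      proof (rule prod.cong)
        fix i assume "i \<in> {1..?k}"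
        then have st: "sub t i \<in> ltrees" using sub_in_ltrees Suc.prems by blast
        show "(\<integral>\<^sup>+K. ?\<Phi> i K \<partial>?A) = ennreal (pmf (augp lam s n (sub t i)) (f i))"
          unfolding Suc.IH[OF st, symmetric] by (rule meas[symmetric, OF st]) measurable
      qed simp
      also have "(\<Prod>j\<in>{1..a}. ennreal (pmf (gwp lam n) (f (?k + j)))) *
        ((\<integral>\<^sup>+b. indicator {a} b \<partial>Poisson (lam * (1 - s))) * (\<Prod>i\<in>{1..?k}. ennreal (pmf (augp lam s n (sub t i)) (f i)))) =
        ennreal (pmf (augp lam s (Suc n) t) x)"
        unfolding x c using Nil_in_ltrees_upto[OF f]
        by (subst pmf_augp_node)
           (auto simp: prod_ennreal emeasure_pmf_single ennreal_mult' prod_nonneg Nil_in_ltrees_upto ac_simps)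
      finally show ?thesis .
    qed
  qed
qed

text \<open>Once the value of the root permutation is fixed, the event is a product over the
  children; the finitely many values are then summed with weight \<open>1 / fact ?c\<close>.\<close>

lemma emeasure_uniform_relabeling_cyl:
  "t \<in> ltrees \<Longrightarrow> emeasure (uniform_relabeling t) (cyl n x) = ennreal (pmf (relp n t) x)"
proof (induction n arbitrary: x t)
  case 0
  have "space (uniform_relabeling t) = ltrees" by (simp add: uniform_relabeling_def)
  then show ?case
    using prob_space.emeasure_space_1[OF prob_space_uniform_relabeling[OF 0]] by (simp add: cyl_0)
next
  case (Suc n)
  let ?c = "nchildren t []"
  let ?M = "\<lambda>t m. uniform_count_measure (perms (nchildren t m))"
  let ?P = "\<lambda>t. PiM UNIV (?M t)"
  have pM: "prob_space (?M t m)" for m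
    by (intro prob_space_uniform_count_measure finite_perms perms_nonempty)
  have meas: "emeasure (uniform_relabeling t') C = (\<integral>\<^sup>+\<sigma>. indicator C (new_label \<sigma> ` t') \<partial>?P t')"
    if "t' \<in> ltrees" "C \<in> sets tree_space" for t' C
  proof -
    note [measurable] = that(2) measurable_new_label[OF that(1)]
    have "(\<integral>\<^sup>+y. indicator C y \<partial>uniform_relabeling t') = (\<integral>\<^sup>+\<sigma>. indicator C (new_label \<sigma> ` t') \<partial>?P t')"
      unfolding uniform_relabeling_def by (rule nn_integral_distr) measurable
    then show ?thesis by simp
  qed
  have spP: "\<sigma> \<in> space (?P t) \<Longrightarrow> \<sigma> m permutes {1..nchildren t m}" for \<sigma> m
    by (auto simp: space_PiM PiE_def Pi_def space_uniform_count_measure)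
  have emp: "new_label \<sigma> ` t \<in> cyl (Suc n) (node c f) \<longleftrightarrow> c = ?c \<and>
      (\<forall>i\<in>{1..?c}. new_label (\<lambda>m. \<sigma> (i # m)) ` sub t i \<in> cyl n (f (\<sigma> [] i)))"
    if \<sigma>: "\<sigma> \<in> space (?P t)" and f: "\<And>i. f i \<in> ltrees_upto n" for \<sigma> c f
  proof -
    let ?N = "\<lambda>i. new_label (\<lambda>m. \<sigma> (i # m)) ` sub t i"
    have N: "?N i \<in> ltrees" if "i \<in> {1..?c}" for i
      using that Suc.prems spP[OF \<sigma>] by (intro new_label_in_ltrees sub_in_ltrees) (auto simp: nchildren_sub)
    note \<pi> = spP[OF \<sigma>, of "[]"]
    have "new_label \<sigma> ` t \<in> ltrees" using Suc.prems spP[OF \<sigma>] by (intro new_label_in_ltrees)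
    then have "new_label \<sigma> ` t \<in> cyl (Suc n) (node c f) \<longleftrightarrow> prune (Suc n) (new_label \<sigma> ` t) = node c f" by simp
    also have "\<dots> \<longleftrightarrow> c = ?c \<and> (\<forall>j\<in>{1..?c}. prune n (?N (inv (\<sigma> []) j)) = f j)"
      using Nil_in_ltrees_upto[OF f] N inv_perm_in[OF \<pi>] Suc.prems \<pi>
      by (subst new_label_node, simp, simp, subst prune_node, subst node_eq_iff)
         (auto simp: Nil_in_ltrees Nil_in_ltrees_upto Let_def)
    also have "(\<forall>j\<in>{1..?c}. prune n (?N (inv (\<sigma> []) j)) = f j) \<longleftrightarrow>
       (\<forall>j\<in>\<sigma> [] ` {1..?c}. prune n (?N (inv (\<sigma> []) j)) = f j)"
      using permutes_image[OF \<pi>] by simp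
    also have "\<dots> \<longleftrightarrow> (\<forall>i\<in>{1..?c}. ?N i \<in> cyl n (f (\<sigma> [] i)))"
      using permutes_inverses[OF \<pi>] N by auto
    finally show ?thesis .
  qed
  show ?case
  proof (cases "x \<in> ltrees_upto (Suc n)")
    case False
    have "pmf (relp (Suc n) t) x = 0" by (rule pmf_eq_0_outside[OF _ False]) (rule set_relp)
    then show ?thesis unfolding emeasure_prune_outside[OF False] by simp
  next
    case True
    then obtain c f where x: "x = node c f" and f: "\<And>i. f i \<in> ltrees_upto n"
      by (blast elim: ltrees_upto_SucE)
    show ?thesis
    proof (cases "c = ?c")
      case False
      have "(\<integral>\<^sup>+\<sigma>. indicator (cyl (Suc n) x) (new_label \<sigma> ` t) \<partial>?P t) = (\<integral>\<^sup>+\<sigma>. 0 \<partial>?P t)"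
        unfolding x using False f by (intro nn_integral_cong) (auto simp: emp simp del: mem_Collect_eq)
      moreover have "x \<notin> set_pmf (relp (Suc n) t)"
      proof
        assume "x \<in> set_pmf (relp (Suc n) t)"
        then obtain \<pi> F where \<pi>: "\<pi> permutes {1..?c}"
          and F: "F \<in> set_pmf (Pi_pmf {1..?c} {[]} (\<lambda>i. relp n (sub t i)))"
          and xF: "x = node ?c (\<lambda>j. F (inv \<pi> j))"
          by auto
        have "[] \<in> F (inv \<pi> j)" if "j \<in> {1..?c}" for j
          using set_Pi_pmf_in[OF F inv_perm_in[OF \<pi> that]] by (auto dest: set_relp Nil_in_ltrees_upto)
        then have "c = ?c" using xF Nil_in_ltrees_upto[OF f] unfolding x by (subst (asm) node_eq_iff) (auto simp: Nil_in_ltrees_upto)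
        then show False using False by simp
      qed
      ultimately show ?thesis
        by (subst meas) (auto simp: Suc.prems set_pmf_eq simp del: relp.simps)
    next
      case True
      let ?h = "\<lambda>\<pi> i \<sigma>. indicator (cyl n (f (\<pi> i))) (new_label \<sigma> ` sub t i) :: ennreal"
      have h: "?h \<pi> i \<in> borel_measurable (PiM UNIV (\<lambda>m. ?M t (i # m)))" if "i \<in> {1..?c}" for \<pi> i
      proof -
        have "(\<lambda>\<sigma>. new_label \<sigma> ` sub t i) \<in> ?P (sub t i) \<rightarrow>\<^sub>M tree_space"
          using that Suc.prems by (intro measurable_new_label sub_in_ltrees)
        then show ?thesis by (simp add: nchildren_sub) measurable
      qed
      have h0: "indicator {\<pi>} \<in> borel_measurable (?M t [])" for \<pi> :: "nat \<Rightarrow> nat"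
        by (auto simp: measurable_def sets_uniform_count_measure space_uniform_count_measure)
      have "emeasure (uniform_relabeling t) (cyl (Suc n) x) =
          (\<integral>\<^sup>+\<sigma>. indicator (cyl (Suc n) x) (new_label \<sigma> ` t) \<partial>?P t)"
        using Suc.prems by (rule meas) measurable
      \<comment> \<open>The sum splits the event by the value of the root permutation; only the term
        with \<pi> equal to \<open>\<sigma> []\<close> is nonzero.\<close>
      also have "\<dots> = (\<integral>\<^sup>+\<sigma>. (\<Sum>\<pi>\<in>perms ?c. indicator {\<pi>} (\<sigma> []) * (\<Prod>i\<in>{1..?c}. ?h \<pi> i (\<lambda>m. \<sigma> (i # m)))) \<partial>?P t)"
      proof (rule nn_integral_cong)
        fix \<sigma> assume \<sigma>: "\<sigma> \<in> space (?P t)"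
        have "(\<Sum>\<pi>\<in>perms ?c. indicator {\<pi>} (\<sigma> []) * (\<Prod>i\<in>{1..?c}. ?h \<pi> i (\<lambda>m. \<sigma> (i # m)))) =
           (\<Sum>\<pi>\<in>{\<sigma> []}. indicator {\<pi>} (\<sigma> []) * (\<Prod>i\<in>{1..?c}. ?h \<pi> i (\<lambda>m. \<sigma> (i # m))))"
          using spP[OF \<sigma>] by (intro sum.mono_neutral_right) (auto simp: finite_perms)
        also have "\<dots> = indicator (cyl (Suc n) x) (new_label \<sigma> ` t)"
          unfolding x indicator_def[of "cyl (Suc n) (node c f)"] emp[OF \<sigma> f]
          using True by (simp add: prod_indicator del: mem_Collect_eq)
        finally show "indicator (cyl (Suc n) x) (new_label \<sigma> ` t) =
          (\<Sum>\<pi>\<in>perms ?c. indicator {\<pi>} (\<sigma> []) * (\<Prod>i\<in>{1..?c}. ?h \<pi> i (\<lambda>m. \<sigma> (i # m))))" by simp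
      qed
      also have "\<dots> = (\<Sum>\<pi>\<in>perms ?c. \<integral>\<^sup>+\<sigma>. indicator {\<pi>} (\<sigma> []) * (\<Prod>i\<in>{1..?c}. ?h \<pi> i (\<lambda>m. \<sigma> (i # m))) \<partial>?P t)"
      proof (rule nn_integral_sum)
        fix \<pi>
        have [measurable]: "(\<lambda>\<sigma>. ?h \<pi> i (\<lambda>m. \<sigma> (i # m))) \<in> borel_measurable (?P t)" if "i \<in> {1..?c}" for i
          by (rule measurable_compose[OF measurable_reindex[of "(#) i" "?M t"] h[OF that]])
        have [measurable]: "(\<lambda>\<sigma>. indicator {\<pi>} (\<sigma> []) :: ennreal) \<in> borel_measurable (?P t)"
          by (rule measurable_compose[OF measurable_component_singleton[of "[]" UNIV "?M t"] h0]) simp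
        show "(\<lambda>\<sigma>. indicator {\<pi>} (\<sigma> []) * (\<Prod>i\<in>{1..?c}. ?h \<pi> i (\<lambda>m. \<sigma> (i # m)))) \<in> borel_measurable (?P t)"
          by measurable
      qed
      also have "\<dots> = (\<Sum>\<pi>\<in>perms ?c. ennreal (1 / fact ?c) *
          (\<Prod>i\<in>{1..?c}. ennreal (pmf (relp n (sub t i)) (f (\<pi> i)))))"
      proof (rule sum.cong)
        fix \<pi> assume \<pi>: "\<pi> \<in> perms ?c"
        have "(\<integral>\<^sup>+\<sigma>. indicator {\<pi>} (\<sigma> []) * (\<Prod>i\<in>{1..?c}. ?h \<pi> i (\<lambda>m. \<sigma> (i # m))) \<partial>?P t) =
          (\<integral>\<^sup>+\<rho>. indicator {\<pi>} \<rho> \<partial>?M t []) * (\<Prod>i\<in>{1..?c}. \<integral>\<^sup>+\<sigma>. ?h \<pi> i \<sigma> \<partial>PiM UNIV (\<lambda>m. ?M t (i # m)))"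
          using h h0 pM by (intro PiM_nn_integral_Cons) auto
        also have "(\<integral>\<^sup>+\<rho>. indicator {\<pi>} \<rho> \<partial>?M t []) = ennreal (1 / fact ?c)"
          using \<pi> by (subst nn_integral_indicator)
            (auto simp: sets_uniform_count_measure emeasure_uniform_count_measure finite_perms card_perms)
        also have "(\<Prod>i\<in>{1..?c}. \<integral>\<^sup>+\<sigma>. ?h \<pi> i \<sigma> \<partial>PiM UNIV (\<lambda>m. ?M t (i # m))) =
          (\<Prod>i\<in>{1..?c}. ennreal (pmf (relp n (sub t i)) (f (\<pi> i))))"
        proof (rule prod.cong)
          fix i assume "i \<in> {1..?c}"
          then have st: "sub t i \<in> ltrees" using sub_in_ltrees Suc.prems by blast
          show "(\<integral>\<^sup>+\<sigma>. ?h \<pi> i \<sigma> \<partial>PiM UNIV (\<lambda>m. ?M t (i # m))) = ennreal (pmf (relp n (sub t i)) (f (\<pi> i)))"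
            unfolding Suc.IH[OF st, symmetric] nchildren_sub[symmetric]
            by (rule meas[symmetric, OF st]) measurable
        qed simp
        finally show "(\<integral>\<^sup>+\<sigma>. indicator {\<pi>} (\<sigma> []) * (\<Prod>i\<in>{1..?c}. ?h \<pi> i (\<lambda>m. \<sigma> (i # m))) \<partial>?P t) =
          ennreal (1 / fact ?c) * (\<Prod>i\<in>{1..?c}. ennreal (pmf (relp n (sub t i)) (f (\<pi> i))))" .
      qed simp
      also have "\<dots> = ennreal (pmf (relp (Suc n) t) x)"
        unfolding x True using Nil_in_ltrees_upto[OF f]
        by (subst pmf_relp_node)
           (auto simp: prod_ennreal ennreal_mult'[symmetric] prod_nonneg Nil_in_ltrees_upto sum_ennreal
              sum_divide_distrib)
      finally show ?thesis .
    qed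
  qed
qed

section \<open>The pruned laws of the two hypotheses\<close>

lemma sets_tree_space_cyl: "sets tree_space = sigma_sets ltrees (insert {} {cyl n x | n x. True})"
proof -
  let ?G = "insert {} {cyl n x | n x. True}"
  have "sets tree_space = sigma_sets ltrees {{t \<in> ltrees. m \<in> t} | m. True}"
    unfolding tree_space_def by (rule sets_measure_of) auto
  also have "\<dots> = sigma_sets ltrees ?G"
  proof (rule sigma_sets_eqI)
    fix A assume "A \<in> {{t \<in> ltrees. m \<in> t} | m. True}"
    then obtain m where A: "A = {t \<in> ltrees. m \<in> t}" by blast
    have "A = (\<Union>x\<in>{x \<in> ltrees_upto (length m). m \<in> x}. cyl (length m) x)"
      unfolding A using prune_in_ltrees_upto by (auto simp: prune_def)
    moreover have "\<dots> \<in> sigma_sets ltrees ?G"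
      by (rule sigma_sets_UNION) (auto intro!: countable_subset[OF _ countable_ltrees_upto[of "length m"]] sigma_sets.Basic)
    ultimately show "A \<in> sigma_sets ltrees ?G" by simp
  next
    fix A assume "A \<in> ?G"
    then have "A \<in> sets tree_space" by (auto simp: sets_cyl)
    then show "A \<in> sigma_sets ltrees {{t \<in> ltrees. m \<in> t} | m. True}"
      unfolding \<open>sets tree_space = _\<close> .
  qed
  finally show ?thesis .
qed

text \<open>Two cylinders are nested or disjoint, because the deeper pruning determines the
  shallower one; \<open>{}\<close> is in the generator to cover the disjoint case.\<close>

lemma Int_stable_cyl: "Int_stable (insert {} {cyl n x | n x. True})"
proof -
  have le: "cyl n x \<inter> cyl m y \<in> {{}, cyl m y}" if "n \<le> m" for n m x y
  proof (cases "prune n y = x")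
    case True
    then show ?thesis using prune_prune[OF that] by auto
  next
    case False
    have "cyl n x \<inter> cyl m y = {}"
    proof (rule equals0I)
      fix t assume "t \<in> cyl n x \<inter> cyl m y"
      then have "prune n y = x" using prune_prune[OF that, of t] by auto
      with False show False by simp
    qed
    then show ?thesis by blast
  qed
  have main: "cyl n x \<inter> cyl m y \<in> insert {} {cyl n x | n x. True}" for n m x y
  proof (cases "n \<le> m")
    case True
    then show ?thesis using le[OF True, of x y] by auto
  next
    case False
    then show ?thesis using le[of m n y x] by (auto simp: Int_commute)
  qed
  show ?thesis
  proof (rule Int_stableI)
    fix A B assume "A \<in> insert {} {cyl n x | n x. True}" "B \<in> insert {} {cyl n x | n x. True}"
    then consider "A = {} \<or> B = {}" | n x m y where "A = cyl n x" "B = cyl m y" by blast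
    then show "A \<inter> B \<in> insert {} {cyl n x | n x. True}"
    proof cases
      case 2
      then show ?thesis using main by simp
    qed auto
  qed
qed

lemma measurable_prune_UNIV: "prune n \<in> tree_space \<rightarrow>\<^sub>M count_space UNIV"
  by (rule measurable_compose[OF measurable_prune]) simp

text \<open>Cylinders form an intersection-stable generator, and a function of a finite pruning is
  measurable as a function on a countable discrete space. Hence locality of the kernel yields
  measurability.\<close>

lemma measurable_tree_kernelI:
  assumes "\<And>t. t \<in> ltrees \<Longrightarrow> prob_space (K t)" "\<And>t. t \<in> ltrees \<Longrightarrow> sets (K t) = sets tree_space"
    and "\<And>n x t. t \<in> ltrees \<Longrightarrow> emeasure (K t) (cyl n x) = g n x (prune n t)"
  shows "K \<in> tree_space \<rightarrow>\<^sub>M prob_algebra tree_space"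
proof (rule measurable_prob_algebra_generated[OF sets_tree_space_cyl Int_stable_cyl])
  fix A assume "A \<in> insert {} {cyl n x | n x. True}"
  then consider "A = {}" | n x where "A = cyl n x" by blast
  then show "(\<lambda>t. emeasure (K t) A) \<in> borel_measurable tree_space"
  proof cases
    case 2
    have "(\<lambda>t. g n x (prune n t)) \<in> borel_measurable tree_space"
      by (rule measurable_compose[OF measurable_prune_UNIV]) simp
    then show ?thesis unfolding 2 by (subst measurable_cong) (auto simp: assms)
  qed simp
qed (use assms in auto)

lemma nchildren_prune: "t \<in> ltrees \<Longrightarrow> nchildren (prune (Suc n) t) [] = nchildren t []"
  by (auto simp: nchildren_def prune_def)

lemma sub_prune: "sub (prune (Suc n) t) i = prune n (sub t i)"
  by (auto simp: sub_def prune_def)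

lemma augp_prune: "t \<in> ltrees \<Longrightarrow> augp lam s n (prune n t) = augp lam s n t"
proof (induction n arbitrary: t)
  case (Suc n)
  have "Pi_pmf {1..nchildren t [] + a} {[]} (\<lambda>i. if i \<le> nchildren t [] then augp lam s n (prune n (sub t i)) else gwp lam n) =
    Pi_pmf {1..nchildren t [] + a} {[]} (\<lambda>i. if i \<le> nchildren t [] then augp lam s n (sub t i) else gwp lam n)" for a
    using Suc.IH[OF sub_in_ltrees[OF Suc.prems]] by (intro Pi_pmf_cong) auto
  then show ?case unfolding augp.simps nchildren_prune[OF Suc.prems] sub_prune by simp
qed simp

lemma relp_prune: "t \<in> ltrees \<Longrightarrow> relp n (prune n t) = relp n t"
proof (induction n arbitrary: t)
  case (Suc n)
  have "Pi_pmf {1..nchildren t []} {[]} (\<lambda>i. relp n (prune n (sub t i))) =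
    Pi_pmf {1..nchildren t []} {[]} (\<lambda>i. relp n (sub t i))"
    using Suc.IH[OF sub_in_ltrees[OF Suc.prems]] by (intro Pi_pmf_cong) auto
  then show ?case by (simp add: nchildren_prune[OF Suc.prems] sub_prune)
qed simp

lemma measurable_augmentation: "augmentation lam s \<in> tree_space \<rightarrow>\<^sub>M prob_algebra tree_space"
  by (rule measurable_tree_kernelI[where g = "\<lambda>n x t. ennreal (pmf (augp lam s n t) x)"])
     (auto simp: prob_space_augmentation emeasure_augmentation_cyl augp_prune)

lemma measurable_uniform_relabeling: "uniform_relabeling \<in> tree_space \<rightarrow>\<^sub>M prob_algebra tree_space"
  by (rule measurable_tree_kernelI[where g = "\<lambda>n x t. ennreal (pmf (relp n t) x)"])
     (auto simp: prob_space_uniform_relabeling emeasure_uniform_relabeling_cyl relp_prune)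

text \<open>The target is \<open>count_space UNIV\<close>, where a \<open>measure_pmf\<close> lives;
  the countable carrier \<open>A\<close> allows the two measures to be compared on points.\<close>

lemma distr_eq_measure_pmf:
  assumes "T \<in> M \<rightarrow>\<^sub>M count_space UNIV" "\<And>x. x \<in> space M \<Longrightarrow> T x \<in> A" "set_pmf p \<subseteq> A" "countable A"
    and "\<And>y. y \<in> A \<Longrightarrow> emeasure M (T -` {y} \<inter> space M) = ennreal (pmf p y)"
  shows "distr M (count_space UNIV) T = measure_pmf p"
proof (rule measure_eqI_countable_AE[where \<Omega> = A])
  show "AE x in distr M (count_space UNIV) T. x \<in> A"
    using assms by (subst AE_distr_iff) auto
  show "AE x in measure_pmf p. x \<in> A" using assms(3) by (auto simp: AE_measure_pmf_iff)
qed (use assms in \<open>auto simp: emeasure_distr emeasure_pmf_single\<close>)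

lemma distr_prune_tree_measure:
  assumes M: "sets M = sets tree_space" and p: "\<And>t. t \<in> set_pmf p \<Longrightarrow> t \<in> ltrees_upto n"
    and eq: "\<And>x. emeasure M (cyl n x) = ennreal (pmf p x)"
  shows "distr M (count_space UNIV) (prune n) = measure_pmf p"
proof -
  have sp: "space M = ltrees" using sets_eq_imp_space_eq[OF M] by simp
  show ?thesis
  proof (rule distr_eq_measure_pmf[where A = "ltrees_upto n"])
    show "prune n \<in> M \<rightarrow>\<^sub>M count_space UNIV"
      using measurable_prune_UNIV measurable_cong_sets[OF M refl] by blast
    fix y
    have "prune n -` {y} \<inter> space M = cyl n y" by (auto simp: sp)
    then show "emeasure M (prune n -` {y} \<inter> space M) = ennreal (pmf p y)" using eq by simp
  qed (use sp p in \<open>auto intro: prune_in_ltrees_upto\<close>)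
qed

lemma nn_integral_prune:
  assumes M: "sets M = sets tree_space" and D: "distr M (count_space UNIV) (prune n) = measure_pmf p"
  shows "(\<integral>\<^sup>+t. g (prune n t) \<partial>M) = (\<integral>\<^sup>+x. g x \<partial>measure_pmf p)"
  unfolding D[symmetric]
  by (rule nn_integral_distr[symmetric])
     (use measurable_prune_UNIV measurable_cong_sets[OF M refl] in \<open>auto\<close>)

lemma distr_GW: "distr (GW \<mu>) (count_space UNIV) (prune n) = measure_pmf (gwp \<mu> n)"
  by (rule distr_prune_tree_measure) (auto simp: emeasure_GW_cyl dest: set_gwp)

text \<open>\<open>qp\<close> is the depth-\<open>n\<close> law of one side given the common tree
  \<open>t\<close>; \<open>p1p\<close> and \<open>p0p\<close> are the pruned pair laws under the two
  hypotheses.\<close>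

definition qp :: "real \<Rightarrow> real \<Rightarrow> nat \<Rightarrow> ltree \<Rightarrow> ltree pmf" where
  "qp lam s n t = augp lam s n t \<bind> relp n"

definition p1p :: "real \<Rightarrow> real \<Rightarrow> nat \<Rightarrow> (ltree \<times> ltree) pmf" where
  "p1p lam s n = gwp (lam * s) n \<bind> (\<lambda>t. pair_pmf (qp lam s n t) (qp lam s n t))"

definition p0p :: "real \<Rightarrow> nat \<Rightarrow> (ltree \<times> ltree) pmf" where
  "p0p lam n = pair_pmf (gwp lam n) (gwp lam n)"

lemma set_qp: "x \<in> set_pmf (qp lam s n t) \<Longrightarrow> x \<in> ltrees_upto n"
  by (auto simp: qp_def dest: set_relp)

lemma set_p1p: "set_pmf (p1p lam s n) \<subseteq> ltrees_upto n \<times> ltrees_upto n"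
  by (auto simp: p1p_def dest: set_qp)

lemma set_p0p: "set_pmf (p0p lam n) \<subseteq> ltrees_upto n \<times> ltrees_upto n"
  by (auto simp: p0p_def dest: set_gwp)

lemma qp_prune: "t \<in> ltrees \<Longrightarrow> qp lam s n (prune n t) = qp lam s n t"
  by (simp add: qp_def augp_prune)

abbreviation aug_relabeled :: "real \<Rightarrow> real \<Rightarrow> ltree \<Rightarrow> ltree measure" where
  "aug_relabeled lam s t \<equiv> augmentation lam s t \<bind> uniform_relabeling"

lemma measurable_aug_relabeled: "aug_relabeled lam s \<in> tree_space \<rightarrow>\<^sub>M prob_algebra tree_space"
  by (rule measurable_bind_prob_space[OF measurable_augmentation measurable_uniform_relabeling])

lemma tree_prob_algebra:
  "K \<in> tree_space \<rightarrow>\<^sub>M prob_algebra N \<Longrightarrow> t \<in> ltrees \<Longrightarrow> sets (K t) = sets N \<and> prob_space (K t)"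
  using measurable_space[of K tree_space "prob_algebra N" t] by (simp add: space_prob_algebra)

text \<open>The relabeling kernel seen at depth \<open>n\<close> depends only on the
  depth-\<open>n\<close> pruning of its argument, so the composition of the two kernels can be
  computed at depth \<open>n\<close>.\<close>

lemma emeasure_aug_relabeled_cyl:
  assumes t: "t \<in> ltrees"
  shows "emeasure (aug_relabeled lam s t) (cyl n y) = ennreal (pmf (qp lam s n t) y)"
proof -
  have sp: "space (augmentation lam s t) = ltrees" by (simp add: augmentation_def)
  have D: "distr (augmentation lam s t) (count_space UNIV) (prune n) = measure_pmf (augp lam s n t)"
    by (rule distr_prune_tree_measure) (auto simp: emeasure_augmentation_cyl t dest: set_augp)
  have "emeasure (aug_relabeled lam s t) (cyl n y) =
      (\<integral>\<^sup>+x. emeasure (uniform_relabeling x) (cyl n y) \<partial>augmentation lam s t)"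
    by (rule emeasure_bind_prob_algebra[OF _ measurable_uniform_relabeling sets_cyl])
       (simp add: space_prob_algebra prob_space_augmentation[OF t])
  also have "\<dots> = (\<integral>\<^sup>+x. ennreal (pmf (relp n (prune n x)) y) \<partial>augmentation lam s t)"
    by (intro nn_integral_cong) (simp add: sp emeasure_uniform_relabeling_cyl relp_prune)
  also have "\<dots> = (\<integral>\<^sup>+x. ennreal (pmf (relp n x) y) \<partial>augp lam s n t)"
    by (rule nn_integral_prune[OF _ D]) simp
  also have "\<dots> = ennreal (pmf (qp lam s n t) y)" by (simp add: qp_def ennreal_pmf_bind)
  finally show ?thesis .
qed

lemma measurable_P1_kernel:
  "(\<lambda>t. aug_relabeled lam s t \<Otimes>\<^sub>M aug_relabeled lam s t) \<in> tree_space \<rightarrow>\<^sub>M prob_algebra (tree_space \<Otimes>\<^sub>M tree_space)"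
  by (intro measurable_pair_prob measurable_aug_relabeled)

lemma GW_prob_algebra: "GW \<mu> \<in> space (prob_algebra tree_space)"
  by (simp add: space_prob_algebra prob_space_GW)

lemma sets_P1 [simp, measurable_cong]: "sets (P1 lam s) = sets (tree_space \<Otimes>\<^sub>M tree_space)"
  and prob_space_P1: "prob_space (P1 lam s)"
  unfolding P1_def
  using sets_bind'[OF GW_prob_algebra measurable_P1_kernel] prob_space_bind'[OF GW_prob_algebra measurable_P1_kernel]
  by auto

lemma sets_P0 [simp, measurable_cong]: "sets (P0 lam) = sets (tree_space \<Otimes>\<^sub>M tree_space)"
  unfolding P0_def by (rule sets_pair_measure_cong) auto

lemma prob_space_P0: "prob_space (P0 lam)"
  unfolding P0_def by (intro prob_space_pair prob_space_GW)

lemma space_P0 [simp]: "space (P0 lam) = ltrees \<times> ltrees"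
  and space_P1 [simp]: "space (P1 lam s) = ltrees \<times> ltrees"
  using sets_eq_imp_space_eq[OF sets_P0] sets_eq_imp_space_eq[OF sets_P1] by (auto simp: space_pair_measure)

lemma measurable_prune2: "prune2 n \<in> tree_space \<Otimes>\<^sub>M tree_space \<rightarrow>\<^sub>M count_space (ltrees_upto n \<times> ltrees_upto n)"
proof (subst measurable_count_space_eq_countable, simp, safe)
  fix x y
  have "prune2 n -` {(x, y)} \<inter> space (tree_space \<Otimes>\<^sub>M tree_space) = cyl n x \<times> cyl n y"
    by (auto simp: prune2_def space_pair_measure)
  also have "\<dots> \<in> sets (tree_space \<Otimes>\<^sub>M tree_space)" by (intro pair_measureI sets_cyl)
  finally show "prune2 n -` {(x, y)} \<inter> space (tree_space \<Otimes>\<^sub>M tree_space) \<in> sets (tree_space \<Otimes>\<^sub>M tree_space)" .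
qed (auto simp: prune2_def space_pair_measure intro: prune_in_ltrees_upto)

lemma measurable_prune2_UNIV: "prune2 n \<in> tree_space \<Otimes>\<^sub>M tree_space \<rightarrow>\<^sub>M count_space UNIV"
  by (rule measurable_compose[OF measurable_prune2]) simp

lemma prune2_in: "x \<in> ltrees \<times> ltrees \<Longrightarrow> prune2 n x \<in> ltrees_upto n \<times> ltrees_upto n"
  by (auto simp: prune2_def intro: prune_in_ltrees_upto)

lemma distr_prune2_pair:
  assumes M: "sets M = sets (tree_space \<Otimes>\<^sub>M tree_space)" and p: "set_pmf p \<subseteq> ltrees_upto n \<times> ltrees_upto n"
    and eq: "\<And>x y. emeasure M (cyl n x \<times> cyl n y) = ennreal (pmf p (x, y))"
  shows "distr M (count_space UNIV) (prune2 n) = measure_pmf p"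
proof -
  have sp: "space M = ltrees \<times> ltrees" using sets_eq_imp_space_eq[OF M] by (simp add: space_pair_measure)
  show ?thesis
  proof (rule distr_eq_measure_pmf[where A = "ltrees_upto n \<times> ltrees_upto n"])
    show "prune2 n \<in> M \<rightarrow>\<^sub>M count_space UNIV"
      using measurable_prune2_UNIV measurable_cong_sets[OF M refl] by blast
    fix z :: "ltree \<times> ltree"
    have "prune2 n -` {z} \<inter> space M = cyl n (fst z) \<times> cyl n (snd z)" by (auto simp: sp prune2_def)
    then show "emeasure M (prune2 n -` {z} \<inter> space M) = ennreal (pmf p z)" using eq by simp
  qed (use sp p prune2_in in auto)
qed

lemma distr_P0: "distr (P0 lam) (count_space UNIV) (prune2 n) = measure_pmf (p0p lam n)"
proof (rule distr_prune2_pair)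
  interpret GW: prob_space "GW lam" by (rule prob_space_GW)
  fix x y
  show "emeasure (P0 lam) (cyl n x \<times> cyl n y) = ennreal (pmf (p0p lam n) (x, y))"
    unfolding P0_def by (subst GW.emeasure_pair_measure_Times)
      (auto simp: emeasure_GW_cyl p0p_def pmf_pair ennreal_mult')
qed (use set_p0p in auto)

lemma distr_P1: "distr (P1 lam s) (count_space UNIV) (prune2 n) = measure_pmf (p1p lam s n)"
proof (rule distr_prune2_pair)
  fix x y
  have "emeasure (P1 lam s) (cyl n x \<times> cyl n y) =
      (\<integral>\<^sup>+t. emeasure (aug_relabeled lam s t \<Otimes>\<^sub>M aug_relabeled lam s t) (cyl n x \<times> cyl n y) \<partial>GW (lam * s))"
    unfolding P1_def
    by (rule emeasure_bind_prob_algebra[OF GW_prob_algebra measurable_P1_kernel]) (intro pair_measureI sets_cyl)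
  also have "\<dots> = (\<integral>\<^sup>+t. ennreal (pmf (pair_pmf (qp lam s n (prune n t)) (qp lam s n (prune n t))) (x, y)) \<partial>GW (lam * s))"
  proof (intro nn_integral_cong)
    fix t assume "t \<in> space (GW (lam * s))"
    then have t: "t \<in> ltrees" by simp
    note K = tree_prob_algebra[OF measurable_aug_relabeled t, of lam s]
    interpret K: prob_space "aug_relabeled lam s t" using K by blast
    show "emeasure (aug_relabeled lam s t \<Otimes>\<^sub>M aug_relabeled lam s t) (cyl n x \<times> cyl n y) =
       ennreal (pmf (pair_pmf (qp lam s n (prune n t)) (qp lam s n (prune n t))) (x, y))"
      using K by (subst K.emeasure_pair_measure_Times)
        (auto simp: emeasure_aug_relabeled_cyl t qp_prune pmf_pair ennreal_mult')
  qed
  also have "\<dots> = (\<integral>\<^sup>+t. ennreal (pmf (pair_pmf (qp lam s n t) (qp lam s n t)) (x, y)) \<partial>gwp (lam * s) n)"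
    by (rule nn_integral_prune[OF _ distr_GW]) simp
  also have "\<dots> = ennreal (pmf (p1p lam s n) (x, y))" by (simp add: p1p_def ennreal_pmf_bind)
  finally show "emeasure (P1 lam s) (cyl n x \<times> cyl n y) = ennreal (pmf (p1p lam s n) (x, y))" .
qed (use set_p1p in auto)

lemma prune2_prune2: "m \<le> n \<Longrightarrow> prune2 m (prune2 n x) = prune2 m x"
  by (auto simp: prune2_def prune_prune split: prod.splits)

text \<open>Consistency in the depth comes from the measure on infinite trees, of which all
  \<open>p n\<close> are images, and not from the recursions.\<close>

lemma map_prune2_eq:
  assumes M: "sets M = sets (tree_space \<Otimes>\<^sub>M tree_space)" and "m \<le> n"
    and "\<And>n. distr M (count_space UNIV) (prune2 n) = measure_pmf (p n)"
  shows "map_pmf (prune2 m) (p n) = p m"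
proof -
  have "measure_pmf (map_pmf (prune2 m) (p n)) = distr (distr M (count_space UNIV) (prune2 n)) (count_space UNIV) (prune2 m)"
    by (simp add: assms map_pmf_rep_eq)
  also have "\<dots> = distr M (count_space UNIV) (prune2 m \<circ> prune2 n)"
    using measurable_prune2_UNIV measurable_cong_sets[OF M refl] by (subst distr_distr) auto
  also have "prune2 m \<circ> prune2 n = prune2 m" using assms(2) by (auto simp: prune2_prune2)
  finally show ?thesis using assms(3)[of m] by (simp add: measure_pmf_inject)
qed

lemma map_prune2_p1p: "m \<le> n \<Longrightarrow> map_pmf (prune2 m) (p1p lam s n) = p1p lam s m"
  by (rule map_prune2_eq[OF sets_P1 _ distr_P1])

lemma map_prune2_p0p: "m \<le> n \<Longrightarrow> map_pmf (prune2 m) (p0p lam n) = p0p lam m"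
  by (rule map_prune2_eq[OF sets_P0 _ distr_P0])

lemma map_prune_gwp:
  assumes "m \<le> n" shows "map_pmf (prune m) (gwp \<mu> n) = gwp \<mu> m"
proof -
  have "map_pmf fst (map_pmf (prune2 m) (p0p \<mu> n)) = map_pmf fst (p0p \<mu> m)"
    using assms by (simp add: map_prune2_p0p)
  moreover have "map_pmf fst (map_pmf (prune2 m) (p0p \<mu> n)) = map_pmf (prune m) (map_pmf fst (p0p \<mu> n))"
    by (simp add: pmf.map_comp o_def prune2_def case_prod_unfold)
  ultimately show ?thesis by (simp add: p0p_def map_fst_pair_pmf)
qed

lemma measure_pruned_law:
  assumes "sets M = sets (tree_space \<Otimes>\<^sub>M tree_space)"
    and "distr M (count_space UNIV) (prune2 n) = measure_pmf p" "A \<subseteq> ltrees_upto n \<times> ltrees_upto n"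
  shows "measure (pruned_law M n) A = measure_pmf.prob p A"
proof -
  have m: "prune2 n \<in> M \<rightarrow>\<^sub>M count_space UNIV" "prune2 n \<in> M \<rightarrow>\<^sub>M count_space (ltrees_upto n \<times> ltrees_upto n)"
    using measurable_prune2_UNIV measurable_prune2 measurable_cong_sets[OF assms(1) refl] by blast+
  have "measure (pruned_law M n) A = measure M (prune2 n -` A \<inter> space M)"
    unfolding pruned_law_def using m assms by (intro measure_distr) auto
  also have "\<dots> = measure (distr M (count_space UNIV) (prune2 n)) A"
    using m by (subst measure_distr) auto
  finally show ?thesis using assms by simp
qed

lemmas measure_pruned_P0 = measure_pruned_law[OF sets_P0 distr_P0]
lemmas measure_pruned_P1 = measure_pruned_law[OF sets_P1 distr_P1]

lemma L_eq: "L lam s n x = pmf (p1p lam s n) x / pmf (p0p lam n) x"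
proof (cases "x \<in> ltrees_upto n \<times> ltrees_upto n")
  case True
  then show ?thesis
    by (simp add: L_def measure_pruned_P0 measure_pruned_P1 measure_pmf_single)
next
  case False
  then have "pmf (p1p lam s n) x = 0" using set_p1p by (auto simp: set_pmf_eq)
  \<comment> \<open>\<open>pruned_law\<close> lives on pairs of trees of depth at most
    \<open>n\<close>; a point outside is not measurable there and gets measure \<open>0\<close>, in
    agreement with the vanishing numerator on the right.\<close>
  moreover have "{x} \<notin> sets (pruned_law (P1 lam s) n)" using False by (auto simp: pruned_law_def)
  ultimately show ?thesis by (simp add: L_def measure_notin_sets)
qed

section \<open>The recursive structure of the correlated law\<close>

lemma relp_node:
  assumes "\<And>i. i \<in> {1..c} \<Longrightarrow> [] \<in> F i"
  shows "relp (Suc n) (node c F) = do {\<pi> \<leftarrow> pmf_of_set (perms c);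
    F' \<leftarrow> Pi_pmf {1..c} {[]} (\<lambda>i. relp n (F i)); return_pmf (node c (\<lambda>j. F' (inv \<pi> j)))}"
proof -
  have c: "nchildren (node c F) [] = c" using assms by (rule nchildren_node)
  have "Pi_pmf {1..c} {[]} (\<lambda>i. relp n (sub (node c F) i)) = Pi_pmf {1..c} {[]} (\<lambda>i. relp n (F i))"
    by (intro Pi_pmf_cong) (auto simp: sub_node)
  then show ?thesis by (simp add: c)
qed

lemma Pi_pmf_relp_node:
  assumes P: "\<And>i t. i \<in> {1..c} \<Longrightarrow> t \<in> set_pmf (P i) \<Longrightarrow> [] \<in> t"
  shows "Pi_pmf {1..c} {[]} P \<bind> (\<lambda>F. relp (Suc n) (node c F)) =
    do {\<pi> \<leftarrow> pmf_of_set (perms c); F \<leftarrow> Pi_pmf {1..c} {[]} (\<lambda>i. P i \<bind> relp n);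
        return_pmf (node c (\<lambda>j. F (inv \<pi> j)))}"
proof -
  have "Pi_pmf {1..c} {[]} P \<bind> (\<lambda>F. relp (Suc n) (node c F)) =
    Pi_pmf {1..c} {[]} P \<bind> (\<lambda>F. do {\<pi> \<leftarrow> pmf_of_set (perms c);
      F' \<leftarrow> Pi_pmf {1..c} {[]} (\<lambda>i. relp n (F i)); return_pmf (node c (\<lambda>j. F' (inv \<pi> j)))})"
  proof (intro bind_pmf_cong refl)
    fix F assume F: "F \<in> set_pmf (Pi_pmf {1..c} {[]} P)"
    show "relp (Suc n) (node c F) = do {\<pi> \<leftarrow> pmf_of_set (perms c);
      F' \<leftarrow> Pi_pmf {1..c} {[]} (\<lambda>i. relp n (F i)); return_pmf (node c (\<lambda>j. F' (inv \<pi> j)))}"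
      by (rule relp_node) (use P set_Pi_pmf_in[OF F] in blast)
  qed
  also have "\<dots> = do {\<pi> \<leftarrow> pmf_of_set (perms c); F \<leftarrow> Pi_pmf {1..c} {[]} P;
      F' \<leftarrow> Pi_pmf {1..c} {[]} (\<lambda>i. relp n (F i)); return_pmf (node c (\<lambda>j. F' (inv \<pi> j)))}"
    by (rule bind_commute_pmf)
  also have "\<dots> = do {\<pi> \<leftarrow> pmf_of_set (perms c); F \<leftarrow> Pi_pmf {1..c} {[]} (\<lambda>i. P i \<bind> relp n);
        return_pmf (node c (\<lambda>j. F (inv \<pi> j)))}"
    by (simp add: Pi_pmf_bind[where d' = "{[]}"] bind_assoc_pmf)
  finally show ?thesis .
qed

text \<open>Exchangeability: permuting an i.i.d. family does not change its law.\<close>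

lemma Pi_pmf_perm:
  assumes "\<pi> permutes {1..c::nat}"
  shows "Pi_pmf {1..c} d (\<lambda>_. p) \<bind> (\<lambda>F. return_pmf (node c (\<lambda>j. F (inv \<pi> j)))) =
    Pi_pmf {1..c} d (\<lambda>_. p) \<bind> (\<lambda>F. return_pmf (node c F))"
proof -
  have "Pi_pmf {1..c} d (\<lambda>_. p) = map_pmf (\<lambda>g. g \<circ> inv \<pi>) (Pi_pmf {1..c} d (\<lambda>_. p))"
    using permutes_inv[OF assms] by (intro Pi_pmf_bij_betw)
      (auto intro: permutes_imp_bij simp: permutes_not_in)
  then have "Pi_pmf {1..c} d (\<lambda>_. p) \<bind> (\<lambda>F. return_pmf (node c F)) =
     map_pmf (\<lambda>g. g \<circ> inv \<pi>) (Pi_pmf {1..c} d (\<lambda>_. p)) \<bind> (\<lambda>F. return_pmf (node c F))" by simp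
  then show ?thesis by (simp add: bind_map_pmf o_def)
qed

text \<open>Subtrees of a Galton-Watson tree are i.i.d. given the degree, so shuffling them changes
  nothing; by induction neither does shuffling inside them.\<close>

lemma gwp_relp: "gwp \<mu> n \<bind> relp n = gwp \<mu> n"
proof (induction n)
  case 0 show ?case by (simp add: bind_return_pmf)
next
  case (Suc n)
  have "gwp \<mu> (Suc n) \<bind> relp (Suc n) =
    Poisson \<mu> \<bind> (\<lambda>c. Pi_pmf {1..c} {[]} (\<lambda>_. gwp \<mu> n) \<bind> (\<lambda>F. relp (Suc n) (node c F)))"
    by (simp add: bind_assoc_pmf bind_return_pmf del: relp.simps)
  also have "\<dots> = Poisson \<mu> \<bind> (\<lambda>c. pmf_of_set (perms c) \<bind> (\<lambda>\<pi>.
      Pi_pmf {1..c} {[]} (\<lambda>_. gwp \<mu> n) \<bind> (\<lambda>F. return_pmf (node c F))))"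
  proof (intro bind_pmf_cong refl)
    fix c
    have "Pi_pmf {1..c} {[]} (\<lambda>_. gwp \<mu> n) \<bind> (\<lambda>F. relp (Suc n) (node c F)) =
      pmf_of_set (perms c) \<bind> (\<lambda>\<pi>. Pi_pmf {1..c} {[]} (\<lambda>_. gwp \<mu> n) \<bind> (\<lambda>F. return_pmf (node c (\<lambda>j. F (inv \<pi> j)))))"
      by (subst Pi_pmf_relp_node) (auto simp: Suc dest: set_gwp Nil_in_ltrees_upto)
    also have "\<dots> = pmf_of_set (perms c) \<bind> (\<lambda>\<pi>.
      Pi_pmf {1..c} {[]} (\<lambda>_. gwp \<mu> n) \<bind> (\<lambda>F. return_pmf (node c F)))"
      by (intro bind_pmf_cong refl Pi_pmf_perm) simp
    finally show "Pi_pmf {1..c} {[]} (\<lambda>_. gwp \<mu> n) \<bind> (\<lambda>F. relp (Suc n) (node c F)) =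
      pmf_of_set (perms c) \<bind> (\<lambda>\<pi>.
      Pi_pmf {1..c} {[]} (\<lambda>_. gwp \<mu> n) \<bind> (\<lambda>F. return_pmf (node c F)))" .
  qed
  also have "\<dots> = gwp \<mu> (Suc n)" by simp
  finally show ?case .
qed

text \<open>One side of the pair given its \<open>k\<close> common subtrees \<open>f\<close>:
  \<open>a\<close> fresh Galton-Watson subtrees are added and all \<open>k + a\<close> are
  shuffled.\<close>

definition fill :: "real \<Rightarrow> nat \<Rightarrow> nat \<Rightarrow> nat \<Rightarrow> (nat \<Rightarrow> ltree) \<Rightarrow> ltree pmf" where
  "fill lam n k a f = do {
     \<pi> \<leftarrow> pmf_of_set (perms (k + a));
     E \<leftarrow> Pi_pmf {k + 1..k + a} {[]} (\<lambda>_. gwp lam n);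
     return_pmf (node (k + a) (\<lambda>j. let i = inv \<pi> j in if i \<le> k then f i else E i))}"

lemma qp_0: "qp lam s 0 t = return_pmf {[]}"
  by (simp add: qp_def bind_return_pmf)

text \<open>Relabeling inside the grafted trees is absorbed by \<open>gwp_relp\<close>, so beyond
  the common children only fresh Galton-Watson trees and the shuffle at the root remain.\<close>

lemma qp_Suc:
  "qp lam s (Suc n) t = do {
     a \<leftarrow> Poisson (lam * (1 - s));
     f \<leftarrow> Pi_pmf {1..nchildren t []} {[]} (\<lambda>i. qp lam s n (sub t i));
     fill lam n (nchildren t []) a f}"
proof -
  let ?k = "nchildren t []"
  let ?P = "\<lambda>i. if i \<le> ?k then augp lam s n (sub t i) else gwp lam n"
  let ?Q = "\<lambda>i. qp lam s n (sub t i)"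
  have "Pi_pmf {1..?k + a} {[]} ?P \<bind> (\<lambda>F. relp (Suc n) (node (?k + a) F)) =
    Pi_pmf {1..?k} {[]} ?Q \<bind> fill lam n ?k a" for a
  proof -
    have eq: "(\<lambda>i. ?P i \<bind> relp n) = (\<lambda>i. if i \<le> ?k then ?Q i else gwp lam n)"
      by (auto simp: qp_def gwp_relp)
    have un: "{1..?k + a} = {1..?k} \<union> {?k + 1..?k + a}" by auto
    have Pi: "Pi_pmf {1..?k + a} {[]} (\<lambda>i. if i \<le> ?k then ?Q i else gwp lam n) =
      Pi_pmf {1..?k} {[]} ?Q \<bind> (\<lambda>f. Pi_pmf {?k + 1..?k + a} {[]} (\<lambda>_. gwp lam n) \<bind>
        (\<lambda>E. return_pmf (\<lambda>i. if i \<in> {1..?k} then f i else E i)))"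
    proof -
      have "Pi_pmf {1..?k} {[]} (\<lambda>i. if i \<le> ?k then ?Q i else gwp lam n) = Pi_pmf {1..?k} {[]} ?Q"
        by (intro Pi_pmf_cong) auto
      moreover have "Pi_pmf {?k + 1..?k + a} {[]} (\<lambda>i. if i \<le> ?k then ?Q i else gwp lam n) =
          Pi_pmf {?k + 1..?k + a} {[]} (\<lambda>_. gwp lam n)"
        by (intro Pi_pmf_cong) auto
      ultimately show ?thesis
        unfolding un by (subst Pi_pmf_union) (auto simp: map_pmf_def pair_pmf_def bind_assoc_pmf bind_return_pmf)
    qed
    have "Pi_pmf {1..?k + a} {[]} ?P \<bind> (\<lambda>F. relp (Suc n) (node (?k + a) F)) =
      pmf_of_set (perms (?k + a)) \<bind> (\<lambda>\<pi>. Pi_pmf {1..?k + a} {[]} (\<lambda>i. if i \<le> ?k then ?Q i else gwp lam n) \<bind>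
        (\<lambda>F. return_pmf (node (?k + a) (\<lambda>j. F (inv \<pi> j)))))"
      by (subst Pi_pmf_relp_node)
         (auto simp: eq split: if_splits dest: set_gwp set_augp Nil_in_ltrees_upto)
    also have "\<dots> = pmf_of_set (perms (?k + a)) \<bind> (\<lambda>\<pi>. Pi_pmf {1..?k} {[]} ?Q \<bind> (\<lambda>f.
        Pi_pmf {?k + 1..?k + a} {[]} (\<lambda>_. gwp lam n) \<bind>
        (\<lambda>E. return_pmf (node (?k + a) (\<lambda>j. let i = inv \<pi> j in if i \<le> ?k then f i else E i)))))"
      unfolding Pi bind_assoc_pmf bind_return_pmf
    proof (intro bind_pmf_cong refl arg_cong[where f = return_pmf] node_cong)
      fix \<pi> f E j assume "\<pi> \<in> set_pmf (pmf_of_set (perms (?k + a)))" "j \<in> {1..?k + a}"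
      then have "inv \<pi> j \<in> {1..?k + a}" using inv_perm_in by auto
      then show "(if inv \<pi> j \<in> {1..?k} then f (inv \<pi> j) else E (inv \<pi> j)) =
        (let i = inv \<pi> j in if i \<le> ?k then f i else E i)" by (auto simp: Let_def)
    qed
    also have "\<dots> = Pi_pmf {1..?k} {[]} ?Q \<bind> fill lam n ?k a"
      unfolding fill_def by (rule bind_commute_pmf)
    finally show ?thesis .
  qed
  then show ?thesis
    by (simp add: qp_def[of lam s "Suc n"] bind_assoc_pmf bind_return_pmf del: relp.simps)
qed

lemma Pi_pmf_pair:
  assumes "finite A"
  shows "Pi_pmf A (d, d') (\<lambda>i. pair_pmf (p i) (q i)) =
    do {f \<leftarrow> Pi_pmf A d p; f' \<leftarrow> Pi_pmf A d' q; return_pmf (\<lambda>i. (f i, f' i))}"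
proof (rule pmf_eqI)
  fix g
  have "map_pmf (\<lambda>(f, f') i. (f i, f' i)) (pair_pmf (Pi_pmf A d p) (Pi_pmf A d' q)) =
    do {f \<leftarrow> Pi_pmf A d p; f' \<leftarrow> Pi_pmf A d' q; return_pmf (\<lambda>i. (f i, f' i))}"
    by (simp add: map_pmf_def pair_pmf_def bind_assoc_pmf bind_return_pmf)
  moreover have "pmf (map_pmf (\<lambda>(f, f') i. (f i, f' i)) (pair_pmf (Pi_pmf A d p) (Pi_pmf A d' q)))
      ((\<lambda>(f, f') i. (f i, f' i)) (fst \<circ> g, snd \<circ> g)) = pmf (pair_pmf (Pi_pmf A d p) (Pi_pmf A d' q)) (fst \<circ> g, snd \<circ> g)"
    by (rule pmf_map_inj') (auto simp: inj_def fun_eq_iff)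
  moreover have "pmf (pair_pmf (p i) (q i)) (g i) = pmf (p i) (fst (g i)) * pmf (q i) (snd (g i))" for i
    by (cases "g i") (simp add: pmf_pair)
  then have "pmf (Pi_pmf A (d, d') (\<lambda>i. pair_pmf (p i) (q i))) g =
      pmf (Pi_pmf A d p) (fst \<circ> g) * pmf (Pi_pmf A d' q) (snd \<circ> g)"
    using assms by (auto simp: pmf_Pi prod.distrib prod_eq_iff)
  ultimately show "pmf (Pi_pmf A (d, d') (\<lambda>i. pair_pmf (p i) (q i))) g = pmf (do {f \<leftarrow> Pi_pmf A d p; f' \<leftarrow> Pi_pmf A d' q; return_pmf (\<lambda>i. (f i, f' i))}) g"
    by (simp add: pmf_pair)
qed

text \<open>Given the common subtrees \<open>T i\<close>, the two sides are independent. Averaging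
  over the i.i.d. \<open>T i\<close> turns the two families of subtrees into one i.i.d. family of
  correlated pairs. The bulk of the proof commutes draws so that the degrees come first.\<close>

lemma p1p_Suc:
  "p1p lam s (Suc n) = do {
     k \<leftarrow> Poisson (lam * s); a \<leftarrow> Poisson (lam * (1 - s)); a' \<leftarrow> Poisson (lam * (1 - s));
     g \<leftarrow> Pi_pmf {1..k} ({[]}, {[]}) (\<lambda>_. p1p lam s n);
     x \<leftarrow> fill lam n k a (\<lambda>i. fst (g i)); y \<leftarrow> fill lam n k a' (\<lambda>i. snd (g i)); return_pmf (x, y)}"
proof -
  let ?A = "Poisson (lam * (1 - s))"
  have 1: "qp lam s (Suc n) (node k T) = do {a \<leftarrow> ?A; f \<leftarrow> Pi_pmf {1..k} {[]} (\<lambda>i. qp lam s n (T i)); fill lam n k a f}"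
    if "\<And>i. i \<in> {1..k} \<Longrightarrow> [] \<in> T i" for k T
  proof -
    have c: "nchildren (node k T) [] = k" using that by (rule nchildren_node)
    have "Pi_pmf {1..k} {[]} (\<lambda>i. qp lam s n (sub (node k T) i)) = Pi_pmf {1..k} {[]} (\<lambda>i. qp lam s n (T i))"
      by (intro Pi_pmf_cong) (auto simp: sub_node)
    then show ?thesis by (simp add: qp_Suc c)
  qed
  have 2: "Pi_pmf {1..k} ({[]}, {[]}) (\<lambda>_. p1p lam s n) = do {T \<leftarrow> Pi_pmf {1..k} {[]} (\<lambda>_. gwp (lam * s) n);
      f \<leftarrow> Pi_pmf {1..k} {[]} (\<lambda>i. qp lam s n (T i)); f' \<leftarrow> Pi_pmf {1..k} {[]} (\<lambda>i. qp lam s n (T i));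
      return_pmf (\<lambda>i. (f i, f' i))}" for k :: nat
    unfolding p1p_def
    by (subst Pi_pmf_bind[where d' = "{[]}"], simp) (intro bind_pmf_cong refl Pi_pmf_pair finite_atLeastAtMost)
  have "p1p lam s (Suc n) = do {k \<leftarrow> Poisson (lam * s); T \<leftarrow> Pi_pmf {1..k} {[]} (\<lambda>_. gwp (lam * s) n);
      pair_pmf (qp lam s (Suc n) (node k T)) (qp lam s (Suc n) (node k T))}"
    by (simp add: p1p_def bind_assoc_pmf bind_return_pmf)
  also have "\<dots> = do {k \<leftarrow> Poisson (lam * s); T \<leftarrow> Pi_pmf {1..k} {[]} (\<lambda>_. gwp (lam * s) n);
      pair_pmf (do {a \<leftarrow> ?A; f \<leftarrow> Pi_pmf {1..k} {[]} (\<lambda>i. qp lam s n (T i)); fill lam n k a f})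
        (do {a \<leftarrow> ?A; f \<leftarrow> Pi_pmf {1..k} {[]} (\<lambda>i. qp lam s n (T i)); fill lam n k a f})}"
  proof (intro bind_pmf_cong refl)
    fix k :: nat and T assume T: "T \<in> set_pmf (Pi_pmf {1..k} {[]} (\<lambda>_. gwp (lam * s) n))"
    have "[] \<in> T i" if "i \<in> {1..k}" for i
      using set_gwp[OF set_Pi_pmf_in[OF T that]] by (rule Nil_in_ltrees_upto)
    from 1[OF this]
    show "pair_pmf (qp lam s (Suc n) (node k T)) (qp lam s (Suc n) (node k T)) =
       pair_pmf (do {a \<leftarrow> ?A; f \<leftarrow> Pi_pmf {1..k} {[]} (\<lambda>i. qp lam s n (T i)); fill lam n k a f})
        (do {a \<leftarrow> ?A; f \<leftarrow> Pi_pmf {1..k} {[]} (\<lambda>i. qp lam s n (T i)); fill lam n k a f})"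
      by simp
  qed
  also have "\<dots> = do {k \<leftarrow> Poisson (lam * s); a \<leftarrow> ?A; a' \<leftarrow> ?A;
      T \<leftarrow> Pi_pmf {1..k} {[]} (\<lambda>_. gwp (lam * s) n);
      f \<leftarrow> Pi_pmf {1..k} {[]} (\<lambda>i. qp lam s n (T i)); f' \<leftarrow> Pi_pmf {1..k} {[]} (\<lambda>i. qp lam s n (T i));
      x \<leftarrow> fill lam n k a f; y \<leftarrow> fill lam n k a' f'; return_pmf (x, y)}"
    unfolding pair_pmf_def bind_assoc_pmf
    by (simp only: bind_commute_pmf[of "fill lam n k a f" ?A for k a f]
       bind_commute_pmf[of "Pi_pmf B d P" ?A for B d P]
       bind_commute_pmf[of "fill lam n k a f" "Pi_pmf B d P" for k a f B d P])
  also have "\<dots> = do {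
     k \<leftarrow> Poisson (lam * s); a \<leftarrow> ?A; a' \<leftarrow> ?A;
     g \<leftarrow> Pi_pmf {1..k} ({[]}, {[]}) (\<lambda>_. p1p lam s n);
     x \<leftarrow> fill lam n k a (\<lambda>i. fst (g i)); y \<leftarrow> fill lam n k a' (\<lambda>i. snd (g i)); return_pmf (x, y)}"
    unfolding 2 bind_assoc_pmf bind_return_pmf by simp
  finally show ?thesis .
qed

section \<open>Likelihood ratio and changes of measure\<close>

lemma pmf_Poisson: "0 \<le> \<mu> \<Longrightarrow> pmf (Poisson \<mu>) k = \<mu> ^ k / fact k * exp (- \<mu>)"
  by (cases "\<mu> = 0") (auto simp: Poisson_def pmf_return power_0_left)

lemma prob_pmf_le_mult:
  assumes "0 \<le> c" "\<And>x. x \<in> A \<Longrightarrow> pmf p x \<le> c * pmf q x"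
  shows "measure_pmf.prob p A \<le> c * measure_pmf.prob q A"
proof -
  have "emeasure (measure_pmf p) A = (\<integral>\<^sup>+x. ennreal (pmf p x) \<partial>count_space A)"
    by (simp add: nn_integral_pmf)
  also have "\<dots> \<le> (\<integral>\<^sup>+x. ennreal c * ennreal (pmf q x) \<partial>count_space A)"
    using assms by (intro nn_integral_mono) (auto simp: ennreal_mult'[symmetric])
  also have "\<dots> = ennreal c * emeasure (measure_pmf q) A"
    by (simp add: nn_integral_cmult nn_integral_pmf)
  finally show ?thesis
    using assms(1) by (simp add: measure_pmf.emeasure_eq_measure ennreal_mult'[symmetric])
qed

lemma liminf_ereal_pos_iff:
  "liminf (\<lambda>d. ereal (f d)) > 0 \<longleftrightarrow> (\<exists>\<epsilon>>0. eventually (\<lambda>d. \<epsilon> \<le> f d) sequentially)"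
proof
  assume "liminf (\<lambda>d. ereal (f d)) > 0"
  then obtain e where e: "0 < ereal e" "ereal e < liminf (\<lambda>d. ereal (f d))"
    using ereal_dense2 by blast
  then have "eventually (\<lambda>d. ereal e < ereal (f d)) sequentially" by (intro less_LiminfD)
  then have "eventually (\<lambda>d. e \<le> f d) sequentially" by eventually_elim simp
  then show "\<exists>\<epsilon>>0. eventually (\<lambda>d. \<epsilon> \<le> f d) sequentially" using e by auto
next
  assume "\<exists>\<epsilon>>0. eventually (\<lambda>d. \<epsilon> \<le> f d) sequentially"
  then obtain e where "e > 0" "eventually (\<lambda>d. e \<le> f d) sequentially" by blast
  then have "ereal e \<le> liminf (\<lambda>d. ereal (f d))" by (intro Liminf_bounded) simp
  then show "liminf (\<lambda>d. ereal (f d)) > 0" using \<open>e > 0\<close> by (meson ereal_less(2) less_le_trans)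
qed

lemma nn_integral_pruned_law:
  fixes f :: "ltree \<times> ltree \<Rightarrow> ennreal"
  assumes M: "sets M = sets (tree_space \<Otimes>\<^sub>M tree_space)"
    and p: "distr M (count_space UNIV) (prune2 n) = measure_pmf p"
  shows "(\<integral>\<^sup>+x. f (prune2 n x) \<partial>M) = (\<integral>\<^sup>+x. f x \<partial>measure_pmf p)"
    and "(\<integral>\<^sup>+x. f x \<partial>pruned_law M n) = (\<integral>\<^sup>+x. f x \<partial>measure_pmf p)"
proof -
  have m: "prune2 n \<in> M \<rightarrow>\<^sub>M count_space UNIV" "prune2 n \<in> M \<rightarrow>\<^sub>M count_space (ltrees_upto n \<times> ltrees_upto n)"
    using measurable_prune2_UNIV measurable_prune2 measurable_cong_sets[OF M refl] by blast+
  show 1: "(\<integral>\<^sup>+x. f (prune2 n x) \<partial>M) = (\<integral>\<^sup>+x. f x \<partial>measure_pmf p)"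
    unfolding p[symmetric] using m by (subst nn_integral_distr) auto
  show "(\<integral>\<^sup>+x. f x \<partial>pruned_law M n) = (\<integral>\<^sup>+x. f x \<partial>measure_pmf p)"
    unfolding pruned_law_def 1[symmetric] using m by (subst nn_integral_distr) auto
qed

lemma integral_pruned_law:
  fixes f :: "ltree \<times> ltree \<Rightarrow> real"
  assumes M: "sets M = sets (tree_space \<Otimes>\<^sub>M tree_space)"
    and p: "distr M (count_space UNIV) (prune2 n) = measure_pmf p"
  shows "(\<integral>x. f (prune2 n x) \<partial>M) = (\<integral>x. f x \<partial>measure_pmf p)"
    and "(\<integral>x. f x \<partial>pruned_law M n) = (\<integral>x. f x \<partial>measure_pmf p)"
    and "integrable M (\<lambda>x. f (prune2 n x)) \<longleftrightarrow> integrable (measure_pmf p) f"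
proof -
  have m: "prune2 n \<in> M \<rightarrow>\<^sub>M count_space UNIV" "prune2 n \<in> M \<rightarrow>\<^sub>M count_space (ltrees_upto n \<times> ltrees_upto n)"
    using measurable_prune2_UNIV measurable_prune2 measurable_cong_sets[OF M refl] by blast+
  show 1: "(\<integral>x. f (prune2 n x) \<partial>M) = (\<integral>x. f x \<partial>measure_pmf p)"
    unfolding p[symmetric] using m by (subst integral_distr) auto
  show "(\<integral>x. f x \<partial>pruned_law M n) = (\<integral>x. f x \<partial>measure_pmf p)"
    unfolding pruned_law_def 1[symmetric] using m by (subst integral_distr) auto
  show "integrable M (\<lambda>x. f (prune2 n x)) \<longleftrightarrow> integrable (measure_pmf p) f"
    unfolding p[symmetric] using m by (subst integrable_distr_eq) auto
qed

locale correlated_trees =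
  fixes lam s :: real
  assumes lam_pos: "lam > 0" and s_nonneg: "0 \<le> s" and s_le_1: "s \<le> 1"
begin

abbreviation p1 :: "nat \<Rightarrow> (ltree \<times> ltree) pmf" where "p1 n \<equiv> p1p lam s n"
abbreviation p0 :: "nat \<Rightarrow> (ltree \<times> ltree) pmf" where "p0 n \<equiv> p0p lam n"
abbreviation gw :: "nat \<Rightarrow> ltree pmf" where "gw n \<equiv> gwp lam n"
abbreviation lr :: "nat \<Rightarrow> ltree \<times> ltree \<Rightarrow> real" where "lr n \<equiv> L lam s n"
abbreviation \<mu> :: real where "\<mu> \<equiv> lam * s"
abbreviation X2 :: "nat \<Rightarrow> (ltree \<times> ltree) set" where "X2 n \<equiv> ltrees_upto n \<times> ltrees_upto n"

lemma mu_nonneg: "0 \<le> \<mu>" and nu_nonneg: "0 \<le> lam * (1 - s)"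
  using lam_pos s_nonneg s_le_1 by auto

text \<open>Since \<open>lam > 0\<close>, every finite tree has positive mass. Thus the ratio never
  divides by zero on the relevant pairs, and the correlated law is absolutely continuous at each
  depth.\<close>

lemma pmf_gw_pos: "x \<in> ltrees_upto n \<Longrightarrow> pmf (gw n) x > 0"
proof (induction n arbitrary: x)
  case 0 then show ?case by (simp add: ltrees_upto_0)
next
  case (Suc n)
  then obtain c f where x: "x = node c f" and f: "\<And>i. f i \<in> ltrees_upto n"
    by (blast elim: ltrees_upto_SucE)
  have "pmf (Poisson lam) c > 0" using lam_pos by (simp add: pmf_Poisson)
  then show ?case unfolding x using Suc.IH[OF f] Nil_in_ltrees_upto[OF f]
    by (subst pmf_gwp_node) (auto intro!: mult_pos_pos prod_pos)
qed

lemma pmf_p0_pos: "x \<in> X2 n \<Longrightarrow> pmf (p0 n) x > 0"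
  by (cases x) (auto simp: p0p_def pmf_pair pmf_gw_pos)

lemma pmf_p1_outside: "x \<notin> X2 n \<Longrightarrow> pmf (p1 n) x = 0"
  using set_p1p by (auto simp: set_pmf_eq)

lemma lr_nonneg: "lr n x \<ge> 0"
  by (simp add: L_eq)

lemma pmf_p1_eq: "pmf (p1 n) x = lr n x * pmf (p0 n) x"
  using pmf_p0_pos[of x n] pmf_p1_outside[of x n] by (cases "x \<in> X2 n") (auto simp: L_eq)

lemma lr_pos: "x \<in> set_pmf (p1 n) \<Longrightarrow> lr n x > 0"
  using lr_nonneg[of n x] pmf_p1_eq[of n x] by (auto simp: set_pmf_eq less_le)

lemma p1_density: "measure_pmf (p1 n) = density (measure_pmf (p0 n)) (\<lambda>x. ennreal (lr n x))"
proof (rule measure_eqI)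
  fix A
  have "emeasure (density (measure_pmf (p0 n)) (\<lambda>x. ennreal (lr n x))) A =
      (\<integral>\<^sup>+x. ennreal (lr n x) * indicator A x \<partial>p0 n)" by (subst emeasure_density) auto
  also have "\<dots> = (\<integral>\<^sup>+x. ennreal (pmf (p0 n) x) * (ennreal (lr n x) * indicator A x) \<partial>count_space UNIV)"
    by (simp add: nn_integral_measure_pmf)
  also have "\<dots> = (\<integral>\<^sup>+x. ennreal (pmf (p1 n) x) * indicator A x \<partial>count_space UNIV)"
    by (intro nn_integral_cong) (simp add: pmf_p1_eq ennreal_mult' lr_nonneg ac_simps)
  also have "\<dots> = emeasure (p1 n) A"
    by (simp add: nn_integral_pmf[symmetric] nn_integral_count_space_indicator)
  finally show "emeasure (p1 n) A = emeasure (density (measure_pmf (p0 n)) (\<lambda>x. ennreal (lr n x))) A" by simp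
qed simp

lemma nn_integral_p1: "(\<integral>\<^sup>+x. f x \<partial>p1 n) = (\<integral>\<^sup>+x. ennreal (lr n x) * f x \<partial>p0 n)"
  unfolding p1_density by (subst nn_integral_density) auto

lemma prob_p1_le:
  assumes "0 \<le> c" "\<And>x. x \<in> A \<Longrightarrow> lr n x \<le> c"
  shows "measure_pmf.prob (p1 n) A \<le> c * measure_pmf.prob (p0 n) A"
  using assms by (intro prob_pmf_le_mult) (auto simp: pmf_p1_eq mult_right_mono)

lemma prob_p1_ge:
  assumes "0 < c" "\<And>x. x \<in> A \<Longrightarrow> c \<le> lr n x"
  shows "c * measure_pmf.prob (p0 n) A \<le> measure_pmf.prob (p1 n) A"
proof -
  have "measure_pmf.prob (p0 n) A \<le> (1 / c) * measure_pmf.prob (p1 n) A"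
  proof (rule prob_pmf_le_mult)
    fix x assume "x \<in> A"
    then have "c * pmf (p0 n) x \<le> pmf (p1 n) x" using assms(2) by (simp add: pmf_p1_eq mult_right_mono)
    then show "pmf (p0 n) x \<le> (1 / c) * pmf (p1 n) x" using assms(1) by (simp add: field_simps)
  qed (use assms(1) in simp)
  then show ?thesis using assms(1) by (simp add: field_simps)
qed

lemma prob_p0_lr_gt: "0 < c \<Longrightarrow> measure_pmf.prob (p0 n) {x. lr n x > c} \<le> 1 / c"
proof -
  assume c: "0 < c"
  have "c * measure_pmf.prob (p0 n) {x. lr n x > c} \<le> measure_pmf.prob (p1 n) {x. lr n x > c}"
    by (rule prob_p1_ge) (use c in auto)
  also have "\<dots> \<le> 1" by simp
  finally show ?thesis using c by (simp add: field_simps)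
qed

text \<open>Under its own numerator law a likelihood ratio is rarely small: on the event the
  \<open>p1\<close>-mass is at most \<open>c\<close> times the \<open>p0\<close>-mass. This controls
  the negative influence of siblings later on.\<close>

lemma prob_p1_lr_lt: "0 \<le> c \<Longrightarrow> measure_pmf.prob (p1 n) {x. lr n x < c} \<le> c"
proof -
  assume c: "0 \<le> c"
  have "measure_pmf.prob (p1 n) {x. lr n x < c} \<le> c * measure_pmf.prob (p0 n) {x. lr n x < c}"
    by (rule prob_p1_le) (use c in auto)
  also have "\<dots> \<le> c" using c by (simp add: mult_left_le)
  finally show ?thesis .
qed

lemma prob_p1_prune2: "m \<le> n \<Longrightarrow> measure_pmf.prob (p1 n) (prune2 m -` A) = measure_pmf.prob (p1 m) A"
  using map_prune2_p1p[of m n lam s] by (metis measure_map_pmf)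

lemma prob_p0_prune2: "m \<le> n \<Longrightarrow> measure_pmf.prob (p0 n) (prune2 m -` A) = measure_pmf.prob (p0 m) A"
  using map_prune2_p0p[of m n lam] by (metis measure_map_pmf)

lemma prob_Int_X2:
  "measure_pmf.prob (p1 n) {x \<in> X2 n. P x} = measure_pmf.prob (p1 n) {x. P x}"
  "measure_pmf.prob (p0 n) {x \<in> X2 n. P x} = measure_pmf.prob (p0 n) {x. P x}"
proof -
  show "measure_pmf.prob (p1 n) {x \<in> X2 n. P x} = measure_pmf.prob (p1 n) {x. P x}"
    using set_p1p by (intro measure_prob_cong_0) (auto simp: set_pmf_eq)
  show "measure_pmf.prob (p0 n) {x \<in> X2 n. P x} = measure_pmf.prob (p0 n) {x. P x}"
    using set_p0p by (intro measure_prob_cong_0) (auto simp: set_pmf_eq)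
qed

section \<open>Tests and likelihood ratio tests\<close>

definition Likelihood_test :: bool where
  "Likelihood_test \<longleftrightarrow> (\<exists>a :: nat \<Rightarrow> real. filterlim a at_top sequentially \<and>
     (\<exists>\<epsilon>>0. eventually (\<lambda>d. \<epsilon> \<le> measure_pmf.prob (p1 d) {x. lr d x > a d}) sequentially))"

text \<open>The vanishing of the \<open>p0\<close>-probabilities is Markov's inequality: they are at
  most \<open>1 / a d\<close>.\<close>

lemma Likelihood_test_iff:
  "(\<exists>a :: nat \<Rightarrow> real. filterlim a at_top sequentially \<and>
      (\<lambda>d. measure (pruned_law (P0 lam) d) {x \<in> X2 d. lr d x > a d}) \<longlonglongrightarrow> 0 \<and>
      liminf (\<lambda>d. ereal (measure (pruned_law (P1 lam s) d) {x \<in> X2 d. lr d x > a d})) > 0)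
    \<longleftrightarrow> Likelihood_test"
proof -
  have "(\<lambda>d. measure_pmf.prob (p0 d) {x. lr d x > a d}) \<longlonglongrightarrow> 0"
    if a: "filterlim a at_top sequentially" for a :: "nat \<Rightarrow> real"
  proof (rule tendsto_sandwich[where f = "\<lambda>_. 0" and h = "\<lambda>d. 1 / a d"])
    show "(\<lambda>d. 1 / a d) \<longlonglongrightarrow> 0" by (rule tendsto_divide_0[OF tendsto_const filterlim_at_top_imp_at_infinity[OF a]])
    have "eventually (\<lambda>d. a d > 0) sequentially" using a by (auto simp: filterlim_at_top_dense)
    then show "eventually (\<lambda>d. measure_pmf.prob (p0 d) {x. lr d x > a d} \<le> 1 / a d) sequentially"
      by eventually_elim (rule prob_p0_lr_gt)
  qed auto
  then show ?thesis
    by (simp add: Likelihood_test_def liminf_ereal_pos_iff measure_pruned_P0 measure_pruned_P1 prob_Int_X2 cong: conj_cong)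
qed

lemma Likelihood_test_imp_Test:
  assumes Likelihood_test
  shows "\<exists>T. one_sided_test (pruned_law (P0 lam)) (pruned_law (P1 lam s)) T"
proof -
  obtain a :: "nat \<Rightarrow> real" where "(\<lambda>d. measure (pruned_law (P0 lam) d) {x \<in> X2 d. lr d x > a d}) \<longlonglongrightarrow> 0"
      "liminf (\<lambda>d. ereal (measure (pruned_law (P1 lam s) d) {x \<in> X2 d. lr d x > a d})) > 0"
    using assms unfolding Likelihood_test_iff[symmetric] by blast
  moreover have "{x \<in> X2 d. (if lr d x > a d then 1 else 0 :: nat) = 1} = {x \<in> X2 d. lr d x > a d}" for d
    by auto
  ultimately have "one_sided_test (pruned_law (P0 lam)) (pruned_law (P1 lam s)) (\<lambda>d x. if lr d x > a d then 1 else 0)"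
    unfolding one_sided_test_def by (intro conjI) auto
  then show ?thesis by blast
qed

lemma Test_imp_Likelihood_test:
  assumes "one_sided_test (pruned_law (P0 lam)) (pruned_law (P1 lam s)) T"
  shows Likelihood_test
proof -
  define b where "b n = measure_pmf.prob (p0 n) {x. T n x = 1}" for n
  have b: "b \<longlonglongrightarrow> 0" and "\<exists>\<epsilon>>0. eventually (\<lambda>d. \<epsilon> \<le> measure_pmf.prob (p1 d) {x. T d x = 1}) sequentially"
    using assms unfolding one_sided_test_def b_def liminf_ereal_pos_iff
    by (simp_all add: measure_pruned_P0 measure_pruned_P1 prob_Int_X2)
  then obtain e where e: "e > 0" "eventually (\<lambda>d. e \<le> measure_pmf.prob (p1 d) {x. T d x = 1}) sequentially" by blast
  define c where "c n = b n + 1 / real (Suc n)" for n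
  \<comment> \<open>With \<open>c\<close> at least the error \<open>b\<close> of the given test, the
    part of its rejection region with ratio at most \<open>a\<close> has \<open>p1\<close>-mass at
    most \<open>a * c = sqrt c\<close>, which vanishes, while \<open>a = 1 / sqrt c\<close>
    diverges. The summand \<open>1 / Suc n\<close> in \<open>c\<close> keeps it positive.\<close>
  define a where "a n = 1 / sqrt (c n)" for n
  have b0: "b n \<ge> 0" for n by (simp add: b_def)
  have cpos: "c n > 0" for n using b0[of n] by (simp add: c_def add_nonneg_pos)
  have clim: "c \<longlonglongrightarrow> 0"
    unfolding c_def using tendsto_add[OF b LIMSEQ_inverse_real_of_nat] by (simp add: inverse_eq_divide)
  have sq: "(\<lambda>n. sqrt (c n)) \<longlonglongrightarrow> 0" using tendsto_real_sqrt[OF clim] by simp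
  have a: "filterlim a at_top sequentially"
    unfolding a_def
  proof (rule filterlim_inverse_at_top[of "\<lambda>n. sqrt (c n)", simplified inverse_eq_divide])
    show "(\<lambda>n. sqrt (c n)) \<longlonglongrightarrow> 0" by (rule sq)
    show "eventually (\<lambda>n. 0 < sqrt (c n)) sequentially" using cpos by simp
  qed
  have "eventually (\<lambda>n. sqrt (c n) < e / 2) sequentially"
    using order_tendstoD(2)[OF sq, of "e / 2"] e by simp
  then have "eventually (\<lambda>d. e / 2 \<le> measure_pmf.prob (p1 d) {x. lr d x > a d}) sequentially"
    using e(2)
  proof eventually_elim
    case (elim n)
    have an: "a n > 0" using cpos[of n] by (simp add: a_def)
    have "measure_pmf.prob (p1 n) ({x. T n x = 1} \<inter> {x. lr n x \<le> a n}) \<le>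
        a n * measure_pmf.prob (p0 n) ({x. T n x = 1} \<inter> {x. lr n x \<le> a n})"
      using an by (intro prob_p1_le) auto
    also have "\<dots> \<le> a n * b n"
      unfolding b_def using an by (intro mult_left_mono measure_pmf.finite_measure_mono) auto
    also have "\<dots> \<le> a n * c n" using an by (intro mult_left_mono) (auto simp: c_def)
    also have "\<dots> = sqrt (c n)" using cpos[of n] by (simp add: a_def real_div_sqrt)
    finally have "measure_pmf.prob (p1 n) ({x. T n x = 1} \<inter> {x. lr n x \<le> a n}) \<le> sqrt (c n)" .
    moreover have "measure_pmf.prob (p1 n) {x. T n x = 1} \<le>
      measure_pmf.prob (p1 n) {x. lr n x > a n} + measure_pmf.prob (p1 n) ({x. T n x = 1} \<inter> {x. lr n x \<le> a n})"
      by (rule order_trans[OF measure_pmf.finite_measure_mono measure_Un_le]) auto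
    ultimately show ?case using elim by linarith
  qed
  then show ?thesis unfolding Likelihood_test_def using a e by (intro exI[of _ a] conjI exI[of _ "e / 2"]) auto
qed

subsection \<open>Uniform integrability\<close>

text \<open>Change of measure: the tail expectation under \<open>p0\<close> in the definition of
  uniform integrability is a tail probability of the ratio under \<open>p1\<close>.\<close>

lemma lr_tail_integral:
  assumes "0 \<le> K"
  shows "(\<integral>\<^sup>+x. ennreal \<bar>lr n (prune2 n x)\<bar> * indicator {x. \<bar>lr n (prune2 n x)\<bar> > K} x \<partial>P0 lam) =
    ennreal (measure_pmf.prob (p1 n) {x. lr n x > K})"
proof -
  have "(\<integral>\<^sup>+x. ennreal \<bar>lr n (prune2 n x)\<bar> * indicator {x. \<bar>lr n (prune2 n x)\<bar> > K} x \<partial>P0 lam) =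
     (\<integral>\<^sup>+x. ennreal (lr n (prune2 n x)) * indicator {x. lr n x > K} (prune2 n x) \<partial>P0 lam)"
    by (intro nn_integral_cong) (simp add: lr_nonneg indicator_def)
  also have "\<dots> = (\<integral>\<^sup>+x. ennreal (lr n x) * indicator {x. lr n x > K} x \<partial>p0 n)"
    by (rule nn_integral_pruned_law(1)[OF sets_P0 distr_P0])
  also have "\<dots> = emeasure (p1 n) {x. lr n x > K}" by (simp add: nn_integral_p1[symmetric])
  finally show ?thesis by (simp add: measure_pmf.emeasure_eq_measure)
qed

lemma measurable_lr: "(\<lambda>x. lr n (prune2 n x)) \<in> borel_measurable (P0 lam)"
proof -
  have "prune2 n \<in> P0 lam \<rightarrow>\<^sub>M count_space UNIV"
    using measurable_prune2_UNIV measurable_cong_sets[OF sets_P0 refl] by blast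
  then show ?thesis by (rule measurable_compose) simp
qed

lemma Likelihood_test_imp_not_UI:
  assumes Likelihood_test
  shows "\<not> uniformly_integrable (P0 lam) (\<lambda>d x. lr d (prune2 d x))"
proof
  let ?f = "\<lambda>K::real. SUP n. \<integral>\<^sup>+x. ennreal \<bar>lr n (prune2 n x)\<bar> * indicator {x. \<bar>lr n (prune2 n x)\<bar> > K} x \<partial>P0 lam"
  assume "uniformly_integrable (P0 lam) (\<lambda>d x. lr d (prune2 d x))"
  then have lim: "(?f \<longlongrightarrow> 0) at_top" by (simp add: uniformly_integrable_def)
  obtain a e where a: "filterlim a at_top sequentially" and e: "e > 0"
    "eventually (\<lambda>d. e \<le> measure_pmf.prob (p1 d) {x. lr d x > a d}) sequentially"
    using assms unfolding Likelihood_test_def by blast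
  have "eventually (\<lambda>K. ?f K < ennreal e) at_top"
    using order_tendstoD(2)[OF lim, of "ennreal e"] e by simp
  then have "eventually (\<lambda>K. ?f K < ennreal e \<and> 0 \<le> K) at_top"
    using eventually_ge_at_top by (rule eventually_conj)
  then obtain K where K: "?f K < ennreal e" "0 \<le> K" by (auto dest!: eventually_happens)
  have "eventually (\<lambda>d. K < a d) sequentially" using a by (auto simp: filterlim_at_top_dense)
  then have "eventually (\<lambda>d. K < a d \<and> e \<le> measure_pmf.prob (p1 d) {x. lr d x > a d}) sequentially"
    using e(2) by (rule eventually_conj)
  then obtain d where d: "K < a d" "e \<le> measure_pmf.prob (p1 d) {x. lr d x > a d}"
    by (auto dest!: eventually_happens)
  have "e \<le> measure_pmf.prob (p1 d) {x. lr d x > K}"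
    using d by (intro order_trans[OF d(2) measure_pmf.finite_measure_mono]) auto
  then have "ennreal e \<le> ennreal (measure_pmf.prob (p1 d) {x. lr d x > K})" by (rule ennreal_leI)
  also have "\<dots> \<le> ?f K" unfolding lr_tail_integral[OF K(2)] by (rule SUP_upper) simp
  finally show False using K by simp
qed

text \<open>Diagonal choice: \<open>a n\<close> is the largest \<open>K\<close> whose property
  already holds for good from \<open>n\<close> on. The cap \<open>K \<le> n\<close> keeps the
  candidate set finite.\<close>

lemma ex_slow_threshold:
  fixes Q :: "nat \<Rightarrow> nat \<Rightarrow> bool"
  assumes ev: "\<And>K. eventually (Q K) sequentially"
  shows "\<exists>a. filterlim a at_top sequentially \<and> eventually (\<lambda>n. Q (a n) n) sequentially"
proof -
  define S where "S n = {K. K \<le> n \<and> (\<forall>n'\<ge>n. Q K n')}" for n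
  define a where "a n = Max (insert 0 (S n))" for n
  have fin: "finite (insert 0 (S n))" for n
    by (rule finite_subset[of _ "{..n}"]) (auto simp: S_def)
  have ge: "eventually (\<lambda>n. K \<in> S n) sequentially" for K
  proof -
    obtain N where "\<forall>n\<ge>N. Q K n" using ev[of K] by (auto simp: eventually_sequentially)
    then show ?thesis unfolding eventually_sequentially
      by (intro exI[of _ "max N K"]) (auto simp: S_def)
  qed
  have "filterlim a at_top sequentially"
    unfolding filterlim_at_top
  proof
    fix K show "eventually (\<lambda>n. K \<le> a n) sequentially"
      using ge[of K] by eventually_elim (auto simp: a_def intro!: Max_ge fin)
  qed
  moreover have "eventually (\<lambda>n. Q (a n) n) sequentially"
    using ge[of 0]
  proof eventually_elim
    case (elim n)
    have "a n \<in> insert 0 (S n)" unfolding a_def by (rule Max_in[OF fin]) simp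
    then have "a n \<in> S n" using elim by auto
    then show ?case by (auto simp: S_def)
  qed
  ultimately show ?thesis by blast
qed

text \<open>The event \<open>lr m > 2 K\<close> seen at a deeper level \<open>n\<close> has small \<open>p0\<close>-probability, so most of
  its \<open>p1\<close>-mass lies in \<open>lr n > K\<close>; this replaces almost sure convergence of the ratio under \<open>p1\<close>.\<close>

lemma prob_lr_gt_persists:
  assumes "m \<le> n" "0 < K"
  shows "measure_pmf.prob (p1 m) {x. lr m x > 2 * K} / 2 \<le> measure_pmf.prob (p1 n) {x. lr n x > K}"
proof -
  let ?q = "measure_pmf.prob (p1 m) {x. lr m x > 2 * K}"
  let ?A = "prune2 m -` {x. lr m x > 2 * K}"
  have p0: "2 * K * measure_pmf.prob (p0 m) {x. lr m x > 2 * K} \<le> ?q"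
    using assms(2) by (intro prob_p1_ge) auto
  have "?q = measure_pmf.prob (p1 n) ?A" by (rule prob_p1_prune2[symmetric, OF assms(1)])
  also have "\<dots> \<le> measure_pmf.prob (p1 n) {x. lr n x > K} + measure_pmf.prob (p1 n) (?A \<inter> {x. lr n x \<le> K})"
    by (rule order_trans[OF measure_pmf.finite_measure_mono measure_Un_le]) auto
  also have "measure_pmf.prob (p1 n) (?A \<inter> {x. lr n x \<le> K}) \<le> K * measure_pmf.prob (p0 n) (?A \<inter> {x. lr n x \<le> K})"
    using assms(2) by (intro prob_p1_le) auto
  also have "\<dots> \<le> K * measure_pmf.prob (p0 n) ?A"
    using assms(2) by (intro mult_left_mono measure_pmf.finite_measure_mono) auto
  also have "measure_pmf.prob (p0 n) ?A = measure_pmf.prob (p0 m) {x. lr m x > 2 * K}"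
    by (rule prob_p0_prune2[OF assms(1)])
  finally show ?thesis using p0 by simp
qed

lemma not_UI_imp_Likelihood_test:
  assumes "\<not> uniformly_integrable (P0 lam) (\<lambda>d x. lr d (prune2 d x))"
  shows Likelihood_test
proof -
  let ?f = "\<lambda>K::real. SUP n. \<integral>\<^sup>+x. ennreal \<bar>lr n (prune2 n x)\<bar> * indicator {x. \<bar>lr n (prune2 n x)\<bar> > K} x \<partial>P0 lam"
  have nlim: "\<not> (?f \<longlongrightarrow> 0) at_top"
    using assms measurable_lr by (simp add: uniformly_integrable_def)
  \<comment> \<open>The tail function is decreasing in \<open>K\<close>, so failure to converge to
    \<open>0\<close> means a lower bound valid for all \<open>K\<close> at once.\<close>
  have "\<exists>e>0. \<forall>K\<ge>0. ?f K \<ge> ennreal e"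
  proof (rule ccontr)
    assume neg: "\<not> (\<exists>e>0. \<forall>K\<ge>0. ?f K \<ge> ennreal e)"
    have "(?f \<longlongrightarrow> 0) at_top"
    proof (rule order_tendstoI)
      fix y :: ennreal assume "0 < y"
      then obtain e where e: "0 < e" "ennreal e < y"
      proof (cases y)
        case (real r)
        then show ?thesis using \<open>0 < y\<close> by (intro that[of "r / 2"]) (auto simp: ennreal_lessI)
      next
        case top
        then show ?thesis by (intro that[of 1]) auto
      qed
      with neg obtain K where K: "K \<ge> 0" "?f K < ennreal e" by (auto simp: not_le)
      show "eventually (\<lambda>K. ?f K < y) at_top"
        using eventually_ge_at_top[of K]
      proof eventually_elim
        case (elim K')
        have "?f K' \<le> ?f K"
          using elim K(1) unfolding lr_tail_integral[OF K(1)] lr_tail_integral[OF order_trans[OF K(1) elim]]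
          by (intro SUP_mono' ennreal_leI measure_pmf.finite_measure_mono) auto
        then show ?case using K e by order
      qed
    qed simp
    then show False using nlim by contradiction
  qed
  then obtain e where e: "e > 0" "\<And>K. K \<ge> 0 \<Longrightarrow> ?f K \<ge> ennreal e" by blast
  have ev: "eventually (\<lambda>n. e / 4 \<le> measure_pmf.prob (p1 n) {x. lr n x > real K}) sequentially" for K
  proof -
    \<comment> \<open>The shift by \<open>1\<close> supplies the positive level that
      \<open>prob_lr_gt_persists\<close> asks for, also when \<open>K = 0\<close>.\<close>
    let ?K = "real K + 1"
    have "ennreal (e / 2) < ennreal e" using e(1) by (simp add: ennreal_lessI)
    also have "ennreal e \<le> ?f (2 * ?K)" by (rule e(2)) simp
    also have "?f (2 * ?K) = (SUP n. ennreal (measure_pmf.prob (p1 n) {x. lr n x > 2 * ?K}))"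
      by (intro SUP_cong refl lr_tail_integral) simp
    finally obtain m where "ennreal (e / 2) < ennreal (measure_pmf.prob (p1 m) {x. lr m x > 2 * ?K})"
      unfolding less_SUP_iff by blast
    then have m: "e / 2 < measure_pmf.prob (p1 m) {x. lr m x > 2 * ?K}"
      using e(1) by (simp add: ennreal_less_iff)
    show ?thesis
      using eventually_ge_at_top[of m]
    proof eventually_elim
      case (elim n)
      have "measure_pmf.prob (p1 m) {x. lr m x > 2 * ?K} / 2 \<le> measure_pmf.prob (p1 n) {x. lr n x > ?K}"
        using elim by (intro prob_lr_gt_persists) auto
      also have "\<dots> \<le> measure_pmf.prob (p1 n) {x. lr n x > real K}"
        by (intro measure_pmf.finite_measure_mono) auto
      finally show ?case using m by linarith
    qed
  qed
  from ex_slow_threshold[of "\<lambda>K n. e / 4 \<le> measure_pmf.prob (p1 n) {x. lr n x > real K}", OF ev]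
  obtain a where "filterlim a at_top sequentially"
    "eventually (\<lambda>n. e / 4 \<le> measure_pmf.prob (p1 n) {x. lr n x > real (a n)}) sequentially" by blast
  then show ?thesis
    unfolding Likelihood_test_def using e(1)
    by (intro exI[of _ "\<lambda>n. real (a n)"] conjI exI[of _ "e / 4"])
       (auto intro: filterlim_compose[OF filterlim_real_sequentially])
qed

section \<open>The martingale property of the likelihood ratio\<close>

lemma sets_pruned_filtration:
  "sets (pruned_filtration d) = {prune2 d -` A \<inter> (ltrees \<times> ltrees) | A. A \<subseteq> X2 d}"
  unfolding pruned_filtration_def by (subst sets_vimage_algebra2) (use prune2_in in auto)

lemma space_pruned_filtration [simp]: "space (pruned_filtration d) = ltrees \<times> ltrees"
  by (simp add: pruned_filtration_def)

lemma integral_lr_indicator: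
  "(\<integral>x. lr n x * indicator B x \<partial>p0 n) = measure_pmf.prob (p1 n) B"
  "integrable (p0 n) (lr n)"
proof -
  have "(\<integral>\<^sup>+x. ennreal (lr n x) * 1 \<partial>p0 n) = 1"
    by (subst nn_integral_p1[symmetric]) (simp add: measure_pmf.emeasure_space_1[simplified])
  then show "integrable (p0 n) (lr n)"
    by (intro integrableI_nonneg) (auto simp: lr_nonneg)
  have "(\<integral>\<^sup>+x. ennreal (lr n x * indicator B x) \<partial>p0 n) = (\<integral>\<^sup>+x. ennreal (lr n x) * indicator B x \<partial>p0 n)"
    by (intro nn_integral_cong) (auto simp: indicator_def)
  also have "\<dots> = ennreal (measure_pmf.prob (p1 n) B)"
    by (subst nn_integral_p1[symmetric]) (simp add: measure_pmf.emeasure_eq_measure)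
  finally show "(\<integral>x. lr n x * indicator B x \<partial>p0 n) = measure_pmf.prob (p1 n) B"
    by (subst integral_eq_nn_integral) (auto simp: lr_nonneg)
qed

text \<open>Integrated over an event of depth \<open>m\<close>, the ratio at any depth
  \<open>k \<ge> m\<close> gives the \<open>p1\<close>-probability of that event, which does not
  depend on \<open>k\<close> by consistency.\<close>

lemma martingale_lr: "martingale (P0 lam) pruned_filtration (\<lambda>d x. lr d (prune2 d x))"
proof -
  have mono: "sets (pruned_filtration i) \<subseteq> sets (pruned_filtration j)" if "i \<le> j" for i j
  proof
    fix C assume "C \<in> sets (pruned_filtration i)"
    then obtain A where A: "C = prune2 i -` A \<inter> (ltrees \<times> ltrees)" by (auto simp: sets_pruned_filtration)
    have "C = prune2 j -` (prune2 i -` A \<inter> X2 j) \<inter> (ltrees \<times> ltrees)"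
    proof (rule set_eqI)
      fix x show "x \<in> C \<longleftrightarrow> x \<in> prune2 j -` (prune2 i -` A \<inter> X2 j) \<inter> (ltrees \<times> ltrees)"
        unfolding A Int_iff vimage_eq prune2_prune2[OF that] using prune2_in[of x j] by blast
    qed
    then show "C \<in> sets (pruned_filtration j)" unfolding sets_pruned_filtration by blast
  qed
  have sub: "subalgebra (P0 lam) (pruned_filtration n)" for n
    unfolding subalgebra_def
  proof (intro conjI subsetI)
    fix C assume "C \<in> sets (pruned_filtration n)"
    then obtain A where A: "C = prune2 n -` A \<inter> space (tree_space \<Otimes>\<^sub>M tree_space)"
      by (auto simp: sets_pruned_filtration space_pair_measure)
    show "C \<in> sets (P0 lam)" unfolding A sets_P0 by (rule measurable_sets[OF measurable_prune2_UNIV]) simp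
  qed simp
  have meas: "(\<lambda>x. lr n (prune2 n x)) \<in> borel_measurable (pruned_filtration n)" for n
    unfolding pruned_filtration_def
    by (rule measurable_compose[OF measurable_vimage_algebra1]) (use prune2_in in auto)
  have int: "integrable (P0 lam) (\<lambda>x. lr n (prune2 n x))" for n
    using integral_pruned_law(3)[OF sets_P0 distr_P0] integral_lr_indicator(2) by blast
  have ce: "AE x in P0 lam. real_cond_exp (P0 lam) (pruned_filtration m) (\<lambda>x. lr n (prune2 n x)) x = lr m (prune2 m x)"
    if "m \<le> n" for m n
  proof -
    interpret P: prob_space "P0 lam" by (rule prob_space_P0)
    interpret finite_measure_subalgebra "P0 lam" "pruned_filtration m"
      by unfold_locales (rule sub)
    show ?thesis
    proof (rule real_cond_exp_charact[OF _ int int meas])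
      fix C assume "C \<in> sets (pruned_filtration m)"
      then obtain A where A: "C = prune2 m -` A \<inter> (ltrees \<times> ltrees)" by (auto simp: sets_pruned_filtration)
      have eq: "(\<integral>x\<in>C. lr k (prune2 k x) \<partial>P0 lam) = measure_pmf.prob (p1 m) A" if "m \<le> k" for k
      proof -
        have "(\<integral>x\<in>C. lr k (prune2 k x) \<partial>P0 lam) =
            (\<integral>x. lr k (prune2 k x) * indicator (prune2 m -` A) (prune2 k x) \<partial>P0 lam)"
          unfolding set_lebesgue_integral_def A
          by (intro Bochner_Integration.integral_cong) (auto simp: indicator_def prune2_prune2[OF that])
        also have "\<dots> = (\<integral>x. lr k x * indicator (prune2 m -` A) x \<partial>p0 k)"
          by (rule integral_pruned_law(1)[OF sets_P0 distr_P0])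
        finally show ?thesis using that by (simp add: integral_lr_indicator prob_p1_prune2)
      qed
      show "(\<integral>x\<in>C. lr n (prune2 n x) \<partial>P0 lam) = (\<integral>x\<in>C. lr m (prune2 m x) \<partial>P0 lam)"
        using eq[OF that] eq[OF order_refl] by simp
    qed
  qed
  show ?thesis
    unfolding martingale_def using mono sub meas int ce by (auto intro!: filtration.intro)
qed

section \<open>Relative entropy as the mean log-ratio under the correlated law\<close>

lemma KL_eq: "KL lam s d = (\<integral>x. ln (lr d x) \<partial>p1 d)"
proof -
  let ?M = "pruned_law (P0 lam) d" and ?N = "pruned_law (P1 lam s) d"
  have sM: "sets ?M = Pow (X2 d)" "sets ?N = Pow (X2 d)" by (simp_all add: pruned_law_def)
  have spM: "space ?M = X2 d" by (simp add: pruned_law_def)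
  have m: "f \<in> borel_measurable ?M" for f :: "ltree \<times> ltree \<Rightarrow> 'b :: topological_space"
    by (auto simp: measurable_def sM spM)
  interpret P: prob_space ?M
    unfolding pruned_law_def using measurable_prune2 measurable_cong_sets[OF sets_P0 refl]
    by (intro prob_space.prob_space_distr prob_space_P0) blast
  have "?N = density ?M (\<lambda>x. ennreal (lr d x))"
  proof (rule measure_eqI)
    fix A assume A: "A \<in> sets ?N"
    have "emeasure ?N A = (\<integral>\<^sup>+x. indicator A x \<partial>?N)" using A by simp
    also have "\<dots> = (\<integral>\<^sup>+x. indicator A x \<partial>p1 d)" by (rule nn_integral_pruned_law(2)[OF sets_P1 distr_P1])
    also have "\<dots> = (\<integral>\<^sup>+x. ennreal (lr d x) * indicator A x \<partial>p0 d)" by (rule nn_integral_p1)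
    also have "\<dots> = (\<integral>\<^sup>+x. ennreal (lr d x) * indicator A x \<partial>?M)"
      by (rule nn_integral_pruned_law(2)[OF sets_P0 distr_P0, symmetric])
    also have "\<dots> = emeasure (density ?M (\<lambda>x. ennreal (lr d x))) A"
      using A sM by (subst emeasure_density) (auto simp: m)
    finally show "emeasure ?N A = emeasure (density ?M (\<lambda>x. ennreal (lr d x))) A" .
  qed (simp add: sM)
  then have "KL lam s d = (\<integral>x. lr d x * log (exp 1) (lr d x) \<partial>?M)"
    unfolding KL_def by (simp only:) (intro P.KL_density m, auto simp: lr_nonneg)
  also have "\<dots> = (\<integral>x. lr d x * ln (lr d x) \<partial>p0 d)"
    by (simp add: log_def integral_pruned_law(2)[OF sets_P0 distr_P0])
  also have "\<dots> = (\<integral>x. ln (lr d x) \<partial>p1 d)"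
    unfolding p1_density by (subst integral_real_density) (auto simp: lr_nonneg)
  finally show ?thesis .
qed

end

section \<open>Second moments of branching sums\<close>

lemma pmf_bind_ge: "pmf p x * pmf (f x) y \<le> pmf (p \<bind> f) y"
proof -
  have "ennreal (pmf p x * pmf (f x) y) = (\<integral>\<^sup>+z. ennreal (pmf (f x) y) * indicator {x} z \<partial>p)"
    by (simp add: nn_integral_cmult_indicator emeasure_pmf_single ennreal_mult' mult.commute)
  also have "\<dots> \<le> (\<integral>\<^sup>+z. ennreal (pmf (f z) y) \<partial>p)"
    by (intro nn_integral_mono) (auto simp: indicator_def)
  finally show ?thesis by (simp add: ennreal_pmf_bind[symmetric])
qed

lemma integrable_pmf_indicator: "integrable (measure_pmf p) (indicator A :: _ \<Rightarrow> real)"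
  by (rule integrable_real_indicator) (auto simp: measure_pmf.emeasure_eq_measure)

text \<open>Mean zero and variance at most \<open>v\<close>. Square integrability is part of it so
  that the zero integral is a genuine mean and not the default value of the Bochner
  integral.\<close>

definition centred :: "'a pmf \<Rightarrow> ('a \<Rightarrow> real) \<Rightarrow> real \<Rightarrow> bool" where
  "centred p f v \<longleftrightarrow> integrable p (\<lambda>x. (f x)\<^sup>2) \<and> (\<integral>x. f x \<partial>p) = 0 \<and> (\<integral>x. (f x)\<^sup>2 \<partial>p) \<le> v"

lemma centred_map_cong:
  assumes "map_pmf F p = map_pmf X q" "centred q X v" shows "centred p F v"
proof -
  have *: "integrable p (\<lambda>x. h (F x)) \<longleftrightarrow> integrable q (\<lambda>x. h (X x))" "(\<integral>x. h (F x) \<partial>p) = (\<integral>x. h (X x) \<partial>q)"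
    for h :: "real \<Rightarrow> real"
    using integrable_map_pmf_eq[of F p h] integrable_map_pmf_eq[of X q h]
      integral_map_pmf[of F p h] integral_map_pmf[of X q h] assms(1) by auto
  show ?thesis using assms(2) *[of "\<lambda>x. x\<^sup>2"] *[of "\<lambda>x. x"] by (simp add: centred_def)
qed

lemma integrable_of_square:
  assumes "integrable (measure_pmf p) (\<lambda>x. (f x)\<^sup>2 :: real)" shows "integrable (measure_pmf p) f"
proof (rule Bochner_Integration.integrable_bound)
  show "integrable (measure_pmf p) (\<lambda>x. 1 + (f x)\<^sup>2)" using assms by simp
  have "\<bar>y\<bar> \<le> 1 + y\<^sup>2" for y :: real
  proof -
    have "0 \<le> (\<bar>y\<bar> - 1)\<^sup>2 + \<bar>y\<bar>" by simp
    then show ?thesis by (simp add: power2_eq_square algebra_simps)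
  qed
  then show "AE x in measure_pmf p. norm (f x) \<le> norm (1 + (f x)\<^sup>2)" by simp
qed simp

lemma integral_shift_square:
  assumes "integrable (measure_pmf p) (\<lambda>x. (f x)\<^sup>2 :: real)"
  shows "integrable (measure_pmf p) (\<lambda>x. (\<alpha> + f x)\<^sup>2)"
    "(\<integral>x. (\<alpha> + f x)\<^sup>2 \<partial>p) = \<alpha>\<^sup>2 + 2 * \<alpha> * (\<integral>x. f x \<partial>p) + (\<integral>x. (f x)\<^sup>2 \<partial>p)"
proof -
  note int = integrable_of_square[OF assms]
  have eq: "(\<lambda>x. (\<alpha> + f x)\<^sup>2) = (\<lambda>x. \<alpha>\<^sup>2 + (2 * \<alpha> * f x + (f x)\<^sup>2))"
    by (auto simp: power2_eq_square algebra_simps)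
  show "integrable (measure_pmf p) (\<lambda>x. (\<alpha> + f x)\<^sup>2)" unfolding eq using assms int by simp
  show "(\<integral>x. (\<alpha> + f x)\<^sup>2 \<partial>p) = \<alpha>\<^sup>2 + 2 * \<alpha> * (\<integral>x. f x \<partial>p) + (\<integral>x. (f x)\<^sup>2 \<partial>p)"
    unfolding eq using assms int by simp
qed

text \<open>The offset \<alpha> is arbitrary so that, in the induction, the value at the inserted
  coordinate can be absorbed into it; the cross terms vanish because \<open>f\<close> has mean
  zero.\<close>

lemma Pi_pmf_square_sum:
  assumes f: "integrable (measure_pmf p) (\<lambda>x. (f x)\<^sup>2 :: real)" "(\<integral>x. f x \<partial>p) = 0" and "finite I"
  shows "(\<integral>\<^sup>+G. ennreal ((\<alpha> + (\<Sum>i\<in>I. f (G i)))\<^sup>2) \<partial>Pi_pmf I d (\<lambda>_. p)) =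
    ennreal (\<alpha>\<^sup>2 + real (card I) * (\<integral>x. (f x)\<^sup>2 \<partial>p))"
  using assms(3)
proof (induction I arbitrary: \<alpha> rule: finite_induct)
  case empty show ?case by simp
next
  case (insert i I)
  let ?v = "\<integral>x. (f x)\<^sup>2 \<partial>p"
  have v: "0 \<le> ?v" by simp
  have upd: "(\<Sum>j\<in>I. f (if j = i then y else G j)) = (\<Sum>j\<in>I. f (G j))" for G y
    using insert.hyps by (intro sum.cong) auto
  have "(\<integral>\<^sup>+G. ennreal ((\<alpha> + (\<Sum>j\<in>insert i I. f (G j)))\<^sup>2) \<partial>Pi_pmf (insert i I) d (\<lambda>_. p)) =
    (\<integral>\<^sup>+y. \<integral>\<^sup>+G. ennreal ((\<alpha> + f y + (\<Sum>j\<in>I. f (G j)))\<^sup>2) \<partial>Pi_pmf I d (\<lambda>_. p) \<partial>p)"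
    using insert.hyps by (simp add: Pi_pmf_insert' upd add.assoc)
  also have "\<dots> = (\<integral>\<^sup>+y. ennreal ((\<alpha> + f y)\<^sup>2 + real (card I) * ?v) \<partial>p)"
    by (simp only: insert.IH)
  also have "\<dots> = ennreal (\<integral>y. (\<alpha> + f y)\<^sup>2 + real (card I) * ?v \<partial>p)"
    using integral_shift_square(1)[OF f(1)] v by (intro nn_integral_eq_integral) auto
  also have "(\<integral>y. (\<alpha> + f y)\<^sup>2 + real (card I) * ?v \<partial>p) = \<alpha>\<^sup>2 + real (card (insert i I)) * ?v"
    using integral_shift_square[OF f(1), of \<alpha>] f(2) insert.hyps by (simp add: algebra_simps)
  finally show ?case .
qed

text \<open>One generation of branching: a root mark \<open>r\<close> and, independently given
  \<open>r\<close>, \<open>\<kappa> r\<close> copies of \<open>p\<close>.\<close>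

definition branch :: "'r pmf \<Rightarrow> ('r \<Rightarrow> nat) \<Rightarrow> 's \<Rightarrow> 's pmf \<Rightarrow> ('r \<times> (nat \<Rightarrow> 's)) pmf" where
  "branch \<rho> \<kappa> d p = \<rho> \<bind> (\<lambda>r. map_pmf (Pair r) (Pi_pmf {1..\<kappa> r} d (\<lambda>_. p)))"

lemma branch_square_sum:
  assumes f: "integrable (measure_pmf p) (\<lambda>x. (f x)\<^sup>2 :: real)" "(\<integral>x. f x \<partial>p) = 0"
    and A: "integrable (measure_pmf \<rho>) (\<lambda>r. (A r)\<^sup>2)" and \<kappa>: "integrable (measure_pmf \<rho>) (\<lambda>r. real (\<kappa> r))"
  shows "integrable (branch \<rho> \<kappa> d p) (\<lambda>(r, G). (A r + (\<Sum>i\<in>{1..\<kappa> r}. f (G i)))\<^sup>2)" (is "integrable ?J ?X")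
    and "(\<integral>y. (case y of (r, G) \<Rightarrow> (A r + (\<Sum>i\<in>{1..\<kappa> r}. f (G i)))\<^sup>2) \<partial>branch \<rho> \<kappa> d p) =
      (\<integral>r. (A r)\<^sup>2 \<partial>\<rho>) + (\<integral>r. real (\<kappa> r) \<partial>\<rho>) * (\<integral>x. (f x)\<^sup>2 \<partial>p)"
proof -
  let ?v = "\<integral>x. (f x)\<^sup>2 \<partial>p"
  have "(\<integral>\<^sup>+y. ennreal (?X y) \<partial>?J) = (\<integral>\<^sup>+r. ennreal ((A r)\<^sup>2 + real (\<kappa> r) * ?v) \<partial>\<rho>)"
    by (simp add: branch_def Pi_pmf_square_sum[OF f])
  also have "\<dots> = ennreal (\<integral>r. (A r)\<^sup>2 + real (\<kappa> r) * ?v \<partial>\<rho>)"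
    using A \<kappa> by (intro nn_integral_eq_integral) auto
  also have "(\<integral>r. (A r)\<^sup>2 + real (\<kappa> r) * ?v \<partial>\<rho>) = (\<integral>r. (A r)\<^sup>2 \<partial>\<rho>) + (\<integral>r. real (\<kappa> r) \<partial>\<rho>) * ?v"
    using A \<kappa> by simp
  finally have eq: "(\<integral>\<^sup>+y. ennreal (?X y) \<partial>?J) = ennreal ((\<integral>r. (A r)\<^sup>2 \<partial>\<rho>) + (\<integral>r. real (\<kappa> r) \<partial>\<rho>) * ?v)" .
  then show int: "integrable ?J ?X" by (intro integrableI_nonneg) auto
  have "(\<integral>\<^sup>+y. ennreal (?X y) \<partial>?J) = ennreal (\<integral>y. ?X y \<partial>?J)"
    by (rule nn_integral_eq_integral[OF int]) auto
  from trans[OF this[symmetric] eq]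
  have "ennreal (\<integral>y. ?X y \<partial>?J) = ennreal ((\<integral>r. (A r)\<^sup>2 \<partial>\<rho>) + (\<integral>r. real (\<kappa> r) \<partial>\<rho>) * ?v)" .
  moreover have "0 \<le> (\<integral>y. ?X y \<partial>?J)" by (rule integral_nonneg_AE) auto
  moreover have "0 \<le> (\<integral>r. (A r)\<^sup>2 \<partial>\<rho>) + (\<integral>r. real (\<kappa> r) \<partial>\<rho>) * ?v" by simp
  ultimately show "(\<integral>y. ?X y \<partial>?J) = (\<integral>r. (A r)\<^sup>2 \<partial>\<rho>) + (\<integral>r. real (\<kappa> r) \<partial>\<rho>) * ?v"
    by (rule ennreal_inj[THEN iffD1, rotated 2])
qed

lemma centred_branch:
  assumes f: "centred p f v" and A: "centred \<rho> A w" and \<kappa>: "integrable (measure_pmf \<rho>) (\<lambda>r. real (\<kappa> r))"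
  shows "centred (branch \<rho> \<kappa> d p) (\<lambda>(r, G). A r + (\<Sum>i\<in>{1..\<kappa> r}. f (G i))) (w + (\<integral>r. real (\<kappa> r) \<partial>\<rho>) * v)"
proof -
  let ?X = "\<lambda>(r, G). A r + (\<Sum>i\<in>{1..\<kappa> r}. f (G i))"
  let ?J = "branch \<rho> \<kappa> d p"
  from f have f': "integrable p (\<lambda>x. (f x)\<^sup>2)" "(\<integral>x. f x \<partial>p) = 0" "(\<integral>x. (f x)\<^sup>2 \<partial>p) \<le> v" by (auto simp: centred_def)
  from A have A': "integrable \<rho> (\<lambda>x. (A x)\<^sup>2)" "(\<integral>x. A x \<partial>\<rho>) = 0" "(\<integral>x. (A x)\<^sup>2 \<partial>\<rho>) \<le> w" by (auto simp: centred_def)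
  have s: "(case y of (r, G) \<Rightarrow> (A r + (\<Sum>i\<in>{1..\<kappa> r}. f (G i)))\<^sup>2) = (?X y)\<^sup>2"
     "(case y of (r, G) \<Rightarrow> (1 + A r + (\<Sum>i\<in>{1..\<kappa> r}. f (G i)))\<^sup>2) = (1 + ?X y)\<^sup>2" for y
    by (auto split: prod.splits simp: add.assoc)
  note b0 = branch_square_sum[OF f'(1,2) A'(1) \<kappa>, of d, unfolded s]
  \<comment> \<open>The mean of \<open>?X\<close> is extracted from second moments: those of
    \<open>1 + ?X\<close> and \<open>?X\<close> differ by 1 plus twice the mean, and the formula for
    shifted root terms shows that the difference is 1.\<close>
  note b1 = branch_square_sum[OF f'(1,2) integral_shift_square(1)[OF A'(1), of 1] \<kappa>, of d, unfolded s]
  have "(\<integral>y. (1 + ?X y)\<^sup>2 \<partial>?J) = 1 + 2 * (\<integral>y. ?X y \<partial>?J) + (\<integral>y. (?X y)\<^sup>2 \<partial>?J)"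
    using integral_shift_square(2)[OF b0(1), of 1] by simp
  moreover have "(\<integral>y. (1 + ?X y)\<^sup>2 \<partial>?J) = 1 + (\<integral>y. (?X y)\<^sup>2 \<partial>?J)"
    unfolding b1(2) b0(2) integral_shift_square(2)[OF A'(1)] using A'(2) by simp
  ultimately have "(\<integral>y. ?X y \<partial>?J) = 0" by simp
  moreover have "(\<integral>r. real (\<kappa> r) \<partial>\<rho>) * (\<integral>x. (f x)\<^sup>2 \<partial>p) \<le> (\<integral>r. real (\<kappa> r) \<partial>\<rho>) * v"
    using f'(3) by (intro mult_left_mono) auto
  ultimately show ?thesis unfolding centred_def using b0 A'(3) by auto
qed

text \<open>A Paley-Zygmund bound. Where \<open>X\<close> reaches \<open>m / 2\<close>, it is at
  most \<open>e / 2 * X^2 + 1 / (2 * e)\<close> by the arithmetic-geometric mean inequality;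
  integrating this bounds the probability from below.\<close>

lemma prob_large_of_second_moment:
  assumes X: "integrable (measure_pmf p) (\<lambda>x. (X x)\<^sup>2 :: real)"
    and m: "m \<le> (\<integral>x. X x \<partial>p)" "0 < m" and V: "(\<integral>x. (X x)\<^sup>2 \<partial>p) \<le> V"
  shows "m\<^sup>2 / (4 * V) \<le> measure_pmf.prob p {x. X x \<ge> m / 2}"
proof -
  let ?P = "measure_pmf.prob p {x. X x \<ge> m / 2}"
  note X1 = integrable_of_square[OF X]
  have sq: "(\<integral>x. X x \<partial>p)\<^sup>2 \<le> (\<integral>x. (X x)\<^sup>2 \<partial>p)"
  proof -
    have "0 \<le> (\<integral>x. (- (\<integral>x. X x \<partial>p) + X x)\<^sup>2 \<partial>p)" by simp
    also have "\<dots> = (\<integral>x. (X x)\<^sup>2 \<partial>p) - (\<integral>x. X x \<partial>p)\<^sup>2"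
      unfolding integral_shift_square(2)[OF X] by (simp add: power2_eq_square)
    finally show ?thesis by simp
  qed
  have "0 < (\<integral>x. X x \<partial>p)" using m by linarith
  then have Vpos: "0 < V" using sq V by (smt (verit) zero_less_power)
  \<comment> \<open>Makes \<open>e / 2 * V\<close> equal to \<open>m / 4\<close>, half of what
    remains of \<open>m\<close> after the part below \<open>m / 2\<close>.\<close>
  define e where "e = m / (2 * V)"
  have e: "e > 0" using m Vpos by (simp add: e_def)
  have "X x \<le> m / 2 + (e / 2 * (X x)\<^sup>2 + 1 / (2 * e) * indicator {x. X x \<ge> m / 2} x)" for x
  proof (cases "X x \<ge> m / 2")
    case True
    have "0 \<le> (e * X x - 1)\<^sup>2 / (2 * e)" using e by simp
    also have "\<dots> = e / 2 * (X x)\<^sup>2 - X x + 1 / (2 * e)"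
      using e by (simp add: power2_eq_square field_simps)
    finally have "X x \<le> e / 2 * (X x)\<^sup>2 + 1 / (2 * e)" by simp
    then show ?thesis using True m by simp
  next
    case False
    moreover have "0 \<le> e / 2 * (X x)\<^sup>2" using e by simp
    ultimately show ?thesis by simp
  qed
  then have "(\<integral>x. X x \<partial>p) \<le> (\<integral>x. m / 2 + (e / 2 * (X x)\<^sup>2 + 1 / (2 * e) * indicator {x. X x \<ge> m / 2} x) \<partial>p)"
    using X X1 integrable_pmf_indicator[of p "{x. X x \<ge> m / 2}"] by (intro integral_mono) auto
  also have "\<dots> = m / 2 + (e / 2 * (\<integral>x. (X x)\<^sup>2 \<partial>p) + 1 / (2 * e) * ?P)"
    using X integrable_pmf_indicator[of p "{x. X x \<ge> m / 2}"] by simp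
  also have "\<dots> \<le> m / 2 + (e / 2 * V + 1 / (2 * e) * ?P)"
    using V e by (intro add_left_mono add_right_mono mult_left_mono) auto
  finally have "m \<le> m / 2 + (e / 2 * V + 1 / (2 * e) * ?P)" using m by linarith
  then have "m / 4 \<le> V / m * ?P"
    using Vpos m(2) by (simp add: e_def field_simps)
  then show ?thesis using Vpos m(2) by (simp add: field_simps power2_eq_square)
qed

text \<open>Chebyshev's inequality.\<close>

lemma prob_large_centred:
  assumes "centred p R v" "0 < c"
  shows "measure_pmf.prob p {x. \<bar>R x\<bar> > c} \<le> v / c\<^sup>2"
proof -
  have R: "integrable p (\<lambda>x. (R x)\<^sup>2)" "(\<integral>x. (R x)\<^sup>2 \<partial>p) \<le> v" using assms(1) by (auto simp: centred_def)
  have "c\<^sup>2 * indicator {x. \<bar>R x\<bar> > c} x \<le> (R x)\<^sup>2" for x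
    using assms(2) by (auto simp: indicator_def abs_le_square_iff[symmetric])
  then have "(\<integral>x. c\<^sup>2 * indicator {x. \<bar>R x\<bar> > c} x \<partial>p) \<le> (\<integral>x. (R x)\<^sup>2 \<partial>p)"
    using R integrable_pmf_indicator by (intro integral_mono) auto
  then have "c\<^sup>2 * measure_pmf.prob p {x. \<bar>R x\<bar> > c} \<le> v" using R by simp
  then show ?thesis using assms(2) by (simp add: field_simps)
qed

section \<open>Poisson moments\<close>

lemma integrable_Poisson_exp:
  assumes "0 \<le> \<mu>" shows "integrable (Poisson \<mu>) (\<lambda>k. exp (c * real k))"
proof -
  have sm: "summable (\<lambda>k. exp (- \<mu>) * ((\<mu> * exp c) ^ k / fact k))"
    using summable_exp[of "\<mu> * exp c"] by (intro summable_mult) (simp add: divide_inverse mult.commute)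
  have "(\<integral>\<^sup>+k. ennreal (exp (c * real k)) \<partial>Poisson \<mu>) =
    (\<integral>\<^sup>+k. ennreal (exp (- \<mu>) * ((\<mu> * exp c) ^ k / fact k)) \<partial>count_space UNIV)"
    unfolding nn_integral_measure_pmf using assms
    by (intro nn_integral_cong)
       (simp add: pmf_Poisson ennreal_mult'[symmetric] power_mult_distrib exp_of_nat_mult[symmetric] mult.commute)
  also have "\<dots> = ennreal (\<Sum>k. exp (- \<mu>) * ((\<mu> * exp c) ^ k / fact k))"
    using sm assms by (subst nn_integral_count_space_nat) (auto intro!: suminf_ennreal2)
  finally show ?thesis by (intro integrableI_nonneg) auto
qed

lemma Poisson_pgf:
  assumes "0 \<le> \<mu>" and that: "0 \<le> z"
  shows "(\<integral>k. z ^ k \<partial>Poisson \<mu>) = exp (\<mu> * (z - 1))"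
proof -
  have "(\<lambda>k. exp (- \<mu>) * ((\<mu> * z) ^ k /\<^sub>R fact k)) sums (exp (- \<mu>) * exp (\<mu> * z))"
    by (intro sums_mult exp_converges)
  then have s: "(\<lambda>k. exp (- \<mu>) * ((\<mu> * z) ^ k / fact k)) sums exp (\<mu> * (z - 1))"
    by (simp add: exp_add[symmetric] algebra_simps divide_inverse)
  have "(\<integral>\<^sup>+k. ennreal (z ^ k) \<partial>Poisson \<mu>) =
    (\<integral>\<^sup>+k. ennreal (exp (- \<mu>) * ((\<mu> * z) ^ k / fact k)) \<partial>count_space UNIV)"
    unfolding nn_integral_measure_pmf using assms that
    by (intro nn_integral_cong) (simp add: pmf_Poisson ennreal_mult'[symmetric] power_mult_distrib mult.commute)
  also have "\<dots> = ennreal (exp (\<mu> * (z - 1)))"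
    unfolding nn_integral_count_space_nat using s assms that sums_unique[OF s] sums_summable[OF s]
    by (subst suminf_ennreal2) auto
  finally show ?thesis using that by (subst integral_eq_nn_integral) auto
qed

lemma Poisson_mean:
  assumes "0 \<le> \<mu>" shows "integrable (Poisson \<mu>) real" "(\<integral>k. real k \<partial>Poisson \<mu>) = \<mu>"
proof -
  have bd: "real k \<le> exp (real k)" for k using exp_ge_add_one_self[of "real k"] by linarith
  show int: "integrable (Poisson \<mu>) real"
    by (rule Bochner_Integration.integrable_bound[OF integrable_Poisson_exp[OF assms, of 1]]) (use bd in auto)
  have "(\<lambda>k. exp (- \<mu>) * \<mu> * (\<mu> ^ k /\<^sub>R fact k)) sums (exp (- \<mu>) * \<mu> * exp \<mu>)"
    by (intro sums_mult exp_converges)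
  moreover have "exp (- \<mu>) * \<mu> * (\<mu> ^ k /\<^sub>R fact k) = real (Suc k) * (\<mu> ^ Suc k / fact (Suc k) * exp (- \<mu>))" for k
    by (simp add: fact_Suc divide_simps del: of_nat_Suc)
  moreover have "exp (- \<mu>) * \<mu> * exp \<mu> = \<mu>" by (simp add: exp_minus)
  ultimately have s0: "(\<lambda>k. real (Suc k) * (\<mu> ^ Suc k / fact (Suc k) * exp (- \<mu>))) sums \<mu>"
    by (simp only:)
  have s: "(\<lambda>k. real k * (\<mu> ^ k / fact k * exp (- \<mu>))) sums \<mu>"
    using s0 sums_Suc_iff[of "\<lambda>k. real k * (\<mu> ^ k / fact k * exp (- \<mu>))" \<mu>] by simp
  have "(\<integral>\<^sup>+k. ennreal (real k) \<partial>Poisson \<mu>) =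
    (\<integral>\<^sup>+k. ennreal (real k * (\<mu> ^ k / fact k * exp (- \<mu>))) \<partial>count_space UNIV)"
    unfolding nn_integral_measure_pmf using assms
    by (intro nn_integral_cong) (simp add: pmf_Poisson ennreal_mult'[symmetric] mult.commute)
  also have "\<dots> = ennreal \<mu>"
    unfolding nn_integral_count_space_nat using s assms sums_unique[OF s] sums_summable[OF s]
    by (subst suminf_ennreal2) auto
  finally show "(\<integral>k. real k \<partial>Poisson \<mu>) = \<mu>" using assms by (subst integral_eq_nn_integral) auto
qed

text \<open>Rate \<open>0\<close> is covered as well: the support then forces \<open>k = 0\<close>,
  and the value of \<open>ln 0\<close> is multiplied by \<open>0\<close>.\<close>

lemma pmf_Poisson_exp:
  assumes "0 \<le> \<mu>" "k \<in> set_pmf (Poisson \<mu>)"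
  shows "pmf (Poisson \<mu>) k = exp (real k * ln \<mu> - ln (fact k) - \<mu>)"
proof (cases "\<mu> = 0")
  case True then show ?thesis using assms(2) by (simp add: Poisson_def)
next
  case False
  then have "\<mu> > 0" using assms by simp
  then show ?thesis
    by (simp add: pmf_Poisson exp_diff exp_minus exp_add exp_of_nat_mult field_simps)
qed

lemma ln_fact_le: "ln (fact k :: real) \<le> (real k)\<^sup>2"
proof (cases "k = 0")
  case False
  have "ln (fact k :: real) \<le> ln (real k ^ k)"
  proof (subst ln_le_cancel_iff)
    show "fact k \<le> real k ^ k" using fact_le_power[of k, where 'a = real] by simp
  qed (use False in auto)
  also have "\<dots> = real k * ln (real k)" using False by (simp add: ln_realpow)
  also have "\<dots> \<le> real k * real k" using False ln_le_minus_one[of "real k"] by (intro mult_left_mono) auto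
  finally show ?thesis by (simp add: power2_eq_square)
qed simp

section \<open>A lower bound for the likelihood ratio\<close>

lemma square_le_exp: "0 \<le> x \<Longrightarrow> x\<^sup>2 \<le> 2 * exp (x :: real)"
  using exp_lower_Taylor_quadratic[of x] by linarith

lemma fill_support:
  assumes "x \<in> set_pmf (fill lam n k a f)"
  obtains \<pi> h where "\<pi> permutes {1..k + a}" "\<And>i. i \<in> {1..k} \<Longrightarrow> h i = f i"
    "\<And>i. i \<in> {k + 1..k + a} \<Longrightarrow> h i \<in> ltrees_upto n" "x = node (k + a) (\<lambda>j. h (inv \<pi> j))"
proof -
  from assms obtain \<pi> E where \<pi>: "\<pi> permutes {1..k + a}"
    and E: "E \<in> set_pmf (Pi_pmf {k + 1..k + a} {[]} (\<lambda>_. gwp lam n))"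
    and x: "x = node (k + a) (\<lambda>j. let i = inv \<pi> j in if i \<le> k then f i else E i)"
    by (auto simp: fill_def)
  have "E i \<in> ltrees_upto n" if "i \<in> {k + 1..k + a}" for i
    using E that by (auto simp: set_Pi_pmf PiE_dflt_def dest!: bspec[of _ _ i] intro: set_gwp)
  then show ?thesis
    by (intro that[of \<pi> "\<lambda>i. if i \<le> k then f i else E i"]) (use \<pi> x in \<open>auto simp: Let_def\<close>)
qed

context correlated_trees
begin

abbreviation \<nu> :: real where "\<nu> \<equiv> lam * (1 - s)"

text \<open>Joint law of the root degrees: common children, extra children on the first side, extra
  children on the second.\<close>

definition rootp :: "(nat \<times> nat \<times> nat) pmf" where
  "rootp = pair_pmf (Poisson \<mu>) (pair_pmf (Poisson \<nu>) (Poisson \<nu>))"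

text \<open>The logarithm of the Poisson weights of \<open>k\<close>, \<open>a\<close>,
  \<open>a'\<close> over the two weights \<open>lam ^ (k + a) * exp (- lam)\<close> and
  \<open>lam ^ (k + a') * exp (- lam)\<close>. The factorials of \<open>k + a\<close> and
  \<open>k + a'\<close> are absent because they cancel against the probability of one fixed shuffle
  on each side.\<close>

definition B :: "nat \<times> nat \<times> nat \<Rightarrow> real" where
  "B = (\<lambda>(k, a, a'). (2 * lam - \<mu> - 2 * \<nu>) + (real k * (ln \<mu> - 2 * ln lam) - ln (fact k)) +
     (real a * (ln \<nu> - ln lam) - ln (fact a)) + (real a' * (ln \<nu> - ln lam) - ln (fact a')))"

lemma exp_B:
  assumes "(k, a, a') \<in> set_pmf rootp"
  shows "exp (B (k, a, a')) * ((lam ^ (k + a) * exp (- lam)) * (lam ^ (k + a') * exp (- lam))) =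
    pmf (Poisson \<mu>) k * pmf (Poisson \<nu>) a * pmf (Poisson \<nu>) a'"
proof -
  have 1: "k \<in> set_pmf (Poisson \<mu>)" "a \<in> set_pmf (Poisson \<nu>)" "a' \<in> set_pmf (Poisson \<nu>)"
    using assms by (auto simp: rootp_def)
  have pw: "lam ^ m * exp (- lam) = exp (real m * ln lam - lam)" for m
    using lam_pos by (simp add: exp_diff exp_minus exp_of_nat_mult field_simps)
  show ?thesis
    unfolding pw pmf_Poisson_exp[OF mu_nonneg 1(1)] pmf_Poisson_exp[OF nu_nonneg 1(2)]
      pmf_Poisson_exp[OF nu_nonneg 1(3)] exp_add[symmetric]
    by (simp add: B_def algebra_simps)
qed

text \<open>The term of fastest growth is \<open>ln (fact k)\<close>, at most \<open>k^2\<close>. An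
  exponential bound is crude but enough, since Poisson laws have all exponential moments; it makes
  \<open>B\<close> square integrable.\<close>

lemma B_bound: "\<exists>C. \<forall>k a a'. \<bar>B (k, a, a')\<bar> \<le> C * exp (real k + real a + real a')"
proof -
  define c0 where "c0 = \<bar>2 * lam - \<mu> - 2 * \<nu>\<bar>"
  define c1 where "c1 = \<bar>ln \<mu> - 2 * ln lam\<bar>"
  define c2 where "c2 = \<bar>ln \<nu> - ln lam\<bar>"
  have part: "\<bar>real k * c - ln (fact k)\<bar> \<le> (\<bar>c\<bar> + 2) * exp t" if "real k \<le> t" for k c t
  proof -
    have t: "0 \<le> t" using that by linarith
    have e: "exp (real k) \<le> exp t" using that by simp
    have "real k \<le> exp t" using that exp_ge_add_one_self[of t] by linarith
    then have "\<bar>real k * c\<bar> \<le> \<bar>c\<bar> * exp t" by (simp add: abs_mult mult.commute mult_left_mono)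
    moreover have "ln (fact k :: real) \<le> 2 * exp t"
      using ln_fact_le[of k] square_le_exp[of "real k"] e by linarith
    moreover have "0 \<le> ln (fact k :: real)" by (simp add: ln_ge_zero)
    ultimately show ?thesis unfolding distrib_right by linarith
  qed
  have "\<bar>B (k, a, a')\<bar> \<le> (c0 + (c1 + 2) + (c2 + 2) + (c2 + 2)) * exp (real k + real a + real a')" for k a a'
  proof -
    let ?t = "real k + real a + real a'"
    have "\<bar>2 * lam - \<mu> - 2 * \<nu>\<bar> \<le> c0 * exp ?t" unfolding c0_def by (simp add: mult_left_le mult_le_cancel_left1)
    moreover have "\<bar>real k * (ln \<mu> - 2 * ln lam) - ln (fact k)\<bar> \<le> (c1 + 2) * exp ?t"
      unfolding c1_def by (rule part) simp
    moreover have "\<bar>real a * (ln \<nu> - ln lam) - ln (fact a)\<bar> \<le> (c2 + 2) * exp ?t"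
      unfolding c2_def by (rule part) simp
    moreover have "\<bar>real a' * (ln \<nu> - ln lam) - ln (fact a')\<bar> \<le> (c2 + 2) * exp ?t"
      unfolding c2_def by (rule part) simp
    ultimately show ?thesis unfolding B_def distrib_right prod.case by linarith
  qed
  then show ?thesis by blast
qed

lemma integrable_rootp:
  assumes "\<And>k a a'. \<bar>h (k, a, a')\<bar> \<le> C * exp (c * (real k + real a + real a'))"
  shows "integrable rootp (h :: _ \<Rightarrow> real)"
proof (rule Bochner_Integration.integrable_bound)
  let ?g = "\<lambda>(k :: nat, a :: nat, a' :: nat). exp (c * (real k + real a + real a'))"
  have fin: "(\<integral>\<^sup>+k. ennreal (exp (c * real k)) \<partial>Poisson m) < \<infinity>" if "0 \<le> m" for m
    using integrable_Poisson_exp[OF that, of c] by (simp add: integrable_iff_bounded)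
  have "(\<integral>\<^sup>+r. ennreal (?g r) \<partial>rootp) =
    (\<integral>\<^sup>+k. \<integral>\<^sup>+a. \<integral>\<^sup>+a'. ennreal (exp (c * real k)) * (ennreal (exp (c * real a)) * ennreal (exp (c * real a')))
       \<partial>Poisson \<nu> \<partial>Poisson \<nu> \<partial>Poisson \<mu>)"
    unfolding rootp_def nn_integral_pair_pmf'
    by (intro nn_integral_cong) (simp add: ennreal_mult'[symmetric] exp_add[symmetric] algebra_simps)
  also have "\<dots> < \<infinity>"
    using fin[OF mu_nonneg] fin[OF nu_nonneg]
    by (simp add: nn_integral_cmult nn_integral_multc ennreal_mult_eq_top_iff less_top[symmetric])
  finally have "integrable rootp ?g" by (intro integrableI_nonneg) auto
  then show "integrable rootp (\<lambda>r. C * ?g r)" by simp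
  show "AE r in rootp. norm (h r) \<le> norm (C * ?g r)"
    using order_trans[OF assms abs_ge_self] by (auto intro!: AE_I2)
qed simp

lemma mean_rootp: "integrable rootp (\<lambda>r. real (fst r))" "(\<integral>r. real (fst r) \<partial>rootp) = \<mu>"
proof -
  have m: "map_pmf fst rootp = Poisson \<mu>" by (simp add: rootp_def map_fst_pair_pmf)
  show "integrable rootp (\<lambda>r. real (fst r))" "(\<integral>r. real (fst r) \<partial>rootp) = \<mu>"
    using Poisson_mean[OF mu_nonneg] unfolding m[symmetric] by simp_all
qed

text \<open>The probability of a single outcome of \<^const>\<open>fill\<close> already suffices for the lower bound.\<close>

lemma fill_ge:
  assumes \<pi>: "\<pi> permutes {1..k + a}" and h: "\<And>i. i \<in> {1..k + a} \<Longrightarrow> h i \<in> ltrees_upto n"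
    and f: "\<And>i. i \<in> {1..k} \<Longrightarrow> h i = f i" and x: "x = node (k + a) (\<lambda>j. h (inv \<pi> j))"
  shows "pmf (gw (Suc n)) x \<le>
    pmf (fill lam n k a f) x * ((lam ^ (k + a) * exp (- lam)) * (\<Prod>i\<in>{1..k}. pmf (gw n) (f i)))"
proof -
  define E where "E i = (if i \<in> {k + 1..k + a} then h i else {[]})" for i
  let ?C = "\<Prod>i\<in>{k + 1..k + a}. pmf (gw n) (h i)"
  have inv: "inv \<pi> j \<in> {1..k + a}" if "j \<in> {1..k + a}" for j using inv_perm_in[OF \<pi> that] .
  have xE: "node (k + a) (\<lambda>j. let i = inv \<pi> j in if i \<le> k then f i else E i) = x"
    unfolding x using inv f by (intro node_cong) (auto simp: Let_def E_def)
  have "pmf (Pi_pmf {k + 1..k + a} {[]} (\<lambda>_. gw n)) E = ?C"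
    by (subst pmf_Pi') (auto simp: E_def intro!: prod.cong)
  moreover have "pmf (pmf_of_set (perms (k + a))) \<pi> = 1 / fact (k + a)"
    using \<pi> by (simp add: pmf_of_set[OF perms_nonempty finite_perms] card_perms)
  moreover have "pmf (Pi_pmf {k + 1..k + a} {[]} (\<lambda>_. gw n)) E * 1 \<le> pmf (Pi_pmf {k + 1..k + a} {[]} (\<lambda>_. gw n) \<bind>
      (\<lambda>E. return_pmf (node (k + a) (\<lambda>j. let i = inv \<pi> j in if i \<le> k then f i else E i)))) x"
    (is "_ \<le> pmf (?b \<pi>) x")
    using pmf_bind_ge[of "Pi_pmf {k + 1..k + a} {[]} (\<lambda>_. gw n)" E
        "\<lambda>E. return_pmf (node (k + a) (\<lambda>j. let i = inv \<pi> j in if i \<le> k then f i else E i))" x] xE by simp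
  moreover have "pmf (pmf_of_set (perms (k + a))) \<pi> * pmf (?b \<pi>) x \<le> pmf (fill lam n k a f) x"
    unfolding fill_def by (rule pmf_bind_ge)
  ultimately have "1 / fact (k + a) * ?C \<le> pmf (fill lam n k a f) x"
    using order_trans[OF mult_left_mono, of ?C "pmf (?b \<pi>) x" "1 / fact (k + a)" "pmf (fill lam n k a f) x"]
    by simp
  then have F: "?C \<le> pmf (fill lam n k a f) x * fact (k + a)" by (simp add: field_simps)
  have "pmf (gw (Suc n)) x = pmf (Poisson lam) (k + a) * (\<Prod>j\<in>{1..k + a}. pmf (gw n) (h (inv \<pi> j)))"
    unfolding x by (rule pmf_gwp_node) (use h[OF inv] Nil_in_ltrees_upto in blast)
  also have "(\<Prod>j\<in>{1..k + a}. pmf (gw n) (h (inv \<pi> j))) = (\<Prod>i\<in>{1..k + a}. pmf (gw n) (h i))"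
    using prod.permute[OF permutes_inv[OF \<pi>], of "\<lambda>i. pmf (gw n) (h i)"] by (simp add: o_def)
  also have "{1..k + a} = {1..k} \<union> {k + 1..k + a}" by auto
  also have "(\<Prod>i\<in>{1..k} \<union> {k + 1..k + a}. pmf (gw n) (h i)) = (\<Prod>i\<in>{1..k}. pmf (gw n) (f i)) * ?C"
    using f by (subst prod.union_disjoint) (auto intro!: arg_cong2[where f = "(*)"] prod.cong)
  also have "pmf (Poisson lam) (k + a) * ((\<Prod>i\<in>{1..k}. pmf (gw n) (f i)) * ?C) \<le>
     pmf (Poisson lam) (k + a) * ((\<Prod>i\<in>{1..k}. pmf (gw n) (f i)) * (pmf (fill lam n k a f) x * fact (k + a)))"
    using F by (intro mult_left_mono) (auto intro!: prod_nonneg)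
  also have "\<dots> = pmf (fill lam n k a f) x * ((lam ^ (k + a) * exp (- lam)) * (\<Prod>i\<in>{1..k}. pmf (gw n) (f i)))"
    using lam_pos by (simp add: pmf_Poisson)
  finally show ?thesis .
qed

lemma pmf_p1_Suc_ge:
  "pmf (Poisson \<mu>) k * (pmf (Poisson \<nu>) a * (pmf (Poisson \<nu>) a' * ((\<Prod>i\<in>{1..k}. pmf (p1 n) (g i)) *
     (pmf (fill lam n k a (\<lambda>i. fst (g i))) x * pmf (fill lam n k a' (\<lambda>i. snd (g i))) y)))) \<le> pmf (p1 (Suc n)) (x, y)"
proof -
  \<comment> \<open>\<open>Pi_pmf\<close> charges only families with the default value outside
    \<open>{1..k}\<close>, so \<open>g\<close> is first normalised there; neither side of the claim
    sees the change.\<close>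
  define g' where "g' i = (if i \<in> {1..k} then g i else ({[]}, {[]}))" for i
  have fill_cong: "fill lam n k b f = fill lam n k b f'" if "\<And>i. i \<in> {1..k} \<Longrightarrow> f i = f' i" for b f f'
    unfolding fill_def
  proof (intro bind_pmf_cong refl arg_cong[where f = return_pmf] node_cong)
    fix \<pi> E j assume "\<pi> \<in> set_pmf (pmf_of_set (perms (k + b)))" "j \<in> {1..k + b}"
    then have "inv \<pi> j \<in> {1..k + b}" using inv_perm_in by auto
    then show "(let i = inv \<pi> j in if i \<le> k then f i else E i) = (let i = inv \<pi> j in if i \<le> k then f' i else E i)"
      using that by (auto simp: Let_def)
  qed
  have 1: "pmf (Pi_pmf {1..k} ({[]}, {[]}) (\<lambda>_. p1 n)) g' = (\<Prod>i\<in>{1..k}. pmf (p1 n) (g i))"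
    by (subst pmf_Pi') (auto simp: g'_def intro!: prod.cong)
  have 2: "fill lam n k a (\<lambda>i. fst (g' i)) = fill lam n k a (\<lambda>i. fst (g i))"
     "fill lam n k a' (\<lambda>i. snd (g' i)) = fill lam n k a' (\<lambda>i. snd (g i))"
    by (auto intro!: fill_cong simp: g'_def)
  let ?b = "\<lambda>a a' g. fill lam n k a (\<lambda>i. fst (g i)) \<bind> (\<lambda>x. fill lam n k a' (\<lambda>i. snd (g i)) \<bind> (\<lambda>y. return_pmf (x, y)))"
  let ?Pi = "Pi_pmf {1..k} ({[]}, {[]}) (\<lambda>_. p1 n)"
  have "pmf (fill lam n k a (\<lambda>i. fst (g i))) x * pmf (fill lam n k a' (\<lambda>i. snd (g i))) y = pmf (?b a a' g') (x, y)"
    unfolding 2[symmetric] pair_pmf_def[symmetric] pmf_pair ..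
  moreover have s1: "pmf ?Pi g' * pmf (?b a a' g') (x, y) \<le> pmf (?Pi \<bind> ?b a a') (x, y)"
    by (rule pmf_bind_ge)
  moreover have s2: "pmf (Poisson \<nu>) a' * pmf (?Pi \<bind> ?b a a') (x, y) \<le> pmf (Poisson \<nu> \<bind> (\<lambda>a'. ?Pi \<bind> ?b a a')) (x, y)"
    by (rule pmf_bind_ge)
  moreover have s3: "pmf (Poisson \<nu>) a * pmf (Poisson \<nu> \<bind> (\<lambda>a'. ?Pi \<bind> ?b a a')) (x, y) \<le>
      pmf (Poisson \<nu> \<bind> (\<lambda>a. Poisson \<nu> \<bind> (\<lambda>a'. ?Pi \<bind> ?b a a'))) (x, y)"
    by (rule pmf_bind_ge)
  moreover have s4: "pmf (Poisson \<mu>) k * pmf (Poisson \<nu> \<bind> (\<lambda>a. Poisson \<nu> \<bind> (\<lambda>a'. ?Pi \<bind> ?b a a'))) (x, y) \<le> pmf (p1 (Suc n)) (x, y)"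
    unfolding p1p_Suc by (rule pmf_bind_ge)
  ultimately show ?thesis
    unfolding 1[symmetric]
    by (simp only:) (intro order_trans[OF mult_left_mono s4] order_trans[OF mult_left_mono s3]
      order_trans[OF mult_left_mono s2] s1 pmf_nonneg)
qed

text \<open>The product of both Galton-Watson masses is bounded above by \<open>fill_ge\<close>,
  which brings in the two \<open>fill\<close> masses; precisely these stand in the lower bound
  \<open>pmf_p1_Suc_ge\<close> for the numerator, and the remaining Poisson weights combine to
  \<open>exp B\<close>.\<close>

lemma lr_node_ge:
  assumes r: "(k, a, a') \<in> set_pmf rootp" and g: "\<And>i. i \<in> {1..k} \<Longrightarrow> g i \<in> X2 n"
    and \<pi>: "\<pi> permutes {1..k + a}" "\<And>i. i \<in> {1..k + a} \<Longrightarrow> h i \<in> ltrees_upto n"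
      "\<And>i. i \<in> {1..k} \<Longrightarrow> h i = fst (g i)"
    and \<pi>': "\<pi>' permutes {1..k + a'}" "\<And>i. i \<in> {1..k + a'} \<Longrightarrow> h' i \<in> ltrees_upto n"
      "\<And>i. i \<in> {1..k} \<Longrightarrow> h' i = snd (g i)"
  shows "exp (B (k, a, a')) * (\<Prod>i\<in>{1..k}. lr n (g i)) \<le>
    lr (Suc n) (node (k + a) (\<lambda>j. h (inv \<pi> j)), node (k + a') (\<lambda>j. h' (inv \<pi>' j)))" (is "_ \<le> lr _ (?x, ?y)")
proof -
  let ?f = "pmf (fill lam n k a (\<lambda>i. fst (g i))) ?x" and ?f' = "pmf (fill lam n k a' (\<lambda>i. snd (g i))) ?y"
  let ?w = "lam ^ (k + a) * exp (- lam)" and ?w' = "lam ^ (k + a') * exp (- lam)"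
  let ?Q = "\<Prod>i\<in>{1..k}. pmf (gw n) (fst (g i))" and ?Q' = "\<Prod>i\<in>{1..k}. pmf (gw n) (snd (g i))"
  let ?P = "\<Prod>i\<in>{1..k}. pmf (p1 n) (g i)"
  have gx: "pmf (gw (Suc n)) ?x \<le> ?f * (?w * ?Q)" by (rule fill_ge) (use \<pi> in auto)
  have gy: "pmf (gw (Suc n)) ?y \<le> ?f' * (?w' * ?Q')" by (rule fill_ge) (use \<pi>' in auto)
  have xin: "?x \<in> ltrees_upto (Suc n)" "?y \<in> ltrees_upto (Suc n)"
    using \<pi>(2)[OF inv_perm_in[OF \<pi>(1)]] \<pi>'(2)[OF inv_perm_in[OF \<pi>'(1)]] by (auto intro!: node_in_ltrees_upto)
  have pos: "pmf (gw (Suc n)) ?x > 0" "pmf (gw (Suc n)) ?y > 0"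
    by (rule pmf_gw_pos[OF xin(1)]) (rule pmf_gw_pos[OF xin(2)])
  have Qpos: "?Q > 0" "?Q' > 0" using g by (auto intro!: prod_pos pmf_gw_pos simp: mem_Times_iff)
  have lrP: "(\<Prod>i\<in>{1..k}. lr n (g i)) * (?Q * ?Q') = ?P"
  proof -
    have "lr n (g i) * (pmf (gw n) (fst (g i)) * pmf (gw n) (snd (g i))) = pmf (p1 n) (g i)" for i
      unfolding pmf_p1_eq by (cases "g i") (simp add: p0p_def pmf_pair)
    then show ?thesis by (simp only: prod.distrib[symmetric])
  qed
  have "exp (B (k, a, a')) * (\<Prod>i\<in>{1..k}. lr n (g i)) * (pmf (gw (Suc n)) ?x * pmf (gw (Suc n)) ?y) \<le>
     exp (B (k, a, a')) * (\<Prod>i\<in>{1..k}. lr n (g i)) * ((?f * (?w * ?Q)) * (?f' * (?w' * ?Q')))"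
    using gx gy by (intro mult_left_mono mult_mono mult_nonneg_nonneg prod_nonneg)
      (auto intro!: lr_nonneg mult_nonneg_nonneg prod_nonneg simp: lam_pos less_imp_le)
  also have "\<dots> = (exp (B (k, a, a')) * (?w * ?w')) * (((\<Prod>i\<in>{1..k}. lr n (g i)) * (?Q * ?Q')) * (?f * ?f'))"
    by (simp only: ac_simps)
  also have "\<dots> = pmf (Poisson \<mu>) k * pmf (Poisson \<nu>) a * pmf (Poisson \<nu>) a' * (?P * (?f * ?f'))"
    unfolding exp_B[OF r] lrP ..
  also have "\<dots> = pmf (Poisson \<mu>) k * (pmf (Poisson \<nu>) a * (pmf (Poisson \<nu>) a' * (?P * (?f * ?f'))))"
    by (simp only: ac_simps)
  also have "\<dots> \<le> pmf (p1 (Suc n)) (?x, ?y)" by (rule pmf_p1_Suc_ge)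
  also have "\<dots> = lr (Suc n) (?x, ?y) * (pmf (gw (Suc n)) ?x * pmf (gw (Suc n)) ?y)"
    by (simp add: pmf_p1_eq p0p_def pmf_pair del: gwp.simps)
  finally show ?thesis using mult_pos_pos[OF pos] by (simp only: mult_le_cancel_right_pos)
qed

text \<open>Pruning commutes with \<open>node\<close>, so the shuffles realised at depth
  \<open>n\<close> witness the bound at every smaller depth \<open>m\<close> too. One experiment
  therefore controls the ratios at all depths simultaneously.\<close>

lemma lr_fill_ge:
  assumes r: "(k, a, a') \<in> set_pmf rootp" and g: "\<And>i. i \<in> {1..k} \<Longrightarrow> g i \<in> X2 n"
    and x: "x \<in> set_pmf (fill lam n k a (\<lambda>i. fst (g i)))" and y: "y \<in> set_pmf (fill lam n k a' (\<lambda>i. snd (g i)))"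
    and m: "m \<le> n"
  shows "exp (B (k, a, a')) * (\<Prod>i\<in>{1..k}. lr m (prune2 m (g i))) \<le> lr (Suc m) (prune2 (Suc m) (x, y))"
proof -
  obtain \<pi> h where \<pi>: "\<pi> permutes {1..k + a}" "\<And>i. i \<in> {1..k} \<Longrightarrow> h i = fst (g i)"
    "\<And>i. i \<in> {k + 1..k + a} \<Longrightarrow> h i \<in> ltrees_upto n" "x = node (k + a) (\<lambda>j. h (inv \<pi> j))"
    using fill_support[OF x] by blast
  obtain \<pi>' h' where \<pi>': "\<pi>' permutes {1..k + a'}" "\<And>i. i \<in> {1..k} \<Longrightarrow> h' i = snd (g i)"
    "\<And>i. i \<in> {k + 1..k + a'} \<Longrightarrow> h' i \<in> ltrees_upto n" "y = node (k + a') (\<lambda>j. h' (inv \<pi>' j))"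
    using fill_support[OF y] by blast
  have h: "h i \<in> ltrees" if "i \<in> {1..k + a}" for i
    using \<pi>(2,3)[of i] g[of i] that by (cases "i \<le> k") (auto simp: mem_Times_iff ltrees_upto_def)
  have h': "h' i \<in> ltrees" if "i \<in> {1..k + a'}" for i
    using \<pi>'(2,3)[of i] g[of i] that by (cases "i \<le> k") (auto simp: mem_Times_iff ltrees_upto_def)
  have g': "g i \<in> ltrees \<times> ltrees" if "i \<in> {1..k}" for i using g[OF that] by (auto simp: mem_Times_iff ltrees_upto_def)
  have "exp (B (k, a, a')) * (\<Prod>i\<in>{1..k}. lr m (prune2 m (g i))) \<le>
    lr (Suc m) (node (k + a) (\<lambda>j. prune m (h (inv \<pi> j))), node (k + a') (\<lambda>j. prune m (h' (inv \<pi>' j))))"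
    by (rule lr_node_ge[OF r, where h = "\<lambda>i. prune m (h i)" and h' = "\<lambda>i. prune m (h' i)"])
       (use \<pi> \<pi>' h h' prune2_in[OF g'] in \<open>auto simp: prune2_def case_prod_unfold prune_in_ltrees_upto\<close>)
  then show ?thesis unfolding \<pi>(4) \<pi>'(4) by (simp add: prune2_def prune_node)
qed

section \<open>A coupled branching lower bound\<close>

text \<open>The second component of \<open>cp d0 Y D\<close> is a sequence \<open>S\<close> with \<open>S n \<le> ln (lr (n + d0))\<close>, where
  \<open>S n\<close> adds up \<open>Y\<close> over the common vertices at depth \<open>n\<close> and \<^const>\<open>B\<close> over those above.\<close>

primrec cp :: "nat \<Rightarrow> (ltree \<times> ltree \<Rightarrow> real) \<Rightarrow> nat \<Rightarrow> ((ltree \<times> ltree) \<times> (nat \<Rightarrow> real)) pmf" where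
  "cp d0 Y 0 = map_pmf (\<lambda>z. (z, \<lambda>n. if n = 0 then Y z else 0)) (p1 d0)"
| "cp d0 Y (Suc D) = branch rootp fst (({[]}, {[]}), \<lambda>_. 0) (cp d0 Y D) \<bind> (\<lambda>(r, G). do {
     x \<leftarrow> fill lam (D + d0) (fst r) (fst (snd r)) (\<lambda>i. fst (fst (G i)));
     y \<leftarrow> fill lam (D + d0) (fst r) (snd (snd r)) (\<lambda>i. snd (fst (G i)));
     return_pmf ((x, y), case_nat (Y (prune2 d0 (x, y))) (\<lambda>n. B r + (\<Sum>i\<in>{1..fst r}. snd (G i) n)))})"

text \<open>The attached sums never feed back into the trees, so forgetting them leaves the
  recursion of \<open>p1\<close>. This is what makes \<open>cp\<close> a coupling.\<close>

lemma map_fst_cp: "map_pmf fst (cp d0 Y D) = p1 (D + d0)"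
proof (induction D)
  case 0 show ?case by (simp add: pmf.map_comp o_def)
next
  case (Suc D)
  have Pi: "Pi_pmf {1..k} ({[]}, {[]}) (\<lambda>_. p1 (D + d0)) =
      map_pmf (\<lambda>G. fst \<circ> G) (Pi_pmf {1..k} (({[]}, {[]}), \<lambda>_. 0) (\<lambda>_. cp d0 Y D))" for k :: nat
    unfolding Suc.IH[symmetric] by (rule Pi_pmf_map) auto
  show ?case
    unfolding add_Suc p1p_Suc Pi
    by (simp add: branch_def rootp_def pair_pmf_def map_pmf_def bind_assoc_pmf bind_return_pmf)
qed

lemma fst_cp_in: "st \<in> set_pmf (cp d0 Y D) \<Longrightarrow> fst st \<in> X2 (D + d0)"
  using set_p1p[of lam s "D + d0"] unfolding map_fst_cp[of d0 Y D, symmetric] by auto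

lemma set_branch:
  assumes "(r, G) \<in> set_pmf (branch \<rho> \<kappa> d p)"
  shows "r \<in> set_pmf \<rho>" "\<And>i. i \<in> {1..\<kappa> r} \<Longrightarrow> G i \<in> set_pmf p"
  using assms by (auto simp: branch_def intro: set_Pi_pmf_in)

lemma cp_S0: "st \<in> set_pmf (cp d0 Y D) \<Longrightarrow> snd st 0 = Y (prune2 d0 (fst st))"
proof (cases D)
  case 0
  assume "st \<in> set_pmf (cp d0 Y D)"
  then obtain z where z: "z \<in> set_pmf (p1 d0)" "st = (z, \<lambda>n. if n = 0 then Y z else 0)" using 0 by auto
  have "prune2 d0 z = z" using z(1) set_p1p[of lam s d0] by (auto simp: prune2_def prune_ident)
  then show ?thesis using z by simp
qed auto

text \<open>Induction over the tree: adding \<open>B\<close> at the root and summing over the common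
  children is the logarithm of the left side of \<open>lr_fill_ge\<close>. Level \<open>0\<close> is
  the hypothesis on \<open>Y\<close> at depth \<open>d0\<close>.\<close>

lemma cp_lower:
  assumes Y: "\<And>z. z \<in> set_pmf (p1 d0) \<Longrightarrow> exp (Y z) \<le> lr d0 z"
  shows "st \<in> set_pmf (cp d0 Y D) \<Longrightarrow> n \<le> D \<Longrightarrow> exp (snd st n) \<le> lr (n + d0) (prune2 (n + d0) (fst st))"
proof (induction D arbitrary: st n)
  case 0
  then obtain z where z: "z \<in> set_pmf (p1 d0)" "st = (z, \<lambda>n. if n = 0 then Y z else 0)" by auto
  have "prune2 d0 z = z" using z(1) set_p1p[of lam s d0] by (auto simp: prune2_def prune_ident)
  then show ?case using z 0 Y by simp
next
  case (Suc D)
  show ?case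
  proof (cases n)
    case 0
    have "prune2 d0 (fst st) \<in> set_pmf (p1 d0)"
    proof -
      have "map_pmf (prune2 d0) (p1 (Suc D + d0)) = p1 d0" by (rule map_prune2_p1p) simp
      moreover have "fst st \<in> set_pmf (p1 (Suc D + d0))"
        unfolding map_fst_cp[of d0 Y, symmetric] using Suc.prems(1) by simp
      ultimately show ?thesis by (metis imageI set_map_pmf)
    qed
    then show ?thesis using Y cp_S0[OF Suc.prems(1)] 0 by simp
  next
    case (Suc n')
    obtain r G x y where rG: "(r, G) \<in> set_pmf (branch rootp fst (({[]}, {[]}), \<lambda>_. 0) (cp d0 Y D))"
      and x: "x \<in> set_pmf (fill lam (D + d0) (fst r) (fst (snd r)) (\<lambda>i. fst (fst (G i))))"
      and y: "y \<in> set_pmf (fill lam (D + d0) (fst r) (snd (snd r)) (\<lambda>i. snd (fst (G i))))"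
      and st: "st = ((x, y), case_nat (Y (prune2 d0 (x, y))) (\<lambda>n. B r + (\<Sum>i\<in>{1..fst r}. snd (G i) n)))"
      using Suc.prems(1) by auto
    obtain k a a' where r: "r = (k, a, a')" by (cases r)
    have "exp (snd st n) = exp (B r) * (\<Prod>i\<in>{1..k}. exp (snd (G i) n'))"
      by (simp add: st Suc r exp_add exp_sum)
    also have "\<dots> \<le> exp (B r) * (\<Prod>i\<in>{1..k}. lr (n' + d0) (prune2 (n' + d0) (fst (G i))))"
      using Suc.IH[OF set_branch(2)[OF rG]] Suc.prems(2) Suc r by (intro mult_left_mono prod_mono) auto
    also have "\<dots> \<le> lr (Suc (n' + d0)) (prune2 (Suc (n' + d0)) (x, y))"
      unfolding r
    proof (rule lr_fill_ge[where n = "D + d0"])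
      show "(k, a, a') \<in> set_pmf rootp" using set_branch(1)[OF rG] r by simp
      show "fst (G i) \<in> X2 (D + d0)" if "i \<in> {1..k}" for i
        using fst_cp_in[OF set_branch(2)[OF rG]] that r by simp
    qed (use x y r Suc Suc.prems(2) in auto)
    finally show ?thesis by (simp add: st Suc)
  qed
qed

text \<open>A functional that reads only the sums is insensitive to the shuffles and the extra
  subtrees, so its law is that of a plain branching sum and \<open>centred_branch\<close> applies.
  Both uses below are linear in \<open>S\<close>.\<close>

lemma centred_cp_step:
  assumes f: "centred (cp d0 Y D) f v" and A: "centred rootp A w"
    and F: "\<And>z S r G. S 0 = Y (prune2 d0 z) \<Longrightarrow> (\<And>n. S (Suc n) = B r + (\<Sum>i\<in>{1..fst r}. snd (G i) n)) \<Longrightarrow>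
       (\<And>i. i \<in> {1..fst r} \<Longrightarrow> G i \<in> set_pmf (cp d0 Y D)) \<Longrightarrow>
       F (z, S) = A r + (\<Sum>i\<in>{1..fst r}. f (G i))"
  shows "centred (cp d0 Y (Suc D)) F (w + \<mu> * v)"
proof (rule centred_map_cong)
  let ?J = "branch rootp fst (({[]}, {[]}), \<lambda>_. 0) (cp d0 Y D)"
  let ?X = "\<lambda>(r, G). A r + (\<Sum>i\<in>{1..fst r}. f (G i))"
  show "centred ?J ?X (w + \<mu> * v)"
    using centred_branch[OF f A mean_rootp(1), of "(({[]}, {[]}), \<lambda>_. 0)"] by (simp add: mean_rootp(2))
  have "map_pmf F (cp d0 Y (Suc D)) = ?J \<bind> (\<lambda>rG. return_pmf (?X rG))"
    unfolding cp.simps map_bind_pmf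
  proof (intro bind_pmf_cong refl)
    fix rG assume rG: "rG \<in> set_pmf ?J"
    obtain r G where eq: "rG = (r, G)" by (cases rG)
    have *: "F ((x, y), case_nat (Y (prune2 d0 (x, y))) (\<lambda>n. B r + (\<Sum>i\<in>{1..fst r}. snd (G i) n))) = ?X (r, G)" for x y
      using set_branch(2)[OF rG[unfolded eq]] by (subst F[where r = r and G = G]) auto
    show "map_pmf F (case rG of (r, G) \<Rightarrow> do {
       x \<leftarrow> fill lam (D + d0) (fst r) (fst (snd r)) (\<lambda>i. fst (fst (G i)));
       y \<leftarrow> fill lam (D + d0) (fst r) (snd (snd r)) (\<lambda>i. snd (fst (G i)));
       return_pmf ((x, y), case_nat (Y (prune2 d0 (x, y))) (\<lambda>n. B r + (\<Sum>i\<in>{1..fst r}. snd (G i) n)))}) =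
       return_pmf (?X rG)"
      by (simp add: eq map_bind_pmf * del: case_prod_conv)
  qed
  then show "map_pmf F (cp d0 Y (Suc D)) = map_pmf ?X ?J" by (simp add: map_pmf_def)
qed

end

section \<open>Exponential growth with positive probability\<close>

lemma geometric_sum_le:
  fixes w :: real
  assumes "0 \<le> w" "w < 1" "N \<le> D"
  shows "(\<Sum>n\<in>{N..<D}. w ^ n) \<le> w ^ N / (1 - w)"
proof -
  have "(\<Sum>n\<in>{N..<D}. w ^ n) * (1 - w) = w ^ N - w ^ D"
    using assms(3)
  proof (induction D rule: dec_induct)
    case (step n)
    have "(\<Sum>n\<in>{N..<Suc n}. w ^ n) * (1 - w) = (\<Sum>n\<in>{N..<n}. w ^ n) * (1 - w) + w ^ n * (1 - w)"
      using step.hyps by (simp add: distrib_right)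
    then show ?case unfolding step.IH by (simp add: algebra_simps)
  qed simp
  also have "\<dots> \<le> w ^ N" using assms by simp
  finally show ?thesis using assms by (simp add: pos_le_divide_eq)
qed

lemma centred_diff:
  assumes "centred p f v" "centred p g w" shows "centred p (\<lambda>x. f x - c * g x) (2 * v + 2 * c\<^sup>2 * w)"
proof -
  have f: "integrable p (\<lambda>x. (f x)\<^sup>2)" "(\<integral>x. f x \<partial>p) = 0" "(\<integral>x. (f x)\<^sup>2 \<partial>p) \<le> v"
    and g: "integrable p (\<lambda>x. (g x)\<^sup>2)" "(\<integral>x. g x \<partial>p) = 0" "(\<integral>x. (g x)\<^sup>2 \<partial>p) \<le> w"
    using assms by (auto simp: centred_def)
  have le: "(f x - c * g x)\<^sup>2 \<le> 2 * (f x)\<^sup>2 + 2 * c\<^sup>2 * (g x)\<^sup>2" for x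
  proof -
    have "0 \<le> (f x + c * g x)\<^sup>2" by simp
    then show ?thesis by (simp add: power2_eq_square algebra_simps)
  qed
  have bd: "integrable p (\<lambda>x. 2 * (f x)\<^sup>2 + 2 * c\<^sup>2 * (g x)\<^sup>2)" using f g by simp
  have int: "integrable p (\<lambda>x. (f x - c * g x)\<^sup>2)"
    by (rule Bochner_Integration.integrable_bound[OF bd]) (use le in \<open>auto intro: order_trans[OF le abs_ge_self]\<close>)
  have "(\<integral>x. (f x - c * g x)\<^sup>2 \<partial>p) \<le> (\<integral>x. 2 * (f x)\<^sup>2 + 2 * c\<^sup>2 * (g x)\<^sup>2 \<partial>p)"
    by (intro integral_mono int bd le)
  also have "\<dots> = 2 * (\<integral>x. (f x)\<^sup>2 \<partial>p) + 2 * c\<^sup>2 * (\<integral>x. (g x)\<^sup>2 \<partial>p)" using f g by simp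
  also have "\<dots> \<le> 2 * v + 2 * c\<^sup>2 * w" using f g by (intro add_mono mult_left_mono) auto
  finally show ?thesis
    using int f g integrable_of_square[OF f(1)] integrable_of_square[OF g(1)] by (simp add: centred_def)
qed

context correlated_trees
begin

definition meanB :: real where "meanB = (\<integral>r. B r \<partial>rootp)"

text \<open>The root terms arising below are affine in \<open>B r\<close> and the number of common
  children, with coefficients depending on the means.\<close>

lemma integrable_root_affine:
  "integrable rootp (\<lambda>r. x + y * B r + z * real (fst r))"
  "integrable rootp (\<lambda>r. (x + y * B r + z * real (fst r))\<^sup>2)"
proof -
  obtain C where C: "\<And>k a a'. \<bar>B (k, a, a')\<bar> \<le> C * exp (real k + real a + real a')" using B_bound by blast
  have bd: "\<bar>x + y * B (k, a, a') + z * real k\<bar> \<le> (\<bar>x\<bar> + \<bar>y\<bar> * C + \<bar>z\<bar>) * exp (real k + real a + real a')" for k a a'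
  proof -
    let ?E = "exp (real k + real a + real a')"
    have "\<bar>x\<bar> \<le> \<bar>x\<bar> * ?E" by (simp add: mult_le_cancel_left1)
    moreover have "\<bar>y * B (k, a, a')\<bar> \<le> \<bar>y\<bar> * (C * ?E)" using C by (simp add: abs_mult mult_left_mono)
    moreover have "real k \<le> ?E" using exp_ge_add_one_self[of "real k + real a + real a'"] by linarith
    then have "\<bar>z * real k\<bar> \<le> \<bar>z\<bar> * ?E" by (simp add: abs_mult mult_left_mono)
    ultimately show ?thesis unfolding distrib_right by linarith
  qed
  show "integrable rootp (\<lambda>r. x + y * B r + z * real (fst r))"
    by (rule integrable_rootp[where c = 1]) (use bd in auto)
  show "integrable rootp (\<lambda>r. (x + y * B r + z * real (fst r))\<^sup>2)"
  proof (rule integrable_rootp[where c = 2])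
    fix k a a'
    have "(x + y * B (k, a, a') + z * real k)\<^sup>2 \<le> ((\<bar>x\<bar> + \<bar>y\<bar> * C + \<bar>z\<bar>) * exp (real k + real a + real a'))\<^sup>2"
      using bd[of k a a'] by (meson abs_le_square_iff abs_ge_self order_trans)
    also have "\<dots> = (\<bar>x\<bar> + \<bar>y\<bar> * C + \<bar>z\<bar>)\<^sup>2 * exp (2 * (real k + real a + real a'))"
      by (simp only: power_mult_distrib exp_double)
    finally show "\<bar>(x + y * B (k, a, a') + z * real (fst (k, a, a')))\<^sup>2\<bar> \<le>
      (\<bar>x\<bar> + \<bar>y\<bar> * C + \<bar>z\<bar>)\<^sup>2 * exp (2 * (real k + real a + real a'))" by simp
  qed
qed

lemma integrable_B: "integrable rootp B"
  using integrable_root_affine(1)[of 0 1 0] by simp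

lemma centred_root:
  assumes "x + y * meanB + z * \<mu> = 0"
  shows "centred rootp (\<lambda>r. x + y * B r + z * real (fst r)) (\<integral>r. (x + y * B r + z * real (fst r))\<^sup>2 \<partial>rootp)"
  unfolding centred_def using integrable_root_affine[of x y z] integrable_B mean_rootp assms by (simp add: meanB_def)

text \<open>\<open>mS\<close> and \<open>vS\<close> are the mean and variance of the coupled sum \<open>S n\<close>; \<open>vR\<close> bounds the variance of
  the innovation \<open>S (n + 1) - \<mu> * S n - meanB\<close>, which is again a centred branching sum.\<close>

primrec mS :: "real \<Rightarrow> nat \<Rightarrow> real" where
  "mS y0 0 = y0"
| "mS y0 (Suc n) = meanB + \<mu> * mS y0 n"

primrec vS :: "real \<Rightarrow> real \<Rightarrow> nat \<Rightarrow> real" where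
  "vS y0 v0 0 = v0"
| "vS y0 v0 (Suc n) = (\<integral>r. (- (meanB + \<mu> * mS y0 n) + 1 * B r + mS y0 n * real (fst r))\<^sup>2 \<partial>rootp) + \<mu> * vS y0 v0 n"

primrec vR :: "real \<Rightarrow> nat \<Rightarrow> real" where
  "vR v 0 = v"
| "vR v (Suc n) = (\<integral>r. (- meanB + (1 - \<mu>) * B r + meanB * real (fst r))\<^sup>2 \<partial>rootp) + \<mu> * vR v n"

text \<open>Subtracting means turns the recursion for \<open>S\<close> into a sum of the children's
  centred values plus \<open>B - meanB\<close> plus \<open>mS y0 n\<close> times the fluctuation of
  the number of common children around \<mu>.\<close>

lemma centred_S:
  assumes Y: "integrable (p1 d0) (\<lambda>z. (Y z)\<^sup>2)"
    and y0: "y0 = (\<integral>z. Y z \<partial>p1 d0)" and v0: "v0 = (\<integral>z. (Y z - y0)\<^sup>2 \<partial>p1 d0)"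
  shows "n \<le> D \<Longrightarrow> centred (cp d0 Y D) (\<lambda>st. snd st n - mS y0 n) (vS y0 v0 n)"
proof (induction n arbitrary: D)
  case 0
  show ?case
  proof (rule centred_map_cong)
    have "map_pmf (\<lambda>st. snd st 0 - mS y0 0) (cp d0 Y D) = map_pmf (\<lambda>st. Y (prune2 d0 (fst st)) - y0) (cp d0 Y D)"
      by (intro map_pmf_cong) (auto simp: cp_S0)
    also have "\<dots> = map_pmf (\<lambda>z. Y z - y0) (map_pmf (prune2 d0) (map_pmf fst (cp d0 Y D)))"
      by (simp add: pmf.map_comp o_def)
    also have "map_pmf (prune2 d0) (map_pmf fst (cp d0 Y D)) = p1 d0"
      unfolding map_fst_cp by (rule map_prune2_p1p) simp
    finally show "map_pmf (\<lambda>st. snd st 0 - mS y0 0) (cp d0 Y D) = map_pmf (\<lambda>z. Y z - y0) (p1 d0)" .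
    show "centred (p1 d0) (\<lambda>z. Y z - y0) (vS y0 v0 0)"
      using integral_shift_square(1)[OF Y, of "- y0"] integrable_of_square[OF Y]
      by (simp add: centred_def y0 v0)
  qed
next
  case (Suc n)
  then obtain D' where D: "D = Suc D'" "n \<le> D'" by (cases D) auto
  let ?A = "\<lambda>r. - (meanB + \<mu> * mS y0 n) + 1 * B r + mS y0 n * real (fst r)"
  have "centred (cp d0 Y (Suc D')) (\<lambda>st. snd st (Suc n) - mS y0 (Suc n)) ((\<integral>r. (?A r)\<^sup>2 \<partial>rootp) + \<mu> * vS y0 v0 n)"
    by (rule centred_cp_step[OF Suc.IH[OF D(2)] centred_root]) (simp_all add: sum_subtractf)
  then show ?case unfolding D by simp
qed

text \<open>The innovation at level \<open>n + 1\<close> is the sum of the children's innovations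
  plus \<open>(1 - \<mu>) * B r - meanB + meanB * real (fst r)\<close>. This root term has mean zero
  and, unlike the one for \<open>S\<close>, a law that does not change with
  \<open>n\<close>.\<close>

lemma centred_R:
  assumes Y: "integrable (p1 d0) (\<lambda>z. (Y z)\<^sup>2)"
    and y0: "y0 = (\<integral>z. Y z \<partial>p1 d0)" and v0: "v0 = (\<integral>z. (Y z - y0)\<^sup>2 \<partial>p1 d0)"
  shows "Suc n \<le> D \<Longrightarrow> centred (cp d0 Y D) (\<lambda>st. snd st (Suc n) - \<mu> * snd st n - meanB)
     (vR (2 * vS y0 v0 (Suc 0) + 2 * \<mu>\<^sup>2 * vS y0 v0 0) n)"
proof (induction n arbitrary: D)
  case 0
  have "centred (cp d0 Y D) (\<lambda>st. (snd st (Suc 0) - mS y0 (Suc 0)) - \<mu> * (snd st 0 - mS y0 0))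
     (2 * vS y0 v0 (Suc 0) + 2 * \<mu>\<^sup>2 * vS y0 v0 0)"
    using 0 by (intro centred_diff centred_S[OF assms]) auto
  then show ?case by (simp add: algebra_simps)
next
  case (Suc n)
  then obtain D' where D: "D = Suc D'" "Suc n \<le> D'" by (cases D) auto
  let ?A = "\<lambda>r. - meanB + (1 - \<mu>) * B r + meanB * real (fst r)"
  have "centred (cp d0 Y (Suc D')) (\<lambda>st. snd st (Suc (Suc n)) - \<mu> * snd st (Suc n) - meanB)
    ((\<integral>r. (?A r)\<^sup>2 \<partial>rootp) + \<mu> * vR (2 * vS y0 v0 (Suc 0) + 2 * \<mu>\<^sup>2 * vS y0 v0 0) n)"
    by (rule centred_cp_step[OF Suc.IH[OF D(2)] centred_root])
       (simp_all add: sum_subtractf sum.distrib sum_distrib_left algebra_simps)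
  then show ?case unfolding D by simp
qed

text \<open>\<open>vS\<close> is driven by \<open>(mS y0 n)^2\<close>, of order \<mu>^(2n), which
  dominates the factor \<mu> of the recursion. \<open>vR\<close> is driven by a constant and so
  grows only like \<mu>^n; this gap is what the growth argument exploits.\<close>

lemma moment_bounds:
  assumes "1 < \<mu>" "0 \<le> v0" "0 \<le> v"
  shows "y0 - \<bar>meanB\<bar> / (\<mu> - 1) \<ge> 0 \<Longrightarrow> (y0 - \<bar>meanB\<bar> / (\<mu> - 1)) * \<mu> ^ n \<le> mS y0 n"
    and "\<bar>mS y0 n\<bar> \<le> (\<bar>y0\<bar> + \<bar>meanB\<bar> / (\<mu> - 1)) * \<mu> ^ n"
    and "\<exists>C\<ge>0. \<forall>n. vS y0 v0 n \<le> C * \<mu> ^ (2 * n)"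
    and "\<exists>C\<ge>0. \<forall>n. vR v n \<le> C * \<mu> ^ n"
proof -
  have mu: "\<mu> - 1 > 0" using assms by simp
  \<comment> \<open>\<open>q\<close> is the fixed point of
    \<open>x \<mapsto> \<mu> * x - \<bar>meanB\<bar>\<close>, so the worst effect of
    \<open>meanB\<close> over all generations is a shift of the initial value by
    \<open>q\<close>.\<close>
  define q where "q = \<bar>meanB\<bar> / (\<mu> - 1)"
  have q: "\<mu> * q = \<bar>meanB\<bar> + q" "0 \<le> q" using mu by (auto simp: q_def field_simps)
  show "(y0 - \<bar>meanB\<bar> / (\<mu> - 1)) * \<mu> ^ n \<le> mS y0 n" if "y0 - \<bar>meanB\<bar> / (\<mu> - 1) \<ge> 0"
  proof -
    have "(y0 - q) * \<mu> ^ n + q \<le> mS y0 n"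
    proof (induction n)
      case (Suc n)
      have "\<mu> * ((y0 - q) * \<mu> ^ n + q) \<le> \<mu> * mS y0 n" using Suc mu by (intro mult_left_mono) auto
      then have "(y0 - q) * \<mu> ^ Suc n + \<mu> * q \<le> \<mu> * mS y0 n" by (simp add: algebra_simps)
      then show ?case using q by simp
    qed simp
    then show ?thesis using q unfolding q_def by linarith
  qed
  have mabs: "\<bar>mS y0 n\<bar> \<le> (\<bar>y0\<bar> + q) * \<mu> ^ n - q" for n
  proof (induction n)
    case (Suc n)
    have "\<bar>\<mu> * mS y0 n\<bar> = \<mu> * \<bar>mS y0 n\<bar>" by (subst abs_mult, subst abs_of_pos) (use mu in auto)
    then have "\<bar>meanB + \<mu> * mS y0 n\<bar> \<le> \<bar>meanB\<bar> + \<mu> * \<bar>mS y0 n\<bar>"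
      using abs_triangle_ineq[of meanB "\<mu> * mS y0 n"] by linarith
    also have "\<dots> \<le> \<bar>meanB\<bar> + \<mu> * ((\<bar>y0\<bar> + q) * \<mu> ^ n - q)" using Suc mu by (intro add_left_mono mult_left_mono) auto
    also have "\<dots> = (\<bar>y0\<bar> + q) * \<mu> ^ Suc n - q" using q by (simp add: algebra_simps)
    finally show ?case by simp
  qed simp
  then show mabs': "\<bar>mS y0 n\<bar> \<le> (\<bar>y0\<bar> + \<bar>meanB\<bar> / (\<mu> - 1)) * \<mu> ^ n" for n
    using q(2) unfolding q_def by (smt (verit))
  define Cm where "Cm = \<bar>y0\<bar> + \<bar>meanB\<bar> / (\<mu> - 1)"
  define wB where "wB = (\<integral>r. (- meanB + 1 * B r + 0 * real (fst r))\<^sup>2 \<partial>rootp)"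
  define wk where "wk = (\<integral>r. (- \<mu> + 0 * B r + 1 * real (fst r))\<^sup>2 \<partial>rootp)"
  have w: "0 \<le> wB" "0 \<le> wk" by (auto simp: wB_def wk_def)
  have Wle: "(\<integral>r. (- (meanB + \<mu> * m) + 1 * B r + m * real (fst r))\<^sup>2 \<partial>rootp) \<le> 2 * wB + 2 * m\<^sup>2 * wk" for m
  proof -
    have "centred rootp (\<lambda>r. (- meanB + 1 * B r + 0 * real (fst r)) - (- m) * (- \<mu> + 0 * B r + 1 * real (fst r)))
      (2 * wB + 2 * (- m)\<^sup>2 * wk)"
      unfolding wB_def wk_def by (intro centred_diff centred_root) auto
    then show ?thesis by (simp add: centred_def algebra_simps)
  qed
  define C1 where "C1 = 2 * wB + 2 * Cm\<^sup>2 * wk"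
  have C1: "0 \<le> C1" using w by (simp add: C1_def)
  \<comment> \<open>The second summand is what closes the induction, giving
    \<open>C1 + \<mu> * C2 \<le> C2 * \<mu>^2\<close>; the first covers
    \<open>n = 0\<close>.\<close>
  define C2 where "C2 = v0 + C1 / (\<mu>\<^sup>2 - \<mu>)"
  have mm: "\<mu>\<^sup>2 - \<mu> > 0"
    using mult_strict_left_mono[OF assms(1), of \<mu>] assms(1) by (simp add: power2_eq_square)
  have C2: "C1 + \<mu> * C2 \<le> C2 * \<mu>\<^sup>2"
  proof -
    have "C1 \<le> C2 * (\<mu>\<^sup>2 - \<mu>)" using mm assms(2) by (simp add: C2_def distrib_right)
    then show ?thesis by (simp add: algebra_simps)
  qed
  have "vS y0 v0 n \<le> C2 * \<mu> ^ (2 * n)" for n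
  proof (induction n)
    case 0
    then show ?case using C1 mm by (simp add: C2_def)
  next
    case (Suc n)
    have one: "1 \<le> \<mu> ^ (2 * n)" using assms(1) by (intro one_le_power) simp
    have "(mS y0 n)\<^sup>2 \<le> (Cm * \<mu> ^ n)\<^sup>2"
      using mabs'[of n] unfolding Cm_def by (meson abs_le_square_iff abs_ge_self order_trans)
    also have "\<dots> = Cm\<^sup>2 * \<mu> ^ (2 * n)" by (simp add: power_mult_distrib power_mult[symmetric] mult.commute)
    finally have m2: "(mS y0 n)\<^sup>2 \<le> Cm\<^sup>2 * \<mu> ^ (2 * n)" .
    have "vS y0 v0 (Suc n) \<le> (2 * wB + 2 * (mS y0 n)\<^sup>2 * wk) + \<mu> * vS y0 v0 n" using Wle by simp
    also have "\<dots> \<le> (2 * wB * \<mu> ^ (2 * n) + 2 * (Cm\<^sup>2 * \<mu> ^ (2 * n)) * wk) + \<mu> * (C2 * \<mu> ^ (2 * n))"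
    proof (intro add_mono)
      show "2 * wB \<le> 2 * wB * \<mu> ^ (2 * n)" using mult_left_mono[OF one, of "2 * wB"] w by simp
      show "2 * (mS y0 n)\<^sup>2 * wk \<le> 2 * (Cm\<^sup>2 * \<mu> ^ (2 * n)) * wk"
        using m2 w by (intro mult_right_mono mult_left_mono) auto
      show "\<mu> * vS y0 v0 n \<le> \<mu> * (C2 * \<mu> ^ (2 * n))" using mult_left_mono[OF Suc, of \<mu>] mu by simp
    qed
    also have "\<dots> = (C1 + \<mu> * C2) * \<mu> ^ (2 * n)" by (simp add: C1_def algebra_simps)
    also have "\<dots> \<le> (C2 * \<mu>\<^sup>2) * \<mu> ^ (2 * n)" using C2 mu by (intro mult_right_mono) auto
    also have "\<dots> = C2 * \<mu> ^ (2 * Suc n)" by (simp add: power2_eq_square)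
    finally show ?case .
  qed
  moreover have "0 \<le> C2" using assms C1 mm by (simp add: C2_def)
  ultimately show "\<exists>C\<ge>0. \<forall>n. vS y0 v0 n \<le> C * \<mu> ^ (2 * n)" by blast
  define w' where "w' = (\<integral>r. (- meanB + (1 - \<mu>) * B r + meanB * real (fst r))\<^sup>2 \<partial>rootp)"
  define p where "p = w' / (\<mu> - 1)"
  have "0 \<le> w'" by (simp add: w'_def)
  then have p: "\<mu> * p = w' + p" "0 \<le> p" using mu by (auto simp: p_def field_simps)
  have vr: "vR v n \<le> (v + p) * \<mu> ^ n - p" for n
  proof (induction n)
    case (Suc n)
    have "vR v (Suc n) = w' + \<mu> * vR v n" by (simp add: w'_def)
    also have "\<dots> \<le> w' + \<mu> * ((v + p) * \<mu> ^ n - p)" using Suc mu by (intro add_left_mono mult_left_mono) auto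
    also have "\<dots> = (v + p) * \<mu> ^ Suc n - p" using p by (simp add: algebra_simps)
    finally show ?case .
  qed simp
  have "vR v n \<le> (v + p) * \<mu> ^ n" for n using vr[of n] p(2) by linarith
  moreover have "0 \<le> v + p" using p assms by simp
  ultimately show "\<exists>C\<ge>0. \<forall>n. vR v n \<le> C * \<mu> ^ n" by blast
qed

text \<open>Paley-Zygmund gives size of order \<mu>^N at a single depth \<open>N\<close> with a
  probability \<delta> not depending on \<open>N\<close>. From there \<open>S\<close> is propagated
  by \<open>S (n + 1) = \<mu> * S n + meanB + R n\<close>, outside the event that some later
  innovation \<open>R n\<close> is large; for \<open>N\<close> large that event costs less than half
  of \<delta>.\<close>

lemma growth_coupled:
  assumes mu: "1 < \<mu>" and Y: "integrable (p1 d0) (\<lambda>z. (Y z)\<^sup>2)"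
    and large: "\<bar>meanB\<bar> / (\<mu> - 1) < (\<integral>z. Y z \<partial>p1 d0)"
  shows "\<exists>c>0. \<exists>\<delta>>0. \<exists>N. \<forall>D\<ge>N. \<delta> \<le> measure_pmf.prob (cp d0 Y D) {st. \<forall>n\<in>{N..D}. c * \<mu> ^ n \<le> snd st n}"
proof -
  define y0 where "y0 = (\<integral>z. Y z \<partial>p1 d0)"
  define v0 where "v0 = (\<integral>z. (Y z - y0)\<^sup>2 \<partial>p1 d0)"
  have v0: "0 \<le> v0" by (simp add: v0_def)
  define \<theta> where "\<theta> = y0 - \<bar>meanB\<bar> / (\<mu> - 1)"
  have \<theta>: "\<theta> > 0" using large by (simp add: \<theta>_def y0_def)
  have mS_ge: "\<theta> * \<mu> ^ n \<le> mS y0 n" for n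
    using moment_bounds(1)[OF mu order_refl order_refl, of y0 n] \<theta> by (simp add: \<theta>_def)
  define Cm where "Cm = \<bar>y0\<bar> + \<bar>meanB\<bar> / (\<mu> - 1)"
  have mS_abs: "\<bar>mS y0 n\<bar> \<le> Cm * \<mu> ^ n" for n
    using moment_bounds(2)[OF mu order_refl order_refl, of y0 n] by (simp add: Cm_def)
  obtain C2 where C2: "0 \<le> C2" "\<And>n. vS y0 v0 n \<le> C2 * \<mu> ^ (2 * n)"
    using moment_bounds(3)[OF mu v0 order_refl, of y0] by blast
  let ?v = "2 * vS y0 v0 (Suc 0) + 2 * \<mu>\<^sup>2 * vS y0 v0 0"
  have "0 \<le> vS y0 v0 n" for n by (induction n) (use v0 mu in auto)
  then have "0 \<le> ?v" by (intro add_nonneg_nonneg mult_nonneg_nonneg) (simp_all del: vS.simps)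
  then obtain CR where CR: "0 \<le> CR" "\<And>n. vR ?v n \<le> CR * \<mu> ^ n"
    using moment_bounds(4)[OF mu order_refl, of ?v] by blast
  note cS = centred_S[OF Y y0_def v0_def] and cR = centred_R[OF Y y0_def v0_def]
  define C3 where "C3 = Cm\<^sup>2 + C2 + 1"
  have C3: "C3 > 0" using C2 by (simp add: C3_def add_nonneg_pos)
  define \<delta> where "\<delta> = \<theta>\<^sup>2 / (4 * C3)"
  have \<delta>: "\<delta> > 0" using \<theta> C3 by (simp add: \<delta>_def)
  have PZ: "\<delta> \<le> measure_pmf.prob (cp d0 Y D) {st. \<theta> * \<mu> ^ n / 2 \<le> snd st n}" if "n \<le> D" for n D
  proof -
    have c: "integrable (cp d0 Y D) (\<lambda>st. (snd st n - mS y0 n)\<^sup>2)"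
      "(\<integral>st. snd st n - mS y0 n \<partial>cp d0 Y D) = 0"
      "(\<integral>st. (snd st n - mS y0 n)\<^sup>2 \<partial>cp d0 Y D) \<le> vS y0 v0 n"
      using cS[OF that] by (auto simp: centred_def)
    note sh = integral_shift_square[OF c(1), of "mS y0 n"]
    have i2: "integrable (cp d0 Y D) (\<lambda>st. (snd st n)\<^sup>2)" using sh(1) by simp
    have m: "(\<integral>st. snd st n \<partial>cp d0 Y D) = mS y0 n"
      using c(2) integrable_of_square[OF i2] by simp
    have "(\<integral>st. (snd st n)\<^sup>2 \<partial>cp d0 Y D) \<le> (mS y0 n)\<^sup>2 + vS y0 v0 n"
      using sh(2) c by simp
    also have "\<dots> \<le> Cm\<^sup>2 * \<mu> ^ (2 * n) + C2 * \<mu> ^ (2 * n)"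
    proof (intro add_mono C2)
      have "(mS y0 n)\<^sup>2 \<le> (Cm * \<mu> ^ n)\<^sup>2" using mS_abs[of n] by (meson abs_le_square_iff abs_ge_self order_trans)
      then show "(mS y0 n)\<^sup>2 \<le> Cm\<^sup>2 * \<mu> ^ (2 * n)" by (simp add: power_mult_distrib power_mult[symmetric] mult.commute)
    qed
    also have "\<dots> \<le> C3 * \<mu> ^ (2 * n)" using mu by (simp add: C3_def distrib_right)
    finally have V: "(\<integral>st. (snd st n)\<^sup>2 \<partial>cp d0 Y D) \<le> C3 * \<mu> ^ (2 * n)" .
    have "(\<theta> * \<mu> ^ n)\<^sup>2 / (4 * (C3 * \<mu> ^ (2 * n))) \<le> measure_pmf.prob (cp d0 Y D) {st. \<theta> * \<mu> ^ n / 2 \<le> snd st n}"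
      by (rule prob_large_of_second_moment[OF i2 _ _ V]) (use mS_ge m \<theta> mu in auto)
    moreover have "lam \<noteq> 0" "s \<noteq> 0" using mu by auto
    then have "(\<theta> * \<mu> ^ n)\<^sup>2 / (4 * (C3 * \<mu> ^ (2 * n))) = \<delta>"
      by (simp add: \<delta>_def power_mult_distrib power_mult[symmetric] mult.commute)
    ultimately show ?thesis by simp
  qed
  \<comment> \<open>\<open>r\<close> is \<mu>^(1/4). Innovations are tolerated up to
    \<open>r ^ (3 * n)\<close>, that is \<mu>^(3n/4): this is small against \<mu>^n, with quotient
    \<open>u ^ n\<close>, yet large against their standard deviation \<mu>^(n/2), so Chebyshev
    errors are of order \<open>u ^ (2 * n)\<close>.\<close>
  define r where "r = sqrt (sqrt \<mu>)"
  have r1: "r > 1" using mu by (simp add: r_def)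
  have r4: "\<mu> = r ^ 4"
  proof -
    have "r ^ 4 = (r\<^sup>2)\<^sup>2" by simp
    also have "\<dots> = \<mu>" using mu by (simp add: r_def)
    finally show ?thesis by simp
  qed
  define u where "u = 1 / r"
  have u: "0 < u" "u < 1" using r1 by (auto simp: u_def)
  have u2: "0 \<le> u\<^sup>2" "u\<^sup>2 < 1" using u by (auto simp: power_less_one_iff)
  have lim1: "(\<lambda>N. (\<bar>meanB\<bar> + 1) * u ^ N / (1 - u)) \<longlonglongrightarrow> (\<bar>meanB\<bar> + 1) * 0 / (1 - u)"
    using u by (intro tendsto_intros LIMSEQ_power_zero) auto
  have lim2: "(\<lambda>N. CR * ((u\<^sup>2) ^ N / (1 - u\<^sup>2))) \<longlonglongrightarrow> CR * (0 / (1 - u\<^sup>2))"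
    using u u2 by (intro tendsto_intros LIMSEQ_power_zero) auto
  \<comment> \<open>\<open>N\<close> serves two ends: the total loss of the growth constant stays
    below \<open>\<theta> / 4\<close>, and the bad innovations have total probability below
    \<open>\<delta> / 2\<close>.\<close>
  have "eventually (\<lambda>N. (\<bar>meanB\<bar> + 1) * u ^ N / (1 - u) < \<theta> / 4 \<and> CR * ((u\<^sup>2) ^ N / (1 - u\<^sup>2)) < \<delta> / 2) sequentially"
    using order_tendstoD(2)[OF lim1, of "\<theta> / 4"] order_tendstoD(2)[OF lim2, of "\<delta> / 2"] \<theta> \<delta>
    by (simp add: eventually_conj)
  then obtain N where N: "(\<bar>meanB\<bar> + 1) * u ^ N / (1 - u) < \<theta> / 4" "CR * ((u\<^sup>2) ^ N / (1 - u\<^sup>2)) < \<delta> / 2"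
    by (auto dest!: eventually_happens)
  have "\<delta> / 2 \<le> measure_pmf.prob (cp d0 Y D) {st. \<forall>n\<in>{N..D}. \<theta> / 4 * \<mu> ^ n \<le> snd st n}" if D: "N \<le> D" for D
  proof -
    let ?R = "\<lambda>n st. snd st (Suc n) - \<mu> * snd st n - meanB"
    let ?good = "{st :: (ltree \<times> ltree) \<times> (nat \<Rightarrow> real). \<forall>n\<in>{N..D}. \<theta> / 4 * \<mu> ^ n \<le> snd st n}"
    let ?bad = "\<lambda>n. {st :: (ltree \<times> ltree) \<times> (nat \<Rightarrow> real). \<bar>?R n st\<bar> > r ^ (3 * n)}"
    have incl: "{st. \<theta> * \<mu> ^ N / 2 \<le> snd st N} \<subseteq> ?good \<union> (\<Union>n\<in>{N..<D}. ?bad n)"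
    proof
      fix st :: "(ltree \<times> ltree) \<times> (nat \<Rightarrow> real)"
      assume st: "st \<in> {st. \<theta> * \<mu> ^ N / 2 \<le> snd st N}"
      show "st \<in> ?good \<union> (\<Union>n\<in>{N..<D}. ?bad n)"
      proof (cases "st \<in> (\<Union>n\<in>{N..<D}. ?bad n)")
        case False
        then have Rle: "\<bar>?R n st\<bar> \<le> r ^ (3 * n)" if "n \<in> {N..<D}" for n using that by (auto simp: not_less)
        \<comment> \<open>The normalised lower bound starts at \<open>\<theta> / 2\<close> and loses
          \<open>(\<bar>meanB\<bar> + 1) * u ^ n\<close> at step \<open>n\<close>; the fraction is
          the geometric sum of the losses so far.\<close>
        have main: "n \<le> D \<longrightarrow> (\<theta> / 2 - (\<bar>meanB\<bar> + 1) * ((u ^ N - u ^ n) / (1 - u))) * \<mu> ^ n \<le> snd st n" if "N \<le> n" for n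
          using that
        proof (induction n rule: dec_induct)
          case base
          then show ?case using st by simp
        next
          case (step n)
          show ?case
          proof
            assume nD: "Suc n \<le> D"
            let ?c = "\<lambda>n. \<theta> / 2 - (\<bar>meanB\<bar> + 1) * ((u ^ N - u ^ n) / (1 - u))"
            have r3: "1 \<le> r ^ (3 * n)" using r1 by (intro one_le_power) simp
            have ur: "u ^ n * \<mu> ^ n = r ^ (3 * n)"
            proof -
              have "u * \<mu> = r ^ 3" using r1 by (simp add: u_def r4 power4_eq_xxxx power3_eq_cube)
              then show ?thesis by (simp add: power_mult_distrib[symmetric] power_mult)
            qed
            have cdiff: "?c (Suc n) = ?c n - (\<bar>meanB\<bar> + 1) * u ^ n"
              using u by (simp add: field_simps)
            have "?c (Suc n) * \<mu> ^ Suc n = \<mu> * (?c n * \<mu> ^ n) - \<mu> * ((\<bar>meanB\<bar> + 1) * (u ^ n * \<mu> ^ n))"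
              unfolding cdiff by (simp add: algebra_simps)
            also have "\<dots> \<le> \<mu> * snd st n - \<mu> * ((\<bar>meanB\<bar> + 1) * r ^ (3 * n))"
              unfolding ur using step.IH nD mu by (intro diff_right_mono mult_left_mono) auto
            also have "\<dots> \<le> \<mu> * snd st n - (\<bar>meanB\<bar> + 1) * r ^ (3 * n)"
            proof -
              have "0 \<le> (\<bar>meanB\<bar> + 1) * r ^ (3 * n)" using r3 by (intro mult_nonneg_nonneg) auto
              from mult_right_mono[OF less_imp_le[OF mu] this] show ?thesis by simp
            qed
            also have "\<dots> \<le> \<mu> * snd st n - \<bar>meanB\<bar> - r ^ (3 * n)"
              using r3 mult_left_mono[OF r3, of "\<bar>meanB\<bar>"] by (simp add: distrib_right)
            also have "\<dots> \<le> snd st (Suc n)"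
              using Rle[of n] nD step.hyps by (auto simp: abs_le_iff)
            finally show "?c (Suc n) * \<mu> ^ Suc n \<le> snd st (Suc n)" .
          qed
        qed
        have "\<theta> / 4 * \<mu> ^ n \<le> snd st n" if n: "n \<in> {N..D}" for n
        proof -
          have "(\<bar>meanB\<bar> + 1) * ((u ^ N - u ^ n) / (1 - u)) \<le> (\<bar>meanB\<bar> + 1) * (u ^ N / (1 - u))"
            using u by (intro mult_left_mono divide_right_mono) auto
          then have "\<theta> / 4 \<le> \<theta> / 2 - (\<bar>meanB\<bar> + 1) * ((u ^ N - u ^ n) / (1 - u))"
            using N(1) unfolding times_divide_eq_right by linarith
          then have "\<theta> / 4 * \<mu> ^ n \<le> (\<theta> / 2 - (\<bar>meanB\<bar> + 1) * ((u ^ N - u ^ n) / (1 - u))) * \<mu> ^ n"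
            using mu by (intro mult_right_mono) auto
          also have "\<dots> \<le> snd st n" using main[of n] n by auto
          finally show ?thesis .
        qed
        then show ?thesis by blast
      qed blast
    qed
    have bad: "measure_pmf.prob (cp d0 Y D) (?bad n) \<le> CR * (u\<^sup>2) ^ n" if n: "n \<in> {N..<D}" for n
    proof -
      have "measure_pmf.prob (cp d0 Y D) (?bad n) \<le> vR ?v n / (r ^ (3 * n))\<^sup>2"
        by (rule prob_large_centred[OF cR]) (use n r1 in auto)
      also have "\<dots> \<le> (CR * \<mu> ^ n) / (r ^ (3 * n))\<^sup>2" using CR by (intro divide_right_mono) auto
      also have "\<dots> = CR * (u\<^sup>2) ^ n"
      proof -
        have "\<mu> ^ n / (r ^ (3 * n))\<^sup>2 = (r ^ 4 / r ^ 6) ^ n"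
          by (simp add: r4 power_divide power_mult[symmetric] mult.commute)
        also have "r ^ 4 / r ^ 6 = u\<^sup>2" using r1 by (simp add: u_def field_simps power_numeral_reduce)
        finally show ?thesis by (simp only: times_divide_eq_right[symmetric])
      qed
      finally show ?thesis .
    qed
    have "\<delta> \<le> measure_pmf.prob (cp d0 Y D) (?good \<union> (\<Union>n\<in>{N..<D}. ?bad n))"
      by (rule order_trans[OF PZ[OF D] measure_pmf.finite_measure_mono[OF incl]]) simp
    also have "\<dots> \<le> measure_pmf.prob (cp d0 Y D) ?good + measure_pmf.prob (cp d0 Y D) (\<Union>n\<in>{N..<D}. ?bad n)"
      by (rule measure_Un_le) auto
    also have "measure_pmf.prob (cp d0 Y D) (\<Union>n\<in>{N..<D}. ?bad n) \<le> (\<Sum>n\<in>{N..<D}. measure_pmf.prob (cp d0 Y D) (?bad n))"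
      by (rule measure_UNION_le) auto
    also have "\<dots> \<le> (\<Sum>n\<in>{N..<D}. CR * (u\<^sup>2) ^ n)" by (intro sum_mono bad)
    also have "\<dots> \<le> CR * ((u\<^sup>2) ^ N / (1 - u\<^sup>2))"
      unfolding sum_distrib_left[symmetric] using CR by (intro mult_left_mono geometric_sum_le u2 D)
    finally show ?thesis using N(2) by linarith
  qed
  then show ?thesis using \<theta> \<delta> by (intro exI[of _ "\<theta> / 4"] conjI exI[of _ "\<delta> / 2"] exI[of _ N]) auto
qed

text \<open>Under \<open>p0\<close> the integrand becomes \<open>x * (ln x)^2\<close> with
  \<open>x < 1\<close>, bounded by \<open>2\<close> through \<open>t^2 \<le> 2 * exp t\<close> at
  \<open>t = - ln x\<close>. The bound is uniform in the depth.\<close>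

lemma ln_lr_neg_square:
  "(\<integral>\<^sup>+z. ennreal ((ln (lr n z))\<^sup>2) * indicator {z. lr n z < 1} z \<partial>p1 n) \<le> 2"
proof -
  have "(\<integral>\<^sup>+z. ennreal ((ln (lr n z))\<^sup>2) * indicator {z. lr n z < 1} z \<partial>p1 n) =
    (\<integral>\<^sup>+z. ennreal (lr n z) * (ennreal ((ln (lr n z))\<^sup>2) * indicator {z. lr n z < 1} z) \<partial>p0 n)"
    by (rule nn_integral_p1)
  also have "\<dots> \<le> (\<integral>\<^sup>+z. 2 \<partial>p0 n)"
  proof (intro nn_integral_mono)
    fix z
    have "lr n z * (ln (lr n z))\<^sup>2 \<le> 2" if "lr n z < 1"
    proof (cases "lr n z = 0")
      case False
      then have p: "lr n z > 0" using lr_nonneg[of n z] by simp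
      then have "(- ln (lr n z))\<^sup>2 \<le> 2 * exp (- ln (lr n z))" using that by (intro square_le_exp) auto
      then show ?thesis using p by (simp add: exp_minus field_simps)
    qed simp
    then show "ennreal (lr n z) * (ennreal ((ln (lr n z))\<^sup>2) * indicator {z. lr n z < 1} z) \<le> 2"
      by (auto simp: indicator_def ennreal_mult'[symmetric] lr_nonneg simp flip: ennreal_numeral)
  qed
  also have "\<dots> = 2" by (simp add: measure_pmf.emeasure_space_1[simplified])
  finally show ?thesis .
qed

text \<open>\<open>Y\<close> is the log-ratio capped at \<open>M\<close>: the cap bounds the square
  from above, \<open>ln_lr_neg_square\<close> handles negative values, and by dominated convergence
  a large \<open>M\<close> keeps the mean above \<open>K\<close>.\<close>

lemma ex_truncation:
  assumes KL: "filterlim (KL lam s) at_top sequentially"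
  shows "\<exists>d0 (Y :: ltree \<times> ltree \<Rightarrow> real). integrable (p1 d0) (\<lambda>z. (Y z)\<^sup>2) \<and> K < (\<integral>z. Y z \<partial>p1 d0) \<and>
    (\<forall>z\<in>set_pmf (p1 d0). exp (Y z) \<le> lr d0 z)"
proof -
  have "eventually (\<lambda>d. KL lam s d > max K 0) sequentially" using KL unfolding filterlim_at_top_dense by blast
  then obtain d0 where d0: "KL lam s d0 > K" "KL lam s d0 > 0" by (auto dest!: eventually_happens)
  let ?X = "\<lambda>z. ln (lr d0 z)"
  have int: "integrable (p1 d0) ?X"
    \<comment> \<open>A nonzero Bochner integral certifies integrability; this is why
      \<open>d0\<close> was chosen with positive relative entropy.\<close>
    using d0(2) not_integrable_integral_eq[of "p1 d0" ?X] unfolding KL_eq by auto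
  have "(\<lambda>M. \<integral>z. min (real M) (?X z) \<partial>p1 d0) \<longlonglongrightarrow> (\<integral>z. ?X z \<partial>p1 d0)"
  proof (rule integral_dominated_convergence[where w = "\<lambda>z. \<bar>?X z\<bar>"])
    show "AE z in p1 d0. (\<lambda>M. min (real M) (?X z)) \<longlonglongrightarrow> ?X z"
    proof (rule AE_I2)
      fix z
      obtain M0 :: nat where M0: "?X z \<le> real M0" using real_arch_simple by blast
      have "eventually (\<lambda>M. min (real M) (?X z) = ?X z) sequentially"
        using eventually_ge_at_top[of M0] by eventually_elim (use M0 in auto)
      then show "(\<lambda>M. min (real M) (?X z)) \<longlonglongrightarrow> ?X z" by (rule tendsto_eventually)
    qed
  qed (use int in auto)
  then have "eventually (\<lambda>M. (\<integral>z. min (real M) (?X z) \<partial>p1 d0) > K) sequentially"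
    using d0(1) unfolding KL_eq by (rule order_tendstoD)
  then obtain M :: nat where M: "(\<integral>z. min (real M) (?X z) \<partial>p1 d0) > K" by (auto dest!: eventually_happens)
  let ?Y = "\<lambda>z. min (real M) (?X z)"
  have "(\<integral>\<^sup>+z. ennreal ((?Y z)\<^sup>2) \<partial>p1 d0) \<le>
      (\<integral>\<^sup>+z. ennreal ((real M)\<^sup>2) + ennreal ((ln (lr d0 z))\<^sup>2) * indicator {z. lr d0 z < 1} z \<partial>p1 d0)"
  proof (rule nn_integral_mono_AE, unfold AE_measure_pmf_iff, safe)
    fix x y assume z: "(x, y) \<in> set_pmf (p1 d0)"
    have p: "lr d0 (x, y) > 0" using lr_pos[OF z] .
    show "ennreal ((?Y (x, y))\<^sup>2) \<le> ennreal ((real M)\<^sup>2) + ennreal ((ln (lr d0 (x, y)))\<^sup>2) * indicator {z. lr d0 z < 1} (x, y)"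
    proof (cases "lr d0 (x, y) < 1")
      case True
      then have "ln (lr d0 (x, y)) < 0" using p by simp
      then have "?Y (x, y) = ln (lr d0 (x, y))" by simp
      then show ?thesis using True by simp
    next
      case False
      then have "0 \<le> ?Y (x, y)" "?Y (x, y) \<le> real M" by auto
      then have "(?Y (x, y))\<^sup>2 \<le> (real M)\<^sup>2" by (rule power_mono[rotated])
      then show ?thesis using False by (simp add: ennreal_leI)
    qed
  qed
  also have "\<dots> \<le> ennreal ((real M)\<^sup>2) + 2"
    using ln_lr_neg_square[of d0]
    by (subst nn_integral_add) (auto simp: measure_pmf.emeasure_space_1[simplified] intro!: add_left_mono)
  also have "\<dots> < \<infinity>" by simp
  finally have "integrable (p1 d0) (\<lambda>z. (?Y z)\<^sup>2)" by (intro integrableI_nonneg) auto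
  moreover have "exp (?Y z) \<le> lr d0 z" if "z \<in> set_pmf (p1 d0)" for z
  proof -
    have "exp (?Y z) \<le> exp (ln (lr d0 z))" by simp
    then show ?thesis using lr_pos[OF that] by simp
  qed
  ultimately show ?thesis using M by (intro exI[of _ d0] exI[of _ ?Y]) auto
qed

lemma positive_growth:
  assumes mu: "1 < \<mu>" and KL: "filterlim (KL lam s) at_top sequentially"
  shows "\<exists>c>0. \<exists>\<delta>>0. \<exists>N. \<forall>D\<ge>N. \<delta> \<le> measure_pmf.prob (p1 D) {z. \<forall>n\<in>{N..D}. exp (c * \<mu> ^ n) \<le> lr n (prune2 n z)}"
proof -
  obtain d0 and Y :: "ltree \<times> ltree \<Rightarrow> real" where Y: "integrable (p1 d0) (\<lambda>z. (Y z)\<^sup>2)"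
    "\<bar>meanB\<bar> / (\<mu> - 1) < (\<integral>z. Y z \<partial>p1 d0)" "\<And>z. z \<in> set_pmf (p1 d0) \<Longrightarrow> exp (Y z) \<le> lr d0 z"
    using ex_truncation[OF KL, of "\<bar>meanB\<bar> / (\<mu> - 1)"] by blast
  obtain c \<delta> N where c: "c > 0" "\<delta> > 0"
    "\<And>D. D \<ge> N \<Longrightarrow> \<delta> \<le> measure_pmf.prob (cp d0 Y D) {st. \<forall>n\<in>{N..D}. c * \<mu> ^ n \<le> snd st n}"
    using growth_coupled[OF mu Y(1,2)] by blast
  \<comment> \<open>Level \<open>n\<close> of the coupled sums speaks about depth
    \<open>n + d0\<close>, so the rate is rescaled by \<mu> to the power \<open>d0\<close>.\<close>
  let ?c = "c / \<mu> ^ d0"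
  have "\<delta> \<le> measure_pmf.prob (p1 D) {z. \<forall>n\<in>{N + d0..D}. exp (?c * \<mu> ^ n) \<le> lr n (prune2 n z)}"
    (is "_ \<le> measure_pmf.prob _ ?A") if D: "D \<ge> N + d0" for D
  proof -
    obtain D' where D': "D = D' + d0" "N \<le> D'" using D by (metis add_le_cancel_right le_add2 le_trans ordered_cancel_comm_monoid_diff_class.diff_add)
    have "\<delta> \<le> measure_pmf.prob (cp d0 Y D') {st. \<forall>n\<in>{N..D'}. c * \<mu> ^ n \<le> snd st n}" using c(3)[OF D'(2)] .
    also have "\<dots> \<le> measure_pmf.prob (cp d0 Y D') (fst -` ?A)"
    proof (rule measure_pmf.finite_measure_mono_AE, unfold AE_measure_pmf_iff, intro ballI impI)
      fix st assume st: "st \<in> set_pmf (cp d0 Y D')" and le: "st \<in> {st. \<forall>n\<in>{N..D'}. c * \<mu> ^ n \<le> snd st n}"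
      show "st \<in> fst -` ?A"
        unfolding vimage_eq mem_Collect_eq
      proof
        fix n assume n: "n \<in> {N + d0..D}"
        then obtain m where m: "n = m + d0" "m \<in> {N..D'}" unfolding D'(1)
          by (metis add_le_cancel_right atLeastAtMost_iff le_add2 le_trans ordered_cancel_comm_monoid_diff_class.diff_add)
        have "lam \<noteq> 0" "s \<noteq> 0" using mu by auto
        then have "?c * \<mu> ^ n = c * \<mu> ^ m" by (simp add: m power_add)
        then have "exp (?c * \<mu> ^ n) \<le> exp (snd st m)" using le m by simp
        also have "\<dots> \<le> lr n (prune2 n (fst st))" unfolding m(1) using cp_lower[OF Y(3) st, of m] m(2) by simp
        finally show "exp (?c * \<mu> ^ n) \<le> lr n (prune2 n (fst st))" .
      qed
    qed simp
    also have "\<dots> = measure_pmf.prob (p1 D) ?A"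
      unfolding D'(1) map_fst_cp[of d0 Y D', symmetric] by (simp only: measure_map_pmf)
    finally show ?thesis .
  qed
  then show ?thesis using c mu by (intro exI[of _ ?c] conjI exI[of _ \<delta>] exI[of _ "N + d0"]) auto
qed

end

section \<open>Extinction\<close>

lemma prob_bind_pmf: "measure_pmf.prob (bind_pmf p f) A = (\<integral>x. measure_pmf.prob (f x) A \<partial>measure_pmf p)"
proof -
  have int: "integrable (measure_pmf p) (\<lambda>x. measure_pmf.prob (f x) A)"
    by (rule measure_pmf.integrable_const_bound[where B = 1]) auto
  have "ennreal (measure_pmf.prob (bind_pmf p f) A) = (\<integral>\<^sup>+x. ennreal (measure_pmf.prob (f x) A) \<partial>p)"
    by (simp add: measure_pmf.emeasure_eq_measure[symmetric])
  also have "\<dots> = ennreal (\<integral>x. measure_pmf.prob (f x) A \<partial>p)"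
    by (rule nn_integral_eq_integral[OF int]) simp
  finally show ?thesis by simp
qed

definition short :: "nat \<Rightarrow> ltree set" where
  "short n = {t. \<forall>m\<in>t. length m \<noteq> n}"

definition ext :: "real \<Rightarrow> nat \<Rightarrow> real" where
  "ext \<mu> n = measure_pmf.prob (gwp \<mu> n) (short n)"

lemma ext_0: "ext \<mu> 0 = 0"
  by (simp add: ext_def short_def)

lemma ext_Suc:
  assumes "0 \<le> \<mu>" shows "ext \<mu> (Suc n) = exp (\<mu> * (ext \<mu> n - 1))"
proof -
  have short: "node c F \<in> short (Suc n) \<longleftrightarrow> F \<in> Pi {1..c} (\<lambda>_. short n)" for c F
  proof
    assume *: "node c F \<in> short (Suc n)"
    have "length u \<noteq> n" if "i \<in> {1..c}" "u \<in> F i" for i u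
    proof -
      have "i # u \<in> node c F" using that by simp
      then have "length (i # u) \<noteq> Suc n" using * unfolding short_def by blast
      then show ?thesis by simp
    qed
    then show "F \<in> Pi {1..c} (\<lambda>_. short n)" by (auto simp: short_def)
  next
    assume "F \<in> Pi {1..c} (\<lambda>_. short n)"
    then show "node c F \<in> short (Suc n)" by (fastforce simp: short_def node_def Pi_def)
  qed
  have "measure_pmf.prob (Pi_pmf {1..c} {[]} (\<lambda>_. gwp \<mu> n) \<bind> (\<lambda>F. return_pmf (node c F))) (short (Suc n)) = ext \<mu> n ^ c" for c
  proof -
    have "measure_pmf.prob (Pi_pmf {1..c} {[]} (\<lambda>_. gwp \<mu> n) \<bind> (\<lambda>F. return_pmf (node c F))) (short (Suc n)) =
      measure_pmf.prob (map_pmf (node c) (Pi_pmf {1..c} {[]} (\<lambda>_. gwp \<mu> n))) (short (Suc n))"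
      by (simp add: map_pmf_def)
    also have "\<dots> = measure_pmf.prob (Pi_pmf {1..c} {[]} (\<lambda>_. gwp \<mu> n)) (Pi {1..c} (\<lambda>_. short n))"
      unfolding measure_map_pmf using short by (intro arg_cong[where f = "measure_pmf.prob _"]) auto
    also have "\<dots> = ext \<mu> n ^ c" by (simp add: measure_Pi_pmf_Pi ext_def)
    finally show ?thesis .
  qed
  then have "ext \<mu> (Suc n) = (\<integral>c. ext \<mu> n ^ c \<partial>Poisson \<mu>)"
    by (simp add: ext_def[of _ "Suc n"] prob_bind_pmf)
  also have "\<dots> = exp (\<mu> * (ext \<mu> n - 1))" by (rule Poisson_pgf[OF assms]) (simp add: ext_def)
  finally show ?thesis .
qed

text \<open>The events "no node at depth \<open>n\<close>" increase with \<open>n\<close>, since a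
  node at depth \<open>n + 1\<close> has its parent at depth \<open>n\<close>. Extinction is their
  union.\<close>

lemma ext_tendsto_p_ext: "ext \<mu> \<longlonglongrightarrow> p_ext \<mu>" and ext_le_p_ext: "ext \<mu> n \<le> p_ext \<mu>"
proof -
  interpret G: prob_space "GW \<mu>" by (rule prob_space_GW)
  let ?E = "\<lambda>n. prune n -` short n \<inter> ltrees"
  have E: "?E n = {t \<in> ltrees. \<forall>m\<in>t. length m \<noteq> n}" for n
    by (auto simp: short_def prune_def)
  have meas: "?E n \<in> sets (GW \<mu>)" for n
    using measurable_sets[OF measurable_prune_UNIV, of "short n" n] by simp
  have eq: "measure (GW \<mu>) (?E n) = ext \<mu> n" for n
  proof -
    have "measure (distr (GW \<mu>) (count_space UNIV) (prune n)) (short n) = measure (GW \<mu>) (prune n -` short n \<inter> space (GW \<mu>))"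
      using measurable_prune_UNIV measurable_cong_sets[OF sets_GW refl] by (intro measure_distr) auto
    then show ?thesis by (simp add: distr_GW ext_def)
  qed
  have inc: "incseq ?E"
  proof (rule incseq_SucI)
    fix n
    show "?E n \<subseteq> ?E (Suc n)" unfolding E
    proof safe
      fix t m assume t: "t \<in> ltrees" "\<forall>m\<in>t. length m \<noteq> n" "m \<in> t" "length m = Suc n"
      then have "m = butlast m @ [last m]" by (cases m rule: rev_cases) auto
      then have "butlast m \<in> t" using t ltrees_snocD by metis
      then show False using t by auto
    qed
  qed
  have U: "(\<Union>n. ?E n) = {t \<in> ltrees. \<exists>n. \<forall>m\<in>t. length m \<noteq> n}" unfolding E by blast
  have "(\<lambda>n. measure (GW \<mu>) (?E n)) \<longlonglongrightarrow> measure (GW \<mu>) (\<Union>n. ?E n)"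
    using meas inc by (intro G.finite_Lim_measure_incseq) auto
  then show "ext \<mu> \<longlonglongrightarrow> p_ext \<mu>" unfolding eq U p_ext_def .
  show "ext \<mu> n \<le> p_ext \<mu>"
    unfolding eq[symmetric] p_ext_def U[symmetric]
    by (rule G.finite_measure_mono) (blast, intro sets.countable_UN, use meas in blast)
qed

lemma p_ext_fixed: "0 \<le> \<mu> \<Longrightarrow> p_ext \<mu> = exp (\<mu> * (p_ext \<mu> - 1))"
proof (rule LIMSEQ_unique)
  assume "0 \<le> \<mu>"
  have "(\<lambda>n. exp (\<mu> * (ext \<mu> n - 1))) \<longlonglongrightarrow> exp (\<mu> * (p_ext \<mu> - 1))"
    by (intro tendsto_intros ext_tendsto_p_ext)
  then show "(\<lambda>n. ext \<mu> (Suc n)) \<longlonglongrightarrow> exp (\<mu> * (p_ext \<mu> - 1))" using ext_Suc[OF \<open>0 \<le> \<mu>\<close>] by simp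
  show "(\<lambda>n. ext \<mu> (Suc n)) \<longlonglongrightarrow> p_ext \<mu>" by (rule LIMSEQ_Suc[OF ext_tendsto_p_ext])
qed

text \<open>Squaring the weak inequality at \<open>x / 2\<close> gains the strictly positive term
  \<open>x^2 / 4\<close>.\<close>

lemma exp_gt_add_one: "x \<noteq> 0 \<Longrightarrow> 1 + x < exp (x :: real)"
proof (cases "0 \<le> 1 + x / 2")
  case True
  assume "x \<noteq> 0"
  then have "0 < x\<^sup>2" by simp
  then have "1 + x < (1 + x / 2)\<^sup>2" by (simp add: power2_eq_square algebra_simps)
  also have "\<dots> \<le> (exp (x / 2))\<^sup>2" using True exp_ge_add_one_self[of "x / 2"] by (intro power_mono) auto
  also have "\<dots> = exp x" by (simp add: exp_double[symmetric])
  finally show ?thesis .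
next
  case False
  then show ?thesis using exp_gt_zero[of x] by linarith
qed

lemma p_ext_le_1: "p_ext \<mu> \<le> 1"
  unfolding p_ext_def using prob_space.prob_le_1[OF prob_space_GW] .

lemma p_ext_subcritical:
  assumes "0 \<le> \<mu>" "\<mu> \<le> 1" shows "p_ext \<mu> = 1"
proof (rule ccontr)
  assume "p_ext \<mu> \<noteq> 1"
  then have q: "p_ext \<mu> < 1" using p_ext_le_1[of \<mu>] by simp
  show False
  proof (cases "\<mu> = 0")
    case True then show ?thesis using p_ext_fixed[of \<mu>] q by simp
  next
    case False
    then have "1 + \<mu> * (p_ext \<mu> - 1) < p_ext \<mu>"
      using exp_gt_add_one[of "\<mu> * (p_ext \<mu> - 1)"] p_ext_fixed[OF assms(1)] q by simp
    moreover have "(1 - \<mu>) * (p_ext \<mu> - 1) \<le> 0" using assms q by (intro mult_nonneg_nonpos) auto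
    ultimately show ?thesis by (simp add: algebra_simps)
  qed
qed

text \<open>The offspring generating function maps \<open>[0, 1 - e]\<close> into itself for a
  suitable \<open>e > 0\<close>, so the iterates \<open>ext \<mu> n\<close>, which start at
  \<open>0\<close>, never leave that interval.\<close>

lemma p_ext_supercritical:
  assumes "1 < \<mu>" shows "p_ext \<mu> < 1"
proof -
  \<comment> \<open>With \<open>y = \<mu> * e\<close>, the bound
    \<open>exp (- y) \<le> 1 - y + y^2 / 2\<close> stays below \<open>1 - e\<close> as long as
    \<open>e\<close> is at most twice this value.\<close>
  define e where "e = (\<mu> - 1) / \<mu>\<^sup>2"
  have e: "0 < e" using assms by (simp add: e_def)
  define y where "y = \<mu> * e"
  have y: "0 < y" using e assms by (simp add: y_def)
  have "exp (- y) \<le> 1 - y + y\<^sup>2 / 2"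
  proof -
    have pos: "0 < 1 - y + y\<^sup>2 / 2"
    proof -
      have "0 \<le> (1 - y)\<^sup>2" by simp
      then show ?thesis by (simp add: power2_eq_square algebra_simps)
    qed
    \<comment> \<open>The upper bound on \<open>exp (- y)\<close> is obtained by inverting the lower
      Taylor bound on \<open>exp y\<close>: the two quadratic polynomials multiply to
      \<open>1 + y ^ 4 / 4\<close>.\<close>
    have "1 \<le> 1 + y ^ 4 / 4" by simp
    also have "\<dots> = (1 + y + y\<^sup>2 / 2) * (1 - y + y\<^sup>2 / 2)" by (simp add: power2_eq_square power4_eq_xxxx algebra_simps)
    also have "\<dots> \<le> exp y * (1 - y + y\<^sup>2 / 2)"
      using exp_lower_Taylor_quadratic[of y] y pos by (intro mult_right_mono) auto
    finally show ?thesis by (simp add: exp_minus field_simps)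
  qed
  also have "\<dots> \<le> 1 - e"
  proof -
    have "y\<^sup>2 = \<mu>\<^sup>2 * e * e" by (simp add: y_def power2_eq_square)
    also have "\<mu>\<^sup>2 * e = \<mu> - 1" using assms by (simp add: e_def)
    finally have "y\<^sup>2 = (\<mu> - 1) * e" .
    moreover have "0 \<le> (\<mu> - 1) * e" using assms e by simp
    ultimately show ?thesis by (simp add: y_def algebra_simps)
  qed
  finally have g: "exp (- y) \<le> 1 - e" .
  then have e1: "e < 1" using exp_gt_zero[of "- y"] by linarith
  have "ext \<mu> n \<le> 1 - e" for n
  proof (induction n)
    case 0 then show ?case using e1 by (simp add: ext_0)
  next
    case (Suc n)
    have "\<mu> * (ext \<mu> n - 1) \<le> \<mu> * (- e)" using Suc assms by (intro mult_left_mono) auto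
    then have "exp (\<mu> * (ext \<mu> n - 1)) \<le> exp (- y)" by (simp add: y_def)
    from order_trans[OF this g] show ?case using assms by (simp add: ext_Suc)
  qed
  then have "p_ext \<mu> \<le> 1 - e" by (intro LIMSEQ_le_const2[OF ext_tendsto_p_ext]) auto
  then show ?thesis using e by simp
qed

text \<open>By strict convexity the curve lies below the diagonal between its fixed points \<open>p_ext \<mu>\<close> and \<open>1\<close>;
  concretely, the tangent at \<open>\<eta>\<close> lies strictly below the curve at both of them.\<close>

lemma le_p_extI:
  assumes mu: "0 < \<mu>" and \<eta>: "\<eta> < 1" "\<eta> \<le> exp (\<mu> * (\<eta> - 1))"
  shows "\<eta> \<le> p_ext \<mu>"
proof (rule ccontr)
  assume "\<not> \<eta> \<le> p_ext \<mu>"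
  then have q: "p_ext \<mu> < \<eta>" by simp
  define G where "G = exp (\<mu> * (\<eta> - 1))"
  have "1 + \<mu> * (1 - \<eta>) < exp (\<mu> * (1 - \<eta>))" by (rule exp_gt_add_one) (use mu \<eta> in auto)
  then have "G * (1 + \<mu> * (1 - \<eta>)) < G * exp (\<mu> * (1 - \<eta>))" by (simp add: G_def)
  also have "\<dots> = 1" by (simp add: G_def exp_add[symmetric] algebra_simps)
  finally have t1: "G * (1 + \<mu> * (1 - \<eta>)) < 1" .
  have "1 + \<mu> * (p_ext \<mu> - \<eta>) < exp (\<mu> * (p_ext \<mu> - \<eta>))" by (rule exp_gt_add_one) (use mu q in auto)
  then have "G * (1 + \<mu> * (p_ext \<mu> - \<eta>)) < G * exp (\<mu> * (p_ext \<mu> - \<eta>))" by (simp add: G_def)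
  also have "\<dots> = exp (\<mu> * (p_ext \<mu> - 1))" by (simp add: G_def exp_add[symmetric] algebra_simps)
  also have "\<dots> = p_ext \<mu>" using p_ext_fixed[of \<mu>] mu by simp
  finally have t2: "G * (1 + \<mu> * (p_ext \<mu> - \<eta>)) < p_ext \<mu>" .
  have "(\<eta> - p_ext \<mu>) * (G * (1 + \<mu> * (1 - \<eta>))) + (1 - \<eta>) * (G * (1 + \<mu> * (p_ext \<mu> - \<eta>))) <
      (\<eta> - p_ext \<mu>) * 1 + (1 - \<eta>) * p_ext \<mu>"
    using t1 t2 q \<eta> by (intro add_strict_mono mult_strict_left_mono) auto
  then have "G * (1 - p_ext \<mu>) < \<eta> * (1 - p_ext \<mu>)" by (simp add: algebra_simps)
  then show False using q \<eta> by (simp add: G_def)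
qed

section \<open>The growth event\<close>

context correlated_trees
begin

text \<open>A single index \<open>j\<close> gives both the rate \<open>1 / Suc j\<close> and the
  starting depth \<open>j\<close>. So the sets \<open>growth_set j\<close> increase with
  \<open>j\<close>, and their union is the event of positive lower limit. \<open>D\<close> cuts the
  condition to a finite window that a pruned law can see.\<close>

definition grows :: "nat \<Rightarrow> nat \<Rightarrow> (ltree \<times> ltree) set" where
  "grows j D = {z. \<forall>n\<in>{j..D}. exp (\<mu> ^ n / real (Suc j)) \<le> lr n (prune2 n z)}"

definition growth_set :: "nat \<Rightarrow> (ltree \<times> ltree) set" where
  "growth_set j = {x \<in> ltrees \<times> ltrees. \<forall>n\<ge>j. exp (\<mu> ^ n / real (Suc j)) \<le> lr n (prune2 n x)}"

lemma growth_set_Union: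
  assumes mu: "0 < \<mu>"
  shows "{x \<in> ltrees \<times> ltrees. liminf (\<lambda>d. ereal (ln (lr d (prune2 d x)) / \<mu> ^ d)) > 0} = (\<Union>j. growth_set j)"
proof (intro set_eqI iffI)
  fix x assume "x \<in> {x \<in> ltrees \<times> ltrees. liminf (\<lambda>d. ereal (ln (lr d (prune2 d x)) / \<mu> ^ d)) > 0}"
  then obtain e N where x: "x \<in> ltrees \<times> ltrees" and e: "e > 0" "\<And>d. d \<ge> N \<Longrightarrow> e \<le> ln (lr d (prune2 d x)) / \<mu> ^ d"
    unfolding mem_Collect_eq liminf_ereal_pos_iff eventually_sequentially by blast
  obtain i where i: "1 / e \<le> real i" using real_arch_simple by blast
  define j where "j = max N i"
  have j: "1 / real (Suc j) \<le> e"
  proof -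
    have "1 / e \<le> real (Suc j)" using i by (simp add: j_def)
    then show ?thesis using e(1) by (simp add: field_simps)
  qed
  have "exp (\<mu> ^ n / real (Suc j)) \<le> lr n (prune2 n x)" if "n \<ge> j" for n
  proof -
    have mn: "\<mu> ^ n > 0" using mu by simp
    have "\<mu> ^ n / real (Suc j) = (1 / real (Suc j)) * \<mu> ^ n" by simp
    also have "\<dots> \<le> e * \<mu> ^ n" using j mn by (intro mult_right_mono) auto
    also have "\<dots> \<le> ln (lr n (prune2 n x))" using e(2)[of n] that mn by (simp add: j_def pos_le_divide_eq)
    finally have le: "\<mu> ^ n / real (Suc j) \<le> ln (lr n (prune2 n x))" .
    then have "ln (lr n (prune2 n x)) > 0" using mn by (smt (verit) divide_pos_pos of_nat_0_less_iff zero_less_Suc)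
    \<comment> \<open>A positive logarithm excludes the value \<open>0\<close> of the ratio, because
      \<open>ln 0 = 0\<close>.\<close>
    then have "lr n (prune2 n x) > 0" using lr_nonneg[of n "prune2 n x"] by (metis less_le ln_0 order.irrefl)
    then show ?thesis using le by (simp add: ln_ge_iff)
  qed
  then show "x \<in> (\<Union>j. growth_set j)" using x by (auto simp: growth_set_def)
next
  fix x assume "x \<in> (\<Union>j. growth_set j)"
  then obtain j where x: "x \<in> ltrees \<times> ltrees" and j: "\<And>n. n \<ge> j \<Longrightarrow> exp (\<mu> ^ n / real (Suc j)) \<le> lr n (prune2 n x)"
    by (auto simp: growth_set_def)
  have "1 / real (Suc j) \<le> ln (lr n (prune2 n x)) / \<mu> ^ n" if "n \<ge> j" for n
  proof -
    have mn: "\<mu> ^ n > 0" using mu by simp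
    have "lr n (prune2 n x) > 0" using j[OF that] exp_gt_zero less_le_trans by blast
    then have "\<mu> ^ n / real (Suc j) \<le> ln (lr n (prune2 n x))" using j[OF that] by (simp add: ln_ge_iff)
    then show ?thesis using mn by (simp add: pos_le_divide_eq del: of_nat_Suc)
  qed
  then have "\<exists>\<epsilon>>0. eventually (\<lambda>d. \<epsilon> \<le> ln (lr d (prune2 d x)) / \<mu> ^ d) sequentially"
    unfolding eventually_sequentially by (intro exI[of _ "1 / real (Suc j)"]) auto
  then show "x \<in> {x \<in> ltrees \<times> ltrees. liminf (\<lambda>d. ereal (ln (lr d (prune2 d x)) / \<mu> ^ d)) > 0}"
    unfolding mem_Collect_eq liminf_ereal_pos_iff using x by blast
qed

lemma measurable_prune2_P1: "prune2 n \<in> P1 lam s \<rightarrow>\<^sub>M count_space UNIV"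
  using measurable_prune2_UNIV measurable_cong_sets[OF sets_P1 refl] by blast

lemma grows_prune2: "prune2 D x \<in> grows j D \<longleftrightarrow> x \<in> grows j D"
  unfolding grows_def by (auto simp: prune2_prune2)

lemma measure_P1_grows:
  "{x \<in> ltrees \<times> ltrees. x \<in> grows j D} \<in> sets (P1 lam s)"
  "measure (P1 lam s) {x \<in> ltrees \<times> ltrees. x \<in> grows j D} = measure_pmf.prob (p1 D) (grows j D)"
proof -
  have eq: "{x \<in> ltrees \<times> ltrees. x \<in> grows j D} = prune2 D -` grows j D \<inter> space (P1 lam s)"
    by (rule set_eqI) (simp only: mem_Collect_eq Int_iff vimage_eq grows_prune2 space_P1, blast)
  show "{x \<in> ltrees \<times> ltrees. x \<in> grows j D} \<in> sets (P1 lam s)"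
    unfolding eq by (rule measurable_sets[OF measurable_prune2_P1]) simp
  have "measure (distr (P1 lam s) (count_space UNIV) (prune2 D)) (grows j D) = measure (P1 lam s) (prune2 D -` grows j D \<inter> space (P1 lam s))"
    by (rule measure_distr[OF measurable_prune2_P1]) simp
  then show "measure (P1 lam s) {x \<in> ltrees \<times> ltrees. x \<in> grows j D} = measure_pmf.prob (p1 D) (grows j D)"
    unfolding eq by (simp add: distr_P1)
qed

lemma growth_set_Inter: "growth_set j = (\<Inter>D. {x \<in> ltrees \<times> ltrees. x \<in> grows j D})"
proof (intro set_eqI iffI)
  fix x assume x: "x \<in> (\<Inter>D. {x \<in> ltrees \<times> ltrees. x \<in> grows j D})"
  then have "exp (\<mu> ^ n / real (Suc j)) \<le> lr n (prune2 n x)" if "n \<ge> j" for n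
    using that INT_D[OF x, of n] by (simp add: grows_def)
  then show "x \<in> growth_set j" using INT_D[OF x, of 0] by (simp add: growth_set_def)
qed (simp add: growth_set_def grows_def)

lemma sets_growth_set: "growth_set j \<in> sets (P1 lam s)"
  unfolding growth_set_Inter using measure_P1_grows(1) by (intro sets.countable_INT) auto

lemma growth_set_le_grows: "measure (P1 lam s) (growth_set j) \<le> measure_pmf.prob (p1 D) (grows j D)"
proof -
  interpret P: prob_space "P1 lam s" by (rule prob_space_P1)
  show ?thesis unfolding measure_P1_grows(2)[symmetric]
    by (rule P.finite_measure_mono[OF _ measure_P1_grows(1)]) (auto simp: growth_set_Inter)
qed

text \<open>The event is the decreasing limit of its finite windows, so a bound on them that holds
  eventually survives in the limit.\<close>

lemma growth_set_ge:
  assumes "eventually (\<lambda>D. \<delta> \<le> measure_pmf.prob (p1 D) (grows j D)) sequentially"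
  shows "\<delta> \<le> measure (P1 lam s) (growth_set j)"
proof -
  interpret P: prob_space "P1 lam s" by (rule prob_space_P1)
  have "(\<lambda>D. measure (P1 lam s) {x \<in> ltrees \<times> ltrees. x \<in> grows j D}) \<longlonglongrightarrow> measure (P1 lam s) (growth_set j)"
    unfolding growth_set_Inter
  proof (rule P.finite_Lim_measure_decseq)
    have "grows j D' \<subseteq> grows j D" if "D \<le> D'" for D D' using that by (auto simp: grows_def)
    then show "decseq (\<lambda>D. {x \<in> ltrees \<times> ltrees. x \<in> grows j D})" unfolding decseq_def by blast
  qed (use measure_P1_grows(1) in blast)
  then show ?thesis
    unfolding measure_P1_grows(2) using assms by (rule tendsto_lowerbound) simp
qed

definition pG :: real where "pG = measure (P1 lam s) (\<Union>j. growth_set j)"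

lemma incseq_growth_set: "0 \<le> \<mu> \<Longrightarrow> incseq growth_set"
proof (rule incseq_SucI)
  fix j assume mu: "0 \<le> \<mu>"
  have "\<mu> ^ n / real (Suc (Suc j)) \<le> \<mu> ^ n / real (Suc j)" for n
    using mu by (intro divide_left_mono) auto
  then have "exp (\<mu> ^ n / real (Suc (Suc j))) \<le> exp (\<mu> ^ n / real (Suc j))" for n
    unfolding exp_le_cancel_iff .
  note le = order_trans[OF this]
  show "growth_set j \<subseteq> growth_set (Suc j)"
    unfolding growth_set_def by (intro subsetI CollectI conjI allI impI le) (auto simp del: of_nat_Suc)
qed

lemma pG_ge: "measure (P1 lam s) (growth_set j) \<le> pG"
proof -
  interpret P: prob_space "P1 lam s" by (rule prob_space_P1)
  show ?thesis unfolding pG_def by (rule P.finite_measure_mono) (use sets_growth_set in auto)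
qed

lemma pG_approx: "0 < \<epsilon> \<Longrightarrow> \<exists>j. pG - \<epsilon> \<le> measure (P1 lam s) (growth_set j)"
proof -
  assume e: "0 < \<epsilon>"
  interpret P: prob_space "P1 lam s" by (rule prob_space_P1)
  have "(\<lambda>j. measure (P1 lam s) (growth_set j)) \<longlonglongrightarrow> pG"
    unfolding pG_def using sets_growth_set incseq_growth_set[OF mu_nonneg] by (intro P.finite_Lim_measure_incseq) auto
  then have "eventually (\<lambda>j. pG - \<epsilon> < measure (P1 lam s) (growth_set j)) sequentially"
    using e by (intro order_tendstoD) auto
  then obtain j where "pG - \<epsilon> < measure (P1 lam s) (growth_set j)" by (auto dest!: eventually_happens)
  then show ?thesis by (intro exI[of _ j]) simp
qed

lemma pG_pos:
  assumes mu: "1 < \<mu>" and KL: "filterlim (KL lam s) at_top sequentially"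
  shows "0 < pG"
proof -
  obtain c \<delta> N where c: "c > 0" "\<delta> > 0"
    "\<And>D. D \<ge> N \<Longrightarrow> \<delta> \<le> measure_pmf.prob (p1 D) {z. \<forall>n\<in>{N..D}. exp (c * \<mu> ^ n) \<le> lr n (prune2 n z)}"
    using positive_growth[OF assms] by blast
  obtain i where i: "1 / c \<le> real i" using real_arch_simple by blast
  define j where "j = max N i"
  have j: "1 / real (Suc j) \<le> c"
  proof -
    have "1 / c \<le> real (Suc j)" using i by (simp add: j_def)
    then show ?thesis using c(1) by (simp add: field_simps)
  qed
  have le: "exp (\<mu> ^ n / real (Suc j)) \<le> exp (c * \<mu> ^ n)" for n
  proof -
    have "0 \<le> \<mu> ^ n" using mu by (intro zero_le_power) simp
    from mult_right_mono[OF j this] show ?thesis by simp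
  qed
  have "\<delta> \<le> measure_pmf.prob (p1 D) (grows j D)" if "D \<ge> N" for D
  proof -
    have "{z. \<forall>n\<in>{N..D}. exp (c * \<mu> ^ n) \<le> lr n (prune2 n z)} \<subseteq> grows j D"
    proof
      fix z assume z: "z \<in> {z. \<forall>n\<in>{N..D}. exp (c * \<mu> ^ n) \<le> lr n (prune2 n z)}"
      show "z \<in> grows j D" unfolding grows_def mem_Collect_eq
      proof
        fix n assume "n \<in> {j..D}"
        then have "exp (c * \<mu> ^ n) \<le> lr n (prune2 n z)" using z by (auto simp: j_def)
        then show "exp (\<mu> ^ n / real (Suc j)) \<le> lr n (prune2 n z)" using le order_trans by blast
      qed
    qed
    then have "measure_pmf.prob (p1 D) {z. \<forall>n\<in>{N..D}. exp (c * \<mu> ^ n) \<le> lr n (prune2 n z)} \<le> measure_pmf.prob (p1 D) (grows j D)"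
      by (intro measure_pmf.finite_measure_mono) auto
    then show ?thesis using c(3)[OF that] by linarith
  qed
  then have "\<delta> \<le> measure (P1 lam s) (growth_set j)"
    by (intro growth_set_ge) (auto simp: eventually_sequentially)
  then show ?thesis using pG_ge[of j] c(2) by linarith
qed

section \<open>Passing growth from one common child to the root\<close>

lemma p1_Suc_branch:
  "p1 (Suc n) = branch rootp fst ({[]}, {[]}) (p1 n) \<bind> (\<lambda>(r, g). do {
     x \<leftarrow> fill lam n (fst r) (fst (snd r)) (\<lambda>i. fst (g i));
     y \<leftarrow> fill lam n (fst r) (snd (snd r)) (\<lambda>i. snd (g i)); return_pmf (x, y)})"
  unfolding p1p_Suc by (simp add: branch_def rootp_def pair_pmf_def map_pmf_def bind_assoc_pmf bind_return_pmf)

lemma prob_branch: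
  "measure_pmf.prob (branch \<rho> \<kappa> d p) A = (\<integral>r. measure_pmf.prob (Pi_pmf {1..\<kappa> r} d (\<lambda>_. p)) {G. (r, G) \<in> A} \<partial>\<rho>)"
  unfolding branch_def prob_bind_pmf measure_map_pmf by (simp add: vimage_def)

text \<open>The common children of a given type are a thinning of a Poisson number, hence Poisson
  with mean \<mu> times the probability of the type; the value is the chance of none.\<close>

lemma prob_branch_none:
  "measure_pmf.prob (branch rootp fst d p) {(r, g). \<forall>i\<in>{1..fst r}. g i \<notin> A} = exp (- \<mu> * measure_pmf.prob p A)"
proof -
  have "measure_pmf.prob p (- A) = 1 - measure_pmf.prob p A"
    using measure_pmf.prob_compl[of A p] by (simp add: Compl_eq_Diff_UNIV)
  moreover have "measure_pmf.prob (Pi_pmf {1..k} d (\<lambda>_. p)) {g. \<forall>i\<in>{1..k}. g i \<notin> A} = measure_pmf.prob p (- A) ^ k" for k :: nat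
  proof -
    have "{g. \<forall>i\<in>{1..k}. g i \<notin> A} = Pi {1..k} (\<lambda>_. - A)" by (auto simp: Pi_def)
    then show ?thesis by (simp add: measure_Pi_pmf_Pi)
  qed
  ultimately have "measure_pmf.prob (branch rootp fst d p) {(r, g). \<forall>i\<in>{1..fst r}. g i \<notin> A} =
      (\<integral>r. (1 - measure_pmf.prob p A) ^ fst r \<partial>rootp)"
    unfolding prob_branch by simp
  also have "\<dots> = (\<integral>k. (1 - measure_pmf.prob p A) ^ k \<partial>map_pmf fst rootp)" by simp
  also have "map_pmf fst rootp = Poisson \<mu>" by (simp add: rootp_def map_fst_pair_pmf)
  also have "(\<integral>k. (1 - measure_pmf.prob p A) ^ k \<partial>Poisson \<mu>) = exp (\<mu> * ((1 - measure_pmf.prob p A) - 1))"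
    by (rule Poisson_pgf[OF mu_nonneg]) simp
  finally show ?thesis by simp
qed

lemma prob_branch_some:
  "measure_pmf.prob (branch rootp fst d p) {(r, g). \<exists>i\<in>{1..fst r}. g i \<in> A} \<le> \<mu> * measure_pmf.prob p A"
proof -
  have le: "measure_pmf.prob (Pi_pmf {1..k} d (\<lambda>_. p)) {g. \<exists>i\<in>{1..k}. g i \<in> A} \<le> real k * measure_pmf.prob p A" for k :: nat
  proof -
    have "{g. \<exists>i\<in>{1..k}. g i \<in> A} = (\<Union>i\<in>{1..k}. (\<lambda>g. g i) -` A)" by auto
    also have "measure_pmf.prob (Pi_pmf {1..k} d (\<lambda>_. p)) \<dots> \<le> (\<Sum>i\<in>{1..k}. measure_pmf.prob (Pi_pmf {1..k} d (\<lambda>_. p)) ((\<lambda>g. g i) -` A))"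
      by (rule measure_UNION_le) auto
    also have "\<dots> = (\<Sum>i\<in>{1..k}. measure_pmf.prob p A)"
      by (intro sum.cong refl) (simp add: measure_map_pmf[symmetric] Pi_pmf_component)
    finally show ?thesis by simp
  qed
  have "measure_pmf.prob (branch rootp fst d p) {(r, g). \<exists>i\<in>{1..fst r}. g i \<in> A} \<le>
      (\<integral>r. real (fst r) * measure_pmf.prob p A \<partial>rootp)"
    unfolding prob_branch
  proof (rule integral_mono)
    show "integrable rootp (\<lambda>r. measure_pmf.prob (Pi_pmf {1..fst r} d (\<lambda>_. p)) {G. (r, G) \<in> {(r, g). \<exists>i\<in>{1..fst r}. g i \<in> A}})"
      by (rule measure_pmf.integrable_const_bound[where B = 1]) auto
  qed (use mean_rootp le in auto)
  also have "\<dots> = \<mu> * measure_pmf.prob p A" using mean_rootp by simp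
  finally show ?thesis .
qed

text \<open>The root can fail to grow only if its degrees are atypical (\<open>?b1\<close>), if some
  child has a very small ratio at some depth beyond \<open>I\<close> (\<open>?b2\<close>), or if no
  child grows (\<open>?b3\<close>). The first two cost \<epsilon> each and the third has the Poisson
  probability; otherwise \<open>lr_fill_ge\<close> lets one growing child outweigh all its
  siblings.\<close>

lemma pG_amplify_eps:
  assumes mu: "1 < \<mu>" and \<epsilon>: "0 < \<epsilon>"
  shows "1 - pG \<le> exp (- \<mu> * (pG - \<epsilon>)) + 2 * \<epsilon>"
proof -
  obtain j where j: "pG - \<epsilon> \<le> measure (P1 lam s) (growth_set j)" using pG_approx[OF \<epsilon>] by blast
  \<comment> \<open>Bounding \<open>h\<close> controls at once the additive cost \<open>B\<close>
    and the number of siblings, both of which enter the lower bound for the root.\<close>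
  define h where "h r = \<bar>B r\<bar> + real (fst r)" for r
  have hint: "integrable rootp h" unfolding h_def using integrable_B mean_rootp by auto
  define K where "K = (\<integral>r. h r \<partial>rootp) / \<epsilon> + 1"
  have h0: "0 \<le> h r" for r by (simp add: h_def)
  have K0: "K > 0" using \<epsilon> h0 by (simp add: K_def add_nonneg_pos)
  have tail: "measure_pmf.prob rootp {r. h r > K} \<le> \<epsilon>"
  proof -
    have "measure_pmf.prob rootp {r \<in> space rootp. h r \<ge> K} \<le> (\<integral>r. h r \<partial>rootp) / K"
      by (rule integral_Markov_inequality_measure[where A = "{}"]) (use hint h0 K0 in auto)
    also have "\<dots> \<le> \<epsilon>"
    proof -
      have "(\<integral>r. h r \<partial>rootp) \<le> \<epsilon> * K" using \<epsilon> by (simp add: K_def distrib_left)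
      then show ?thesis using K0 by (simp add: pos_divide_le_eq)
    qed
    finally show ?thesis
      by (rule order_trans[rotated]) (intro measure_pmf.finite_measure_mono, auto)
  qed
  \<comment> \<open>A child's ratio at depth \<open>n\<close> is below \<open>exp (- n)\<close> with
    probability at most \<open>exp (- n)\<close>. This is summable in \<open>n\<close>, and the
    exponent is linear, negligible against \<mu>^n.\<close>
  let ?E = "exp (-1) :: real"
  have E: "0 \<le> ?E" "?E < 1" by auto
  have lim1: "(\<lambda>J. \<mu> * (?E ^ J / (1 - ?E))) \<longlonglongrightarrow> \<mu> * (0 / (1 - ?E))"
    using E by (intro tendsto_intros LIMSEQ_power_zero) auto
  have ev1: "eventually (\<lambda>J. \<mu> * (?E ^ J / (1 - ?E)) < \<epsilon>) sequentially"
    using order_tendstoD(2)[OF lim1, of \<epsilon>] \<epsilon> by simp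
  have "eventually (\<lambda>n. K + K * real n \<le> \<mu> ^ n / (2 * real (Suc j))) sequentially"
  proof -
    have i: "norm (1 / \<mu>) < 1" using mu by simp
    have "(\<lambda>n. K * (1 / \<mu>) ^ n + K * (real n * (1 / \<mu>) ^ n)) \<longlonglongrightarrow> K * 0 + K * 0"
      by (intro tendsto_intros LIMSEQ_power_zero i powser_times_n_limit_0)
    then have "eventually (\<lambda>n. K * (1 / \<mu>) ^ n + K * (real n * (1 / \<mu>) ^ n) < 1 / (2 * real (Suc j))) sequentially"
      by (rule order_tendstoD) simp
    then show ?thesis
    proof eventually_elim
      case (elim n)
      have mn: "\<mu> ^ n > 0" using mu by (intro zero_less_power) simp
      have "lam \<noteq> 0" "s \<noteq> 0" using mu by auto
      then have "(K * (1 / \<mu>) ^ n + K * (real n * (1 / \<mu>) ^ n)) * \<mu> ^ n = K + K * real n"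
        by (simp add: power_one_over field_simps)
      moreover have "(K * (1 / \<mu>) ^ n + K * (real n * (1 / \<mu>) ^ n)) * \<mu> ^ n \<le> 1 / (2 * real (Suc j)) * \<mu> ^ n"
        using elim mn by (intro mult_right_mono) auto
      ultimately show ?case by simp
    qed
  qed
  then obtain J0 where J0: "\<And>n. n \<ge> J0 \<Longrightarrow> K + K * real n \<le> \<mu> ^ n / (2 * real (Suc j))"
    by (auto simp: eventually_sequentially)
  obtain J1 where J1: "\<And>n. n \<ge> J1 \<Longrightarrow> \<mu> * (?E ^ n / (1 - ?E)) < \<epsilon>"
    using ev1 by (auto simp: eventually_sequentially)
  \<comment> \<open>The exponent of the growing child is split in two halves: beyond
    \<open>J0\<close> the first pays for \<open>K + K * n\<close>, and by the choice of
    \<open>J2\<close> the second covers the root's exponent one level deeper, where the rate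
    \<open>1 / Suc (Suc I)\<close> absorbs the extra factor \<mu>.\<close>
  obtain J2 where J2: "2 * \<mu> * real (Suc j) \<le> real J2" using real_arch_simple by blast
  define I where "I = max (max j J0) (max J1 J2)"
  have I: "j \<le> I" "J0 \<le> I" "J1 \<le> I" "J2 \<le> I" by (auto simp: I_def)
  let ?ok = "\<lambda>D. {z. \<forall>n\<in>{I..D}. exp (- real n) \<le> lr n (prune2 n z)}"
  have ok: "\<mu> * measure_pmf.prob (p1 D) (- ?ok D) \<le> \<epsilon>" for D
  proof -
    have e: "?E ^ n = exp (- real n)" for n by (simp add: exp_of_nat_mult[symmetric])
    have "- ?ok D = (\<Union>n\<in>{I..<Suc D}. prune2 n -` {z. lr n z < ?E ^ n})"
      by (rule set_eqI) (unfold Compl_iff mem_Collect_eq UN_iff vimage_eq e atLeastLessThanSuc_atLeastAtMost, meson not_le)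
    also have "measure_pmf.prob (p1 D) \<dots> \<le> (\<Sum>n\<in>{I..<Suc D}. measure_pmf.prob (p1 D) (prune2 n -` {z. lr n z < ?E ^ n}))"
      by (rule measure_UNION_le) auto
    also have "\<dots> \<le> (\<Sum>n\<in>{I..<Suc D}. ?E ^ n)"
    proof (rule sum_mono)
      fix n assume "n \<in> {I..<Suc D}"
      then have "n \<le> D" by simp
      then show "measure_pmf.prob (p1 D) (prune2 n -` {z. lr n z < ?E ^ n}) \<le> ?E ^ n"
        unfolding prob_p1_prune2[OF \<open>n \<le> D\<close>] by (intro prob_p1_lr_lt) simp
    qed
    also have "\<dots> \<le> ?E ^ I / (1 - ?E)"
    proof (cases "I \<le> Suc D")
      case True then show ?thesis by (intro geometric_sum_le E)
    qed (use E in auto)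
    finally have "measure_pmf.prob (p1 D) (- ?ok D) \<le> ?E ^ I / (1 - ?E)" .
    then have "\<mu> * measure_pmf.prob (p1 D) (- ?ok D) \<le> \<mu> * (?E ^ I / (1 - ?E))" using mu by (intro mult_left_mono) auto
    then show ?thesis using J1[OF I(3)] by linarith
  qed
  have "1 - exp (- \<mu> * (pG - \<epsilon>)) - 2 * \<epsilon> \<le> measure_pmf.prob (p1 (Suc D)) (grows (Suc I) (Suc D))" for D
  proof -
    let ?J = "branch rootp fst ({[]}, {[]}) (p1 D)"
    let ?b1 = "{(r :: nat \<times> nat \<times> nat, g :: nat \<Rightarrow> ltree \<times> ltree). h r > K}"
    let ?b2 = "{(r :: nat \<times> nat \<times> nat, g). \<exists>i\<in>{1..fst r}. g i \<in> - ?ok D}"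
    let ?b3 = "{(r :: nat \<times> nat \<times> nat, g). \<forall>i\<in>{1..fst r}. g i \<notin> grows j D}"
    let ?f = "\<lambda>(r, g). do {x \<leftarrow> fill lam D (fst r) (fst (snd r)) (\<lambda>i. fst (g i));
       y \<leftarrow> fill lam D (fst r) (snd (snd r)) (\<lambda>i. snd (g i)); return_pmf (x, y)}"
    have good: "measure_pmf.prob (?f (r, g)) (grows (Suc I) (Suc D)) = 1"
      if rg: "(r, g) \<in> set_pmf ?J" "(r, g) \<notin> ?b1 \<union> ?b2 \<union> ?b3" for r g
    proof -
      obtain k a a' where r: "r = (k, a, a')" by (cases r)
      from rg(2) have hK: "h r \<le> K" and okg: "\<And>i. i \<in> {1..k} \<Longrightarrow> g i \<in> ?ok D"
        and "\<exists>i\<in>{1..k}. g i \<in> grows j D" by (auto simp: r not_less)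
      then obtain i0 where i0: "i0 \<in> {1..k}" "g i0 \<in> grows j D" by blast
      have Bk: "- K \<le> B (k, a, a')" "real k \<le> K" using hK by (auto simp: h_def r)
      have gX: "g i \<in> X2 D" if "i \<in> {1..k}" for i
        using set_branch(2)[OF rg(1)] that set_p1p[of lam s D] by (auto simp: r)
      have rs: "(k, a, a') \<in> set_pmf rootp" using set_branch(1)[OF rg(1)] r by simp
      have "(x, y) \<in> grows (Suc I) (Suc D)"
        if x: "x \<in> set_pmf (fill lam D k a (\<lambda>i. fst (g i)))" and y: "y \<in> set_pmf (fill lam D k a' (\<lambda>i. snd (g i)))" for x y
        unfolding grows_def mem_Collect_eq
      proof
        fix n' assume n': "n' \<in> {Suc I..Suc D}"
        then obtain n where n: "n' = Suc n" "I \<le> n" "n \<le> D" by (cases n') auto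
        have "K + K * real n + \<mu> ^ Suc n / real (Suc (Suc I)) \<le> \<mu> ^ n / real (Suc j)"
        proof -
          have mn: "0 < \<mu> ^ n" using mu by (intro zero_less_power) simp
          have "\<mu> / real (Suc (Suc I)) \<le> 1 / (2 * real (Suc j))"
          proof -
            have "2 * \<mu> * real (Suc j) \<le> real (Suc (Suc I))" using J2 I(4) by linarith
            then show ?thesis by (simp add: field_simps)
          qed
          then have "\<mu> / real (Suc (Suc I)) * \<mu> ^ n \<le> 1 / (2 * real (Suc j)) * \<mu> ^ n" using mn by (intro mult_right_mono) auto
          then have f1: "\<mu> ^ Suc n / real (Suc (Suc I)) \<le> \<mu> ^ n / (2 * real (Suc j))" by (simp add: field_simps)
          have f2: "K + K * real n \<le> \<mu> ^ n / (2 * real (Suc j))" using J0 I(2) n(2) by simp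
          have f3: "\<mu> ^ n / (2 * real (Suc j)) + \<mu> ^ n / (2 * real (Suc j)) = \<mu> ^ n / real (Suc j)"
          proof -
            have "t / (2 * x) + t / (2 * x) = t / x" for t x :: real by (cases "x = 0") (auto simp: field_simps)
            then show ?thesis .
          qed
          show ?thesis using add_mono[OF f2 f1] unfolding f3 .
        qed
        then have "exp (\<mu> ^ Suc n / real (Suc (Suc I))) \<le> exp (- K + (\<mu> ^ n / real (Suc j) - K * real n))" by simp
        also have "\<dots> = exp (- K) * (exp (\<mu> ^ n / real (Suc j)) * exp (- (K * real n)))"
          by (simp add: exp_add[symmetric])
        also have "\<dots> \<le> exp (B (k, a, a')) * (lr n (prune2 n (g i0)) * (\<Prod>i\<in>{1..k} - {i0}. lr n (prune2 n (g i))))"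
        proof (intro mult_mono)
          show "exp (\<mu> ^ n / real (Suc j)) \<le> lr n (prune2 n (g i0))" using i0(2) n I(1) by (auto simp: grows_def)
          \<comment> \<open>At most \<open>K\<close> children in all, and each of the other
            \<open>k - 1\<close> contributes at least \<open>exp (- n)\<close>.\<close>
          have "exp (- (K * real n)) \<le> exp (- (real (k - 1) * real n))"
          proof -
            have "real (k - 1) * real n \<le> K * real n" using Bk(2) by (intro mult_right_mono) auto
            then show ?thesis by simp
          qed
          also have "\<dots> = (\<Prod>i\<in>{1..k} - {i0}. exp (- real n))"
            using i0(1) by (simp add: exp_of_nat_mult[symmetric] card_Diff_singleton)
          also have "\<dots> \<le> (\<Prod>i\<in>{1..k} - {i0}. lr n (prune2 n (g i)))"
            using okg n by (intro prod_mono) auto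
          finally show "exp (- (K * real n)) \<le> (\<Prod>i\<in>{1..k} - {i0}. lr n (prune2 n (g i)))" .
        qed (use Bk lr_nonneg in \<open>auto intro!: mult_nonneg_nonneg prod_nonneg\<close>)
        also have "lr n (prune2 n (g i0)) * (\<Prod>i\<in>{1..k} - {i0}. lr n (prune2 n (g i))) = (\<Prod>i\<in>{1..k}. lr n (prune2 n (g i)))"
          using i0(1) by (subst prod.remove[of "{1..k}" i0]) auto
        also have "exp (B (k, a, a')) * \<dots> \<le> lr (Suc n) (prune2 (Suc n) (x, y))"
          by (rule lr_fill_ge[OF rs gX x y n(3)])
        finally show "exp (\<mu> ^ n' / real (Suc (Suc I))) \<le> lr n' (prune2 n' (x, y))" by (simp only: n)
      qed
      then show ?thesis
        by (auto simp: measure_pmf.prob_eq_1 AE_measure_pmf_iff r)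
    qed
    have "1 - measure_pmf.prob ?J (?b1 \<union> ?b2 \<union> ?b3) = measure_pmf.prob ?J (- (?b1 \<union> ?b2 \<union> ?b3))"
      using measure_pmf.prob_compl[of "?b1 \<union> ?b2 \<union> ?b3" ?J] by (simp add: Compl_eq_Diff_UNIV)
    also have "\<dots> = (\<integral>rg. indicator (- (?b1 \<union> ?b2 \<union> ?b3)) rg \<partial>?J)" by simp
    also have "\<dots> \<le> (\<integral>rg. measure_pmf.prob (?f rg) (grows (Suc I) (Suc D)) \<partial>?J)"
    proof (rule integral_mono_AE)
      show "integrable ?J (\<lambda>rg. measure_pmf.prob (?f rg) (grows (Suc I) (Suc D)))"
        by (rule measure_pmf.integrable_const_bound[where B = 1]) auto
      show "AE rg in ?J. indicator (- (?b1 \<union> ?b2 \<union> ?b3)) rg \<le> measure_pmf.prob (?f rg) (grows (Suc I) (Suc D))"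
        unfolding AE_measure_pmf_iff
      proof
        fix rg assume rg: "rg \<in> set_pmf ?J"
        obtain r g where eq: "rg = (r, g)" by (cases rg)
        show "indicator (- (?b1 \<union> ?b2 \<union> ?b3)) rg \<le> measure_pmf.prob (?f rg) (grows (Suc I) (Suc D))"
        proof (cases "rg \<in> ?b1 \<union> ?b2 \<union> ?b3")
          case False
          then show ?thesis using good[of r g] rg unfolding eq by (simp only: indicator_simps) simp
        qed simp
      qed
    qed (rule integrable_pmf_indicator)
    also have "\<dots> = measure_pmf.prob (p1 (Suc D)) (grows (Suc I) (Suc D))"
      unfolding p1_Suc_branch prob_bind_pmf ..
    finally have "1 - measure_pmf.prob ?J (?b1 \<union> ?b2 \<union> ?b3) \<le> measure_pmf.prob (p1 (Suc D)) (grows (Suc I) (Suc D))" .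
    moreover have "measure_pmf.prob ?J (?b1 \<union> ?b2 \<union> ?b3) \<le> measure_pmf.prob ?J ?b1 + measure_pmf.prob ?J ?b2 + measure_pmf.prob ?J ?b3"
      by (intro order_trans[OF measure_Un_le] add_right_mono measure_Un_le) auto
    moreover have "measure_pmf.prob ?J ?b1 \<le> \<epsilon>"
    proof -
      have "map_pmf fst ?J = rootp" by (simp add: branch_def map_bind_pmf pmf.map_comp o_def bind_return_pmf')
      then have "measure_pmf.prob ?J (fst -` {r. h r > K}) \<le> \<epsilon>" using tail by (simp only: measure_map_pmf[symmetric])
      moreover have "fst -` {r. h r > K} = ?b1" by auto
      ultimately show ?thesis by simp
    qed
    moreover have "measure_pmf.prob ?J ?b2 \<le> \<epsilon>" by (rule order_trans[OF prob_branch_some ok])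
    moreover have "measure_pmf.prob ?J ?b3 \<le> exp (- \<mu> * (pG - \<epsilon>))"
    proof -
      have "pG - \<epsilon> \<le> measure_pmf.prob (p1 D) (grows j D)" using j growth_set_le_grows[of j D] by linarith
      then have "\<mu> * (pG - \<epsilon>) \<le> \<mu> * measure_pmf.prob (p1 D) (grows j D)" using mu by (intro mult_left_mono) auto
      then show ?thesis unfolding prob_branch_none by simp
    qed
    ultimately show ?thesis by linarith
  qed
  then have "eventually (\<lambda>D. 1 - exp (- \<mu> * (pG - \<epsilon>)) - 2 * \<epsilon> \<le> measure_pmf.prob (p1 D) (grows (Suc I) D)) sequentially"
    unfolding eventually_sequentially by (intro exI[of _ 1] allI impI) (metis One_nat_def Suc_le_D)
  from growth_set_ge[OF this] pG_ge[of "Suc I"] show ?thesis by linarith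
qed

lemma pG_ge_survival:
  assumes mu: "1 < \<mu>" and KL: "filterlim (KL lam s) at_top sequentially"
  shows "1 - p_ext \<mu> \<le> pG"
proof -
  have "1 - pG \<le> exp (- \<mu> * (pG - 0)) + 2 * 0"
  proof (rule tendsto_lowerbound)
    show "((\<lambda>\<epsilon>. exp (- \<mu> * (pG - \<epsilon>)) + 2 * \<epsilon>) \<longlongrightarrow> exp (- \<mu> * (pG - 0)) + 2 * 0) (at_right 0)"
      by (intro tendsto_intros)
    show "eventually (\<lambda>\<epsilon>. 1 - pG \<le> exp (- \<mu> * (pG - \<epsilon>)) + 2 * \<epsilon>) (at_right 0)"
      using eventually_at_right_less[of 0] by eventually_elim (rule pG_amplify_eps[OF mu])
  qed simp
  then have "1 - pG \<le> exp (\<mu> * ((1 - pG) - 1))" by simp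
  then have "1 - pG \<le> p_ext \<mu>" using pG_pos[OF assms] mu by (intro le_p_extI) auto
  then show ?thesis by simp
qed

end

section \<open>Marginals and the subcritical regime\<close>

text \<open>If the prescribed subtrees are themselves Galton-Watson, old and fresh children form one
  i.i.d. family and the shuffle disappears.\<close>

lemma Pi_pmf_fill:
  "Pi_pmf {1..k} {[]} (\<lambda>_. gwp lam n) \<bind> fill lam n k a =
    Pi_pmf {1..k + a} {[]} (\<lambda>_. gwp lam n) \<bind> (\<lambda>F. return_pmf (node (k + a) F))"
proof -
  let ?g = "\<lambda>_ :: nat. gwp lam n"
  have "Pi_pmf {1..k} {[]} ?g \<bind> fill lam n k a = pmf_of_set (perms (k + a)) \<bind> (\<lambda>\<pi>. Pi_pmf {1..k} {[]} ?g \<bind> (\<lambda>f.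
      Pi_pmf {k + 1..k + a} {[]} ?g \<bind> (\<lambda>E. return_pmf (node (k + a) (\<lambda>j. let i = inv \<pi> j in if i \<le> k then f i else E i)))))"
    unfolding fill_def by (rule bind_commute_pmf)
  also have "\<dots> = pmf_of_set (perms (k + a)) \<bind> (\<lambda>\<pi>. Pi_pmf {1..k + a} {[]} ?g \<bind> (\<lambda>F. return_pmf (node (k + a) F)))"
  proof (rule bind_pmf_cong[OF refl])
    fix \<pi> assume "\<pi> \<in> set_pmf (pmf_of_set (perms (k + a)))"
    then have \<pi>: "\<pi> permutes {1..k + a}" by simp
    have un: "{1..k + a} = {1..k} \<union> {k + 1..k + a}" by auto
    have "Pi_pmf {1..k + a} {[]} ?g \<bind> (\<lambda>F. return_pmf (node (k + a) (\<lambda>j. F (inv \<pi> j)))) =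
      Pi_pmf {1..k} {[]} ?g \<bind> (\<lambda>f. Pi_pmf {k + 1..k + a} {[]} ?g \<bind>
        (\<lambda>E. return_pmf (node (k + a) (\<lambda>j. if inv \<pi> j \<in> {1..k} then f (inv \<pi> j) else E (inv \<pi> j)))))"
      unfolding un by (subst Pi_pmf_union) (auto simp: map_pmf_def pair_pmf_def bind_assoc_pmf bind_return_pmf)
    also have "\<dots> = Pi_pmf {1..k} {[]} ?g \<bind> (\<lambda>f. Pi_pmf {k + 1..k + a} {[]} ?g \<bind>
        (\<lambda>E. return_pmf (node (k + a) (\<lambda>j. let i = inv \<pi> j in if i \<le> k then f i else E i))))"
    proof (intro bind_pmf_cong refl arg_cong[where f = return_pmf] node_cong)
      fix f E j assume "j \<in> {1..k + a}"
      then have "inv \<pi> j \<in> {1..k + a}" using inv_perm_in[OF \<pi>] by blast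
      then show "(if inv \<pi> j \<in> {1..k} then f (inv \<pi> j) else E (inv \<pi> j)) = (let i = inv \<pi> j in if i \<le> k then f i else E i)"
        by (auto simp: Let_def)
    qed
    finally show "Pi_pmf {1..k} {[]} ?g \<bind> (\<lambda>f. Pi_pmf {k + 1..k + a} {[]} ?g \<bind>
        (\<lambda>E. return_pmf (node (k + a) (\<lambda>j. let i = inv \<pi> j in if i \<le> k then f i else E i)))) =
      Pi_pmf {1..k + a} {[]} ?g \<bind> (\<lambda>F. return_pmf (node (k + a) F))"
      unfolding Pi_pmf_perm[OF \<pi>] by simp
  qed
  finally show ?thesis by simp
qed

lemma Poisson_add:
  assumes "0 \<le> \<mu>" "0 \<le> \<nu>"
  shows "do {k \<leftarrow> Poisson \<mu>; a \<leftarrow> Poisson \<nu>; return_pmf (k + a)} = Poisson (\<mu> + \<nu>)"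
proof (rule pmf_eqI)
  fix c
  have "ennreal (pmf (do {k \<leftarrow> Poisson \<mu>; a \<leftarrow> Poisson \<nu>; return_pmf (k + a)}) c) =
    (\<integral>\<^sup>+k. (if k \<le> c then ennreal (pmf (Poisson \<nu>) (c - k)) else 0) \<partial>Poisson \<mu>)"
    unfolding ennreal_pmf_bind
  proof (intro nn_integral_cong)
    fix k
    have "(\<integral>\<^sup>+a. ennreal (pmf (return_pmf (k + a)) c) \<partial>Poisson \<nu>) =
        (\<integral>\<^sup>+a. (if k \<le> c then indicator {c - k} a else 0) \<partial>Poisson \<nu>)"
      by (intro nn_integral_cong) (auto simp: indicator_def)
    then show "(\<integral>\<^sup>+a. ennreal (pmf (return_pmf (k + a)) c) \<partial>Poisson \<nu>) =
        (if k \<le> c then ennreal (pmf (Poisson \<nu>) (c - k)) else 0)" by (auto simp: emeasure_pmf_single)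
  qed
  also have "\<dots> = (\<Sum>k\<in>{..c}. (if k \<le> c then ennreal (pmf (Poisson \<nu>) (c - k)) else 0) * pmf (Poisson \<mu>) k)"
    by (rule nn_integral_measure_pmf_support) auto
  also have "\<dots> = ennreal (\<Sum>k\<in>{..c}. pmf (Poisson \<mu>) k * pmf (Poisson \<nu>) (c - k))"
    by (subst sum_ennreal[symmetric]) (auto intro!: sum.cong simp: ennreal_mult'[symmetric] mult.commute)
  also have "(\<Sum>k\<in>{..c}. pmf (Poisson \<mu>) k * pmf (Poisson \<nu>) (c - k)) = pmf (Poisson (\<mu> + \<nu>)) c"
  proof -
    have "pmf (Poisson \<mu>) k * pmf (Poisson \<nu>) (c - k) =
      of_nat (c choose k) * \<mu> ^ k * \<nu> ^ (c - k) * (exp (- (\<mu> + \<nu>)) / fact c)" if "k \<le> c" for k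
      using assms that by (simp add: pmf_Poisson binomial_fact exp_add[symmetric] exp_minus_inverse field_simps)
    then have "(\<Sum>k\<in>{..c}. pmf (Poisson \<mu>) k * pmf (Poisson \<nu>) (c - k)) =
      (\<Sum>k\<in>{..c}. of_nat (c choose k) * \<mu> ^ k * \<nu> ^ (c - k)) * (exp (- (\<mu> + \<nu>)) / fact c)"
      unfolding sum_distrib_right by (intro sum.cong) auto
    also have "(\<Sum>k\<in>{..c}. of_nat (c choose k) * \<mu> ^ k * \<nu> ^ (c - k)) = (\<mu> + \<nu>) ^ c"
      by (simp add: binomial_ring)
    finally show ?thesis using assms by (simp add: pmf_Poisson)
  qed
  finally show "pmf (do {k \<leftarrow> Poisson \<mu>; a \<leftarrow> Poisson \<nu>; return_pmf (k + a)}) c = pmf (Poisson (\<mu> + \<nu>)) c" by simp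
qed

lemma pmf_bind_mono:
  assumes "\<And>x. pmf p x \<le> C * pmf q x" "0 \<le> C"
  shows "pmf (bind_pmf p f) y \<le> C * pmf (bind_pmf q f) y"
proof -
  have "ennreal (pmf (bind_pmf p f) y) = (\<integral>\<^sup>+x. ennreal (pmf p x) * ennreal (pmf (f x) y) \<partial>count_space UNIV)"
    by (simp add: ennreal_pmf_bind nn_integral_measure_pmf)
  also have "\<dots> \<le> (\<integral>\<^sup>+x. ennreal C * (ennreal (pmf q x) * ennreal (pmf (f x) y)) \<partial>count_space UNIV)"
  proof (intro nn_integral_mono)
    fix x
    have "pmf p x * pmf (f x) y \<le> C * pmf q x * pmf (f x) y" using assms by (intro mult_right_mono) auto
    then show "ennreal (pmf p x) * ennreal (pmf (f x) y) \<le> ennreal C * (ennreal (pmf q x) * ennreal (pmf (f x) y))"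
      using assms(2) by (simp add: ennreal_mult'[symmetric] mult.assoc ennreal_leI)
  qed
  also have "\<dots> = ennreal C * ennreal (pmf (bind_pmf q f) y)"
    by (simp add: nn_integral_cmult ennreal_pmf_bind nn_integral_measure_pmf)
  finally show ?thesis using assms(2) by (simp add: ennreal_mult'[symmetric])
qed

lemma finite_prob_approx:
  assumes "countable A" "0 < \<epsilon>"
  shows "\<exists>F\<subseteq>A. finite F \<and> measure_pmf.prob p A - \<epsilon> \<le> measure_pmf.prob p F"
proof -
  let ?A = "\<lambda>n. {x \<in> A. to_nat_on A x \<le> n}"
  have fin: "finite (?A n)" for n
    by (rule inj_on_finite[of "to_nat_on A" _ "{..n}"]) (auto intro: inj_on_subset[OF inj_on_to_nat_on[OF assms(1)]])
  have "(\<lambda>n. measure_pmf.prob p (?A n)) \<longlonglongrightarrow> measure_pmf.prob p (\<Union>n. ?A n)"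
    by (rule measure_pmf.finite_Lim_measure_incseq) (auto simp: incseq_def)
  also have "(\<Union>n. ?A n) = A" by auto
  finally have "eventually (\<lambda>n. measure_pmf.prob p A - \<epsilon> < measure_pmf.prob p (?A n)) sequentially"
    using assms(2) by (intro order_tendstoD) auto
  then obtain n where "measure_pmf.prob p A - \<epsilon> < measure_pmf.prob p (?A n)" by (auto dest!: eventually_happens)
  then show ?thesis using fin[of n] by (intro exI[of _ "?A n"]) auto
qed

context correlated_trees
begin

text \<open>Each side alone is a Galton-Watson tree of rate \<open>lam\<close>: common and extra
  children superpose, as \<mu> + \<nu> is \<open>lam\<close>, and the shuffle is harmless by
  \<open>Pi_pmf_fill\<close>.\<close>

lemma gwp_qp: "gwp \<mu> n \<bind> qp lam s n = gw n"
proof (induction n)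
  case 0 show ?case by (simp add: qp_0 bind_return_pmf)
next
  case (Suc n)
  have "gwp \<mu> (Suc n) \<bind> qp lam s (Suc n) = Poisson \<mu> \<bind> (\<lambda>k. Pi_pmf {1..k} {[]} (\<lambda>_. gwp \<mu> n) \<bind> (\<lambda>T. qp lam s (Suc n) (node k T)))"
    by (simp add: bind_assoc_pmf bind_return_pmf)
  also have "\<dots> = Poisson \<mu> \<bind> (\<lambda>k. Pi_pmf {1..k} {[]} (\<lambda>_. gwp \<mu> n) \<bind> (\<lambda>T.
     Poisson \<nu> \<bind> (\<lambda>a. Pi_pmf {1..k} {[]} (\<lambda>i. qp lam s n (T i)) \<bind> fill lam n k a)))"
  proof (intro bind_pmf_cong refl)
    fix k :: nat and T assume T: "T \<in> set_pmf (Pi_pmf {1..k} {[]} (\<lambda>_. gwp \<mu> n))"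
    have c: "nchildren (node k T) [] = k"
      by (rule nchildren_node) (use set_gwp[OF set_Pi_pmf_in[OF T]] Nil_in_ltrees_upto in blast)
    have "Pi_pmf {1..k} {[]} (\<lambda>i. qp lam s n (sub (node k T) i)) = Pi_pmf {1..k} {[]} (\<lambda>i. qp lam s n (T i))"
      by (intro Pi_pmf_cong) (auto simp: sub_node)
    then show "qp lam s (Suc n) (node k T) = Poisson \<nu> \<bind> (\<lambda>a. Pi_pmf {1..k} {[]} (\<lambda>i. qp lam s n (T i)) \<bind> fill lam n k a)"
      by (simp add: qp_Suc c)
  qed
  also have "\<dots> = Poisson \<mu> \<bind> (\<lambda>k. Poisson \<nu> \<bind> (\<lambda>a. Pi_pmf {1..k} {[]} (\<lambda>_. gwp \<mu> n) \<bind> (\<lambda>T.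
     Pi_pmf {1..k} {[]} (\<lambda>i. qp lam s n (T i)) \<bind> fill lam n k a)))"
    by (simp only: bind_commute_pmf[of "Pi_pmf C d P" "Poisson \<nu>" for C d P])
  also have "\<dots> = Poisson \<mu> \<bind> (\<lambda>k. Poisson \<nu> \<bind> (\<lambda>a. Pi_pmf {1..k} {[]} (\<lambda>_. gw n) \<bind> fill lam n k a))"
  proof ((rule bind_pmf_cong[OF refl])+)
    fix k a :: nat
    have "Pi_pmf {1..k} {[]} (\<lambda>_. gwp \<mu> n) \<bind> (\<lambda>T. Pi_pmf {1..k} {[]} (\<lambda>i. qp lam s n (T i))) = Pi_pmf {1..k} {[]} (\<lambda>_. gw n)"
      unfolding Suc.IH[symmetric] by (rule Pi_pmf_bind[symmetric]) simp
    then show "Pi_pmf {1..k} {[]} (\<lambda>_. gwp \<mu> n) \<bind> (\<lambda>T. Pi_pmf {1..k} {[]} (\<lambda>i. qp lam s n (T i)) \<bind> fill lam n k a) =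
      Pi_pmf {1..k} {[]} (\<lambda>_. gw n) \<bind> fill lam n k a"
      by (simp add: bind_assoc_pmf[symmetric])
  qed
  also have "\<dots> = do {k \<leftarrow> Poisson \<mu>; a \<leftarrow> Poisson \<nu>; return_pmf (k + a)} \<bind>
     (\<lambda>c. Pi_pmf {1..c} {[]} (\<lambda>_. gw n) \<bind> (\<lambda>F. return_pmf (node c F)))"
    unfolding Pi_pmf_fill bind_assoc_pmf bind_return_pmf ..
  also have "\<dots> = gw (Suc n)"
    unfolding Poisson_add[OF mu_nonneg nu_nonneg] by (simp add: algebra_simps)
  finally show ?case .
qed

lemma map_fst_p1: "map_pmf fst (p1 n) = gw n"
  unfolding p1p_def map_bind_pmf map_fst_pair_pmf by (rule gwp_qp)

text \<open>A joint mass is at most the mass of its second marginal, which cancels one factor of the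
  denominator. Large log-ratios are thereby bounded by the information content of one tree.\<close>

lemma lr_le: 
  assumes "z \<in> X2 n" shows "lr n z \<le> 1 / pmf (gw n) (fst z)"
proof -
  obtain x y where z: "z = (x, y)" by (cases z)
  have pos: "pmf (gw n) x > 0" "pmf (gw n) y > 0" using assms z pmf_gw_pos by auto
  have sym: "map_pmf snd (p1 n) = gw n"
    unfolding p1p_def map_bind_pmf map_snd_pair_pmf by (rule gwp_qp)
  have "pmf (p1 n) (x, y) \<le> measure_pmf.prob (p1 n) (snd -` {y})"
    unfolding measure_pmf_single[symmetric] by (intro measure_pmf.finite_measure_mono) auto
  also have "\<dots> = pmf (gw n) y" by (simp add: pmf_map[symmetric] sym)
  finally have "lr n (x, y) * (pmf (gw n) x * pmf (gw n) y) \<le> pmf (gw n) y"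
    unfolding pmf_p1_eq by (simp add: p0p_def pmf_pair)
  then have "lr n (x, y) * pmf (gw n) x \<le> 1" using pos by (simp add: mult.assoc[symmetric])
  then show ?thesis using pos by (simp add: z pos_le_divide_eq)
qed

text \<open>Thinning: the mass of \<open>k + a\<close> under rate \<open>lam\<close>, times the
  binomial probability of selecting \<open>k\<close> of them, is the product of the Poisson masses
  of \<open>k\<close> (rate \<mu>) and \<open>a\<close> (rate \<nu>). Bounding the binomial
  probability by 1 leaves the factor \<open>1 / pmf (Poisson \<mu>) k\<close>, which is the constant
  here.\<close>

lemma Poisson_weight_bound:
  assumes "0 < s \<or> k = 0"
  shows "pmf (Poisson \<nu>) a \<le> (exp \<mu> * fact k / \<mu> ^ k) * pmf (Poisson lam) (k + a)"
proof -
  have mk: "\<mu> ^ k > 0" using assms lam_pos by (auto simp: power_mult_distrib)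
  have "of_nat (k + a choose k) * s ^ k * (1 - s) ^ (k + a - k) \<le> (\<Sum>i\<le>k + a. of_nat (k + a choose i) * s ^ i * (1 - s) ^ (k + a - i))"
    using s_nonneg s_le_1 by (intro member_le_sum) auto
  also have "\<dots> = (s + (1 - s)) ^ (k + a)" by (rule binomial_ring[symmetric])
  finally have "of_nat (k + a choose k) * s ^ k * (1 - s) ^ a \<le> (1 :: real)" by simp
  moreover have "of_nat (k + a choose k) = (fact (k + a) / (fact k * fact a) :: real)"
    by (subst binomial_fact) auto
  ultimately have le: "fact (k + a) / (fact k * fact a) * s ^ k * (1 - s) ^ a \<le> (1 :: real)" by simp
  have "(exp \<mu> * fact k / \<mu> ^ k) * pmf (Poisson lam) (k + a) = exp (\<mu> - lam) * (fact k * lam ^ (k + a) / (\<mu> ^ k * fact (k + a)))"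
    using lam_pos by (simp add: pmf_Poisson exp_diff exp_minus field_simps)
  also have "\<mu> - lam = - \<nu>" by (simp add: algebra_simps)
  finally have R: "(exp \<mu> * fact k / \<mu> ^ k) * pmf (Poisson lam) (k + a) = exp (- \<nu>) * (fact k * lam ^ (k + a) / (\<mu> ^ k * fact (k + a)))" .
  have "\<nu> ^ a / fact a * (\<mu> ^ k * fact (k + a)) = fact k * lam ^ (k + a) * (fact (k + a) / (fact k * fact a) * s ^ k * (1 - s) ^ a)"
    unfolding power_mult_distrib power_add by (simp add: field_simps)
  also have "\<dots> \<le> fact k * lam ^ (k + a) * 1" using le lam_pos by (intro mult_left_mono) auto
  finally have "\<nu> ^ a / fact a \<le> fact k * lam ^ (k + a) / (\<mu> ^ k * fact (k + a))"
    using mk by (simp add: pos_le_divide_eq)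
  then have "exp (- \<nu>) * (\<nu> ^ a / fact a) \<le> exp (- \<nu>) * (fact k * lam ^ (k + a) / (\<mu> ^ k * fact (k + a)))"
    by (intro mult_left_mono) auto
  then show ?thesis unfolding R pmf_Poisson[OF nu_nonneg] by (simp only: mult.commute)
qed

text \<open>The constant combines the cost of the root degree with the product of the children's
  constants. It does not involve \<open>n\<close>, which is what gives domination uniform in the
  depth; \<open>max 1\<close> takes care of depth \<open>0\<close>.\<close>

lemma qp_dominated_step:
  assumes s: "0 < s \<or> nchildren t [] = 0"
    and C: "\<And>i. i \<in> {1..nchildren t []} \<Longrightarrow> 0 \<le> C i"
      "\<And>i n x. i \<in> {1..nchildren t []} \<Longrightarrow> pmf (qp lam s n (sub t i)) x \<le> C i * pmf (gw n) x"
  shows "\<exists>C\<ge>0. \<forall>n x. pmf (qp lam s n t) x \<le> C * pmf (gw n) x"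
proof -
  let ?k = "nchildren t []"
  define C1 where "C1 = exp \<mu> * fact ?k / \<mu> ^ ?k"
  define C2 where "C2 = (\<Prod>i\<in>{1..?k}. C i)"
  have C0: "0 \<le> C1" "0 \<le> C2" using mu_nonneg C(1) by (auto simp: C1_def C2_def intro!: prod_nonneg)
  have "pmf (qp lam s n t) x \<le> max 1 (C1 * C2) * pmf (gw n) x" for n x
  proof (cases n)
    case 0
    then show ?thesis using mult_right_mono[of 1 "max 1 (C1 * C2)" "pmf (gw 0) x"] by (simp add: qp_0)
  next
    case (Suc m)
    let ?T = "\<lambda>c. Pi_pmf {1..c} {[]} (\<lambda>_. gw m) \<bind> (\<lambda>F. return_pmf (node c F))"
    let ?U = "\<lambda>a. Pi_pmf {1..?k} {[]} (\<lambda>i. qp lam s m (sub t i)) \<bind> fill lam m ?k a"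
    have U: "pmf (?U a) x \<le> C2 * pmf (?T (?k + a)) x" for a
      unfolding Pi_pmf_fill[symmetric]
    proof (rule pmf_bind_mono[OF _ C0(2)])
      fix f
      have "(\<Prod>i\<in>{1..?k}. pmf (qp lam s m (sub t i)) (f i)) \<le> (\<Prod>i\<in>{1..?k}. C i * pmf (gw m) (f i))"
        using C by (intro prod_mono) auto
      also have "\<dots> = C2 * (\<Prod>i\<in>{1..?k}. pmf (gw m) (f i))" by (simp add: prod.distrib C2_def)
      finally show "pmf (Pi_pmf {1..?k} {[]} (\<lambda>i. qp lam s m (sub t i))) f \<le> C2 * pmf (Pi_pmf {1..?k} {[]} (\<lambda>_. gw m)) f"
        by (auto simp: pmf_Pi)
    qed
    have "ennreal (pmf (qp lam s (Suc m) t) x) = (\<integral>\<^sup>+a. ennreal (pmf (Poisson \<nu>) a) * ennreal (pmf (?U a) x) \<partial>count_space UNIV)"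
      by (simp add: qp_Suc ennreal_pmf_bind[of "Poisson \<nu>"] nn_integral_measure_pmf)
    also have "\<dots> \<le> (\<integral>\<^sup>+a. ennreal (C1 * C2) * (ennreal (pmf (Poisson lam) (?k + a)) * ennreal (pmf (?T (?k + a)) x)) \<partial>count_space UNIV)"
    proof (intro nn_integral_mono)
      fix a
      have "pmf (Poisson \<nu>) a * pmf (?U a) x \<le> (C1 * pmf (Poisson lam) (?k + a)) * (C2 * pmf (?T (?k + a)) x)"
        using Poisson_weight_bound[OF s, of a, folded C1_def] U[of a] C0 by (intro mult_mono mult_nonneg_nonneg) auto
      also have "\<dots> = (C1 * C2) * (pmf (Poisson lam) (?k + a) * pmf (?T (?k + a)) x)" by (simp only: ac_simps)
      finally show "ennreal (pmf (Poisson \<nu>) a) * ennreal (pmf (?U a) x) \<le>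
        ennreal (C1 * C2) * (ennreal (pmf (Poisson lam) (?k + a)) * ennreal (pmf (?T (?k + a)) x))"
        using C0 by (simp only: ennreal_mult'[symmetric] pmf_nonneg mult_nonneg_nonneg ennreal_leI)
    qed
    also have "\<dots> = ennreal (C1 * C2) * (\<integral>\<^sup>+a. ennreal (pmf (Poisson lam) (?k + a)) * ennreal (pmf (?T (?k + a)) x) \<partial>count_space UNIV)"
      by (rule nn_integral_cmult) simp
    \<comment> \<open>Substitution \<open>c = k + a\<close>; extending afterwards to all degrees
      \<open>c\<close> only increases the integral.\<close>
    also have "(\<integral>\<^sup>+a. ennreal (pmf (Poisson lam) (?k + a)) * ennreal (pmf (?T (?k + a)) x) \<partial>count_space UNIV) =
        (\<integral>\<^sup>+c. ennreal (pmf (Poisson lam) c) * ennreal (pmf (?T c) x) \<partial>count_space ((+) ?k ` UNIV))"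
      by (rule nn_integral_bij_count_space) (auto simp: bij_betw_def)
    also have "\<dots> \<le> (\<integral>\<^sup>+c. ennreal (pmf (Poisson lam) c) * ennreal (pmf (?T c) x) \<partial>count_space UNIV)"
      by (subst nn_integral_count_space_indicator) (auto intro!: nn_integral_mono simp: indicator_def)
    also have "\<dots> = ennreal (pmf (gw (Suc m)) x)"
      by (simp add: ennreal_pmf_bind[of "Poisson lam"] nn_integral_measure_pmf)
    finally have "ennreal (pmf (qp lam s (Suc m) t) x) \<le> ennreal (C1 * C2) * ennreal (pmf (gw (Suc m)) x)"
      by (simp add: mult_left_mono)
    then have "pmf (qp lam s (Suc m) t) x \<le> (C1 * C2) * pmf (gw (Suc m)) x"
      using C0 by (simp only: ennreal_mult'[symmetric] mult_nonneg_nonneg pmf_nonneg ennreal_le_iff)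
    also have "\<dots> \<le> max 1 (C1 * C2) * pmf (gw (Suc m)) x" by (intro mult_right_mono) auto
    finally show ?thesis using Suc by simp
  qed
  then show ?thesis by (intro exI[of _ "max 1 (C1 * C2)"]) auto
qed

lemma qp_dominated:
  assumes "t \<in> ltrees_upto h" "0 < s \<or> h = 0"
  shows "\<exists>C\<ge>0. \<forall>n x. pmf (qp lam s n t) x \<le> C * pmf (gw n) x"
  using assms
proof (induction h arbitrary: t)
  case 0
  then have "t = {[]}" by (simp add: ltrees_upto_0)
  then have "nchildren t [] = 0" by (simp add: nchildren_def)
  then show ?case by (intro qp_dominated_step[where C = "\<lambda>_. 1"]) auto
next
  case (Suc h)
  have "\<forall>i\<in>{1..nchildren t []}. \<exists>C\<ge>0. \<forall>n x. pmf (qp lam s n (sub t i)) x \<le> C * pmf (gw n) x"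
    using Suc.IH Suc.prems sub_in_ltrees_upto by blast
  then obtain C where "\<And>i. i \<in> {1..nchildren t []} \<Longrightarrow> 0 \<le> C i \<and> (\<forall>n x. pmf (qp lam s n (sub t i)) x \<le> C i * pmf (gw n) x)"
    by metis
  then show ?case using Suc.prems by (intro qp_dominated_step[where C = C]) auto
qed

text \<open>Up to probability \<epsilon> the common tree lies in a finite set \<open>F\<close> of
  trees that die out before depth \<open>h\<close>. Each of these dominates with its own constant,
  and finiteness makes a common constant possible.\<close>

lemma subcritical_dominated:
  assumes mu: "\<mu> \<le> 1" and \<epsilon>: "0 < \<epsilon>"
  shows "\<exists>C\<ge>0. \<forall>d A. measure_pmf.prob (p1 d) A \<le> \<epsilon> + C * measure_pmf.prob (p0 d) A"
proof -
  have "ext \<mu> \<longlonglongrightarrow> 1" using ext_tendsto_p_ext[of \<mu>] p_ext_subcritical[OF mu_nonneg mu] by simp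
  then have "eventually (\<lambda>n. ext \<mu> n > 1 - \<epsilon> / 2) sequentially" using \<epsilon> by (intro order_tendstoD) auto
  then obtain h where h: "ext \<mu> h > 1 - \<epsilon> / 2" by (auto dest!: eventually_happens)
  let ?S = "short h \<inter> set_pmf (gwp \<mu> h)"
  obtain F where F: "F \<subseteq> ?S" "finite F" "measure_pmf.prob (gwp \<mu> h) ?S - \<epsilon> / 2 \<le> measure_pmf.prob (gwp \<mu> h) F"
    using finite_prob_approx[of ?S "\<epsilon> / 2" "gwp \<mu> h"] \<epsilon> by (auto intro: countable_Int2)
  have "measure_pmf.prob (gwp \<mu> h) ?S = ext \<mu> h" by (simp add: ext_def measure_Int_set_pmf)
  then have PF: "1 - \<epsilon> \<le> measure_pmf.prob (gwp \<mu> h) F" using F(3) h by linarith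
  have Fl: "t \<in> ltrees_upto h" if "t \<in> F" for t using F(1) that set_gwp by blast
  have "\<forall>t\<in>F. \<exists>C\<ge>0. \<forall>n x. pmf (qp lam s n t) x \<le> C * pmf (gw n) x"
  proof
    fix t assume t: "t \<in> F"
    show "\<exists>C\<ge>0. \<forall>n x. pmf (qp lam s n t) x \<le> C * pmf (gw n) x"
    proof (cases "s = 0")
      case False
      then show ?thesis using qp_dominated[OF Fl[OF t]] s_nonneg by auto
    next
      \<comment> \<open>With \<open>s = 0\<close> the common tree is just its root, so domination is
        needed only for the tree of depth \<open>0\<close>.\<close>
      case True
      have "t' = {[]}" if "t' \<in> set_pmf (gwp 0 n)" for t' n
      proof (cases n)
        case (Suc m)
        then have "t' = node 0 (\<lambda>_. {[]})" using that by (auto simp: Poisson_def)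
        then show ?thesis by (auto simp: node_def)
      qed (use that in auto)
      then have "t \<in> ltrees_upto 0" using t F(1) True by (auto simp: ltrees_upto_0)
      then show ?thesis by (rule qp_dominated) simp
    qed
  qed
  then obtain C where C: "\<And>t. t \<in> F \<Longrightarrow> 0 \<le> C t" "\<And>t n x. t \<in> F \<Longrightarrow> pmf (qp lam s n t) x \<le> C t * pmf (gw n) x"
    by metis
  \<comment> \<open>Both sides are dominated separately given the common tree, hence the squares;
    the sum is a common upper bound over \<open>F\<close>.\<close>
  define C' where "C' = (\<Sum>t\<in>F. (C t)\<^sup>2)"
  have C': "0 \<le> C'" by (simp add: C'_def sum_nonneg)
  have main: "measure_pmf.prob (p1 d) A \<le> \<epsilon> + C' * measure_pmf.prob (p0 d) A" if d: "h \<le> d" for d A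
  proof -
    let ?q = "\<lambda>t. measure_pmf.prob (pair_pmf (qp lam s d t) (qp lam s d t)) A"
    have q: "?q t \<le> indicator (- F) t + C' * measure_pmf.prob (p0 d) A" for t
    proof (cases "t \<in> F")
      case True
      have "?q t \<le> (C t)\<^sup>2 * measure_pmf.prob (p0 d) A"
      proof (rule prob_pmf_le_mult)
        fix z
        show "pmf (pair_pmf (qp lam s d t) (qp lam s d t)) z \<le> (C t)\<^sup>2 * pmf (p0 d) z"
        proof (cases z)
          case (Pair x y)
          have "pmf (qp lam s d t) x * pmf (qp lam s d t) y \<le> (C t * pmf (gw d) x) * (C t * pmf (gw d) y)"
            using C True by (intro mult_mono) auto
          then show ?thesis by (simp add: Pair pmf_pair p0p_def power2_eq_square ac_simps)
        qed
      qed simp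
      also have "(C t)\<^sup>2 \<le> C'" unfolding C'_def using F(2) True by (intro member_le_sum) auto
      finally show ?thesis using True by (simp add: mult_right_mono)
    next
      case False
      have "?q t \<le> 1" by simp
      moreover have "0 \<le> C' * measure_pmf.prob (p0 d) A" using C' by simp
      moreover have "indicator (- F) t = (1 :: real)" using False by simp
      ultimately show ?thesis by linarith
    qed
    have "measure_pmf.prob (p1 d) A = (\<integral>t. ?q t \<partial>gwp \<mu> d)" unfolding p1p_def prob_bind_pmf ..
    also have "\<dots> \<le> (\<integral>t. indicator (- F) t + C' * measure_pmf.prob (p0 d) A \<partial>gwp \<mu> d)"
    proof (rule integral_mono[OF _ _ q])
      show "integrable (gwp \<mu> d) ?q" by (rule measure_pmf.integrable_const_bound[where B = 1]) auto
      show "integrable (gwp \<mu> d) (\<lambda>t. indicator (- F) t + C' * measure_pmf.prob (p0 d) A)"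
        using integrable_pmf_indicator[of "gwp \<mu> d" "- F"] by simp
    qed
    also have "\<dots> = measure_pmf.prob (gwp \<mu> d) (- F) + C' * measure_pmf.prob (p0 d) A"
      using integrable_pmf_indicator[of "gwp \<mu> d" "- F"] by simp
    also have "measure_pmf.prob (gwp \<mu> d) (- F) \<le> \<epsilon>"
    proof -
      have "measure_pmf.prob (gwp \<mu> h) F = measure_pmf.prob (gwp \<mu> d) (prune h -` F)"
        using map_prune_gwp[OF d, of \<mu>] by (metis measure_map_pmf)
      \<comment> \<open>A tree whose pruning at \<open>h\<close> has no node at depth
        \<open>h\<close> has none below either, so it equals that pruning. Thus \<open>F\<close>
        keeps its mass at larger depths.\<close>
      also have "\<dots> \<le> measure_pmf.prob (gwp \<mu> d) F"
      proof (rule measure_pmf.finite_measure_mono_AE, unfold AE_measure_pmf_iff, intro ballI impI)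
        fix t assume t: "t \<in> set_pmf (gwp \<mu> d)" "t \<in> prune h -` F"
        have tl: "t \<in> ltrees" using set_gwp[OF t(1)] by (rule ltrees_upto_imp)
        have sh: "prune h t \<in> short h" using t(2) F(1) by auto
        have "length m \<le> h" if "m \<in> t" for m
        proof (rule ccontr)
          assume "\<not> length m \<le> h"
          then have "take h m \<in> t" "length (take h m) = h" using ltrees_prefix[OF tl, of "take h m" "drop h m"] that by auto
          then show False using sh by (auto simp: short_def prune_def)
        qed
        then have "prune h t = t" by (auto simp: prune_def)
        then show "t \<in> F" using t(2) by simp
      qed simp
      finally have "1 - \<epsilon> \<le> measure_pmf.prob (gwp \<mu> d) F" using PF by linarith
      then show ?thesis using measure_pmf.prob_compl[of F "gwp \<mu> d"] by (simp add: Compl_eq_Diff_UNIV)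
    qed
    finally show ?thesis by simp
  qed
  have "measure_pmf.prob (p1 d) A \<le> \<epsilon> + C' * measure_pmf.prob (p0 d) A" for d A
  proof (cases "h \<le> d")
    case True then show ?thesis by (rule main)
  next
    case False
    then have "d \<le> h" by simp
    from main[OF order_refl, of "prune2 d -` A"] show ?thesis
      unfolding prob_p1_prune2[OF \<open>d \<le> h\<close>] prob_p0_prune2[OF \<open>d \<le> h\<close>] .
  qed
  then show ?thesis using C' by blast
qed

lemma Likelihood_test_imp_supercritical:
  assumes Likelihood_test shows "1 < \<mu>"
proof (rule ccontr)
  assume "\<not> 1 < \<mu>"
  then have mu: "\<mu> \<le> 1" by simp
  obtain a e where a: "filterlim a at_top sequentially" and e: "e > 0"
    "eventually (\<lambda>d. e \<le> measure_pmf.prob (p1 d) {x. lr d x > a d}) sequentially"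
    using assms unfolding Likelihood_test_def by blast
  obtain C where C: "C \<ge> 0" "\<And>d A. measure_pmf.prob (p1 d) A \<le> e / 2 + C * measure_pmf.prob (p0 d) A"
    using subcritical_dominated[OF mu, of "e / 2"] e(1) by auto
  have "eventually (\<lambda>d. a d > max 0 (2 * C / e)) sequentially" using a unfolding filterlim_at_top_dense by blast
  then have "eventually (\<lambda>d. a d > max 0 (2 * C / e) \<and> e \<le> measure_pmf.prob (p1 d) {x. lr d x > a d}) sequentially"
    using e(2) by (rule eventually_conj)
  then obtain d where d: "0 < a d" "2 * C / e < a d" "e \<le> measure_pmf.prob (p1 d) {x. lr d x > a d}"
    by (auto dest!: eventually_happens)
  have "C * measure_pmf.prob (p0 d) {x. lr d x > a d} \<le> C * (1 / a d)"
    using prob_p0_lr_gt[OF d(1)] C(1) by (intro mult_left_mono) auto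
  also have "\<dots> < e / 2" using d(1,2) e(1) by (simp add: field_simps)
  finally show False using C(2)[of d "{x. lr d x > a d}"] d(3) by linarith
qed

section \<open>Divergence of the relative entropy\<close>

lemma neg_ln_pmf_nonneg: "0 \<le> - ln (pmf p x)"
  by (cases "pmf p x = 0") (auto simp: pmf_le_1 pmf_pos less_le)

text \<open>Finite entropy, by the recursion: the entropy at depth \<open>n + 1\<close> is that of
  the degree plus \<open>lam\<close> times the entropy at depth \<open>n\<close>.\<close>

lemma nn_integral_neg_ln_gw: "(\<integral>\<^sup>+x. ennreal (- ln (pmf (gw n) x)) \<partial>gw n) < \<infinity>"
proof (induction n)
  case 0 show ?case by simp
next
  case (Suc n)
  let ?e = "\<lambda>x. ennreal (- ln (pmf (gw n) x))"
  let ?I = "\<integral>\<^sup>+x. ?e x \<partial>gw n"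
  have gen: "(\<integral>\<^sup>+x. h x \<partial>gw (Suc n)) = (\<integral>\<^sup>+c. \<integral>\<^sup>+F. h (node c F) \<partial>Pi_pmf {1..c} {[]} (\<lambda>_. gw n) \<partial>Poisson lam)"
    for h by simp
  have "(\<integral>\<^sup>+x. ennreal (- ln (pmf (gw (Suc n)) x)) \<partial>gw (Suc n)) =
    (\<integral>\<^sup>+c. \<integral>\<^sup>+F. ennreal (- ln (pmf (gw (Suc n)) (node c F))) \<partial>Pi_pmf {1..c} {[]} (\<lambda>_. gw n) \<partial>Poisson lam)"
    by (rule gen)
  also have "\<dots> = (\<integral>\<^sup>+c. ennreal (- ln (pmf (Poisson lam) c)) + of_nat c * ?I \<partial>Poisson lam)"
  proof (intro nn_integral_cong)
    fix c :: nat
    let ?P = "Pi_pmf {1..c} {[]} (\<lambda>_. gw n)"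
    have "(\<integral>\<^sup>+F. ennreal (- ln (pmf (gw (Suc n)) (node c F))) \<partial>?P) =
      (\<integral>\<^sup>+F. ennreal (- ln (pmf (Poisson lam) c)) + (\<Sum>i\<in>{1..c}. ?e (F i)) \<partial>?P)"
    proof (intro nn_integral_cong_AE, unfold AE_measure_pmf_iff, intro ballI)
      fix F assume F: "F \<in> set_pmf ?P"
      have Fi: "F i \<in> ltrees_upto n" if "i \<in> {1..c}" for i using set_gwp[OF set_Pi_pmf_in[OF F that]] .
      have pos: "pmf (gw n) (F i) > 0" if "i \<in> {1..c}" for i using pmf_gw_pos[OF Fi[OF that]] .
      have posc: "pmf (Poisson lam) c > 0" using lam_pos by (simp add: pmf_Poisson)
      have "- ln (pmf (gw (Suc n)) (node c F)) = - ln (pmf (Poisson lam) c) + (\<Sum>i\<in>{1..c}. - ln (pmf (gw n) (F i)))"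
      proof -
        have gn: "pmf (gw (Suc n)) (node c F) = pmf (Poisson lam) c * (\<Prod>i\<in>{1..c}. pmf (gw n) (F i))"
          by (rule pmf_gwp_node) (rule Nil_in_ltrees_upto[OF Fi])
        have "ln (\<Prod>i\<in>{1..c}. pmf (gw n) (F i)) = (\<Sum>i\<in>{1..c}. ln (pmf (gw n) (F i)))"
          by (rule ln_prod[OF finite_atLeastAtMost]) (rule less_imp_neq[OF pos, THEN not_sym])
        moreover have "ln (pmf (Poisson lam) c * (\<Prod>i\<in>{1..c}. pmf (gw n) (F i))) =
            ln (pmf (Poisson lam) c) + ln (\<Prod>i\<in>{1..c}. pmf (gw n) (F i))"
          by (rule ln_mult_pos[OF posc]) (rule prod_pos, rule pos)
        ultimately show ?thesis unfolding gn by (simp add: sum_negf)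
      qed
      moreover have "(\<Sum>i\<in>{1..c}. ?e (F i)) = ennreal (\<Sum>i\<in>{1..c}. - ln (pmf (gw n) (F i)))"
        by (rule sum_ennreal) (rule neg_ln_pmf_nonneg)
      ultimately show "ennreal (- ln (pmf (gw (Suc n)) (node c F))) = ennreal (- ln (pmf (Poisson lam) c)) + (\<Sum>i\<in>{1..c}. ?e (F i))"
        by (simp only: ennreal_plus[OF neg_ln_pmf_nonneg sum_nonneg[OF neg_ln_pmf_nonneg]])
    qed
    also have "\<dots> = ennreal (- ln (pmf (Poisson lam) c)) + (\<Sum>i\<in>{1..c}. \<integral>\<^sup>+F. ?e (F i) \<partial>?P)"
      by (subst nn_integral_add) (auto simp: nn_integral_sum measure_pmf.emeasure_space_1[simplified])
    also have "(\<Sum>i\<in>{1..c}. \<integral>\<^sup>+F. ?e (F i) \<partial>?P) = (\<Sum>i\<in>{1..c}. ?I)"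
    proof (rule sum.cong)
      fix i assume i: "i \<in> {1..c}"
      have "(\<integral>\<^sup>+F. ?e (F i) \<partial>?P) = (\<integral>\<^sup>+x. ?e x \<partial>map_pmf (\<lambda>F. F i) ?P)" by simp
      then show "(\<integral>\<^sup>+F. ?e (F i) \<partial>?P) = ?I" using i by (simp add: Pi_pmf_component)
    qed simp
    finally show "(\<integral>\<^sup>+F. ennreal (- ln (pmf (gw (Suc n)) (node c F))) \<partial>?P) = ennreal (- ln (pmf (Poisson lam) c)) + of_nat c * ?I"
      by simp
  qed
  also have "\<dots> = (\<integral>\<^sup>+c. ennreal (- ln (pmf (Poisson lam) c)) \<partial>Poisson lam) + (\<integral>\<^sup>+c. of_nat c \<partial>Poisson lam) * ?I"
    by (subst nn_integral_add) (auto simp: nn_integral_multc)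
  also have "\<dots> < \<infinity>"
  proof -
    have "(\<integral>\<^sup>+c. ennreal (- ln (pmf (Poisson lam) c)) \<partial>Poisson lam) \<le>
      (\<integral>\<^sup>+c. ennreal ((lam + \<bar>ln lam\<bar> + 2) * exp (1 * real c)) \<partial>Poisson lam)"
    proof (intro nn_integral_mono ennreal_leI)
      fix c
      have "- ln (pmf (Poisson lam) c) = lam - real c * ln lam + ln (fact c)"
        using lam_pos pmf_Poisson_exp[of lam c] by (simp add: Poisson_def)
      also have "\<dots> \<le> (lam + \<bar>ln lam\<bar> + 2) * exp (real c)"
      proof -
        have c: "1 \<le> exp (real c)" "real c \<le> exp (real c)" using exp_ge_add_one_self[of "real c"] by linarith+
        have "lam \<le> lam * exp (real c)" using lam_pos c by simp
        moreover have "- (real c * ln lam) \<le> \<bar>ln lam\<bar> * exp (real c)"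
        proof -
          have "- (real c * ln lam) \<le> \<bar>ln lam\<bar> * real c" by (simp add: abs_if mult.commute)
          also have "\<dots> \<le> \<bar>ln lam\<bar> * exp (real c)" using c by (intro mult_left_mono) auto
          finally show ?thesis .
        qed
        moreover have "ln (fact c) \<le> 2 * exp (real c)" using ln_fact_le[of c] square_le_exp[of "real c"] by linarith
        ultimately show ?thesis unfolding distrib_right by linarith
      qed
      finally show "- ln (pmf (Poisson lam) c) \<le> (lam + \<bar>ln lam\<bar> + 2) * exp (1 * real c)" by simp
    qed
    also have "\<dots> < \<infinity>"
      using integrable_Poisson_exp[of lam 1] lam_pos
      by (simp add: integrable_iff_bounded ennreal_mult' nn_integral_cmult ennreal_mult_less_top)
    finally have 1: "(\<integral>\<^sup>+c. ennreal (- ln (pmf (Poisson lam) c)) \<partial>Poisson lam) < \<infinity>" .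
    have 2: "(\<integral>\<^sup>+c. of_nat c \<partial>Poisson lam) < \<infinity>"
      using Poisson_mean(1)[of lam] lam_pos by (simp add: integrable_iff_bounded ennreal_of_nat_eq_real_of_nat)
    show ?thesis using 1 2 Suc by (simp add: ennreal_mult_less_top)
  qed
  finally show ?case .
qed

text \<open>Positive values are dominated by the information content of the first tree through
  \<open>lr_le\<close>, negative ones by the square bound. This rules out that the integral
  expressing \<open>KL\<close> is a mere default value.\<close>

lemma integrable_ln_lr: "integrable (p1 n) (\<lambda>z. ln (lr n z))"
proof (rule integrableI_bounded)
  have "(\<integral>\<^sup>+z. ennreal (norm (ln (lr n z))) \<partial>p1 n) \<le>
    (\<integral>\<^sup>+z. ennreal (- ln (pmf (gw n) (fst z))) + (1 + ennreal ((ln (lr n z))\<^sup>2) * indicator {z. lr n z < 1} z) \<partial>p1 n)"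
  proof (intro nn_integral_mono_AE, unfold AE_measure_pmf_iff, intro ballI)
    fix z assume z: "z \<in> set_pmf (p1 n)"
    have p: "lr n z > 0" using lr_pos[OF z] .
    have zX: "z \<in> X2 n" using z set_p1p by blast
    show "ennreal (norm (ln (lr n z))) \<le> ennreal (- ln (pmf (gw n) (fst z))) + (1 + ennreal ((ln (lr n z))\<^sup>2) * indicator {z. lr n z < 1} z)"
    proof (cases "lr n z < 1")
      case True
      have "\<bar>ln (lr n z)\<bar> \<le> 1 + (ln (lr n z))\<^sup>2"
      proof -
        have "0 \<le> (\<bar>ln (lr n z)\<bar> - 1)\<^sup>2 + \<bar>ln (lr n z)\<bar>" by simp
        then show ?thesis by (simp add: power2_eq_square algebra_simps)
      qed
      then have "ennreal (norm (ln (lr n z))) \<le> 1 + ennreal ((ln (lr n z))\<^sup>2)"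
        by (simp add: ennreal_leI ennreal_plus[symmetric] flip: ennreal_1 del: ennreal_plus ennreal_1)
      also have "\<dots> \<le> ennreal (- ln (pmf (gw n) (fst z))) + (1 + ennreal ((ln (lr n z))\<^sup>2) * indicator {z. lr n z < 1} z)"
        using True by (simp add: add_increasing)
      finally show ?thesis .
    next
      case False
      have pos: "pmf (gw n) (fst z) > 0" using zX pmf_gw_pos by (auto simp: mem_Times_iff)
      have "ln (lr n z) \<le> ln (1 / pmf (gw n) (fst z))" using lr_le[OF zX] p pos by (subst ln_le_cancel_iff) auto
      also have "\<dots> = - ln (pmf (gw n) (fst z))" using pos by (simp add: ln_div)
      finally have "norm (ln (lr n z)) \<le> - ln (pmf (gw n) (fst z))" using False by simp
      then show ?thesis by (intro add_increasing2 ennreal_leI) auto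
    qed
  qed
  also have "\<dots> = (\<integral>\<^sup>+z. ennreal (- ln (pmf (gw n) (fst z))) \<partial>p1 n) +
     (1 + (\<integral>\<^sup>+z. ennreal ((ln (lr n z))\<^sup>2) * indicator {z. lr n z < 1} z \<partial>p1 n))"
    by (simp add: nn_integral_add measure_pmf.emeasure_space_1[simplified])
  also have "(\<integral>\<^sup>+z. ennreal (- ln (pmf (gw n) (fst z))) \<partial>p1 n) = (\<integral>\<^sup>+x. ennreal (- ln (pmf (gw n) x)) \<partial>map_pmf fst (p1 n))"
    by simp
  also have "\<dots> + (1 + (\<integral>\<^sup>+z. ennreal ((ln (lr n z))\<^sup>2) * indicator {z. lr n z < 1} z \<partial>p1 n)) < \<infinity>"
    unfolding map_fst_p1 using nn_integral_neg_ln_gw[of n] le_less_trans[OF ln_lr_neg_square[of n], of \<infinity>] by simp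
  finally show "(\<integral>\<^sup>+z. ennreal (norm (ln (lr n z))) \<partial>p1 n) < \<infinity>" .
qed simp

text \<open>Pointwise, the log-ratio is at least \<open>ln a\<close> on the event minus
  \<open>1\<close> minus its square where the ratio is below 1. The integral of that square is at
  most \<open>2\<close>, which explains the \<open>3\<close>.\<close>

lemma KL_ge:
  assumes "1 \<le> a" shows "ln a * measure_pmf.prob (p1 n) {x. lr n x > a} - 3 \<le> KL lam s n"
proof -
  let ?g = "\<lambda>z. (ln (lr n z))\<^sup>2 * indicator {z. lr n z < 1} z :: real"
  have gfin: "(\<integral>\<^sup>+z. ennreal (?g z) \<partial>p1 n) \<le> 2"
  proof -
    have "(\<integral>\<^sup>+z. ennreal (?g z) \<partial>p1 n) = (\<integral>\<^sup>+z. ennreal ((ln (lr n z))\<^sup>2) * indicator {z. lr n z < 1} z \<partial>p1 n)"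
      by (intro nn_integral_cong) (auto simp: indicator_def)
    then show ?thesis using ln_lr_neg_square by simp
  qed
  have gint: "integrable (p1 n) ?g" using le_less_trans[OF gfin, of \<infinity>] by (intro integrableI_nonneg) auto
  have g2: "(\<integral>z. ?g z \<partial>p1 n) \<le> 2"
    using gfin nn_integral_eq_integral[OF gint] by (simp flip: ennreal_numeral)
  let ?A = "{x. lr n x > a}"
  have "(\<integral>z. ln a * indicator ?A z - (1 + ?g z) \<partial>p1 n) \<le> (\<integral>z. ln (lr n z) \<partial>p1 n)"
  proof (rule integral_mono_AE)
    show "integrable (p1 n) (\<lambda>z. ln a * indicator ?A z - (1 + ?g z))"
      using gint integrable_pmf_indicator[of "p1 n" ?A] by auto
    show "AE z in p1 n. ln a * indicator ?A z - (1 + ?g z) \<le> ln (lr n z)"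
      unfolding AE_measure_pmf_iff
    proof
      fix z assume "z \<in> set_pmf (p1 n)"
      then have p: "lr n z > 0" by (rule lr_pos)
      consider "lr n z < 1" | "1 \<le> lr n z" "lr n z \<le> a" | "a < lr n z" by linarith
      then show "ln a * indicator ?A z - (1 + ?g z) \<le> ln (lr n z)"
      proof cases
        case 1
        have "0 \<le> (1 + ln (lr n z))\<^sup>2 + (- ln (lr n z))" using 1 p by (intro add_nonneg_nonneg) auto
        then have "- (1 + (ln (lr n z))\<^sup>2) \<le> ln (lr n z)" by (simp add: power2_eq_square algebra_simps)
        then show ?thesis using 1 assms by (simp add: indicator_def)
      next
        case 2
        then have "0 \<le> ln (lr n z)" by simp
        moreover have "ln a * indicator ?A z - (1 + ?g z) = - 1" using 2 by (simp add: indicator_def)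
        ultimately show ?thesis by linarith
      next
        case 3
        then have "ln a \<le> ln (lr n z)" using assms by simp
        moreover have "ln a * indicator ?A z - (1 + ?g z) = ln a - 1" using 3 assms by (simp add: indicator_def)
        ultimately show ?thesis by linarith
      qed
    qed
  qed (rule integrable_ln_lr)
  also have "(\<integral>z. ln a * indicator ?A z - (1 + ?g z) \<partial>p1 n) = ln a * measure_pmf.prob (p1 n) ?A - (1 + (\<integral>z. ?g z \<partial>p1 n))"
    using gint integrable_pmf_indicator[of "p1 n" ?A] by simp
  finally show ?thesis unfolding KL_eq using g2 by linarith
qed

lemma Likelihood_test_imp_KL:
  assumes Likelihood_test shows "filterlim (KL lam s) at_top sequentially"
proof -
  obtain a e where a: "filterlim a at_top sequentially" and e: "e > 0"
    "eventually (\<lambda>d. e \<le> measure_pmf.prob (p1 d) {x. lr d x > a d}) sequentially"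
    using assms unfolding Likelihood_test_def by blast
  have "filterlim (\<lambda>d. ln (a d)) at_top sequentially" by (rule filterlim_compose[OF ln_at_top a])
  then have "filterlim (\<lambda>d. e * ln (a d)) at_top sequentially"
    by (rule filterlim_tendsto_pos_mult_at_top[OF tendsto_const e(1)])
  then have "filterlim (\<lambda>d. - 3 + e * ln (a d)) at_top sequentially"
    by (rule filterlim_tendsto_add_at_top[OF tendsto_const])
  moreover have "eventually (\<lambda>d. 1 \<le> a d) sequentially" using a unfolding filterlim_at_top by blast
  then have "eventually (\<lambda>d. - 3 + e * ln (a d) \<le> KL lam s d) sequentially"
    using e(2)
  proof eventually_elim
    case (elim d)
    have "e * ln (a d) \<le> ln (a d) * measure_pmf.prob (p1 d) {x. lr d x > a d}"
      using elim by (subst mult.commute) (intro mult_left_mono, auto)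
    then show ?case using KL_ge[OF elim(1), of d] by linarith
  qed
  ultimately show ?thesis by (rule filterlim_at_top_mono)
qed

end

section \<open>The equivalence\<close>

context correlated_trees
begin

lemma growth_imp_Likelihood_test:
  assumes mu: "1 < \<mu>" and p: "1 - p_ext \<mu> \<le> pG"
  shows Likelihood_test
proof -
  have "0 < pG" using p p_ext_supercritical[OF mu] by linarith
  then obtain j where j: "pG - pG / 2 \<le> measure (P1 lam s) (growth_set j)" using pG_approx[of "pG / 2"] by auto
  \<comment> \<open>Half of the guaranteed size of the ratio, because the test requires a strict
    inequality.\<close>
  define a where "a n = exp (\<mu> ^ n / real (Suc j)) / 2" for n
  have "filterlim (\<lambda>n. \<mu> ^ n) at_top sequentially"
    using mu by (intro filterlim_at_infinity_imp_filterlim_at_top filterlim_realpow_sequentially_gt1)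
      (auto intro!: always_eventually zero_less_power)
  then have "filterlim (\<lambda>n. \<mu> ^ n / real (Suc j)) at_top sequentially"
    using filterlim_tendsto_pos_mult_at_top[OF tendsto_const[of "1 / real (Suc j)"], of "\<lambda>n. \<mu> ^ n"]
    by (simp add: mult.commute)
  then have "filterlim (\<lambda>n. exp (\<mu> ^ n / real (Suc j))) at_top sequentially" by (rule filterlim_compose[OF exp_at_top])
  then have a: "filterlim a at_top sequentially"
    unfolding a_def using filterlim_tendsto_pos_mult_at_top[OF tendsto_const[of "1 / 2 :: real"], of "\<lambda>n. exp (\<mu> ^ n / real (Suc j))"]
    by simp
  have "pG / 2 \<le> measure_pmf.prob (p1 n) {x. lr n x > a n}" if "n \<ge> j" for n
  proof -
    have "pG / 2 \<le> measure_pmf.prob (p1 n) (grows j n)" using j growth_set_le_grows[of j n] by linarith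
    also have "\<dots> \<le> measure_pmf.prob (p1 n) (prune2 n -` {x. lr n x > a n})"
    proof (intro measure_pmf.finite_measure_mono subsetI)
      fix z assume "z \<in> grows j n"
      then have "exp (\<mu> ^ n / real (Suc j)) \<le> lr n (prune2 n z)" using that unfolding grows_def by simp
      moreover have "a n < exp (\<mu> ^ n / real (Suc j))" unfolding a_def using exp_gt_zero[of "\<mu> ^ n / real (Suc j)"] by linarith
      ultimately show "z \<in> prune2 n -` {x. lr n x > a n}" by simp
    qed simp
    finally show ?thesis unfolding prob_p1_prune2[OF order_refl] .
  qed
  then show ?thesis
    unfolding Likelihood_test_def using a \<open>0 < pG\<close>
    by (intro exI[of _ a] conjI exI[of _ "pG / 2"]) (auto simp: eventually_sequentially)
qed

lemma Test_iff: "(\<exists>T. one_sided_test (pruned_law (P0 lam)) (pruned_law (P1 lam s)) T) \<longleftrightarrow> Likelihood_test"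
  using Likelihood_test_imp_Test Test_imp_Likelihood_test by blast

lemma Not_UI_iff:
  "martingale (P0 lam) pruned_filtration (\<lambda>d x. lr d (prune2 d x)) \<and>
     \<not> uniformly_integrable (P0 lam) (\<lambda>d x. lr d (prune2 d x)) \<longleftrightarrow> Likelihood_test"
  using martingale_lr Likelihood_test_imp_not_UI not_UI_imp_Likelihood_test by blast

lemma KL_iff: "filterlim (KL lam s) at_top sequentially \<and> 1 < \<mu> \<longleftrightarrow> Likelihood_test"
  using Likelihood_test_imp_KL Likelihood_test_imp_supercritical pG_ge_survival growth_imp_Likelihood_test by blast

lemma Growth_iff: 
  "1 < \<mu> \<and> 1 - p_ext \<mu> \<le> measure (P1 lam s)
     {x \<in> ltrees \<times> ltrees. liminf (\<lambda>d. ereal (ln (lr d (prune2 d x)) / \<mu> ^ d)) > 0} \<longleftrightarrow> Likelihood_test"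
proof (cases "1 < \<mu>")
  case True
  then have "0 < \<mu>" by simp
  then show ?thesis
    unfolding growth_set_Union[OF \<open>0 < \<mu>\<close>] pG_def[symmetric]
    using True KL_iff pG_ge_survival growth_imp_Likelihood_test by blast
next
  case False
  then show ?thesis using Likelihood_test_imp_supercritical by blast
qed

end

theorem theorem1:
  fixes lam s :: real
  assumes "lam > 0" and "s \<in> {0..1}"
  defines "Test \<equiv> (\<exists>T. one_sided_test (pruned_law (P0 lam)) (pruned_law (P1 lam s)) T)"
    and "KL_diverges \<equiv> filterlim (KL lam s) at_top sequentially \<and> lam * s > 1"
    and "Likelihood_test \<equiv> (\<exists>a :: nat \<Rightarrow> real. filterlim a at_top sequentially \<and>
           (\<lambda>d. measure (pruned_law (P0 lam) d)
                  {x \<in> ltrees_upto d \<times> ltrees_upto d. L lam s d x > a d}) \<longlonglongrightarrow> 0 \<and>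
           liminf (\<lambda>d. ereal (measure (pruned_law (P1 lam s) d)
                  {x \<in> ltrees_upto d \<times> ltrees_upto d. L lam s d x > a d})) > 0)"
    and "Not_UI \<equiv>
           martingale (P0 lam) pruned_filtration (\<lambda>d x. L lam s d (prune2 d x)) \<and>
           \<not> uniformly_integrable (P0 lam) (\<lambda>d x. L lam s d (prune2 d x))"
    and "Growth \<equiv> lam * s > 1 \<and>
           measure (P1 lam s) {x \<in> ltrees \<times> ltrees.
             liminf (\<lambda>d. ereal (ln (L lam s d (prune2 d x)) / (lam * s) ^ d)) > 0}
             \<ge> 1 - p_ext (lam * s)"
  shows "(Test \<longleftrightarrow> KL_diverges) \<and> (Test \<longleftrightarrow> Likelihood_test) \<and>
         (Test \<longleftrightarrow> Not_UI) \<and> (Test \<longleftrightarrow> Growth)"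
proof -
  interpret M: correlated_trees lam s using assms(1,2) by unfold_locales auto
  show ?thesis
    unfolding Test_def KL_diverges_def Likelihood_test_def Not_UI_def Growth_def
      M.Test_iff M.KL_iff M.Likelihood_test_iff M.Not_UI_iff M.Growth_iff by simp
qed

end
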